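(* There is a unitary operator $U$ with continuous spectrum such that for every integer $k\ge 0$, $$\mathcal{M}\big(G(U^{3^k})\big)=\{3^k,\infty\}.$$
   Context: All Hilbert spaces are complex and separable. An automorphism is an invertible measure-preserving transformation $T$ of a standard probability space $(X,\mu)$. $\mathcal{M}(T)\subset\{1,2,3,\dots\}\cup\{\infty\}$ denotes the set of spectral multiplicities of $T$, i.e. the set of essential values of the spectral multiplicity function (with respect to the maximal spectral type) of the Koopman operator $f\mapsto f\circ T$ restricted to the orthogonal complement of the constants in $L^2(X,\mu)$; $\infty$ is countably infinite multiplicity. For a unitary operator $U$ with continuous spectrum, $G(U)$ denotes the associated ergodic Gaussian automorphism: an automorphism of a probability space $(X,\mu)$ having a closed real invariant subspace $H\subset L^2(X,\mu;\mathbb{R})$ of centered Gaussian random variables which generates the full $\sigma$-algebra modulo null sets, and such that the Koopman operator on the complexification of $H$ is unitarily equivalent to $U$. The Koopman operator of $G(U)$ on $L^2(X,\mu)$ is then unitarily equivalent to $\bigoplus_{n=0}^{\infty}U^{\odot n}$, where $U^{\odot n}$ is the $n$-th symmetric tensor power of $U$ and $U^{\odot 0}$ is the identity on a one-dimensional space (the constants). *)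

theory Defs
  imports "HOL-Probability.Probability"
begin

section \<open>Square-integrable functions and unitary operators\<close>

text \<open>
  Elements of an \<open>L\<^sup>2\<close> space are represented by functions, and equality of vectors is equality
  almost everywhere. Every Hilbert space below is a subspace \<open>V\<close> of some complex \<open>L\<^sup>2(M)\<close>
  that is saturated under almost everywhere equality.
\<close>

definition L2 :: "'a measure \<Rightarrow> ('a \<Rightarrow> 'b :: real_normed_vector) set" where
  "L2 M = {f \<in> borel_measurable M. integrable M (\<lambda>x. (norm (f x))\<^sup>2)}"

definition L2_inner :: "'a measure \<Rightarrow> ('a \<Rightarrow> complex) \<Rightarrow> ('a \<Rightarrow> complex) \<Rightarrow> complex" where
  "L2_inner M f g = (\<integral>x. f x * cnj (g x) \<partial>M)"

text \<open>
  Compatibility of \<open>W\<close> with almost everywhere equality is not listed: it follows from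
  linearity and preservation of the inner product.
\<close>

definition unitary_map ::
  "'a measure \<Rightarrow> ('a \<Rightarrow> complex) set \<Rightarrow> 'b measure \<Rightarrow> ('b \<Rightarrow> complex) set
    \<Rightarrow> (('a \<Rightarrow> complex) \<Rightarrow> ('b \<Rightarrow> complex)) \<Rightarrow> bool" where
  "unitary_map M V N V' W \<longleftrightarrow>
     (\<forall>f\<in>V. W f \<in> V') \<and>
     (\<forall>f\<in>V. \<forall>g\<in>V. AE y in N. W (\<lambda>x. f x + g x) y = W f y + W g y) \<and>
     (\<forall>c. \<forall>f\<in>V. AE y in N. W (\<lambda>x. c * f x) y = c * W f y) \<and>
     (\<forall>f\<in>V. \<forall>g\<in>V. L2_inner N (W f) (W g) = L2_inner M f g) \<and>
     (\<forall>g\<in>V'. \<exists>f\<in>V. AE y in N. W f y = g y)"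

definition unitary_operator ::
  "'a measure \<Rightarrow> ('a \<Rightarrow> complex) set \<Rightarrow> (('a \<Rightarrow> complex) \<Rightarrow> ('a \<Rightarrow> complex)) \<Rightarrow> bool" where
  "unitary_operator M V U \<longleftrightarrow> unitary_map M V M V U"

definition unitarily_equivalent ::
  "'a measure \<Rightarrow> ('a \<Rightarrow> complex) set \<Rightarrow> (('a \<Rightarrow> complex) \<Rightarrow> ('a \<Rightarrow> complex))
    \<Rightarrow> 'b measure \<Rightarrow> ('b \<Rightarrow> complex) set \<Rightarrow> (('b \<Rightarrow> complex) \<Rightarrow> ('b \<Rightarrow> complex)) \<Rightarrow> bool" where
  "unitarily_equivalent M V A N V' B \<longleftrightarrow>
     (\<exists>W. unitary_map M V N V' W \<and> (\<forall>f\<in>V. AE y in N. W (A f) y = B (W f) y))"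

definition continuous_spectrum ::
  "'a measure \<Rightarrow> ('a \<Rightarrow> complex) set \<Rightarrow> (('a \<Rightarrow> complex) \<Rightarrow> ('a \<Rightarrow> complex)) \<Rightarrow> bool" where
  "continuous_spectrum M V U \<longleftrightarrow>
     (\<forall>c. \<forall>f\<in>V. (AE x in M. U f x = c * f x) \<longrightarrow> (AE x in M. f x = 0))"


section \<open>Spectral multiplicities\<close>

text \<open>
  By the spectral theorem, a unitary operator on a separable Hilbert space is multiplication by \<open>z\<close>
  on the direct integral, over a finite measure \<open>\<sigma>\<close> on the unit circle, of Hilbert spaces of
  dimension \<open>m z\<close>. Realising the fibre over \<open>z\<close> as \<open>\<ell>\<^sup>2({j. j < m z})\<close>, the direct integral is the
  \<open>L\<^sup>2\<close> space of the following measure.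
\<close>

definition fibre_measure :: "complex measure \<Rightarrow> (complex \<Rightarrow> enat) \<Rightarrow> (complex \<times> nat) measure" where
  "fibre_measure \<sigma> m =
     restrict_space (\<sigma> \<Otimes>\<^sub>M count_space UNIV) {(z, j). enat j < m z}"

text \<open>
  As \<open>m \<ge> 1\<close> almost everywhere, \<open>\<sigma>\<close> has the maximal spectral type, and \<open>m\<close> is the multiplicity
  function.
\<close>

definition spectral_representation ::
  "'a measure \<Rightarrow> ('a \<Rightarrow> complex) set \<Rightarrow> (('a \<Rightarrow> complex) \<Rightarrow> ('a \<Rightarrow> complex))
    \<Rightarrow> complex measure \<Rightarrow> (complex \<Rightarrow> enat) \<Rightarrow> bool" where
  "spectral_representation M V U \<sigma> m \<longleftrightarrow>
     finite_measure \<sigma> \<and> sets \<sigma> = sets borel \<and> (AE z in \<sigma>. cmod z = 1) \<and>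
     m \<in> \<sigma> \<rightarrow>\<^sub>M count_space UNIV \<and> (AE z in \<sigma>. 1 \<le> m z) \<and>
     unitarily_equivalent M V U
       (fibre_measure \<sigma> m) (L2 (fibre_measure \<sigma> m)) (\<lambda>f (z, j). z * f (z, j))"

definition essential_values :: "complex measure \<Rightarrow> (complex \<Rightarrow> enat) \<Rightarrow> enat set" where
  "essential_values \<sigma> m = {n. emeasure \<sigma> {z \<in> space \<sigma>. m z = n} > 0}"

text \<open>
  The class of \<open>\<sigma>\<close> and, up to null sets, \<open>m\<close> are determined by the operator (Hahn-Hellinger),
  so all spectral representations contribute the same set to the union.
\<close>

definition spectral_multiplicities ::
  "'a measure \<Rightarrow> ('a \<Rightarrow> complex) set \<Rightarrow> (('a \<Rightarrow> complex) \<Rightarrow> ('a \<Rightarrow> complex)) \<Rightarrow> enat set" where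
  "spectral_multiplicities M V U =
     \<Union>{essential_values \<sigma> m | \<sigma> m. spectral_representation M V U \<sigma> m}"


section \<open>Automorphisms of standard probability spaces\<close>

definition standard_probability_space :: "'a measure \<Rightarrow> bool" where
  "standard_probability_space M \<longleftrightarrow>
     prob_space M \<and>
     (\<exists>X. completely_metrizable_space X \<and> second_countable X \<and> topspace X = space M \<and>
          sets M = sigma_sets (space M) {U. openin X U})"

text \<open>Invertibility is understood modulo null sets.\<close>

definition automorphism :: "'a measure \<Rightarrow> ('a \<Rightarrow> 'a) \<Rightarrow> bool" where
  "automorphism M T \<longleftrightarrow>
     standard_probability_space M \<and> T \<in> M \<rightarrow>\<^sub>M M \<and> distr M M T = M \<and>
     (\<exists>S \<in> M \<rightarrow>\<^sub>M M. (AE x in M. S (T x) = x) \<and> (AE x in M. T (S x) = x))"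

definition ergodic :: "'a measure \<Rightarrow> ('a \<Rightarrow> 'a) \<Rightarrow> bool" where
  "ergodic M T \<longleftrightarrow>
     (\<forall>A\<in>sets M. (AE x in M. T x \<in> A \<longleftrightarrow> x \<in> A) \<longrightarrow> measure M A = 0 \<or> measure M A = 1)"

definition koopman :: "('a \<Rightarrow> 'a) \<Rightarrow> ('a \<Rightarrow> 'b) \<Rightarrow> 'a \<Rightarrow> 'b" where
  "koopman T f = (\<lambda>x. f (T x))"

definition L2_orth_constants :: "'a measure \<Rightarrow> ('a \<Rightarrow> complex) set" where
  "L2_orth_constants M = {f \<in> L2 M. \<forall>c. L2_inner M f (\<lambda>_. c) = 0}"

definition multiplicities :: "'a measure \<Rightarrow> ('a \<Rightarrow> 'a) \<Rightarrow> enat set" where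
  "multiplicities M T = spectral_multiplicities M (L2_orth_constants M) (koopman T)"


section \<open>Gaussian automorphisms\<close>

text \<open>Closedness under \<open>L\<^sup>2\<close> limits includes closedness under almost everywhere equality.\<close>

definition closed_real_subspace :: "'a measure \<Rightarrow> ('a \<Rightarrow> real) set \<Rightarrow> bool" where
  "closed_real_subspace M H \<longleftrightarrow>
     H \<subseteq> L2 M \<and> (\<lambda>_. 0) \<in> H \<and>
     (\<forall>f\<in>H. \<forall>g\<in>H. (\<lambda>x. f x + g x) \<in> H) \<and>
     (\<forall>c. \<forall>f\<in>H. (\<lambda>x. c * f x) \<in> H) \<and>
     (\<forall>h f. (\<forall>n::nat. h n \<in> H) \<and> f \<in> L2 M \<and>
        (\<lambda>n. \<integral>x. (h n x - f x)\<^sup>2 \<partial>M) \<longlonglongrightarrow> 0 \<longrightarrow> f \<in> H)"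

definition centered_gaussian :: "'a measure \<Rightarrow> ('a \<Rightarrow> real) \<Rightarrow> bool" where
  "centered_gaussian M h \<longleftrightarrow>
     h \<in> borel_measurable M \<and>
     ((AE x in M. h x = 0) \<or> (\<exists>s>0. distributed M lborel h (normal_density 0 s)))"

definition generates_mod_null :: "'a measure \<Rightarrow> ('a \<Rightarrow> real) set \<Rightarrow> bool" where
  "generates_mod_null M H \<longleftrightarrow>
     (\<forall>A\<in>sets M.
        \<exists>B\<in>sigma_sets (space M) {h -` C \<inter> space M | h C. h \<in> H \<and> C \<in> sets borel}.
          AE x in M. x \<in> A \<longleftrightarrow> x \<in> B)"

definition complexification :: "('a \<Rightarrow> real) set \<Rightarrow> ('a \<Rightarrow> complex) set" where
  "complexification H = {(\<lambda>x. Complex (u x) (v x)) | u v. u \<in> H \<and> v \<in> H}"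

text \<open>
  \<open>(M, T)\<close> is a realisation of the Gaussian automorphism associated with the unitary operator \<open>U\<close>
  on \<open>V \<subseteq> L\<^sup>2(N)\<close>. Such a realisation exists only if \<open>U\<close> is unitarily equivalent to the
  complexification of an orthogonal operator; it is then unique up to isomorphism.
\<close>

definition gaussian_automorphism ::
  "'a measure \<Rightarrow> ('a \<Rightarrow> 'a) \<Rightarrow> 'b measure \<Rightarrow> ('b \<Rightarrow> complex) set
    \<Rightarrow> (('b \<Rightarrow> complex) \<Rightarrow> ('b \<Rightarrow> complex)) \<Rightarrow> bool" where
  "gaussian_automorphism M T N V U \<longleftrightarrow>
     automorphism M T \<and> ergodic M T \<and>
     (\<exists>H. closed_real_subspace M H \<and> (\<forall>h\<in>H. koopman T h \<in> H) \<and>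
          (\<forall>h\<in>H. centered_gaussian M h) \<and> generates_mod_null M H \<and>
          unitarily_equivalent M (complexification H) (koopman T) N V U)"

text \<open>
  A unitary operator with continuous spectrum on a nonzero separable Hilbert space acts on an
  infinite-dimensional space, which may be taken to be \<open>\<ell>\<^sup>2\<close>.
\<close>

abbreviation counting :: "nat measure" where
  "counting \<equiv> count_space UNIV"

abbreviation ell2 :: "(nat \<Rightarrow> complex) set" where
  "ell2 \<equiv> L2 counting"

end

theory Submission
  imports Defs "HOL-Computational_Algebra.Fundamental_Theorem_Algebra"
begin

text \<open>
  Let \<open>\<sigma>\<close> be the law of \<open>cis (2 * pi * x)\<close>, where \<open>x\<close> has independent ternary digits in \<open>{-1, 0, 1}\<close>
  with weights 1/4, 1/2, 1/4. Then \<open>\<sigma>\<close> is invariant under \<open>z \<mapsto> z ^ 3\<close>, each fibre of that map splits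
  \<open>L\<^sup>2(\<sigma>)\<close> into three cyclic pieces of type \<open>\<sigma>\<close>, and \<open>\<sigma>\<close> is singular to its convolution powers of order
  at least 2: averages of \<open>z ^ 3 ^ i\<close> converge to different constants under different powers. Let \<open>\<theta>\<close> be a
  mixture of all convolution powers and \<open>S\<close> a set that carries \<open>\<sigma>\<close> and is null for the other powers.
  \<open>U\<close> is multiplication by \<open>z\<close> with simple spectrum \<open>\<sigma>\<close> on \<open>S\<close> and infinite multiplicity off \<open>S\<close>. In the
  Gaussian automorphism of \<open>U ^^ 3 ^ k\<close> the first chaos contributes multiplicity \<open>3 ^ k\<close> on \<open>S\<close>, while
  the spectral measures of the higher chaoses are convolutions, hence carried by the complement of \<open>S\<close>.
\<close>

text \<open>The multiplicities of the higher chaoses are never computed. Off \<open>S\<close> the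
  first chaos is padded with infinitely many cyclic copies of one type, so the multiplicity there is
  infinite whatever the convolutions add; all one has to know of the higher chaoses is that they
  miss \<open>S\<close>. Nor are they separated: \<open>wick h\<close> is an exponential vector
  without its constant and linear terms, its correlations are \<open>exp c - 1 - c\<close> for the
  correlations \<open>c\<close> of \<open>h\<close>, and one density off \<open>S\<close> serves all
  orders at once. A digit is half the sum of two fair signs. Its characteristic function
  \<open>(1 + cos (2 * pi * t)) / 2\<close> makes the Fourier coefficients of \<sigma> real, as a
  real Gaussian space requires, and keeps the first one strictly between 0 and 1, so that its
  powers, the limits of the averages, differ. Hence lower bounds are proved for every
  representation, the upper bound for one reference representation over \<theta>, and a
  Hahn-Hellinger comparison transfers it to the others.\<close>

section \<open>The space L2: inner product, Cauchy-Schwarz and completeness\<close>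

definition l2sq :: "'a measure => ('a => complex) => real" where
 "l2sq M f = (\<integral>x. (norm (f x))\<^sup>2 \<partial>M)"

abbreviation (input) l2lim :: "'a measure => (nat => 'a => complex) => ('a => complex) => bool" where
 "l2lim M h f \<equiv> (%n. l2sq M (%x. h n x - f x)) \<longlonglongrightarrow> 0"

lemma L2_measurable [measurable_dest]: "f \<in> L2 M ==> f \<in> borel_measurable M"
 by (simp add: L2_def)

lemma L2_integrable: "f \<in> L2 M ==> integrable M (%x. (norm (f x))\<^sup>2)"
 by (simp add: L2_def)

lemma L2_bound:
 fixes f :: "'a => 'b::{real_normed_vector}"
 assumes "f \<in> borel_measurable M" "integrable M g" "AE x in M. (norm (f x))\<^sup>2 \<le> g x"
 shows "f \<in> L2 M"
 unfolding L2_def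
 using assms by (auto intro!: Bochner_Integration.integrable_bound[OF assms(2)])

lemma norm_sum_square_le: "(norm (a + b :: 'b::real_normed_vector))\<^sup>2 \<le> 2 * (norm a)\<^sup>2 + 2 * (norm b)\<^sup>2"
proof -
 have "(norm (a + b))\<^sup>2 \<le> (norm a + norm b)\<^sup>2"
 by (simp add: norm_triangle_ineq power_mono)
 also have "\<dots> \<le> 2 * (norm a)\<^sup>2 + 2 * (norm b)\<^sup>2"
 using zero_le_power2[of "norm a - norm b"] by (simp add: power2_sum power2_diff)
 finally show ?thesis .
qed

lemma L2_zero [simp]: "(%_. 0) \<in> L2 M"
 by (simp add: L2_def)

lemma L2_add:
 fixes f g :: "'a => complex"
 assumes "f \<in> L2 M" "g \<in> L2 M" shows "(%x. f x + g x) \<in> L2 M"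
proof (rule L2_bound)
 show "integrable M (%x. 2 * (norm (f x))\<^sup>2 + 2 * (norm (g x))\<^sup>2)"
 using assms by (auto simp: L2_def)
qed (use assms norm_sum_square_le in \<open>auto simp: L2_def\<close>)

lemma L2_scale:
 fixes f :: "'a => complex"
 assumes "f \<in> L2 M" shows "(%x. c * f x) \<in> L2 M"
 using assms by (auto simp: L2_def norm_mult power_mult_distrib)

lemma L2_uminus:
 fixes f :: "'a => complex"
 assumes "f \<in> L2 M" shows "(%x. - f x) \<in> L2 M"
 using assms by (auto simp: L2_def)

lemma L2_diff:
 fixes f g :: "'a => complex"
 assumes "f \<in> L2 M" "g \<in> L2 M" shows "(%x. f x - g x) \<in> L2 M"
 using L2_add[OF assms(1) L2_uminus[OF assms(2)]] by simp

lemma L2_cnj: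
 assumes "f \<in> L2 M" shows "(%x. cnj (f x)) \<in> L2 M"
 using assms by (auto simp: L2_def intro: borel_measurable_continuous_on[where f=cnj] continuous_intros)

lemma L2_sum:
 fixes f :: "'i => 'a => complex"
 assumes "!!i. i \<in> I ==> f i \<in> L2 M" shows "(%x. \<Sum>i\<in>I. f i x) \<in> L2 M"
 using assms by (induction I rule: infinite_finite_induct) (auto intro: L2_add)

lemma norm_mult_le_squares: "norm (a * b :: complex) \<le> (norm a)\<^sup>2 + (norm b)\<^sup>2"
proof -
 have "0 \<le> (norm a - norm b)\<^sup>2" "0 \<le> norm a * norm b" by auto
 then show ?thesis unfolding power2_diff norm_mult by linarith
qed

lemma L2_integrable_mult:
 fixes f g :: "'a => complex"
 assumes "f \<in> L2 M" "g \<in> L2 M" shows "integrable M (%x. f x * g x)"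
proof (rule Bochner_Integration.integrable_bound)
 show "integrable M (%x. (norm (f x))\<^sup>2 + (norm (g x))\<^sup>2)"
 using assms by (auto simp: L2_def)
qed (use assms norm_mult_le_squares in \<open>auto simp: L2_def simp del: norm_mult\<close>)

lemma L2_inner_integrable:
 assumes "f \<in> L2 M" "g \<in> L2 M" shows "integrable M (%x. f x * cnj (g x))"
 using L2_integrable_mult[OF assms(1) L2_cnj[OF assms(2)]] .

lemma L2_inner_add_left:
 assumes "f \<in> L2 M" "g \<in> L2 M" "h \<in> L2 M"
 shows "L2_inner M (%x. f x + g x) h = L2_inner M f h + L2_inner M g h"
 using assms by (simp add: L2_inner_def distrib_right L2_inner_integrable)

lemma L2_inner_scale_left:
 "L2_inner M (%x. c * f x) h = c * L2_inner M f h"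
 by (simp add: L2_inner_def mult.assoc)

lemma L2_inner_commute: "L2_inner M g f = cnj (L2_inner M f g)"
proof -
 have "cnj (L2_inner M f g) = (\<integral>x. cnj (f x * cnj (g x)) \<partial>M)"
 unfolding L2_inner_def by (rule Bochner_Integration.integral_cnj[symmetric])
 then show ?thesis by (simp add: L2_inner_def mult.commute)
qed

lemma L2_inner_add_right:
 assumes "f \<in> L2 M" "g \<in> L2 M" "h \<in> L2 M"
 shows "L2_inner M h (%x. f x + g x) = L2_inner M h f + L2_inner M h g"
 using assms by (subst (1 2 3) L2_inner_commute) (simp add: L2_inner_add_left)

lemma L2_inner_scale_right:
 "L2_inner M h (%x. c * f x) = cnj c * L2_inner M h f"
 by (subst (1 2) L2_inner_commute) (simp add: L2_inner_scale_left)

lemma L2_inner_zero_left [simp]: "L2_inner M (%_. 0) h = 0"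
 by (simp add: L2_inner_def)

lemma L2_inner_zero_right [simp]: "L2_inner M h (%_. 0) = 0"
 by (simp add: L2_inner_def)

lemma L2_inner_diff_left:
 assumes "f \<in> L2 M" "g \<in> L2 M" "h \<in> L2 M"
 shows "L2_inner M (%x. f x - g x) h = L2_inner M f h - L2_inner M g h"
 using assms by (simp add: L2_inner_def left_diff_distrib L2_inner_integrable)

lemma L2_inner_diff_right:
 assumes "f \<in> L2 M" "g \<in> L2 M" "h \<in> L2 M"
 shows "L2_inner M h (%x. f x - g x) = L2_inner M h f - L2_inner M h g"
 using assms by (subst (1 2 3) L2_inner_commute) (simp add: L2_inner_diff_left)

lemma L2_inner_sum_left:
 assumes "!!i. i \<in> I ==> f i \<in> L2 M" "h \<in> L2 M"
 shows "L2_inner M (%x. \<Sum>i\<in>I. f i x) h = (\<Sum>i\<in>I. L2_inner M (f i) h)"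
 using assms
 by (induction I rule: infinite_finite_induct) (simp_all add: L2_inner_add_left L2_sum)

lemma L2_inner_sum_right:
 assumes "!!i. i \<in> I ==> f i \<in> L2 M" "h \<in> L2 M"
 shows "L2_inner M h (%x. \<Sum>i\<in>I. f i x) = (\<Sum>i\<in>I. L2_inner M h (f i))"
 using assms
 by (induction I rule: infinite_finite_induct) (simp_all add: L2_inner_add_right L2_sum)

lemma L2_inner_self: "L2_inner M f f = of_real (l2sq M f)"
proof -
 have "f x * cnj (f x) = of_real ((norm (f x))\<^sup>2)" for x
 by (metis complex_norm_square)
 then show ?thesis unfolding L2_inner_def l2sq_def by (simp only: integral_complex_of_real)
qed

lemma l2sq_inner: "l2sq M f = Re (L2_inner M f f)"
 by (simp add: L2_inner_self)

lemma l2sq_nonneg [simp]: "0 \<le> l2sq M f"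
 by (simp add: l2sq_def)

lemma L2_AE_cong:
 assumes "f \<in> L2 M" "g \<in> borel_measurable M" "AE x in M. f x = g x" shows "g \<in> L2 M"
 by (rule L2_bound[OF assms(2) L2_integrable[OF assms(1)]]) (use assms(3) in auto)

lemma L2_inner_cong_AE:
 assumes "f \<in> L2 M" "f' \<in> L2 M" "g \<in> L2 M" "g' \<in> L2 M"
 and "AE x in M. f x = f' x" "AE x in M. g x = g' x"
 shows "L2_inner M f g = L2_inner M f' g'"
 unfolding L2_inner_def
proof (rule integral_cong_AE)
 show "AE x in M. f x * cnj (g x) = f' x * cnj (g' x)" using assms(5,6) by auto
qed (use assms in \<open>auto intro: borel_measurable_integrable L2_inner_integrable\<close>)

lemma l2sq_zero_iff:
 assumes "f \<in> L2 M" shows "l2sq M f = 0 \<longleftrightarrow> (AE x in M. f x = 0)"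
 unfolding l2sq_def
 by (subst integral_nonneg_eq_0_iff_AE) (use assms in \<open>auto simp: L2_def\<close>)

lemma l2sq_scale: "l2sq M (%x. c * f x) = (norm c)\<^sup>2 * l2sq M f"
 by (simp add: l2sq_def norm_mult power_mult_distrib)

lemma l2sq_commute: "l2sq M (%x. f x - g x) = l2sq M (%x. g x - f x)"
 by (simp add: l2sq_def norm_minus_commute)

lemma l2sq_mono:
 assumes "f \<in> L2 M" "g \<in> borel_measurable M" "AE x in M. norm (g x) \<le> norm (f x)"
 shows "l2sq M g \<le> l2sq M f"
proof -
 have "g \<in> L2 M"
 by (rule L2_bound[OF assms(2) L2_integrable[OF assms(1)]]) (use assms(3) in \<open>auto intro: power_mono\<close>)
 then show ?thesis unfolding l2sq_def
 using assms by (intro integral_mono_AE) (auto simp: L2_def intro: power_mono)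
qed

lemma l2sq_add_le:
 assumes "f \<in> L2 M" "g \<in> L2 M"
 shows "l2sq M (%x. f x + g x) \<le> 2 * l2sq M f + 2 * l2sq M g"
proof -
 have "l2sq M (%x. f x + g x) \<le> (\<integral>x. 2 * (norm (f x))\<^sup>2 + 2 * (norm (g x))\<^sup>2 \<partial>M)"
 unfolding l2sq_def using L2_add[OF assms] assms
 by (intro integral_mono) (auto simp: L2_def norm_sum_square_le)
 also have "\<dots> = 2 * l2sq M f + 2 * l2sq M g"
 using assms by (simp add: l2sq_def L2_def)
 finally show ?thesis .
qed

lemma l2sq_add:
 assumes "f \<in> L2 M" "g \<in> L2 M"
 shows "l2sq M (%x. f x + g x) = l2sq M f + l2sq M g + 2 * Re (L2_inner M f g)"
proof -
 have "Re (L2_inner M g f) = Re (L2_inner M f g)"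
 by (subst L2_inner_commute) simp
 then show ?thesis
 using assms by (simp add: l2sq_inner L2_inner_add_left L2_inner_add_right L2_add)
qed

lemma l2sq_diff:
 assumes "f \<in> L2 M" "g \<in> L2 M"
 shows "l2sq M (%x. f x - g x) = l2sq M f + l2sq M g - 2 * Re (L2_inner M f g)"
proof -
 have "Re (L2_inner M g f) = Re (L2_inner M f g)"
 by (subst L2_inner_commute) simp
 then show ?thesis
 using assms by (simp add: l2sq_inner L2_inner_diff_left L2_inner_diff_right L2_diff)
qed

lemma l2sq_parallelogram:
 assumes "f \<in> L2 M" "g \<in> L2 M"
 shows "l2sq M (%x. f x + g x) + l2sq M (%x. f x - g x) = 2 * l2sq M f + 2 * l2sq M g"
 using assms by (simp add: l2sq_add l2sq_diff)

lemma L2_Cauchy_Schwarz: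
 assumes "f \<in> L2 M" "g \<in> L2 M"
 shows "(norm (L2_inner M f g))\<^sup>2 \<le> l2sq M f * l2sq M g"
proof (cases "l2sq M g = 0")
 case True
 then have "AE x in M. g x = 0" using assms l2sq_zero_iff by blast
 then have "L2_inner M f g = L2_inner M f (%_. 0)"
 using assms by (intro L2_inner_cong_AE) auto
 then show ?thesis by simp
next
 case False
 define b where "b = l2sq M g"
 define c where "c = L2_inner M f g / of_real b"
 have b: "b > 0" using False l2sq_nonneg[of M g] unfolding b_def by linarith
 have "0 \<le> l2sq M (%x. f x - c * g x)" by simp
 also have "\<dots> = l2sq M f + (norm c)\<^sup>2 * b - 2 * Re (cnj c * L2_inner M f g)"
 using assms by (simp add: l2sq_diff L2_scale l2sq_scale L2_inner_scale_right b_def)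
 also have "cnj c * L2_inner M f g = of_real ((norm (L2_inner M f g))\<^sup>2 / b)"
 using b by (simp add: c_def complex_norm_square mult.commute del: of_real_power)
 also have "(norm c)\<^sup>2 * b = (norm (L2_inner M f g))\<^sup>2 / b"
 using b by (simp add: c_def norm_divide power_divide power2_eq_square)
 finally have "(norm (L2_inner M f g))\<^sup>2 / b \<le> l2sq M f" by simp
 then show ?thesis using b by (simp add: divide_le_eq b_def)
qed

lemma L2_inner_tendsto:
 assumes "!!n. h n \<in> L2 M" "f \<in> L2 M" "g \<in> L2 M" "l2lim M h f"
 shows "(%n. L2_inner M (h n) g) \<longlonglongrightarrow> L2_inner M f g"
proof -
 have "(%n. sqrt (l2sq M (%x. h n x - f x) * l2sq M g)) \<longlonglongrightarrow> sqrt (0 * l2sq M g)"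
 by (intro tendsto_intros assms)
 then have 1: "(%n. sqrt (l2sq M (%x. h n x - f x) * l2sq M g)) \<longlonglongrightarrow> 0" by simp
 have 2: "norm (L2_inner M (h n) g - L2_inner M f g) \<le> sqrt (l2sq M (%x. h n x - f x) * l2sq M g)" for n
 proof -
 have "(norm (L2_inner M (%x. h n x - f x) g))\<^sup>2 \<le> l2sq M (%x. h n x - f x) * l2sq M g"
  using assms by (intro L2_Cauchy_Schwarz L2_diff)
 then show ?thesis using assms by (simp add: L2_inner_diff_left real_le_rsqrt)
 qed
 show ?thesis
 by (rule LIM_zero_cancel, rule tendsto_rabs_zero_cancel[THEN tendsto_norm_zero_cancel] Lim_null_comparison[OF _ 1])
  (use 2 in auto)
qed

lemma L2_inner_tendsto2:
 assumes "!!n. h n \<in> L2 M" "f \<in> L2 M" "g \<in> L2 M" "l2lim M h f"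
 shows "(%n. L2_inner M g (h n)) \<longlonglongrightarrow> L2_inner M g f"
proof -
 have "(%n. cnj (L2_inner M (h n) g)) \<longlonglongrightarrow> cnj (L2_inner M f g)"
 by (intro tendsto_intros L2_inner_tendsto assms)
 then show ?thesis by (subst (1 2) L2_inner_commute) 
qed

lemma l2lim_norm:
 assumes "!!n. h n \<in> L2 M" "f \<in> L2 M" "l2lim M h f"
 shows "(%n. l2sq M (h n)) \<longlonglongrightarrow> l2sq M f"
proof -
 have "(%n. l2sq M (%x. h n x - f x) + 2 * Re (L2_inner M (h n) f) - l2sq M f)
  \<longlonglongrightarrow> 0 + 2 * Re (L2_inner M f f) - l2sq M f"
 by (intro tendsto_intros L2_inner_tendsto assms)
 then show ?thesis using assms by (simp add: l2sq_diff l2sq_inner[symmetric])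
qed

lemma l2lim_unique:
 assumes "!!n. h n \<in> L2 M" "f \<in> L2 M" "g \<in> L2 M" "l2lim M h f" "l2lim M h g"
 shows "AE x in M. f x = g x"
proof -
 have le: "l2sq M (%x. f x - g x) \<le> 2 * l2sq M (%x. h n x - f x) + 2 * l2sq M (%x. h n x - g x)" for n
 using l2sq_add_le[OF L2_diff[OF assms(2) assms(1)] L2_diff[OF assms(1,3)], of n n]
 by (simp add: l2sq_commute[of M f])
 have "(%n. 2 * l2sq M (%x. h n x - f x) + 2 * l2sq M (%x. h n x - g x)) \<longlonglongrightarrow> 2 * 0 + 2 * 0"
 by (intro tendsto_intros assms)
 then have "l2sq M (%x. f x - g x) \<le> 2*0+2*0"
 by (rule LIMSEQ_le_const) (use le in auto)
 then have "l2sq M (%x. f x - g x) = 0" using l2sq_nonneg by (simp add: antisym)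
 then show ?thesis using l2sq_zero_iff[OF L2_diff[OF assms(2,3)]] by simp
qed

text \<open>Riesz-Fischer. Along a subsequence whose consecutive squared distances are at most
  \<open>(1/8)^k\<close>, the sum of the squared increments weighted by \<open>4^k\<close> has
  finite integral, so almost everywhere the increments are eventually at most \<open>(1/2)^k\<close>
  and the subsequence converges. Fatou's lemma turns the pointwise limit into an L2 limit of the
  whole sequence.\<close>

theorem L2_complete:
 assumes h: "!!n. h n \<in> L2 M"
 and Cauchy: "!!e. e > 0 ==> \<exists>N. \<forall>m\<ge>N. \<forall>n\<ge>N. l2sq M (%x. h m x - h n x) < e"
 obtains f where "f \<in> L2 M" "l2lim M h f"
proof -
 define N where "N k = (SOME N. \<forall>m\<ge>N. \<forall>n\<ge>N. l2sq M (%x. h m x - h n x) < (1/8)^k)" for k :: nat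
 have N: "l2sq M (%x. h m x - h n x) < (1/8)^k" if "m \<ge> N k" "n \<ge> N k" for k m n
 using someI_ex[OF Cauchy[of "(1/8)^k"]] that unfolding N_def[symmetric] by auto
 \<comment> \<open>Summing the thresholds gives \<open>r k >= N j\<close> for all
   \<open>j <= k\<close> although \<open>N\<close> need not be monotone; the extra \<open>k\<close>
   makes \<open>r\<close> unbounded.\<close>
 define r where "r k = (\<Sum>j\<le>k. N j) + k" for k
 have rN: "r k \<ge> N k" for k unfolding r_def by (simp add: member_le_sum trans_le_add1)
 have rk: "r k \<ge> k" for k by (simp add: r_def)
 have rSuc: "r (Suc k) \<ge> N k" for k using rN[of k] by (simp add: r_def)
 have hm [measurable]: "h n \<in> borel_measurable M" for n using h by measurable
 define a where "a k x = norm (h (r (Suc k)) x - h (r k) x)" for k x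
 have am [measurable]: "a k \<in> borel_measurable M" for k unfolding a_def by measurable
 have aint: "integrable M (%x. (a k x)\<^sup>2)" for k
 using L2_integrable[OF L2_diff[OF h h]] unfolding a_def .
 have anorm: "(\<integral>x. (a k x)\<^sup>2 \<partial>M) \<le> (1/8)^k" for k
 using N[of k "r (Suc k)" "r k"] rN rSuc unfolding a_def l2sq_def by (simp add: less_imp_le)
 have "(\<integral>\<^sup>+x. (\<Sum>k. ennreal (4^k * (a k x)\<^sup>2)) \<partial>M) = (\<Sum>k. \<integral>\<^sup>+x. ennreal (4^k * (a k x)\<^sup>2) \<partial>M)"
 by (rule nn_integral_suminf) measurable
 also have "\<dots> \<le> (\<Sum>k. ennreal ((1/2)^k))"
 proof (intro suminf_le allI)
 fix k
 have "(\<integral>\<^sup>+x. ennreal (4^k * (a k x)\<^sup>2) \<partial>M) = ennreal (\<integral>x. 4^k * (a k x)\<^sup>2 \<partial>M)"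
  by (rule nn_integral_eq_integral) (use aint in auto)
 also have "(\<integral>x. 4^k * (a k x)\<^sup>2 \<partial>M) \<le> 4^k * (1/8)^k"
  using anorm[of k] by simp
 also have "4^k * (1/8)^k = ((1/2)^k :: real)" by (simp add: power_mult_distrib[symmetric])
 finally show "(\<integral>\<^sup>+x. ennreal (4^k * (a k x)\<^sup>2) \<partial>M) \<le> ennreal ((1/2)^k)"
  by (simp add: ennreal_leI)
 qed auto
 also have "\<dots> = ennreal (\<Sum>k. (1/2)^k)"
 by (rule suminf_ennreal2) (auto intro: summable_geometric)
 finally have "(\<integral>\<^sup>+x. (\<Sum>k. ennreal (4^k * (a k x)\<^sup>2)) \<partial>M) ~= \<infinity>"
 using top.not_eq_extremum by (fastforce simp: top_unique)
 then have "AE x in M. (\<Sum>k. ennreal (4^k * (a k x)\<^sup>2)) ~= \<infinity>"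
 by (rule nn_integral_PInf_AE[rotated]) measurable
 then have conv: "AE x in M. convergent (%k. h (r k) x)"
 proof eventually_elim
 case (elim x)
 then have "summable (%k. 4^k * (a k x)\<^sup>2)"
  by (intro summable_suminf_not_top) auto
 then have "(%k. 4^k * (a k x)\<^sup>2) \<longlonglongrightarrow> 0" by (rule summable_LIMSEQ_zero)
 then have "\<forall>\<^sub>F k in sequentially. 4^k * (a k x)\<^sup>2 < 1"
  by (rule order_tendstoD) simp
 then have "\<forall>\<^sub>F k in sequentially. norm (a k x) \<le> (1/2)^k"
 proof eventually_elim
  case (elim k)
  have "(2^k * a k x)\<^sup>2 < 1\<^sup>2"
  using elim by (simp add: power_mult_distrib power_mult[symmetric] mult.commute[of k 2] power_mult)
  then have "2^k * a k x < 1" using power2_less_imp_less by fastforce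
  then show ?case by (simp add: a_def field_simps power_one_over)
 qed
 then have "summable (%k. norm (h (r (Suc k)) x - h (r k) x))"
  using summable_comparison_test_ev[of "%k. a k x" "%k. (1/2)^k"]
  by (simp add: a_def summable_geometric)
 then have "summable (%k. h (r (Suc k)) x - h (r k) x)" by (rule summable_norm_cancel)
 then have "convergent (%n. \<Sum>k<n. h (r (Suc k)) x - h (r k) x)"
  by (simp add: summable_iff_convergent)
 then have "convergent (%n. h (r n) x - h (r 0) x)"
  by (simp only: sum_lessThan_telescope[of "%k. h (r k) x"])
 then have "convergent (%n. (h (r n) x - h (r 0) x) + h (r 0) x)"
  by (intro convergent_add convergent_const)
 then show ?case by simp
 qed
 define f where "f x = lim (%k. h (r k) x)" for x
 have fm [measurable]: "f \<in> borel_measurable M" unfolding f_def by measurable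
 have lim: "AE x in M. (%k. h (r k) x) \<longlonglongrightarrow> f x"
 using conv by eventually_elim (simp add: f_def convergent_LIMSEQ_iff)
 have key: "(\<integral>\<^sup>+x. ennreal ((norm (h n x - f x))\<^sup>2) \<partial>M) \<le> ennreal e"
 if e: "e > 0" and n: "\<forall>m\<ge>K. l2sq M (%x. h n x - h m x) < e" for n e K
 proof -
 have "(\<integral>\<^sup>+x. ennreal ((norm (h n x - f x))\<^sup>2) \<partial>M)
  = (\<integral>\<^sup>+x. liminf (%k. ennreal ((norm (h n x - h (r k) x))\<^sup>2)) \<partial>M)"
 proof (rule nn_integral_cong_AE, use lim in eventually_elim)
  case (elim x)
  have "(%k. ennreal ((norm (h n x - h (r k) x))\<^sup>2)) \<longlonglongrightarrow> ennreal ((norm (h n x - f x))\<^sup>2)"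
  by (intro tendsto_intros tendsto_ennrealI elim)
  then show ?case by (rule lim_imp_Liminf[OF sequentially_bot, symmetric])
 qed
 also have "\<dots> \<le> liminf (%k. \<integral>\<^sup>+x. ennreal ((norm (h n x - h (r k) x))\<^sup>2) \<partial>M)"
  by (rule nn_integral_liminf) measurable
 also have "\<dots> \<le> liminf (%k::nat. ennreal e)"
 proof (rule Liminf_mono, rule eventually_mono[OF eventually_ge_at_top[of K]])
  fix k assume "K \<le> k"
  then have "l2sq M (%x. h n x - h (r k) x) < e" using n rk[of k] by auto
  then show "(\<integral>\<^sup>+x. ennreal ((norm (h n x - h (r k) x))\<^sup>2) \<partial>M) \<le> ennreal e"
  using nn_integral_eq_integral[OF L2_integrable[OF L2_diff[OF h h]]]
  by (simp add: l2sq_def ennreal_leI)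
 qed
 also have "\<dots> = ennreal e" by (rule Liminf_const) simp
 finally show ?thesis .
 qed
 have diffL2: "(%x. h n x - f x) \<in> L2 M" 
 if e: "e > 0" and n: "\<forall>m\<ge>K. l2sq M (%x. h n x - h m x) < e" for n e K
 using key[OF that] unfolding L2_def
 by (auto intro!: integrableI_bounded simp: top.not_eq_extremum[symmetric] top_unique)
 obtain K where K: "\<forall>m\<ge>K. \<forall>n\<ge>K. l2sq M (%x. h m x - h n x) < 1" using Cauchy[of 1] by auto
 have "(%x. h K x - (h K x - f x)) \<in> L2 M"
 using K by (intro L2_diff h diffL2[of 1 K]) auto
 then have fL2: "f \<in> L2 M" by simp
 moreover have "l2lim M h f"
 proof (rule LIMSEQ_I)
 fix e :: real assume "e > 0"
 then obtain K where K: "\<forall>m\<ge>K. \<forall>n\<ge>K. l2sq M (%x. h m x - h n x) < e/2"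
  using Cauchy[of "e/2"] by auto
 show "\<exists>K. \<forall>n\<ge>K. norm (l2sq M (%x. h n x - f x) - 0) < e"
 proof (intro exI allI impI)
  fix n assume "K \<le> n"
  then have "(\<integral>\<^sup>+x. ennreal ((norm (h n x - f x))\<^sup>2) \<partial>M) \<le> ennreal (e/2)"
  using K \<open>e > 0\<close> by (intro key[of "e/2" K]) auto
  then have "ennreal (l2sq M (%x. h n x - f x)) \<le> ennreal (e/2)"
  using nn_integral_eq_integral[OF L2_integrable[OF L2_diff[OF h fL2]]] by (simp add: l2sq_def)
  then show "norm (l2sq M (%x. h n x - f x) - 0) < e"
  using \<open>e > 0\<close> by (simp add: ennreal_le_iff)
 qed
 qed
 ultimately show thesis by (rule that)
qed

section \<open>Closed complex subspaces, closed spans and orthogonal projection\<close>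

definition csub :: "'a measure => ('a => complex) set => bool" where
 "csub M V \<longleftrightarrow> V \<subseteq> L2 M & (%_. 0) \<in> V &
  (\<forall>f\<in>V. \<forall>g\<in>V. (%x. f x + g x) \<in> V) & (\<forall>c. \<forall>f\<in>V. (%x. c * f x) \<in> V) &
  (\<forall>h f. (\<forall>n. h n \<in> V) --> f \<in> L2 M --> l2lim M h f --> f \<in> V)"

lemma csubD:
 assumes "csub M V"
 shows csub_L2: "f \<in> V ==> f \<in> L2 M"
 and csub_zero: "(%_. 0) \<in> V"
 and csub_add: "f \<in> V ==> g \<in> V ==> (%x. f x + g x) \<in> V"
 and csub_scale: "f \<in> V ==> (%x. c * f x) \<in> V"
 and csub_lim: "(!!n. h n \<in> V) ==> f \<in> L2 M ==> l2lim M h f ==> f \<in> V"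
 using assms unfolding csub_def by blast+

lemma csub_diff:
 assumes "csub M V" "f \<in> V" "g \<in> V" shows "(%x. f x - g x) \<in> V"
 using csub_add[OF assms(1,2) csub_scale[OF assms(1,3), of "-1"]] by simp

text \<open>A constant sequence converges in L2 to every function almost everywhere equal to it, so
  closedness already includes saturation.\<close>

lemma csub_AE:
 assumes V: "csub M V" and f: "f \<in> V" and g: "g \<in> borel_measurable M" and eq: "AE x in M. f x = g x"
 shows "g \<in> V"
proof (rule csub_lim[OF V, of "%_. f"])
 show gL: "g \<in> L2 M" using L2_AE_cong[OF csub_L2[OF V f] g eq] .
 have "l2sq M (%x. f x - g x) = 0"
 using l2sq_zero_iff[OF L2_diff[OF csub_L2[OF V f] gL]] eq by auto
 then show "(%n. l2sq M (%x. f x - g x)) \<longlonglongrightarrow> 0" by simp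
qed (use f in auto)

lemma csub_UNIV: "csub M (L2 M)"
 unfolding csub_def by (auto intro: L2_add L2_scale)

text \<open>The limit rule puts closure and linear span into a single induction: a property stable
  under sums, multiples and limits passes from generators to the closed span without a separate
  density argument.\<close>

inductive_set cspan :: "'a measure => ('a => complex) set => ('a => complex) set"
 for M A where
 base: "a \<in> A ==> a \<in> cspan M A"
| zero: "(%_. 0) \<in> cspan M A"
| add: "f \<in> cspan M A ==> g \<in> cspan M A ==> (%x. f x + g x) \<in> cspan M A"
| scale: "f \<in> cspan M A ==> (%x. c * f x) \<in> cspan M A"
| lim: "(!!n. h n \<in> cspan M A) ==> f \<in> L2 M ==> l2lim M h f ==> f \<in> cspan M A"

lemma cspan_least:
 assumes "csub M V" "A \<subseteq> V" shows "cspan M A \<subseteq> V"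
proof
 fix f assume "f \<in> cspan M A" then show "f \<in> V"
 by induction (use assms in \<open>auto intro: csubD\<close>)
qed

lemma cspan_csub:
 assumes "A \<subseteq> L2 M" shows "csub M (cspan M A)"
 unfolding csub_def
 using cspan_least[OF csub_UNIV assms] by (auto intro: cspan.intros)

lemma cspan_mono:
 assumes "B \<subseteq> L2 M" "A \<subseteq> B" shows "cspan M A \<subseteq> cspan M B"
 by (rule cspan_least[OF cspan_csub[OF assms(1)]]) (use assms in \<open>auto intro: cspan.base\<close>)

lemma csub_orth:
 assumes "g \<in> L2 M" shows "csub M {f \<in> L2 M. L2_inner M f g = 0}"
 unfolding csub_def
proof (intro conjI allI impI ballI)
 fix h :: "nat => 'a => complex" and f
 assume h: "\<forall>n. h n \<in> {f \<in> L2 M. L2_inner M f g = 0}" "f \<in> L2 M" "l2lim M h f"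
 then have "(%n. L2_inner M (h n) g) \<longlonglongrightarrow> L2_inner M f g"
 using assms by (intro L2_inner_tendsto) auto
 with h show "f \<in> {f \<in> L2 M. L2_inner M f g = 0}" by (auto simp: LIMSEQ_const_iff)
qed (use assms in \<open>auto simp: L2_inner_add_left L2_inner_scale_left L2_add L2_scale\<close>)

lemma cspan_orth:
 assumes "A \<subseteq> L2 M" "g \<in> L2 M" "!!a. a \<in> A ==> L2_inner M a g = 0" "f \<in> cspan M A"
 shows "L2_inner M f g = 0"
 using cspan_least[OF csub_orth[OF assms(2)], of A] assms by auto

text \<open>A minimising sequence is Cauchy by the parallelogram law, because midpoints stay in
  \<open>Z\<close> and cannot beat the infimum. The residual at the minimiser is orthogonal to
  \<open>Z\<close>, since moving along a correlated \<open>k\<close> would shorten it.\<close>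

lemma L2_projection:
 assumes Z: "csub M Z" and f: "f \<in> L2 M"
 obtains p where "p \<in> Z" "!!g. g \<in> Z ==> L2_inner M (%x. f x - p x) g = 0"
proof -
 define S where "S = (%g. l2sq M (%x. f x - g x)) ` Z"
 define d where "d = Inf S"
 have S: "S ~= {}" "bdd_below S"
 using csub_zero[OF Z] by (auto simp: S_def intro!: bdd_belowI[of _ 0])
 have d: "d \<le> l2sq M (%x. f x - g x)" if "g \<in> Z" for g
 unfolding d_def by (rule cInf_lower) (use S that in \<open>auto simp: S_def\<close>)
 have "\<exists>g\<in>Z. l2sq M (%x. f x - g x) < d + 1 / real (Suc n)" for n
 proof -
 have "d < d + 1 / real (Suc n)" by simp
 then obtain s where "s \<in> S" "s < d + 1 / real (Suc n)"
  unfolding d_def using cInf_lessD[OF S(1)] by blast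
 then show ?thesis by (auto simp: S_def)
 qed
 then obtain g where g: "!!n. g n \<in> Z" "!!n. l2sq M (%x. f x - g n x) < d + 1 / real (Suc n)"
 by metis
 have gL: "g n \<in> L2 M" for n using g csub_L2[OF Z] by blast
 have close: "l2sq M (%x. g m x - g n x) \<le> 2 / real (Suc m) + 2 / real (Suc n)" for m n
 proof -
 let ?mid = "%x. (1/2) * (g m x + g n x)"
 have mid: "?mid \<in> Z" by (intro csub_scale[OF Z] csub_add[OF Z] g)
 have "l2sq M (%x. (f x - g m x) + (f x - g n x)) + l2sq M (%x. (f x - g m x) - (f x - g n x))
  = 2 * l2sq M (%x. f x - g m x) + 2 * l2sq M (%x. f x - g n x)"
  by (intro l2sq_parallelogram L2_diff f gL)
 moreover have "l2sq M (%x. (f x - g m x) + (f x - g n x)) = 4 * l2sq M (%x. f x - ?mid x)"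
 proof -
  have "(%x. (f x - g m x) + (f x - g n x)) = (%x. 2 * (f x - ?mid x))" by (auto simp: field_simps)
  then show ?thesis by (simp only: l2sq_scale) simp
 qed
 moreover have "l2sq M (%x. (f x - g m x) - (f x - g n x)) = l2sq M (%x. g m x - g n x)"
  by (simp add: l2sq_commute[of M "g m"])
 ultimately show ?thesis using d[OF mid] g(2)[of m] g(2)[of n] by linarith
 qed
 obtain p where p: "p \<in> L2 M" "l2lim M g p"
 proof (rule L2_complete[of g M])
 fix e :: real assume e: "e > 0"
 obtain N where N: "inverse (real (Suc N)) < e / 4" using reals_Archimedean[of "e/4"] e by auto
 have "l2sq M (%x. g m x - g n x) < e" if "m \<ge> N" "n \<ge> N" for m n
 proof -
  have "1 / real (Suc m) \<le> 1 / real (Suc N)" "1 / real (Suc n) \<le> 1 / real (Suc N)"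
  using that by (auto intro!: divide_left_mono)
  with close[of m n] N show ?thesis by (simp add: inverse_eq_divide)
 qed
 then show "\<exists>N. \<forall>m\<ge>N. \<forall>n\<ge>N. l2sq M (%x. g m x - g n x) < e" by auto
 qed (use gL in auto)
 have pZ: "p \<in> Z" using csub_lim[OF Z g(1) p] .
 have "(%n. l2sq M (%x. g n x - f x)) \<longlonglongrightarrow> l2sq M (%x. p x - f x)"
 proof (rule l2lim_norm)
 show "(%n. l2sq M (%x. g n x - f x - (p x - f x))) \<longlonglongrightarrow> 0" using p(2) by simp
 qed (auto intro: L2_diff f gL p)
 then have lim: "(%n. l2sq M (%x. f x - g n x)) \<longlonglongrightarrow> l2sq M (%x. f x - p x)"
 by (simp add: l2sq_commute[of M f])
 have "(%n. d + 1 / real (Suc n)) \<longlonglongrightarrow> d + 0"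
 by (intro tendsto_intros LIMSEQ_Suc[OF lim_1_over_n])
 then have min: "l2sq M (%x. f x - p x) \<le> d"
 using LIMSEQ_le[OF lim, of "%n. d + 1 / real (Suc n)" "d+0"] g(2) less_imp_le by auto
 show thesis
 proof (rule that[OF pZ])
 fix k assume k: "k \<in> Z"
 define w where "w = (%x. f x - p x)"
 define a where "a = L2_inner M w k"
 define b where "b = l2sq M k"
 \<comment> \<open>Any step between 0 and \<open>2 / b\<close> in the direction of \<open>k\<close>
   would decrease the distance; the added 1 covers the case \<open>b = 0\<close>.\<close>
 define t where "t = 1 / (b + 1)"
 define c where "c = of_real t * a"
 have b: "b \<ge> 0" by (simp add: b_def)
 have wL: "w \<in> L2 M" unfolding w_def by (intro L2_diff f p)
 have kL: "k \<in> L2 M" using csub_L2[OF Z k] .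
 have "(%x. p x + c * k x) \<in> Z" by (intro csub_add[OF Z] csub_scale[OF Z] pZ k)
 from d[OF this] min have "l2sq M w \<le> l2sq M (%x. w x - c * k x)"
  by (simp add: w_def diff_diff_add)
 also have "\<dots> = l2sq M w + (norm c)\<^sup>2 * b - 2 * Re (cnj c * a)"
  using wL kL by (simp add: l2sq_diff L2_scale l2sq_scale L2_inner_scale_right a_def b_def)
 finally have "2 * Re (cnj c * a) \<le> (norm c)\<^sup>2 * b" by simp
 moreover have "Re (cnj c * a) = t * (norm a)\<^sup>2"
  by (simp add: c_def cmod_power2 algebra_simps) (simp add: power2_eq_square algebra_simps)
 moreover have "(norm c)\<^sup>2 = t\<^sup>2 * (norm a)\<^sup>2" by (simp add: c_def norm_mult power_mult_distrib)
 ultimately have "2 * t * (norm a)\<^sup>2 \<le> t * (t * b) * (norm a)\<^sup>2" by (simp add: power2_eq_square algebra_simps)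
 moreover have "t > 0" "t * b < 1" using b by (auto simp: t_def)
 ultimately have "(2 - t * b) * (norm a)\<^sup>2 \<le> 0"
  by (simp add: algebra_simps)
 then have "(norm a)\<^sup>2 \<le> 0" using \<open>t * b < 1\<close> 
  by (smt (verit) mult_le_0_iff zero_le_power2)
 then show "L2_inner M (%x. f x - p x) k = 0" by (simp add: a_def w_def)
 qed
qed

definition ltotal :: "'a measure => ('a => complex) set => ('a => complex) set => bool" where
 "ltotal M V A \<longleftrightarrow> A \<subseteq> V & (\<forall>f\<in>V. (\<forall>a\<in>A. L2_inner M f a = 0) --> (AE x in M. f x = 0))"

text \<open>Totality is stated as triviality of the orthogonal complement inside \<open>V\<close>,
  which is what Fourier arguments deliver. Projecting onto the closed span turns it into
  density.\<close>

lemma total_cspan: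
 assumes V: "csub M V" and t: "ltotal M V A" shows "cspan M A = V"
proof
 have A: "A \<subseteq> V" using t by (simp add: ltotal_def)
 show sub: "cspan M A \<subseteq> V" by (rule cspan_least[OF V A])
 have AL: "A \<subseteq> L2 M" using A csub_L2[OF V] by auto
 note C = cspan_csub[OF AL]
 show "V \<subseteq> cspan M A"
 proof
 fix f assume f: "f \<in> V"
 obtain p where p: "p \<in> cspan M A" "!!g. g \<in> cspan M A ==> L2_inner M (%x. f x - p x) g = 0"
  using L2_projection[OF C csub_L2[OF V f]] by blast
 have "(%x. f x - p x) \<in> V" using csub_diff[OF V f] p sub by blast
 then have "AE x in M. f x - p x = 0"
  using t p(2) unfolding ltotal_def by (blast intro: cspan.base)
 then have "AE x in M. p x = f x" by eventually_elim simp
 then show "f \<in> cspan M A"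
  using csub_AE[OF C p(1)] csub_L2[OF V f] L2_measurable by blast
 qed
qed

section \<open>Isometries determined by equal Gram matrices\<close>

text \<open>The graph of the isometry sending \<open>a i\<close> to \<open>b i\<close>, closed under
  limits taken in both coordinates at once. Starting from a relation avoids representing vectors by
  coefficients; single-valuedness up to null sets follows from equality of the inner
  products.\<close>

inductive_set grel :: "'a measure => 'b measure => ('i => 'a => complex) => ('i => 'b => complex) => 'i set
 => (('a => complex) \<times> ('b => complex)) set"
 for M N a b I where
 base: "i \<in> I ==> (a i, b i) \<in> grel M N a b I"
| zero: "((%_. 0), (%_. 0)) \<in> grel M N a b I"
| add: "(f, g) \<in> grel M N a b I ==> (f', g') \<in> grel M N a b I
 ==> ((%x. f x + f' x), (%x. g x + g' x)) \<in> grel M N a b I"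
| scale: "(f, g) \<in> grel M N a b I ==> ((%x. c * f x), (%x. c * g x)) \<in> grel M N a b I"
| lim: "(!!n. (h n, k n) \<in> grel M N a b I) ==> f \<in> L2 M ==> g \<in> L2 N ==> l2lim M h f
 ==> l2lim N k g ==> (f, g) \<in> grel M N a b I"

lemma grel_swap: "(f, g) \<in> grel M N a b I ==> (g, f) \<in> grel N M b a I"
 by (induction f g rule: grel.induct) (auto intro: grel.intros)

lemma grel_in:
 assumes "csub M V" "csub N V'" "!!i. i \<in> I ==> a i \<in> V" "!!i. i \<in> I ==> b i \<in> V'"
 shows "(f, g) \<in> grel M N a b I ==> f \<in> V & g \<in> V'"
 by (induction f g rule: grel.induct)
  (use assms in \<open>auto intro: csubD(2-4)\<close>, (blast intro: csub_lim)+)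

definition isometric_map ::
 "'a measure => ('a => complex) set => 'b measure => ('b => complex) set
 => (('a => complex) => ('b => complex)) => bool" where
 "isometric_map M V N V' W \<longleftrightarrow>
  (\<forall>f\<in>V. W f \<in> V') &
  (\<forall>f\<in>V. \<forall>g\<in>V. AE y in N. W (%x. f x + g x) y = W f y + W g y) &
  (\<forall>c. \<forall>f\<in>V. AE y in N. W (%x. c * f x) y = c * W f y) &
  (\<forall>f\<in>V. \<forall>g\<in>V. L2_inner N (W f) (W g) = L2_inner M f g)"

lemma unitary_map_iff: "unitary_map M V N V' W \<longleftrightarrow>
 isometric_map M V N V' W & (\<forall>g\<in>V'. \<exists>f\<in>V. AE y in N. W f y = g y)"
 unfolding unitary_map_def isometric_map_def by blast

lemma isometric_mapD:
 assumes "isometric_map M V N V' W"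
 shows imap_in: "f \<in> V ==> W f \<in> V'"
 and imap_add: "f \<in> V ==> g \<in> V ==> AE y in N. W (%x. f x + g x) y = W f y + W g y"
 and imap_scale: "f \<in> V ==> AE y in N. W (%x. c * f x) y = c * W f y"
 and imap_inner: "f \<in> V ==> g \<in> V ==> L2_inner N (W f) (W g) = L2_inner M f g"
 using assms unfolding isometric_map_def by blast+

lemma imap_diff:
 assumes W: "isometric_map M V N V' W" and V: "csub M V" and "f \<in> V" "g \<in> V"
 shows "AE y in N. W (%x. f x - g x) y = W f y - W g y"
proof -
 have "AE y in N. W (%x. f x + - 1 * g x) y = W f y + W (%x. - 1 * g x) y"
 using assms by (intro imap_add[OF W] csub_scale[OF V])
 moreover have "AE y in N. W (%x. - 1 * g x) y = - 1 * W g y"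
 using assms by (intro imap_scale[OF W])
 ultimately show ?thesis by eventually_elim simp
qed

lemma imap_dist:
 assumes W: "isometric_map M V N V' W" and V: "csub M V" and V': "csub N V'" and f: "f \<in> V" "g \<in> V"
 shows "l2sq N (%y. W f y - W g y) = l2sq M (%x. f x - g x)"
proof -
 have d: "(%x. f x - g x) \<in> V" using csub_diff[OF V f] .
 have L: "W f \<in> L2 N" "W g \<in> L2 N" "W (%x. f x - g x) \<in> L2 N"
 using imap_in[OF W] f d csub_L2[OF V'] by auto
 have "L2_inner N (%y. W f y - W g y) (%y. W f y - W g y)
  = L2_inner N (W (%x. f x - g x)) (W (%x. f x - g x))"
 by (rule L2_inner_cong_AE) (use imap_diff[OF W V f] L in \<open>auto intro: L2_diff\<close>)
 then show ?thesis using imap_inner[OF W d d] by (simp add: l2sq_inner)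
qed

lemma imap_cong:
 assumes W: "isometric_map M V N V' W" and V: "csub M V" and V': "csub N V'" and f: "f \<in> V" "g \<in> V"
 and eq: "AE x in M. f x = g x"
 shows "AE y in N. W f y = W g y"
proof -
 have "l2sq M (%x. f x - g x) = 0"
 using l2sq_zero_iff[OF L2_diff] csub_L2[OF V] f eq by fastforce
 then have "l2sq N (%y. W f y - W g y) = 0" using imap_dist[OF W V V' f] by simp
 moreover have "W f \<in> L2 N" "W g \<in> L2 N" using imap_in[OF W] f csub_L2[OF V'] by auto
 ultimately show ?thesis using l2sq_zero_iff[OF L2_diff] by fastforce
qed

lemma imap_inj:
 assumes W: "isometric_map M V N V' W" and V: "csub M V" and V': "csub N V'" and f: "f \<in> V" "g \<in> V"
 and eq: "AE y in N. W f y = W g y"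
 shows "AE x in M. f x = g x"
proof -
 have L: "W f \<in> L2 N" "W g \<in> L2 N" using imap_in[OF W] f csub_L2[OF V'] by auto
 have "l2sq N (%y. W f y - W g y) = 0"
 using l2sq_zero_iff[OF L2_diff[OF L]] eq by fastforce
 then have "l2sq M (%x. f x - g x) = 0" using imap_dist[OF W V V' f] by simp
 then show ?thesis using l2sq_zero_iff[OF L2_diff] csub_L2[OF V] f by fastforce
qed

lemma imap_lim:
 assumes W: "isometric_map M V N V' W" and V: "csub M V" and V': "csub N V'"
 and "!!n. h n \<in> V" "f \<in> V" "l2lim M h f"
 shows "l2lim N (%n. W (h n)) (W f)"
 using assms by (simp add: imap_dist[OF W V V'])

lemma imap_comp:
 assumes W: "isometric_map M V N V' W" and W2: "isometric_map N V' K V'' W2"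
 and V: "csub M V" and V': "csub N V'" and V'': "csub K V''"
 shows "isometric_map M V K V'' (%f. W2 (W f))"
 unfolding isometric_map_def
proof (intro conjI ballI allI)
 fix f assume f: "f \<in> V"
 then show "W2 (W f) \<in> V''" using imap_in[OF W] imap_in[OF W2] by blast
next
 fix f g assume f: "f \<in> V" "g \<in> V"
 have "AE y in K. W2 (W (%x. f x + g x)) y = W2 (%y. W f y + W g y) y"
 by (intro imap_cong[OF W2 V' V''] imap_in[OF W] csub_add[OF V] csub_add[OF V'] f imap_add[OF W])
 moreover have "AE y in K. W2 (%y. W f y + W g y) y = W2 (W f) y + W2 (W g) y"
 by (intro imap_add[OF W2] imap_in[OF W] f)
 ultimately show "AE y in K. W2 (W (%x. f x + g x)) y = W2 (W f) y + W2 (W g) y"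
 by eventually_elim simp
next
 fix f c assume f: "f \<in> V"
 have "AE y in K. W2 (W (%x. c * f x)) y = W2 (%y. c * W f y) y"
 by (intro imap_cong[OF W2 V' V''] imap_in[OF W] csub_scale[OF V] csub_scale[OF V'] f imap_scale[OF W])
 moreover have "AE y in K. W2 (%y. c * W f y) y = c * W2 (W f) y"
 by (intro imap_scale[OF W2] imap_in[OF W] f)
 ultimately show "AE y in K. W2 (W (%x. c * f x)) y = c * W2 (W f) y"
 by eventually_elim simp
next
 fix f g assume f: "f \<in> V" "g \<in> V"
 then show "L2_inner K (W2 (W f)) (W2 (W g)) = L2_inner M f g"
 using imap_in[OF W] imap_inner[OF W2] imap_inner[OF W] by simp
qed

text \<open>Induction over the closed span of \<open>A\<close>. In the limit case the images of the
  approximants agree, so one sequence has both candidate values as its limit.\<close>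

lemma imap_agree:
 assumes W: "isometric_map M V N V' W1" and W2: "isometric_map M V N V' W2"
 and V: "csub M V" and V': "csub N V'" and t: "ltotal M V A"
 and eq: "!!a. a \<in> A ==> AE y in N. W1 a y = W2 a y" and f: "f \<in> V"
 shows "AE y in N. W1 f y = W2 f y"
proof -
 have "f \<in> cspan M A" using total_cspan[OF V t] f by simp
 then have "f \<in> V & (AE y in N. W1 f y = W2 f y)"
 proof induction
 case (base a) then show ?case using eq t by (auto simp: ltotal_def)
 next
 case zero
 have z: "(%_. 0) \<in> V" using csub_zero[OF V] .
 have "AE y in N. W1 (%x. 0 * (%_. 0) x) y = 0 * W1 (%_. 0) y" by (rule imap_scale[OF W z])
 moreover have "AE y in N. W2 (%x. 0 * (%_. 0) x) y = 0 * W2 (%_. 0) y" by (rule imap_scale[OF W2 z])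
 ultimately have "AE y in N. W1 (%_. 0) y = W2 (%_. 0) y" by eventually_elim simp
 then show ?case using z by simp
 next
 case (add f g)
 then have f: "f \<in> V" "g \<in> V" and eq: "AE y in N. W1 f y = W2 f y" "AE y in N. W1 g y = W2 g y" by auto
 have "AE y in N. W1 (%x. f x + g x) y = W2 (%x. f x + g x) y"
  using imap_add[OF W f] imap_add[OF W2 f] eq by eventually_elim simp
 then show ?case using csub_add[OF V f] by simp
 next
 case (scale f c)
 then have f: "f \<in> V" and eq: "AE y in N. W1 f y = W2 f y" by auto
 have "AE y in N. W1 (%x. c * f x) y = W2 (%x. c * f x) y"
  using imap_scale[OF W f, of c] imap_scale[OF W2 f, of c] eq by eventually_elim simp
 then show ?case using csub_scale[OF V f] by simp
 next
 case (lim h f)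
 have h: "!!n. h n \<in> V" "!!n. AE y in N. W1 (h n) y = W2 (h n) y" using lim.IH by auto
 have f: "f \<in> V" using csub_lim[OF V h(1) lim.hyps(2,3)] .
 have l1: "l2lim N (%n. W1 (h n)) (W1 f)" by (rule imap_lim[OF W V V' h(1) f lim.hyps(3)])
 have l2: "l2lim N (%n. W2 (h n)) (W2 f)" by (rule imap_lim[OF W2 V V' h(1) f lim.hyps(3)])
 have L: "W1 k \<in> L2 N" "W2 k \<in> L2 N" if "k \<in> V" for k
  using that imap_in[OF W] imap_in[OF W2] csub_L2[OF V'] by auto
 have "l2sq N (%y. W2 (h n) y - W2 f y) = l2sq N (%y. W1 (h n) y - W2 f y)" for n
  unfolding l2sq_inner
  by (rule arg_cong[where f=Re], rule L2_inner_cong_AE)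
   (use AE_symmetric[OF h(2)[of n]] L h f in \<open>auto intro!: L2_diff\<close>)
 then have "l2lim N (%n. W1 (h n)) (W2 f)" using l2 by simp
 then show ?case using l2lim_unique[OF _ _ _ l1] L h f by auto
 qed
 then show ?thesis by simp
qed

locale gram_pair =
 fixes M :: "'a measure" and N :: "'b measure" and V V' and a :: "'i => 'a => complex"
 and b :: "'i => 'b => complex" and I
 assumes V: "csub M V" and V': "csub N V'"
 and a: "!!i. i \<in> I ==> a i \<in> V" and b: "!!i. i \<in> I ==> b i \<in> V'"
 and gram: "!!i j. i \<in> I ==> j \<in> I ==> L2_inner M (a i) (a j) = L2_inner N (b i) (b j)"
begin

lemma GV: "(f, g) \<in> grel M N a b I ==> f \<in> V" "(f, g) \<in> grel M N a b I ==> g \<in> V'"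
 by (auto dest!: grel_in[OF V V' a b, rotated 2])

lemma GL: "(f, g) \<in> grel M N a b I ==> f \<in> L2 M" "(f, g) \<in> grel M N a b I ==> g \<in> L2 N"
 by (auto intro: csub_L2[OF V] csub_L2[OF V'] GV)

lemma grel_inner_base:
 assumes that: "(f, g) \<in> grel M N a b I" "j \<in> I"
 shows "L2_inner M f (a j) = L2_inner N g (b j)"
 using that(1)
proof (induction f g rule: grel.induct)
 case (base i) then show ?case using gram that by auto
next
 case (add f g f' g')
 then show ?case using GL[OF add(1)] GL[OF add(2)] GL[OF grel.base[OF that(2)]]
 by (simp add: L2_inner_add_left)
next
 case (lim h k f g)
 have "(%n. L2_inner M (h n) (a j)) \<longlonglongrightarrow> L2_inner M f (a j)"
 using GL[OF lim(1)] GL[OF grel.base[OF that(2)]] lim by (intro L2_inner_tendsto) auto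
 moreover have "(%n. L2_inner N (k n) (b j)) \<longlonglongrightarrow> L2_inner N g (b j)"
 using GL[OF lim(1)] GL[OF grel.base[OF that(2)]] lim by (intro L2_inner_tendsto) auto
 ultimately show ?case using LIMSEQ_unique by (auto simp: lim.IH)
qed (simp_all add: L2_inner_scale_left)

lemma grel_inner:
 assumes *: "(f, g) \<in> grel M N a b I" "(f', g') \<in> grel M N a b I"
 shows "L2_inner M f f' = L2_inner N g g'"
 using *(2)
proof (induction f' g' rule: grel.induct)
 case (base i) then show ?case using grel_inner_base * by auto
next
 case (add f1 g1 f' g')
 then show ?case using GL[OF add(1)] GL[OF add(2)] GL[OF *(1)]
 by (simp add: L2_inner_add_right)
next
 case (lim h k f1 g1)
 have "(%n. L2_inner M f (h n)) \<longlonglongrightarrow> L2_inner M f f1"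
 using GL[OF lim(1)] GL[OF *(1)] lim by (intro L2_inner_tendsto2) auto
 moreover have "(%n. L2_inner N g (k n)) \<longlonglongrightarrow> L2_inner N g g1"
 using GL[OF lim(1)] GL[OF *(1)] lim by (intro L2_inner_tendsto2) auto
 ultimately show ?case using LIMSEQ_unique by (auto simp: lim.IH)
qed (simp_all add: L2_inner_scale_right)

lemma grel_diff:
 assumes "(f, g) \<in> grel M N a b I" "(f', g') \<in> grel M N a b I"
 shows "((%x. f x - f' x), (%x. g x - g' x)) \<in> grel M N a b I"
 using grel.add[OF assms(1) grel.scale[OF assms(2), of "-1"]] by simp

lemma grel_dist:
 assumes "(f, g) \<in> grel M N a b I" "(f', g') \<in> grel M N a b I"
 shows "l2sq M (%x. f x - f' x) = l2sq N (%x. g x - g' x)"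
 using grel_inner[OF grel_diff[OF assms] grel_diff[OF assms]] by (simp add: l2sq_inner)

lemma grel_unique:
 assumes that: "(f, g) \<in> grel M N a b I" "(f', g') \<in> grel M N a b I" "AE x in M. f x = f' x"
 shows "AE y in N. g y = g' y"
proof -
 have "l2sq M (%x. f x - f' x) = 0"
 using l2sq_zero_iff[OF L2_diff[OF GL(1)[OF that(1)] GL(1)[OF that(2)]]] that by auto
 then have "l2sq N (%x. g x - g' x) = 0" using grel_dist[OF that(1,2)] by simp
 then show ?thesis using l2sq_zero_iff[OF L2_diff[OF GL(2)[OF that(1)] GL(2)[OF that(2)]]] by auto
 qed

text \<open>The domain of the relation is itself closed: if first components converge, equality of
  distances makes the second components Cauchy, and completeness supplies a partner. Containing a
  total family, it is all of \<open>V\<close>.\<close>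

lemma grel_domain:
 assumes t: "ltotal M V (a ` I)" and "f \<in> V"
 shows "\<exists>g. (f, g) \<in> grel M N a b I"
proof -
 let ?G = "grel M N a b I"
 have dom: "csub M {f. \<exists>g. (f, g) \<in> ?G}"
 unfolding csub_def
 proof (intro conjI allI impI ballI)
 fix h :: "nat => 'a => complex" and f
 assume h: "\<forall>n. h n \<in> {f. \<exists>g. (f, g) \<in> ?G}" and f: "f \<in> L2 M" and l: "l2lim M h f"
 from h obtain k where k: "!!n. (h n, k n) \<in> ?G" by (auto simp: choice_iff)
 obtain g where g: "g \<in> L2 N" "l2lim N k g"
 proof (rule L2_complete[of k N])
  fix e :: real assume e: "e > 0"
  have "\<forall>\<^sub>F n in sequentially. l2sq M (%x. h n x - f x) < e / 4"
  using l by (rule order_tendstoD) (use e in simp)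
  then obtain K where K: "!!n. n \<ge> K ==> l2sq M (%x. h n x - f x) < e / 4"
  by (auto simp: eventually_sequentially)
  have "l2sq N (%x. k m x - k n x) < e" if "m \<ge> K" "n \<ge> K" for m n
  proof -
  have "l2sq N (%x. k m x - k n x) = l2sq M (%x. (h m x - f x) + (f x - h n x))"
   using grel_dist[OF k k, of m n] by simp
  also have "\<dots> \<le> 2 * l2sq M (%x. h m x - f x) + 2 * l2sq M (%x. f x - h n x)"
   by (intro l2sq_add_le L2_diff f GL(1)[OF k])
  also have "\<dots> < e" using K[of m] K[of n] that by (simp add: l2sq_commute[of M f])
  finally show ?thesis .
  qed
  then show "\<exists>K. \<forall>m\<ge>K. \<forall>n\<ge>K. l2sq N (%x. k m x - k n x) < e" by auto
 qed (use GL(2)[OF k] in auto)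
 have "(f, g) \<in> ?G" by (rule grel.lim[of h k, OF k f g(1) l g(2)])
 then show "f \<in> {f. \<exists>g. (f, g) \<in> ?G}" by auto
 next
 fix f f' assume "f \<in> {f. \<exists>g. (f, g) \<in> ?G}" "f' \<in> {f. \<exists>g. (f, g) \<in> ?G}"
 then show "(%x. f x + f' x) \<in> {f. \<exists>g. (f, g) \<in> ?G}" by (auto intro: grel.add)
 next
 fix c f assume "f \<in> {f. \<exists>g. (f, g) \<in> ?G}"
 then show "(%x. c * f x) \<in> {f. \<exists>g. (f, g) \<in> ?G}" by (auto intro: grel.scale)
 qed (auto intro: GL exI[of _ "%_. 0"] grel.zero)
 have "cspan M (a ` I) \<subseteq> {f. \<exists>g. (f, g) \<in> ?G}"
  by (rule cspan_least[OF dom]) (auto intro: grel.base)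
 then show ?thesis using assms(2) total_cspan[OF V t] by auto
qed

end

text \<open>The source of nearly all isometries below: families with equal Gram matrices are matched
  by an isometry, which is unitary when the second family is total as well. Surjectivity is the
  domain statement for the swapped relation.\<close>

theorem imap_extension:
 assumes V: "csub M V" and V': "csub N V'"
 and a: "!!i. i \<in> I ==> a i \<in> V" and b: "!!i. i \<in> I ==> b i \<in> V'"
 and gram: "!!i j. i \<in> I ==> j \<in> I ==> L2_inner M (a i) (a j) = L2_inner N (b i) (b j)"
 and t: "ltotal M V (a ` I)"
 obtains W where "isometric_map M V N V' W" "!!i. i \<in> I ==> AE y in N. W (a i) y = b i y"
 "ltotal N V' (b ` I) ==> unitary_map M V N V' W"
proof -
 interpret gram_pair M N V V' a b I by standard (use assms in auto)
 let ?G = "grel M N a b I"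
 define W where "W f = (SOME g. (f, g) \<in> ?G)" for f
 have WG: "(f, W f) \<in> ?G" if "f \<in> V" for f using someI_ex[OF grel_domain[OF t that]] by (simp add: W_def)
 have iso: "isometric_map M V N V' W"
 unfolding isometric_map_def
 proof (intro conjI ballI allI)
 fix f g assume f: "f \<in> V" "g \<in> V"
 show "AE y in N. W (%x. f x + g x) y = W f y + W g y"
  by (rule grel_unique[OF WG[OF csub_add[OF V f]] grel.add[OF WG[OF f(1)] WG[OF f(2)]]]) auto
 show "L2_inner N (W f) (W g) = L2_inner M f g" using grel_inner[OF WG[OF f(1)] WG[OF f(2)]] by simp
 next
 fix f c assume f: "f \<in> V"
 show "AE y in N. W (%x. c * f x) y = c * W f y"
  by (rule grel_unique[OF WG[OF csub_scale[OF V f]] grel.scale[OF WG[OF f]]]) auto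
 show "W f \<in> V'" using GV[OF WG[OF f]] by simp
 qed
 moreover have Wa: "AE y in N. W (a i) y = b i y" if "i \<in> I" for i
 by (rule grel_unique[OF WG[OF a[OF that]] grel.base[OF that]]) auto
 moreover have "unitary_map M V N V' W" if t': "ltotal N V' (b ` I)"
 unfolding unitary_map_iff
 proof (intro conjI iso ballI)
 fix g assume g: "g \<in> V'"
 interpret swapped: gram_pair N M V' V b a I by standard (use assms in auto)
 obtain f where "(g, f) \<in> grel N M b a I" using swapped.grel_domain[OF t' g] by blast
 then have f: "(f, g) \<in> ?G" by (rule grel_swap)
 then have "f \<in> V" using GV by blast
 then show "\<exists>f\<in>V. AE y in N. W f y = g y" using grel_unique[OF WG f] by auto
 qed
 ultimately show thesis using that by blast
qed

lemma unitary_map_inverse: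
 assumes W: "unitary_map M V N V' W" and V: "csub M V" and V': "csub N V'"
 obtains W' where "unitary_map N V' M V W'" "!!f. f \<in> V ==> AE x in M. W' (W f) x = f x"
 "!!g. g \<in> V' ==> AE y in N. W (W' g) y = g y"
proof -
 have iso: "isometric_map M V N V' W" and "\<forall>g\<in>V'. \<exists>f\<in>V. AE y in N. W f y = g y"
 using W by (auto simp: unitary_map_iff)
 then obtain W' where W': "!!g. g \<in> V' ==> W' g \<in> V" "!!g. g \<in> V' ==> AE y in N. W (W' g) y = g y"
 by metis
 have inv: "AE x in M. W' (W f) x = f x" if "f \<in> V" for f
 by (rule imap_inj[OF iso V V']) (use that W' imap_in[OF iso] in auto)
 have iso': "isometric_map N V' M V W'"
 unfolding isometric_map_def
 proof (intro conjI ballI allI)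
 fix f g assume f: "f \<in> V'" "g \<in> V'"
 have "AE y in N. W (W' (%x. f x + g x)) y = W (%x. W' f x + W' g x) y"
  using W'(2)[OF csub_add[OF V' f]] W'(2)[OF f(1)] W'(2)[OF f(2)] imap_add[OF iso W'(1)[OF f(1)] W'(1)[OF f(2)]]
  by eventually_elim simp
 then show "AE y in M. W' (%x. f x + g x) y = W' f y + W' g y"
  by (intro imap_inj[OF iso V V']) (use f W' csub_add[OF V] csub_add[OF V'] in auto)
 have "L2_inner M (W' f) (W' g) = L2_inner N (W (W' f)) (W (W' g))"
  using imap_inner[OF iso] W'(1) f by simp
 also have "\<dots> = L2_inner N f g"
  by (rule L2_inner_cong_AE) (use W' f csub_L2[OF V'] imap_in[OF iso] in auto)
 finally show "L2_inner M (W' f) (W' g) = L2_inner N f g" .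
 next
 fix f c assume f: "f \<in> V'"
 have "AE y in N. W (W' (%x. c * f x)) y = W (%x. c * W' f x) y"
  using W'(2)[OF csub_scale[OF V' f, of c]] W'(2)[OF f] imap_scale[OF iso W'(1)[OF f], of c]
  by eventually_elim simp
 then show "AE y in M. W' (%x. c * f x) y = c * W' f y"
  by (intro imap_inj[OF iso V V']) (use f W' csub_scale[OF V] csub_scale[OF V'] in auto)
 qed (use W' in auto)
 have "unitary_map N V' M V W'"
 unfolding unitary_map_iff using iso' inv imap_in[OF iso] by blast
 then show thesis using that inv W'(2) by blast
qed

section \<open>Trigonometric polynomials and finite measures on the circle\<close>

definition circle_measure :: "complex measure => bool" where
 "circle_measure \<mu> \<longleftrightarrow> finite_measure \<mu> & sets \<mu> = sets borel & (AE z in \<mu>. cmod z = 1)"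

lemma circle_measureD:
 assumes "circle_measure \<mu>"
 shows "finite_measure \<mu>" "sets \<mu> = sets borel" "AE z in \<mu>. cmod z = 1" "space \<mu> = UNIV"
 using assms sets_eq_imp_space_eq[of \<mu> borel] by (auto simp: circle_measure_def)

lemma power_int_measurable [measurable]:
 "(%z::complex. z powi n) \<in> borel_measurable borel"
 by (auto simp: power_int_def)

inductive_set trig :: "(complex => complex) set" where
 base: "(%z. z powi n) \<in> trig"
| add: "p \<in> trig ==> q \<in> trig ==> (%z. p z + q z) \<in> trig"
| scale: "p \<in> trig ==> (%z. c * p z) \<in> trig"

lemma trig_measurable [measurable (raw)]: "p \<in> trig ==> p \<in> borel_measurable borel"
 by (induction rule: trig.induct) auto

lemma trig_bounded: "p \<in> trig ==> \<exists>B. \<forall>z. cmod z = 1 --> cmod (p z) \<le> B"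
proof (induction rule: trig.induct)
 case (base n) then show ?case by (auto simp: norm_power_int)
next
 case (add p q)
 then obtain B C where "\<forall>z. cmod z = 1 --> cmod (p z) \<le> B" "\<forall>z. cmod z = 1 --> cmod (q z) \<le> C" by auto
 then show ?case by (intro exI[of _ "B + C"]) (meson add_mono norm_triangle_ineq order_trans)
next
 case (scale p c)
 then obtain B where "\<forall>z. cmod z = 1 --> cmod (p z) \<le> B" by auto
 then show ?case by (intro exI[of _ "cmod c * B"]) (auto simp: norm_mult intro: mult_left_mono)
qed

lemma trig_mult_base:
 "p \<in> trig ==> \<exists>r\<in>trig. \<forall>z. cmod z = 1 --> z powi n * p z = r z"
proof (induction rule: trig.induct)
 case (base m)
 have "z powi n * z powi m = z powi (n + m)" if "cmod z = 1" for z
 using that by (subst power_int_add) auto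
 then show ?case by (intro bexI[OF _ trig.base[of "n + m"]]) auto
next
 case (add p q)
 then obtain r s where "r \<in> trig" "s \<in> trig" "\<forall>z. cmod z = 1 --> z powi n * p z = r z"
  "\<forall>z. cmod z = 1 --> z powi n * q z = s z" by blast
 then show ?case by (intro bexI[OF _ trig.add[of r s]]) (auto simp: distrib_left)
next
 case (scale p c)
 then obtain r where "r \<in> trig" "\<forall>z. cmod z = 1 --> z powi n * p z = r z" by blast
 then show ?case by (intro bexI[OF _ trig.scale[of r c]]) (auto simp: mult.left_commute)
qed

lemma trig_mult:
 "p \<in> trig ==> q \<in> trig ==> \<exists>r\<in>trig. \<forall>z. cmod z = 1 --> p z * q z = r z"
proof (induction rule: trig.induct)
 case (base n) then show ?case by (rule trig_mult_base)
next
 case (add p p')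
 then obtain r s where "r \<in> trig" "s \<in> trig" "\<forall>z. cmod z = 1 --> p z * q z = r z"
  "\<forall>z. cmod z = 1 --> p' z * q z = s z" by blast
 then show ?case by (intro bexI[OF _ trig.add[of r s]]) (auto simp: distrib_right)
next
 case (scale p c)
 then obtain r where "r \<in> trig" "\<forall>z. cmod z = 1 --> p z * q z = r z" by blast
 then show ?case by (intro bexI[OF _ trig.scale[of r c]]) (auto simp: mult.assoc)
qed

text \<open>A real linear form is a combination of \<open>z\<close> and its conjugate, and on the
  circle the conjugate is \<open>z powi -1\<close>. So real polynomials in the plane restrict to
  trigonometric polynomials, and Stone-Weierstrass for the former gives density of the
  latter.\<close>

lemma trig_real_polynomial:
 fixes g :: "complex => real"
 assumes "real_polynomial_function g"
 shows "\<exists>p\<in>trig. \<forall>z. cmod z = 1 --> of_real (g z) = p z"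
 using assms
proof (induction rule: real_polynomial_function.induct)
 case (linear h)
 interpret bounded_linear h by (rule linear)
 let ?p = "%z::complex. Complex (h 1 / 2) (- h \<i> / 2) * z powi 1 + Complex (h 1 / 2) (h \<i> / 2) * z powi (-1)"
 have p: "?p \<in> trig" by (intro trig.intros)
 have "of_real (h z) = ?p z" if "cmod z = 1" for z
 proof -
 have "z * cnj z = 1" using that complex_norm_square[of z] by simp
 then have "inverse z = cnj z" by (rule inverse_unique)
 then have i: "z powi (-1) = cnj z" by (simp add: power_int_minus)
 have "h z = h (Re z *\<^sub>R 1 + Im z *\<^sub>R \<i>)" by (rule arg_cong[of _ _ h]) (simp add: complex_eq_iff)
 also have "\<dots> = Re z * h 1 + Im z * h \<i>" unfolding add scaleR by simp
 finally have h: "h z = Re z * h 1 + Im z * h \<i>" .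
 show ?thesis unfolding i power_int_1_right h by (simp add: complex_eq_iff algebra_simps)
 qed
 with p show ?case by (intro bexI[of _ ?p] allI impI)
next
 case (const c)
 have "(%z. of_real c * z powi 0) \<in> trig" by (intro trig.intros)
 then show ?case by (intro bexI) auto
next
 case (add f g)
 then obtain p q where "p \<in> trig" "q \<in> trig" "\<forall>z. cmod z = 1 --> of_real (f z) = p z"
 "\<forall>z. cmod z = 1 --> of_real (g z) = q z" by blast
 then show ?case by (intro bexI[OF _ trig.add[of p q]]) auto
next
 case (mult f g)
 then obtain p q where p: "p \<in> trig" "q \<in> trig" "\<forall>z. cmod z = 1 --> of_real (f z) = p z"
 "\<forall>z. cmod z = 1 --> of_real (g z) = q z" by blast
 obtain r where "r \<in> trig" "\<forall>z. cmod z = 1 --> p z * q z = r z" using trig_mult p by blast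
 then show ?case using p by (intro bexI[of _ r]) auto
qed

lemma trig_approx:
 fixes \<phi> :: "complex => real"
 assumes "continuous_on (sphere 0 1) \<phi>"
 obtains p where "!!k. p k \<in> trig" "!!k z. cmod z = 1 ==> cmod (p k z - of_real (\<phi> z)) < 1 / real (Suc k)"
proof -
 have "\<exists>p\<in>trig. \<forall>z. cmod z = 1 --> cmod (p z - of_real (\<phi> z)) < 1 / real (Suc k)" for k
 proof -
 obtain g where g: "real_polynomial_function g" "!!x. x \<in> sphere 0 1 ==> \<bar>\<phi> x - g x\<bar> < 1 / real (Suc k)"
  using Stone_Weierstrass_real_polynomial_function[OF compact_sphere assms, of "1 / real (Suc k)"] by auto
 obtain p where p: "p \<in> trig" "\<forall>z. cmod z = 1 --> of_real (g z) = p z" using trig_real_polynomial[OF g(1)] by blast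
 have "cmod (p z - of_real (\<phi> z)) < 1 / real (Suc k)" if "cmod z = 1" for z
 proof -
  have "p z - of_real (\<phi> z) = of_real (g z - \<phi> z)" using p(2) that by simp
  then have "cmod (p z - of_real (\<phi> z)) = \<bar>g z - \<phi> z\<bar>" by (simp only: norm_of_real)
  then show ?thesis using g(2)[of z] that by (simp add: abs_minus_commute)
 qed
 then show ?thesis using p(1) by blast
 qed
 then show thesis using that by metis
qed

lemma trig_integrable:
 assumes "circle_measure \<mu>" "p \<in> trig" "integrable \<mu> f"
 shows "integrable \<mu> (%z. p z * f z)"
proof -
 obtain B where B: "\<forall>z. cmod z = 1 --> cmod (p z) \<le> B" using trig_bounded assms(2) by blast
 have [measurable]: "p \<in> borel_measurable \<mu>"
 using trig_measurable[OF assms(2)] circle_measureD(2)[OF assms(1)] measurable_cong_sets by blast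
 show ?thesis
 proof (rule Bochner_Integration.integrable_bound[where f="%z. B * norm (f z)"])
 show "AE z in \<mu>. norm (p z * f z) \<le> norm (B * norm (f z))"
  using circle_measureD(3)[OF assms(1)]
 proof eventually_elim
  case (elim z)
  then have "norm (p z * f z) \<le> B * norm (f z)" using B by (simp add: norm_mult mult_right_mono)
  then show ?case by simp
 qed
 qed (use assms(3) in auto)
qed

text \<open>The first limit serves uniqueness. The second approximates \<open>\<phi>^2\<close> by
  squared moduli of trigonometric polynomials, the only functions on which a positive definiteness
  hypothesis gives information.\<close>

lemma trig_approx_integral:
 assumes \<mu>: "circle_measure \<mu>" and f: "integrable \<mu> f" and \<phi>: "continuous_on UNIV \<phi>"
 and p: "!!k. p k \<in> trig" "!!k z. cmod z = 1 ==> cmod (p k z - of_real (\<phi> z)) < 1 / real (Suc k)"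
 shows "(%k. \<integral>z. p k z * f z \<partial>\<mu>) \<longlonglongrightarrow> (\<integral>z. of_real (\<phi> z) * f z \<partial>\<mu>)"
 and "(%k. \<integral>z. (p k z * cnj (p k z)) * f z \<partial>\<mu>) \<longlonglongrightarrow> (\<integral>z. of_real ((\<phi> z)\<^sup>2) * f z \<partial>\<mu>)"
proof -
 note [measurable_cong] = circle_measureD(2)[OF \<mu>]
 have [measurable]: "\<phi> \<in> borel_measurable borel" using \<phi> by (rule borel_measurable_continuous_onI)
 have [measurable]: "p k \<in> borel_measurable borel" for k using p(1) by measurable
 have [measurable]: "f \<in> borel_measurable \<mu>" using f by measurable
 have "compact (\<phi> ` sphere 0 1)"
 by (intro compact_continuous_image continuous_on_subset[OF \<phi>]) auto
 then obtain B where "\<forall>x\<in>sphere 0 1. \<bar>\<phi> x\<bar> \<le> B"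
 using compact_imp_bounded bounded_iff[of "\<phi> ` sphere 0 1"] by auto
 then have B: "!!z. cmod z = 1 ==> \<bar>\<phi> z\<bar> \<le> B" by simp
 have lim: "(%k. p k z) \<longlonglongrightarrow> of_real (\<phi> z)" if "cmod z = 1" for z
 by (rule LIM_zero_cancel, rule Lim_null_comparison[OF _ LIMSEQ_Suc[OF lim_1_over_n]])
  (use less_imp_le[OF p(2)[OF that]] in auto)
 have bd: "cmod (p k z) \<le> B + 1" if "cmod z = 1" for k z
 proof -
 have "cmod (p k z) \<le> cmod (p k z - of_real (\<phi> z)) + cmod (of_real (\<phi> z))"
  using norm_triangle_ineq[of "p k z - of_real (\<phi> z)" "of_real (\<phi> z)"] by simp
 also have "\<dots> \<le> 1 + B"
 proof (rule add_mono)
  have "1 / real (Suc k) \<le> 1" by simp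
  then show "cmod (p k z - of_real (\<phi> z)) \<le> 1" using p(2)[OF that, of k] by linarith
 qed (use B that in auto)
 finally show ?thesis by simp
 qed
 show "(%k. \<integral>z. p k z * f z \<partial>\<mu>) \<longlonglongrightarrow> (\<integral>z. of_real (\<phi> z) * f z \<partial>\<mu>)"
 proof (rule integral_dominated_convergence[where w="%z. (B + 1) * norm (f z)"])
 show "AE z in \<mu>. (%k. p k z * f z) \<longlonglongrightarrow> of_real (\<phi> z) * f z"
  using circle_measureD(3)[OF \<mu>] by eventually_elim (intro tendsto_intros lim)
 show "AE z in \<mu>. norm (p k z * f z) \<le> (B + 1) * norm (f z)" for k
  using circle_measureD(3)[OF \<mu>] by eventually_elim (simp add: norm_mult bd mult_right_mono)
 qed (use f in auto)
 show "(%k. \<integral>z. (p k z * cnj (p k z)) * f z \<partial>\<mu>) \<longlonglongrightarrow> (\<integral>z. of_real ((\<phi> z)\<^sup>2) * f z \<partial>\<mu>)"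
 proof (rule integral_dominated_convergence[where w="%z. ((B + 1) * (B + 1)) * norm (f z)"])
 show "AE z in \<mu>. (%k. (p k z * cnj (p k z)) * f z) \<longlonglongrightarrow> of_real ((\<phi> z)\<^sup>2) * f z"
  using circle_measureD(3)[OF \<mu>]
 proof eventually_elim
  case (elim z)
  have "(%k. (p k z * cnj (p k z)) * f z) \<longlonglongrightarrow> (of_real (\<phi> z) * cnj (of_real (\<phi> z))) * f z"
  by (intro tendsto_intros lim elim)
  then show ?case by (simp add: power2_eq_square)
 qed
 show "AE z in \<mu>. norm ((p k z * cnj (p k z)) * f z) \<le> ((B + 1) * (B + 1)) * norm (f z)" for k
  using circle_measureD(3)[OF \<mu>]
  by eventually_elim (auto simp: norm_mult intro!: mult_right_mono mult_mono bd order_trans[OF _ bd])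
 show "(%z. (p k z * cnj (p k z)) * f z) \<in> borel_measurable \<mu>" for k
  by (intro borel_measurable_times borel_measurable_continuous_on[where f=cnj] continuous_intros) measurable
 qed (use f in auto)
qed

text \<open>These continuous functions decrease to the indicator of \<open>C\<close>. Their squares
  are used throughout, so that the same approximation also serves the positivity statement.\<close>

definition closed_bump :: "complex set => nat => complex => real" where
 "closed_bump C k z = max 0 (1 - real k * infdist z C)"

lemma closed_bump_continuous: "continuous_on UNIV (closed_bump C k)"
 unfolding closed_bump_def by (intro continuous_intros)

lemma closed_bump_tendsto:
 assumes "closed C" "C ~= {}"
 shows "(%k. (closed_bump C k z)\<^sup>2) \<longlonglongrightarrow> indicator C z"
proof (cases "z \<in> C")
 case True then show ?thesis by (simp add: closed_bump_def)
next
 case False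
 then have d: "infdist z C > 0" using assms by (simp add: infdist_pos_not_in_closed)
 obtain n where n: "1 < real n * infdist z C" using reals_Archimedean3[OF d] by blast
 have "closed_bump C k z = 0" if "k \<ge> n" for k
 proof -
 have "1 < real k * infdist z C"
  using n mult_right_mono[of "real n" "real k" "infdist z C"] that d by linarith
 then show ?thesis by (simp add: closed_bump_def)
 qed
 then have "\<forall>\<^sub>F k in sequentially. (closed_bump C k z)\<^sup>2 = 0"
 by (auto simp: eventually_sequentially)
 then show ?thesis using False by (simp add: tendsto_eventually)
qed

lemma closed_bump_integral:
 fixes f :: "complex => complex"
 assumes \<mu>: "circle_measure \<mu>" and f: "integrable \<mu> f" and C: "closed C" "C ~= {}"
 shows "(%k. \<integral>z. of_real ((closed_bump C k z)\<^sup>2) * f z \<partial>\<mu>) \<longlonglongrightarrow> (\<integral>z. indicator C z * f z \<partial>\<mu>)"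
proof (rule integral_dominated_convergence[where w="%z. norm (f z)"])
 note [measurable_cong] = circle_measureD(2)[OF \<mu>]
 have [measurable]: "closed_bump C k \<in> borel_measurable borel" for k
 using closed_bump_continuous by (rule borel_measurable_continuous_onI)
 have [measurable]: "f \<in> borel_measurable \<mu>" using f by measurable
 have [measurable]: "C \<in> sets borel" using C by auto
 show "(%z. indicator C z * f z) \<in> borel_measurable \<mu>" by measurable
 show "(%z. of_real ((closed_bump C k z)\<^sup>2) * f z) \<in> borel_measurable \<mu>" for k by measurable
 show "AE z in \<mu>. (%k. of_real ((closed_bump C k z)\<^sup>2) * f z) \<longlonglongrightarrow> indicator C z * f z"
 proof (rule AE_I2)
 fix z
 have "(%k. of_real ((closed_bump C k z)\<^sup>2) * f z) \<longlonglongrightarrow> of_real (indicator C z) * f z"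
  by (intro tendsto_mult tendsto_const tendsto_of_real closed_bump_tendsto C)
 moreover have "of_real (indicator C z) = (indicator C z :: complex)" by (simp split: split_indicator)
 ultimately show "(%k. of_real ((closed_bump C k z)\<^sup>2) * f z) \<longlonglongrightarrow> indicator C z * f z"
  by (simp only:)
 qed
 have "0 \<le> closed_bump C k z" "closed_bump C k z \<le> 1" for k z
 by (auto simp: closed_bump_def infdist_nonneg)
 then have "(closed_bump C k z)\<^sup>2 \<le> 1" for k z by (simp add: power_le_one)
 then show "AE z in \<mu>. norm (of_real ((closed_bump C k z)\<^sup>2) * f z) \<le> norm (f z)" for k
 by (intro AE_I2) (auto simp: norm_mult norm_power mult_left_le_one_le simp del: of_real_power)
qed (use f in auto)

lemma integral_indicator_Re_Im:
 fixes f :: "'a => complex"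
 assumes "integrable M f" "K \<in> sets M"
 shows "(\<integral>z. indicator K z * (c * Re (f z)) \<partial>M) = c * Re (\<integral>z. indicator K z * f z \<partial>M)"
 and "(\<integral>z. indicator K z * (c * Im (f z)) \<partial>M) = c * Im (\<integral>z. indicator K z * f z \<partial>M)"
proof -
 have i: "integrable M (%z. indicator K z * f z)"
 by (rule Bochner_Integration.integrable_bound[OF assms(1)])
  (use assms in \<open>auto split: split_indicator\<close>)
 have "indicator K z * (c * Re (f z)) = c * Re (indicator K z * f z)"
 "indicator K z * (c * Im (f z)) = c * Im (indicator K z * f z)" for z
 by (auto split: split_indicator)
 then show "(\<integral>z. indicator K z * (c * Re (f z)) \<partial>M) = c * Re (\<integral>z. indicator K z * f z \<partial>M)"
 "(\<integral>z. indicator K z * (c * Im (f z)) \<partial>M) = c * Im (\<integral>z. indicator K z * f z \<partial>M)"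
 by (simp_all only: integral_mult_right_zero integral_Re[OF i] integral_Im[OF i])
qed

text \<open>On a compact part of the set where \<open>g\<close> is negative the integral is both
  nonnegative and nonpositive, so that part is null; inner regularity then makes the whole set
  null.\<close>

lemma nonneg_AE_from_compact:
 fixes g :: "complex => real"
 assumes \<mu>: "finite_measure \<mu>" "sets \<mu> = sets borel" and g: "integrable \<mu> g"
 and K: "!!K. compact K ==> K ~= {} ==> 0 \<le> (\<integral>z. indicator K z * g z \<partial>\<mu>)"
 shows "AE z in \<mu>. 0 \<le> g z"
proof -
 interpret finite_measure \<mu> by (rule \<mu>)
 note [measurable_cong] = \<mu>(2)
 have [measurable]: "g \<in> borel_measurable \<mu>" using g by measurable
 define B where "B = {z \<in> space \<mu>. g z < 0}"
 have B [measurable]: "B \<in> sets \<mu>" unfolding B_def by measurable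
 have "emeasure \<mu> K = 0" if "K \<subseteq> B" "compact K" for K
 proof (cases "K = {}")
 case False
 have [measurable]: "K \<in> sets borel" using that by (simp add: borel_closed compact_imp_closed)
 have int: "integrable \<mu> (%z. indicator K z * g z)"
  by (rule Bochner_Integration.integrable_bound[OF g]) (auto simp: indicator_def)
 have neg: "AE z in \<mu>. 0 \<le> - (indicator K z * g z)"
  using that by (intro AE_I2) (auto simp: B_def indicator_def)
 have "(\<integral>z. - (indicator K z * g z) \<partial>\<mu>) \<le> 0" using K[OF that(2) False] by simp
 then have "(\<integral>z. - (indicator K z * g z) \<partial>\<mu>) = 0"
  using integral_nonneg_AE[OF neg] by linarith
 then have "AE z in \<mu>. - (indicator K z * g z) = 0"
  using integral_nonneg_eq_0_iff_AE[OF _ neg] int by auto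
 then have "AE z in \<mu>. z \<notin> K"
  by eventually_elim (use that in \<open>auto simp: B_def indicator_def split: if_splits\<close>)
 moreover have "K \<in> sets \<mu>" by measurable
 ultimately have "K \<in> null_sets \<mu>" using AE_iff_null_sets by blast
 then show ?thesis by (rule null_setsD1)
 qed auto
 then have "(SUP K\<in>{K. K \<subseteq> B & compact K}. emeasure \<mu> K) \<le> 0" by (intro SUP_least) auto
 then have "emeasure \<mu> B = 0"
 using inner_regular[of \<mu> B] \<mu> B emeasure_finite by simp
 then have "AE z in \<mu>. z \<notin> B" using B by (intro AE_not_in) auto
 then show ?thesis by (auto simp: B_def elim!: AE_mp)
qed

text \<open>Vanishing coefficients pass from trigonometric polynomials to squared bumps and on to
  indicators of compact sets. The nonnegativity criterion is then applied to the real and imaginary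
  parts with both signs.\<close>

theorem circle_Fourier_unique:
 assumes \<mu>: "circle_measure \<mu>" and f: "integrable \<mu> f"
 and 0: "!!n. (\<integral>z. z powi n * f z \<partial>\<mu>) = (0::complex)"
 shows "AE z in \<mu>. f z = 0"
proof -
 note c = circle_measureD[OF \<mu>]
 have t: "(\<integral>z. p z * f z \<partial>\<mu>) = 0" if "p \<in> trig" for p
 using that by (induction rule: trig.induct)
  (simp_all add: 0 distrib_right trig_integrable[OF \<mu> _ f] mult.assoc)
 have K: "(\<integral>z. indicator K z * f z \<partial>\<mu>) = 0" if K: "compact K" "K ~= {}" for K
 proof -
 have "(\<integral>z. of_real ((closed_bump K k z)\<^sup>2) * f z \<partial>\<mu>) = 0" for k
 proof -
  have cont: "continuous_on UNIV (%z. (closed_bump K k z)\<^sup>2)"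
  by (intro continuous_intros closed_bump_continuous)
  obtain p where p: "!!j. p j \<in> trig"
  "!!j z. cmod z = 1 ==> cmod (p j z - of_real ((closed_bump K k z)\<^sup>2)) < 1 / real (Suc j)"
  using trig_approx[OF continuous_on_subset[OF cont]] by (metis subset_UNIV)
  from trig_approx_integral(1)[OF \<mu> f cont p] t[OF p(1)] show ?thesis
  by (simp add: LIMSEQ_const_iff)
 qed
 with closed_bump_integral[OF \<mu> f compact_imp_closed[OF K(1)] K(2)] show ?thesis
  by (simp add: LIMSEQ_const_iff)
 qed
 have re: "(\<integral>z. indicator K z * (c * Re (f z)) \<partial>\<mu>) = 0" "(\<integral>z. indicator K z * (c * Im (f z)) \<partial>\<mu>) = 0"
 if "compact K" "K ~= {}" for K and c :: real
 proof -
 have [measurable]: "K \<in> sets \<mu>" using that c by (simp add: borel_closed compact_imp_closed)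
 show "(\<integral>z. indicator K z * (c * Re (f z)) \<partial>\<mu>) = 0" "(\<integral>z. indicator K z * (c * Im (f z)) \<partial>\<mu>) = 0"
  by (simp_all only: integral_indicator_Re_Im[OF f \<open>K \<in> sets \<mu>\<close>] K[OF that]) simp_all
 qed
 have "AE z in \<mu>. 0 \<le> d * Re (f z)" "AE z in \<mu>. 0 \<le> d * Im (f z)" for d :: real
 by (rule nonneg_AE_from_compact[OF c(1,2)], (use f in simp)[], unfold re, rule order_refl)+
 from this[of 1] this[of "-1"] show ?thesis
 by eventually_elim (auto simp: complex_eq_iff)
qed

text \<open>The uniqueness half of Herglotz' theorem for a measure already known to have a complex
  density: indicators of compact sets are limits of squared moduli of trigonometric polynomials, so
  \<open>f\<close> is tested to be real and nonnegative on all of them.\<close>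

theorem circle_positive_definite:
 assumes \<mu>: "circle_measure \<mu>" and f: "integrable \<mu> f"
 and pos: "!!p. p \<in> trig ==> 0 \<le> Re (\<integral>z. (p z * cnj (p z)) * f z \<partial>\<mu>) & Im (\<integral>z. (p z * cnj (p z)) * f z \<partial>\<mu>) = 0"
 shows "AE z in \<mu>. f z = of_real (Re (f z)) & 0 \<le> Re (f z)"
proof -
 note c = circle_measureD[OF \<mu>]
 let ?P = "{w. 0 \<le> Re w} \<inter> {w. Im w = 0}"
 have cl: "closed ?P" by (intro closed_Int closed_halfspace_Re_ge closed_Collect_eq continuous_intros)
 have K: "(\<integral>z. indicator K z * f z \<partial>\<mu>) \<in> ?P" if K: "compact K" "K ~= {}" for K
 proof (rule closed_sequentially[OF cl _ closed_bump_integral[OF \<mu> f compact_imp_closed[OF K(1)] K(2)]])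
 fix k
 note cont = closed_bump_continuous[of K k]
 obtain p where p: "!!j. p j \<in> trig"
  "!!j z. cmod z = 1 ==> cmod (p j z - of_real (closed_bump K k z)) < 1 / real (Suc j)"
  using trig_approx[OF continuous_on_subset[OF cont]] by (metis subset_UNIV)
 show "(\<integral>z. of_real ((closed_bump K k z)\<^sup>2) * f z \<partial>\<mu>) \<in> ?P"
  by (rule closed_sequentially[OF cl _ trig_approx_integral(2)[OF \<mu> f cont p]]) (use pos p in auto)
 qed
 have re: "0 \<le> (\<integral>z. indicator K z * Re (f z) \<partial>\<mu>)" "(\<integral>z. indicator K z * (c * Im (f z)) \<partial>\<mu>) = 0"
 if "compact K" "K ~= {}" for K and c :: real
 proof -
 have [measurable]: "K \<in> sets \<mu>" using that c by (simp add: borel_closed compact_imp_closed)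
 have k: "0 \<le> Re (\<integral>z. indicator K z * f z \<partial>\<mu>)" "Im (\<integral>z. indicator K z * f z \<partial>\<mu>) = 0"
  using K[OF that] by auto
 show "0 \<le> (\<integral>z. indicator K z * Re (f z) \<partial>\<mu>)"
  using integral_indicator_Re_Im(1)[OF f \<open>K \<in> sets \<mu>\<close>, of 1] k(1) by (simp only: mult_1_left)
 show "(\<integral>z. indicator K z * (c * Im (f z)) \<partial>\<mu>) = 0"
  by (simp only: integral_indicator_Re_Im(2)[OF f \<open>K \<in> sets \<mu>\<close>] k mult_zero_right)
 qed
 have "AE z in \<mu>. 0 \<le> Re (f z)"
 by (rule nonneg_AE_from_compact[OF c(1,2)]) (use f re(1) in auto)
 moreover have "AE z in \<mu>. 0 \<le> d * Im (f z)" for d :: real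
 by (rule nonneg_AE_from_compact[OF c(1,2)], (use f in simp)[], unfold re(2), rule order_refl)
 note this[of 1] this[of "-1"]
 ultimately show ?thesis
 by eventually_elim (auto simp: complex_eq_iff)
qed

theorem circle_measure_eqI:
 assumes \<mu>: "circle_measure \<mu>" and \<nu>: "circle_measure \<nu>"
 and eq: "!!n. (\<integral>z. z powi n \<partial>\<mu>) = (\<integral>z. z powi n \<partial>\<nu>)"
 shows "\<mu> = \<nu>"
proof -
 interpret \<mu>: finite_measure \<mu> by (rule circle_measureD[OF \<mu>])
 interpret \<nu>: finite_measure \<nu> by (rule circle_measureD[OF \<nu>])
 note c = circle_measureD[OF \<mu>] and d = circle_measureD[OF \<nu>]
 have one: "integrable \<mu> (%_. 1::complex)" "integrable \<nu> (%_. 1::complex)" by auto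
 have t: "(\<integral>z. p z \<partial>\<mu>) = (\<integral>z. p z \<partial>\<nu>)" if "p \<in> trig" for p
 using that by (induction rule: trig.induct)
  (use trig_integrable[OF \<mu> _ one(1)] trig_integrable[OF \<nu> _ one(2)] eq in simp_all)
 have K: "measure \<mu> C = measure \<nu> C" if C: "closed C" "C ~= {}" for C
 proof -
 have [measurable]: "C \<in> sets \<mu>" "C \<in> sets \<nu>" using C c d by auto
 have "(\<integral>z. of_real ((closed_bump C k z)\<^sup>2) * 1 \<partial>\<mu>) = (\<integral>z. of_real ((closed_bump C k z)\<^sup>2) * (1::complex) \<partial>\<nu>)" for k
 proof -
  have cont: "continuous_on UNIV (%z. (closed_bump C k z)\<^sup>2)"
  by (intro continuous_intros closed_bump_continuous)
  obtain p where p: "!!j. p j \<in> trig"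
  "!!j z. cmod z = 1 ==> cmod (p j z - of_real ((closed_bump C k z)\<^sup>2)) < 1 / real (Suc j)"
  using trig_approx[OF continuous_on_subset[OF cont]] by (metis subset_UNIV)
  have "(%j. \<integral>z. p j z * 1 \<partial>\<mu>) = (%j. \<integral>z. p j z * 1 \<partial>\<nu>)" using t[OF p(1)] by simp
  then show ?thesis
  using LIMSEQ_unique[OF trig_approx_integral(1)[OF \<mu> one(1) cont p]]
   trig_approx_integral(1)[OF \<nu> one(2) cont p] by (simp only:)
 qed
 then have "(\<integral>z. indicator C z * 1 \<partial>\<mu>) = (\<integral>z. indicator C z * (1::complex) \<partial>\<nu>)"
  using LIMSEQ_unique[OF closed_bump_integral[OF \<mu> one(1) C]] closed_bump_integral[OF \<nu> one(2) C]
  by (simp only:)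
 moreover have "(indicator C z * 1 :: complex) = of_real (indicator C z)" for z
  by (simp split: split_indicator)
 ultimately show ?thesis using c d by simp
 qed
 have sets_borel_eq_closed: "sets borel = sigma_sets UNIV (Collect closed :: complex set set)"
 by (subst borel_eq_closed) (simp add: sets_measure_of)
 show ?thesis
 proof (rule measure_eqI_generator_eq[where E="Collect closed" and A="%_. UNIV" and \<Omega>=UNIV])
 show "emeasure \<mu> X = emeasure \<nu> X" if "X \<in> Collect closed" for X
  using that K[of X] by (cases "X = {}") (auto simp: \<mu>.emeasure_eq_measure \<nu>.emeasure_eq_measure)
 qed (use c d sets_borel_eq_closed in \<open>auto simp: Int_stable_def\<close>)
qed

lemma cnj_power_int_circle:
 assumes "cmod z = 1" shows "cnj (z powi n) = z powi (- n)"
proof -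
 have "z * cnj z = 1" using assms complex_norm_square[of z] by simp
 then have "inverse z = cnj z" by (rule inverse_unique)
 moreover have "cnj (z powi n) = cnj z powi n" by (simp add: power_int_def)
 ultimately show ?thesis by (metis power_int_inverse power_int_minus)
qed

lemma ltotal_cspan:
 assumes "A \<subseteq> L2 M" shows "ltotal M (cspan M A) A"
 unfolding ltotal_def
proof (intro conjI ballI impI)
 fix f assume f: "f \<in> cspan M A" "\<forall>a\<in>A. L2_inner M f a = 0"
 have fL: "f \<in> L2 M" using cspan_least[OF csub_UNIV assms] f by auto
 have "L2_inner M a f = 0" if "a \<in> A" for a using f(2) that by (subst L2_inner_commute) simp
 then have "L2_inner M f f = 0" using cspan_orth[OF assms fL _ f(1)] by blast
 then show "AE x in M. f x = 0" using l2sq_zero_iff[OF fL] by (simp add: L2_inner_self)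
qed (auto intro: cspan.base)

section \<open>Unitary groups, spectral densities and orthogonal cyclic subspaces\<close>

text \<open>Linearity holds pointwise but the group laws only almost everywhere. This is exactly
  what composition with the iterates of an almost everywhere invertible map provides.\<close>

locale unitary_group =
 fixes M :: "'a measure" and V and P :: "int => ('a => complex) => 'a => complex"
 assumes V: "csub M V"
 and P_in: "f \<in> V ==> P n f \<in> V"
 and P_add: "P n (%x. f x + g x) = (%x. P n f x + P n g x)"
 and P_scale: "P n (%x. c * f x) = (%x. c * P n f x)"
 and P_inner: "f \<in> V ==> g \<in> V ==> L2_inner M (P n f) (P n g) = L2_inner M f g"
 and P_comp: "f \<in> V ==> AE x in M. P n (P k f) x = P (n + k) f x"
 and P_zero: "f \<in> V ==> AE x in M. P 0 f x = f x"
begin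

lemma VL: "f \<in> V ==> f \<in> L2 M" using csub_L2[OF V] .

lemma P_imap: "isometric_map M V M V (P n)"
 unfolding isometric_map_def using P_in P_inner by (auto simp: P_add P_scale)

lemma P_diff: "P n (%x. f x - g x) = (%x. P n f x - P n g x)"
 using P_add[of n f "%x. - 1 * g x"] P_scale[of n "-1" g] by simp

lemma P_inner_shift:
 assumes "f \<in> V" "g \<in> V"
 shows "L2_inner M (P n f) (P k g) = L2_inner M (P (n - k) f) g"
proof -
 have "L2_inner M (P (n - k) f) g = L2_inner M (P k (P (n - k) f)) (P k g)"
 using assms by (simp add: P_inner P_in)
 also have "\<dots> = L2_inner M (P n f) (P k g)"
 using P_comp[OF assms(1), of k "n - k"] assms by (intro L2_inner_cong_AE) (auto intro: VL P_in)
 finally show ?thesis by simp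
qed

lemma P_adj:
 assumes "f \<in> V" "g \<in> V"
 shows "L2_inner M (P n f) g = L2_inner M f (P (- n) g)"
proof -
 have "L2_inner M (P 0 f) (P (- n) g) = L2_inner M (P n f) g"
 using P_inner_shift[OF assms, of 0 "- n"] by simp
 moreover have "L2_inner M (P 0 f) (P (- n) g) = L2_inner M f (P (- n) g)"
 using P_zero[OF assms(1)] assms by (intro L2_inner_cong_AE) (auto intro: VL P_in)
 ultimately show ?thesis by simp
qed

definition orb :: "('a => complex) set => ('a => complex) set" where
 "orb A = {P n a | n a. a \<in> A}"

lemma orb_sub: "A \<subseteq> V ==> orb A \<subseteq> V" "A \<subseteq> V ==> orb A \<subseteq> L2 M"
 using P_in VL by (auto simp: orb_def)

lemma orb_span_invariant:
 assumes A: "A \<subseteq> V" and f: "f \<in> cspan M (orb A)"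
 shows "P k f \<in> cspan M (orb A)"
proof -
 note C = cspan_csub[OF orb_sub(2)[OF A]]
 have CV: "cspan M (orb A) \<subseteq> V" by (rule cspan_least[OF V orb_sub(1)[OF A]])
 show ?thesis using f
 proof induction
 case (base a)
 then obtain n b where b: "a = P n b" "b \<in> A" by (auto simp: orb_def)
 have "P (k + n) b \<in> cspan M (orb A)" using b by (auto simp: orb_def intro!: cspan.base)
 moreover have "AE x in M. P (k + n) b x = P k a x"
  using P_comp[of b k n] b A by (auto simp: eq_commute)
 moreover have "P k a \<in> borel_measurable M"
  using b A by (intro L2_measurable VL P_in) (auto intro: P_in)
 ultimately show ?case using csub_AE[OF C] by blast
 next
 case zero
 have "P k (%_. 0) = (%x. 0 * P k (%_. 0) x)" using P_scale[of k 0 "%_. 0"] by simp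
 then show ?case by (simp add: cspan.zero)
 next
 case (lim h f)
 show ?case
 proof (rule csub_lim[OF C, of "%n. P k (h n)"])
  have hV: "h n \<in> V" for n using lim.hyps(1) CV by auto
  have fV: "f \<in> V" using csub_lim[OF V hV lim.hyps(2,3)] .
  show "P k f \<in> L2 M" using fV by (intro VL P_in)
  show "l2lim M (%n. P k (h n)) (P k f)" by (rule imap_lim[OF P_imap V V hV fV lim.hyps(3)])
 qed (use lim in auto)
 qed (simp_all add: P_add P_scale cspan.add cspan.scale)
qed

end

lemma trig_finite_sum:
 assumes "p \<in> trig"
 shows "\<exists>F c. finite F & F ~= {} & (\<forall>z. p z = (\<Sum>n\<in>F. c n * z powi n))"
 using assms
proof induction
 case (base n) then show ?case by (intro exI[of _ "{n}"] exI[of _ "%_. 1"]) simp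
next
 case (add p q)
 then obtain F c G d where F: "finite F" "F ~= {}" "\<forall>z. p z = (\<Sum>n\<in>F. c n * z powi n)"
 and G: "finite G" "G ~= {}" "\<forall>z. q z = (\<Sum>n\<in>G. d n * z powi n)" by blast
 have "p z + q z = (\<Sum>n\<in>F \<union> G. ((if n \<in> F then c n else 0) + (if n \<in> G then d n else 0)) * z powi n)" for z
 proof -
 have "p z = (\<Sum>n\<in>F \<union> G. (if n \<in> F then c n else 0) * z powi n)"
  unfolding F(3)[rule_format] by (rule sum.mono_neutral_cong_left) (use F G in auto)
 moreover have "q z = (\<Sum>n\<in>F \<union> G. (if n \<in> G then d n else 0) * z powi n)"
  unfolding G(3)[rule_format] by (rule sum.mono_neutral_cong_left) (use F G in auto)
 ultimately show ?thesis by (simp add: distrib_right sum.distrib)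
 qed
 with F G show ?case
 by (intro exI[of _ "F \<union> G"] exI[of _ "%n. (if n \<in> F then c n else 0) + (if n \<in> G then d n else 0)"]) auto
next
 case (scale p a)
 then obtain F c where F: "finite F" "F ~= {}" "\<forall>z. p z = (\<Sum>n\<in>F. c n * z powi n)" by blast
 then show ?case by (intro exI[of _ F] exI[of _ "%n. a * c n"]) (simp add: sum_distrib_left mult.assoc)
qed

lemma power_int_integrable:
 assumes "circle_measure \<mu>" "integrable \<mu> f"
 shows "integrable \<mu> (%z. z powi n * f z)"
 using trig_integrable[OF assms(1) trig.base assms(2)] .

context unitary_group
begin

text \<open>The integral of \<open>|p|^2 * g\<close> is the squared norm of the vector obtained by
  applying the trigonometric polynomial \<open>p\<close> to the group and then to
  \<open>v\<close>.\<close>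

lemma spectral_density_nonneg:
 assumes \<mu>: "circle_measure \<mu>" and g: "integrable \<mu> g" and v: "v \<in> V"
 and eq: "!!n. L2_inner M (P n v) v = (\<integral>z. z powi n * g z \<partial>\<mu>)"
 shows "AE z in \<mu>. g z = of_real (Re (g z)) & 0 \<le> Re (g z)"
proof (rule circle_positive_definite[OF \<mu> g])
 fix p assume p: "p \<in> trig"
 obtain F c where F: "finite F" "F ~= {}" "!!z. p z = (\<Sum>n\<in>F. c n * z powi n)"
 using trig_finite_sum[OF p] by blast
 define w where "w x = (\<Sum>n\<in>F. c n * P n v x)" for x
 have PL: "P n v \<in> L2 M" for n using v by (intro VL P_in)
 have "L2_inner M w w = (\<Sum>n\<in>F. \<Sum>k\<in>F. c n * cnj (c k) * L2_inner M (P n v) (P k v))"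
 unfolding w_def
 by (simp add: L2_inner_sum_left L2_inner_sum_right L2_sum L2_scale PL L2_inner_scale_left
  L2_inner_scale_right sum_distrib_left mult.assoc)
 also have "\<dots> = (\<Sum>n\<in>F. \<Sum>k\<in>F. \<integral>z. c n * cnj (c k) * (z powi (n - k) * g z) \<partial>\<mu>)"
 using v by (simp add: P_inner_shift eq)
 also have "\<dots> = (\<integral>z. (\<Sum>n\<in>F. \<Sum>k\<in>F. c n * cnj (c k) * (z powi (n - k) * g z)) \<partial>\<mu>)"
 using power_int_integrable[OF \<mu> g] by (simp add: Bochner_Integration.integral_sum)
 also have "\<dots> = (\<integral>z. (p z * cnj (p z)) * g z \<partial>\<mu>)"
 proof (rule integral_cong_AE)
 note [measurable_cong] = circle_measureD(2)[OF \<mu>]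
 have gm [measurable]: "g \<in> borel_measurable \<mu>" using g by measurable
 have pm [measurable]: "p \<in> borel_measurable borel" using p by measurable
 show "(%z. \<Sum>n\<in>F. \<Sum>k\<in>F. c n * cnj (c k) * (z powi (n - k) * g z)) \<in> borel_measurable \<mu>" by measurable
 show "(%z. (p z * cnj (p z)) * g z) \<in> borel_measurable \<mu>"
  by (intro borel_measurable_times borel_measurable_continuous_on[where f=cnj] continuous_intros) measurable
 show "AE z in \<mu>. (\<Sum>n\<in>F. \<Sum>k\<in>F. c n * cnj (c k) * (z powi (n - k) * g z)) = (p z * cnj (p z)) * g z"
  using circle_measureD(3)[OF \<mu>]
 proof eventually_elim
  case (elim z)
  have "z powi (n - k) = z powi n * cnj (z powi k)" for n k
  proof -
  have "z ~= 0" using elim by auto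
  then show ?thesis unfolding cnj_power_int_circle[OF elim] using power_int_add[of z n "- k"] by simp
  qed
  note zp = this
  have "(p z * cnj (p z)) * g z = (\<Sum>n\<in>F. \<Sum>k\<in>F. (c n * z powi n) * cnj (c k * z powi k) * g z)"
  proof -
  have "p z * cnj (p z) = (\<Sum>n\<in>F. \<Sum>k\<in>F. (c n * z powi n) * cnj (c k * z powi k))"
   by (simp only: F(3) cnj_sum sum_product)
  then show ?thesis by (simp only: sum_distrib_right)
  qed
  also have "\<dots> = (\<Sum>n\<in>F. \<Sum>k\<in>F. c n * cnj (c k) * (z powi (n - k) * g z))"
  by (intro sum.cong refl) (simp only: zp complex_cnj_mult mult_ac)
  finally show ?case by simp
 qed
 qed
 finally have "(\<integral>z. (p z * cnj (p z)) * g z \<partial>\<mu>) = of_real (l2sq M w)" by (simp add: L2_inner_self)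
 then show "0 \<le> Re (\<integral>z. (p z * cnj (p z)) * g z \<partial>\<mu>) & Im (\<integral>z. (p z * cnj (p z)) * g z \<partial>\<mu>) = 0" by simp
qed

text \<open>The spectral measure of \<open>v\<close> has density \<open>f\<close> with respect to
  \<mu>. The density is a Borel function that is nonnegative everywhere, so that the number of
  densities positive at \<open>z\<close> can later be counted point by point.\<close>

definition spectral_density :: "complex measure => ('a => complex) => (complex => real) => bool" where
 "spectral_density \<mu> v f \<longleftrightarrow> f \<in> borel_measurable borel & integrable \<mu> f & (\<forall>z. 0 \<le> f z) &
  (\<forall>n. L2_inner M (P n v) v = (\<integral>z. z powi n * of_real (f z) \<partial>\<mu>))"

lemma sqrt_density_L2:
 assumes \<mu>: "circle_measure \<mu>" and f: "f \<in> borel_measurable borel" "integrable \<mu> f" "!!z. 0 \<le> f z"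
 shows "(%z. z powi n * of_real (sqrt (f z))) \<in> L2 \<mu>"
proof -
 note [measurable_cong] = circle_measureD(2)[OF \<mu>]
 note [measurable] = f(1)
 show ?thesis
 proof (rule L2_bound[OF _ f(2)])
 show "AE z in \<mu>. (cmod (z powi n * of_real (sqrt (f z))))\<^sup>2 \<le> f z"
  using circle_measureD(3)[OF \<mu>]
  by eventually_elim (use f(3) in \<open>simp add: norm_mult norm_power_int power_mult_distrib\<close>)
 qed measurable
qed

text \<open>The cyclic space of \<open>v\<close> embeds into \<open>L2 \<mu>\<close> by sending
  \<open>P n v\<close> to \<open>z powi n * sqrt (f z)\<close>. Since \<open>p\<close> and its
  translates lie in \<open>Z\<close>, the correlations of the residual with itself equal those of
  \<open>P n v\<close> with the projection \<open>q\<close> of the residual onto that cyclic space.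
  So they have the density \<open>sqrt f * cnj (W q)\<close>, which visibly vanishes where
  \<open>f\<close> does; that it is nonnegative comes from positive definiteness.\<close>

lemma spectral_density_project:
 assumes \<mu>: "circle_measure \<mu>" and v: "v \<in> V" and d: "spectral_density \<mu> v f"
 and Z: "csub M Z" "Z \<subseteq> V" "!!n u. u \<in> Z ==> P n u \<in> Z"
 and p: "p \<in> Z" "!!u. u \<in> Z ==> L2_inner M (%x. v x - p x) u = 0"
 obtains f' where "spectral_density \<mu> (%x. v x - p x) f'" "AE z in \<mu>. f z = 0 --> f' z = 0"
proof -
 have f [measurable]: "f \<in> borel_measurable borel" and fi: "integrable \<mu> f" and f0: "!!z. 0 \<le> f z"
 and feq: "!!n. L2_inner M (P n v) v = (\<integral>z. z powi n * of_real (f z) \<partial>\<mu>)"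
 using d by (auto simp: spectral_density_def)
 note [measurable_cong] = circle_measureD(2)[OF \<mu>]
 define v' where "v' = (%x. v x - p x)"
 have pV: "p \<in> V" using p Z by auto
 have v'V: "v' \<in> V" unfolding v'_def by (intro csub_diff[OF V] v pV)
 define C where "C = cspan M (orb {v})"
 have orbL: "orb {v} \<subseteq> L2 M" "orb {v} \<subseteq> V" using v orb_sub[of "{v}"] by auto
 have C: "csub M C" unfolding C_def by (rule cspan_csub[OF orbL(1)])
 have orbr: "orb {v} = (%n. P n v) ` UNIV" by (auto simp: orb_def)
 define b where "b n z = z powi n * complex_of_real (sqrt (f z))" for n z
 have bL: "b n \<in> L2 \<mu>" for n unfolding b_def by (rule sqrt_density_L2[OF \<mu> f fi f0])
 have gram: "L2_inner M (P i v) (P j v) = L2_inner \<mu> (b i) (b j)" for i j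
 proof -
 have "L2_inner \<mu> (b i) (b j) = (\<integral>z. z powi (i - j) * of_real (f z) \<partial>\<mu>)"
  unfolding L2_inner_def
 proof (rule integral_cong_AE)
  show "(%z. b i z * cnj (b j z)) \<in> borel_measurable \<mu>"
  using L2_inner_integrable[OF bL bL] by (rule borel_measurable_integrable)
  show "AE z in \<mu>. b i z * cnj (b j z) = z powi (i - j) * of_real (f z)"
  using circle_measureD(3)[OF \<mu>]
  proof eventually_elim
  case (elim z)
  then have "z ~= 0" by auto
  have ss: "complex_of_real (sqrt (f z)) * complex_of_real (sqrt (f z)) = of_real (f z)"
   using f0[of z] by (simp flip: of_real_mult)
  have "b i z * cnj (b j z)
   = (z powi i * cnj (z powi j)) * (complex_of_real (sqrt (f z)) * complex_of_real (sqrt (f z)))"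
   by (simp add: b_def mult_ac)
  also have "\<dots> = z powi (i - j) * of_real (f z)"
   unfolding ss cnj_power_int_circle[OF elim] using power_int_add[of z i "- j"] \<open>z ~= 0\<close> by simp
  finally show ?case .
  qed
 qed measurable
 then show ?thesis using v by (simp add: P_inner_shift feq)
 qed
 obtain W where W: "isometric_map M C \<mu> (L2 \<mu>) W" "!!n. AE z in \<mu>. W (P n v) z = b n z"
 proof (rule imap_extension[OF C csub_UNIV, where a="%n. P n v" and b=b and I=UNIV])
 show "P n v \<in> C" for n unfolding C_def orbr by (auto intro: cspan.base)
 show "ltotal M C (range (%n. P n v))"
  unfolding C_def orbr[symmetric] by (rule ltotal_cspan[OF orbL(1)])
 qed (use bL gram in auto)
 obtain q where q: "q \<in> C" "!!g. g \<in> C ==> L2_inner M (%x. v' x - q x) g = 0"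
 using L2_projection[OF C VL[OF v'V]] by blast
 have PC: "P n v \<in> C" for n unfolding C_def orbr by (auto intro: cspan.base)
 have qL: "q \<in> L2 M" using csub_L2[OF C q(1)] .
 have WqL: "W q \<in> L2 \<mu>" using imap_in[OF W(1) q(1)] .
 define g where "g z = complex_of_real (sqrt (f z)) * cnj (W q z)" for z
 have sL: "(%z. complex_of_real (sqrt (f z))) \<in> L2 \<mu>" using sqrt_density_L2[OF \<mu> f fi f0, of 0] by simp
 have gi: "integrable \<mu> g" unfolding g_def by (rule L2_inner_integrable[OF sL WqL])
 have eq: "L2_inner M (P n v') v' = (\<integral>z. z powi n * g z \<partial>\<mu>)" for n
 proof -
 have Pn: "P n v \<in> L2 M" "P n p \<in> L2 M" "v' \<in> L2 M" using v pV v'V P_in VL by auto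
 have "L2_inner M v' (P n p) = 0" using p(2)[OF Z(3)[OF p(1)]] by (simp add: v'_def)
 then have "L2_inner M (P n p) v' = 0" by (subst L2_inner_commute) simp
 then have "L2_inner M (P n v') v' = L2_inner M (P n v) v'"
  unfolding v'_def P_diff using Pn by (subst L2_inner_diff_left) (auto simp: v'_def)
 also have "\<dots> = L2_inner M (P n v) q"
 proof -
  have "L2_inner M (P n v) (%x. v' x - q x) = 0"
  using q(2)[OF PC, of n] by (subst L2_inner_commute) simp
  then show ?thesis using Pn qL by (simp add: L2_inner_diff_right)
 qed
 also have "\<dots> = L2_inner \<mu> (W (P n v)) (W q)" using imap_inner[OF W(1) PC q(1)] by simp
 also have "\<dots> = L2_inner \<mu> (b n) (W q)"
  by (rule L2_inner_cong_AE) (use W(2) imap_in[OF W(1) PC] WqL bL in auto)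
 also have "\<dots> = (\<integral>z. z powi n * g z \<partial>\<mu>)" by (simp add: L2_inner_def b_def g_def mult.assoc)
 finally show ?thesis .
 qed
 have pos: "AE z in \<mu>. g z = of_real (Re (g z)) & 0 \<le> Re (g z)"
 by (rule spectral_density_nonneg[OF \<mu> gi v'V eq])
 define f' where "f' z = max 0 (Re (g z))" for z
 have gm: "g \<in> borel_measurable borel"
 using borel_measurable_integrable[OF gi] circle_measureD(2)[OF \<mu>] measurable_cong_sets by blast
 have "spectral_density \<mu> v' f'"
 unfolding spectral_density_def
 proof (intro conjI allI)
 show fm: "f' \<in> borel_measurable borel" unfolding f'_def using gm by measurable
 show "integrable \<mu> f'"
  by (rule Bochner_Integration.integrable_bound[OF gi])
   (use fm in auto, simp add: f'_def, rule AE_I2, meson abs_Re_le_cmod abs_ge_self order_trans)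
 show "L2_inner M (P n v') v' = (\<integral>z. z powi n * of_real (f' z) \<partial>\<mu>)" for n
  unfolding eq
 proof (rule integral_cong_AE)
  show "AE z in \<mu>. z powi n * g z = z powi n * of_real (f' z)"
  using pos by eventually_elim (auto simp: f'_def max_def)
 qed (use fm gm in measurable)
 qed (simp add: f'_def)
 moreover have "AE z in \<mu>. f z = 0 --> f' z = 0" by (auto simp: f'_def g_def)
 ultimately show thesis using that unfolding v'_def by blast
qed

text \<open>Gram-Schmidt with cyclic subspaces in place of lines. The supports of the densities only
  shrink, so a bound on how many of them are positive at a point survives the orthogonalisation; the
  upper bound on the multiplicity rests on this.\<close>

theorem cyclic_decomposition:
 assumes \<mu>: "circle_measure \<mu>" and v: "!!i::nat. v i \<in> V" and d: "!!i. spectral_density \<mu> (v i) (f i)"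
 and t: "ltotal M V (orb (range v))"
 obtains v' f' where "!!i::nat. v' i \<in> V" "!!i. spectral_density \<mu> (v' i) (f' i)"
 "!!i. AE z in \<mu>. f i z = 0 --> f' i z = 0" "!!i j n. i ~= j ==> L2_inner M (P n (v' i)) (v' j) = 0"
 "ltotal M V (orb (range v'))"
proof -
 define Z where "Z i = cspan M (orb (v ` {..<i}))" for i
 have vL: "v ` I \<subseteq> V" for I using v by auto
 have Z: "csub M (Z i)" for i unfolding Z_def by (rule cspan_csub[OF orb_sub(2)[OF vL]])
 have ZV: "Z i \<subseteq> V" for i unfolding Z_def by (rule cspan_least[OF V orb_sub(1)[OF vL]])
 have ZP: "P n u \<in> Z i" if "u \<in> Z i" for n u i
 using that unfolding Z_def by (rule orb_span_invariant[OF vL])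
 have Zmono: "Z i \<subseteq> Z j" if "i \<le> j" for i j
 unfolding Z_def by (rule cspan_mono[OF orb_sub(2)[OF vL]]) (use that in \<open>fastforce simp: orb_def\<close>)
 have vZ: "v j \<in> Z i" if "j < i" for i j
 proof -
 have "P 0 (v j) \<in> Z i" unfolding Z_def using that by (auto simp: orb_def intro!: cspan.base)
 then show ?thesis using csub_AE[OF Z _ _ P_zero[OF v]] L2_measurable[OF VL[OF v]] by blast
 qed
 have "\<exists>p. p \<in> Z i & (\<forall>u\<in>Z i. L2_inner M (%x. v i x - p x) u = 0)" for i
 using L2_projection[OF Z VL[OF v]] by metis
 then obtain p where p: "!!i. p i \<in> Z i" "!!i u. u \<in> Z i ==> L2_inner M (%x. v i x - p i x) u = 0" by metis
 define v' where "v' i = (%x. v i x - p i x)" for i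
 have pV: "p i \<in> V" for i using p(1) ZV by auto
 have v'V: "v' i \<in> V" for i unfolding v'_def by (intro csub_diff[OF V] v pV)
 have "\<exists>f'. spectral_density \<mu> (v' i) f' & (AE z in \<mu>. f i z = 0 --> f' z = 0)" for i
 unfolding v'_def using spectral_density_project[OF \<mu> v d Z ZV ZP p(1) p(2)] by metis
 then obtain f' where f': "!!i. spectral_density \<mu> (v' i) (f' i)" "!!i. AE z in \<mu>. f i z = 0 --> f' i z = 0"
 by metis
 have v'Z: "v' j \<in> Z i" if "j < i" for i j
 unfolding v'_def using csub_diff[OF Z vZ[OF that]] p(1)[of j] Zmono[of j i] that by auto
 have orth1: "L2_inner M (P n (v' i)) (v' j) = 0" if "j < i" for i j n
 proof -
 have "L2_inner M (v' i) (P (- n) (v' j)) = 0" using p(2)[OF ZP[OF v'Z[OF that]]] by (simp add: v'_def)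
 then show ?thesis using P_adj[OF v'V v'V] by simp
 qed
 have orth: "L2_inner M (P n (v' i)) (v' j) = 0" if "i ~= j" for i j n
 proof (cases "j < i")
 case False
 then have "L2_inner M (P (- n) (v' j)) (v' i) = 0" using orth1 that by simp
 then have "L2_inner M (v' i) (P (- n) (v' j)) = 0" by (subst L2_inner_commute) simp
 then show ?thesis using P_adj[OF v'V v'V] by simp
 qed (use orth1 in simp)
 have "ltotal M V (orb (range v'))"
 unfolding ltotal_def
 proof (intro conjI ballI impI)
 show "orb (range v') \<subseteq> V" using v'V by (intro orb_sub) auto
 fix g assume g: "g \<in> V" and 0: "\<forall>a\<in>orb (range v'). L2_inner M g a = 0"
 have "\<forall>n. L2_inner M g (P n (v i)) = 0" for i
 proof (induction i rule: less_induct)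
  case (less i)
  show ?case
  proof
  fix n
  have "L2_inner M (P n (p i)) g = 0"
  proof (rule cspan_orth[OF orb_sub(2)[OF vL] VL[OF g]])
   show "P n (p i) \<in> cspan M (orb (v ` {..<i}))" using ZP[OF p(1)] by (simp add: Z_def)
   fix a assume "a \<in> orb (v ` {..<i})"
   then obtain k j where "a = P k (v j)" "j < i" by (auto simp: orb_def)
   then show "L2_inner M a g = 0" using less by (subst L2_inner_commute) simp
  qed
  then have 1: "L2_inner M g (P n (p i)) = 0" by (subst L2_inner_commute) simp
  have "L2_inner M g (P n (v' i)) = 0" using 0 by (force simp: orb_def)
  moreover have "P n (v i) \<in> L2 M" "P n (p i) \<in> L2 M" using VL P_in v pV by auto
  ultimately show "L2_inner M g (P n (v i)) = 0"
   using 1 VL[OF g] unfolding v'_def P_diff by (simp add: L2_inner_diff_right)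
  qed
 qed
 then have "\<forall>a\<in>orb (range v). L2_inner M g a = 0" by (auto simp: orb_def)
 then show "AE x in M. g x = 0" using t g by (auto simp: ltotal_def)
 qed
 with v'V f' orth show thesis using that by blast
qed

end

section \<open>The fibre space and lower bounds for the multiplicity\<close>

lemma integral_count_space_single:
 fixes c :: complex
 shows "integrable (count_space UNIV) (%j::nat. if Q & j = a then c else 0)"
 and "(\<integral>j. (if Q & j = a then c else 0) \<partial>count_space (UNIV::nat set)) = (if Q then c else 0)"
proof -
 have "has_bochner_integral (count_space (UNIV::nat set)) (%j. indicator {a} j *\<^sub>R (if Q then c else 0))
  (measure (count_space (UNIV::nat set)) {a} *\<^sub>R (if Q then c else 0))"
 by (rule has_bochner_integral_indicator) auto
 moreover have "(%j. indicator {a} j *\<^sub>R (if Q then c else 0)) = (%j. if Q & j = a then c else 0)"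
 by (auto simp: indicator_def)
 ultimately have "has_bochner_integral (count_space (UNIV::nat set)) (%j. if Q & j = a then c else 0) (if Q then c else 0)"
 by (simp add: measure_def)
 then show "integrable (count_space UNIV) (%j::nat. if Q & j = a then c else 0)"
 "(\<integral>j. (if Q & j = a then c else 0) \<partial>count_space (UNIV::nat set)) = (if Q then c else 0)"
 by (auto simp: has_bochner_integral_iff)
qed

locale fibre =
 fixes \<rho> :: "complex measure" and m :: "complex => enat"
 assumes \<rho>: "circle_measure \<rho>" and m [measurable]: "m \<in> \<rho> \<rightarrow>\<^sub>M count_space UNIV"
begin

abbreviation "PM \<equiv> \<rho> \<Otimes>\<^sub>M count_space (UNIV :: nat set)"
abbreviation "FM \<equiv> fibre_measure \<rho> m"
definition "E = {(z, j::nat). enat j < m z}"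

lemma sets_\<rho> [measurable_cong]: "sets \<rho> = sets borel" and space_\<rho> [simp]: "space \<rho> = UNIV"
 using circle_measureD[OF \<rho>] by auto

sublocale \<rho>: finite_measure \<rho> by (rule circle_measureD[OF \<rho>])
sublocale pair: pair_sigma_finite \<rho> "count_space (UNIV :: nat set)"
 by (intro pair_sigma_finite.intro sigma_finite_measure_count_space \<rho>.sigma_finite_measure_axioms)

lemma space_PM [simp]: "space PM = UNIV"
 by (simp add: space_pair_measure)

lemma E_sets [measurable]: "E \<in> sets PM"
proof -
 have "E = (\<Union>j. (m -` {x. enat j < x} \<inter> space \<rho>) \<times> {j})" by (auto simp: E_def)
 moreover have "(m -` {x. enat j < x} \<inter> space \<rho>) \<times> {j} \<in> sets PM" for j
 by (intro pair_measureI measurable_sets[OF m]) auto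
 ultimately show ?thesis by auto
qed

lemma FM: "FM = restrict_space PM E"
 by (simp add: fibre_measure_def E_def)

lemma FM_integrable: "integrable FM (F :: _ => complex) \<longleftrightarrow> integrable PM (%x. indicator E x *\<^sub>R F x)"
 unfolding FM by (rule integrable_restrict_space) simp

lemma FM_integral: "(\<integral>x. F x \<partial>FM) = (\<integral>x. indicator E x *\<^sub>R (F x :: complex) \<partial>PM)"
 unfolding FM by (rule integral_restrict_space) simp

lemma FM_measurable: "F \<in> borel_measurable PM ==> F \<in> borel_measurable FM"
 unfolding FM by (rule measurable_restrict_space1)

lemma FM_fst [measurable]: "fst \<in> borel_measurable FM"
proof (rule FM_measurable)
 have "fst \<in> PM \<rightarrow>\<^sub>M \<rho>" by simp
 then show "fst \<in> borel_measurable PM" by (simp add: measurable_cong_sets[OF refl sets_\<rho>])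
qed

lemma PM_AE_fst:
 assumes "AE z in \<rho>. Q z" shows "AE x in PM. Q (fst x)"
proof -
 obtain N where N: "{z \<in> space \<rho>. \<not> Q z} \<subseteq> N" "N \<in> null_sets \<rho>"
 using assms by (auto elim: AE_E simp: null_sets_def)
 have "N \<times> UNIV \<in> null_sets PM"
 using N(2) pair.M2.emeasure_pair_measure_Times[of N \<rho> UNIV] by (auto simp: null_sets_def)
 then show ?thesis by (rule AE_I') (use N(1) in auto)
qed

lemma FM_AE:
 assumes "AE x in PM. Q x" shows "AE x in FM. Q x"
 unfolding FM using assms by (subst AE_restrict_space_iff) auto

lemma FM_AE_circle: "AE x in FM. cmod (fst x) = 1"
 by (intro FM_AE PM_AE_fst circle_measureD[OF \<rho>])

text \<open>Functions living on one sheet \<open>r z\<close> over each \<open>z\<close> in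
  \<open>A\<close> integrate as over \<rho>. The sheet may vary with \<open>z\<close>, as it does
  when several vectors are stacked by rank.\<close>

lemma graph_integral:
 fixes \<phi> :: "complex => complex"
 assumes \<phi>: "integrable \<rho> \<phi>" and A [measurable]: "A \<in> sets borel"
 and r [measurable]: "r \<in> \<rho> \<rightarrow>\<^sub>M count_space UNIV" and rm: "!!z. z \<in> A ==> enat (r z) < m z"
 shows "integrable FM (%x. if fst x \<in> A & snd x = r (fst x) then \<phi> (fst x) else 0)"
 and "(\<integral>x. (if fst x \<in> A & snd x = r (fst x) then \<phi> (fst x) else 0) \<partial>FM) = (\<integral>z. (if z \<in> A then \<phi> z else 0) \<partial>\<rho>)"
proof -
 let ?F = "%x. if fst x \<in> A & snd x = r (fst x) then \<phi> (fst x) else 0"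
 have [measurable]: "\<phi> \<in> borel_measurable \<rho>" using \<phi> by measurable
 have eq: "(%x. indicator E x *\<^sub>R ?F x) = ?F" using rm by (auto simp: indicator_def E_def)
 have rf [measurable]: "(%x. r (fst x)) \<in> PM \<rightarrow>\<^sub>M count_space UNIV" by measurable
 have preq: "(%x. snd x = r (fst x)) = (%x. \<exists>j. snd x = j & r (fst x) = j)" by auto
 have [measurable]: "Measurable.pred PM (%x. snd x = r (fst x))" unfolding preq by measurable
 have Fm: "?F \<in> borel_measurable PM" by measurable
 have i: "integrable \<rho> (%z. if z \<in> A then \<phi> z else 0)"
 by (rule Bochner_Integration.integrable_bound[OF \<phi>]) auto
 have iF: "integrable PM ?F"
 proof (rule pair.Fubini_integrable[OF Fm])
 have "norm (?F (z, j)) = Re (if z \<in> A & j = r z then of_real (norm (\<phi> z)) else 0)" for z j by auto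
 then have "(\<integral>j. norm (?F (z, j)) \<partial>count_space UNIV) = norm (if z \<in> A then \<phi> z else 0)" for z
  using integral_count_space_single[of "z \<in> A" "r z" "of_real (norm (\<phi> z))"] by simp
 then show "integrable \<rho> (%z. \<integral>j. norm (?F (z, j)) \<partial>count_space UNIV)"
  using integrable_norm[OF i] by simp
 show "AE z in \<rho>. integrable (count_space UNIV) (%j. ?F (z, j))"
  by (intro AE_I2) (simp only: fst_conv snd_conv integral_count_space_single(1))
 qed
 then show "integrable FM ?F" by (simp only: FM_integrable eq)
 have "(\<integral>x. ?F x \<partial>FM) = (\<integral>x. ?F x \<partial>PM)" by (simp only: FM_integral eq)
 also have "\<dots> = (\<integral>z. (\<integral>j. ?F (z, j) \<partial>count_space UNIV) \<partial>\<rho>)" using pair.integral_fst'[OF iF] by simp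
 also have "\<dots> = (\<integral>z. (if z \<in> A then \<phi> z else 0) \<partial>\<rho>)"
 by (simp only: fst_conv snd_conv integral_count_space_single(2))
 finally show "(\<integral>x. ?F x \<partial>FM) = (\<integral>z. (if z \<in> A then \<phi> z else 0) \<partial>\<rho>)" .
qed

end

lemma mult_imap:
 assumes fst: "p \<in> borel_measurable N" and c: "AE x in N. cmod (p x) = 1"
 shows "isometric_map N (L2 N) N (L2 N) (%f x. p x powi n * f x)"
proof -
 note [measurable] = fst
 have L: "(%x. p x powi n * f x) \<in> L2 N" if f: "f \<in> L2 N" for f
 proof (rule L2_bound[OF _ L2_integrable[OF f]])
 have [measurable]: "f \<in> borel_measurable N" using f by measurable
 show "(%x. p x powi n * f x) \<in> borel_measurable N" by measurable
 show "AE x in N. (cmod (p x powi n * f x))\<^sup>2 \<le> (cmod (f x))\<^sup>2"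
  using c by eventually_elim (simp add: norm_mult norm_power_int)
 qed
 have "L2_inner N (%x. p x powi n * f x) (%x. p x powi n * g x) = L2_inner N f g"
 if f: "f \<in> L2 N" "g \<in> L2 N" for f g
 unfolding L2_inner_def
 proof (rule integral_cong_AE)
 show "(%x. p x powi n * f x * cnj (p x powi n * g x)) \<in> borel_measurable N"
  using L2_inner_integrable[OF L[OF f(1)] L[OF f(2)]] by (rule borel_measurable_integrable)
 show "(%x. f x * cnj (g x)) \<in> borel_measurable N"
  using L2_inner_integrable[OF f] by (rule borel_measurable_integrable)
 show "AE x in N. p x powi n * f x * cnj (p x powi n * g x) = f x * cnj (g x)"
  using c
 proof eventually_elim
  case (elim x)
  have "p x powi n * cnj (p x powi n) = 1"
  using complex_norm_square[of "p x powi n"] elim by (simp add: norm_power_int)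
  then have "(p x powi n * cnj (p x powi n)) * (f x * cnj (g x)) = f x * cnj (g x)" by simp
  then show ?case by (simp only: complex_cnj_mult mult_ac)
 qed
 qed
 with L show ?thesis by (simp add: isometric_map_def distrib_left mult.left_commute)
qed

text \<open>Bessel's inequality for the \<open>j\<close>-th unit vector bounds the
  \<open>j\<close>-th column sum of squares by \<open>c\<close>; adding the \<open>d\<close> columns
  gives \<open>n * c <= d * c\<close>.\<close>

lemma orthogonal_family_card_le:
 fixes u :: "nat => nat => complex"
 assumes c: "c > 0"
 and u: "!!l k. l < n ==> k < n ==> (\<Sum>j<d. u l j * cnj (u k j)) = (if l = k then complex_of_real c else 0)"
 shows "n \<le> d"
proof -
 define S where "S j = (\<Sum>l<n. (cmod (u l j))\<^sup>2)" for j
 have sq: "a * cnj a = of_real ((cmod a)\<^sup>2)" for a by (simp only: complex_norm_square)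
 have S: "S j \<le> c" if j: "j < d" for j
 proof -
 \<comment> \<open>Up to the factor \<open>c\<close> this is the projection of the
   \<open>j\<close>-th unit vector to the span of the family: its \<open>j\<close>-th entry is
   \<open>S j\<close> and its squared norm is \<open>c * S j\<close>.\<close>
 define w where "w i = (\<Sum>l<n. cnj (u l j) * u l i)" for i
 have wj: "w j = of_real (S j)"
  unfolding w_def S_def by (simp only: mult.commute[of "cnj _"] sq of_real_sum)
 have "of_real (\<Sum>i<d. (cmod (w i))\<^sup>2) = (\<Sum>i<d. w i * cnj (w i))" by (simp only: sq of_real_sum)
 also have "\<dots> = (\<Sum>i<d. \<Sum>l<n. \<Sum>k<n. cnj (u l j) * u k j * (u l i * cnj (u k i)))"
  by (simp only: w_def cnj_sum sum_product complex_cnj_mult complex_cnj_cnj mult_ac)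
 also have "\<dots> = (\<Sum>l<n. \<Sum>k<n. \<Sum>i<d. cnj (u l j) * u k j * (u l i * cnj (u k i)))"
  by (subst sum.swap) (rule sum.cong[OF refl], rule sum.swap)
 also have "\<dots> = (\<Sum>l<n. \<Sum>k<n. cnj (u l j) * u k j * (if l = k then of_real c else 0))"
  by (intro sum.cong refl) (simp only: sum_distrib_left[symmetric] u lessThan_iff)
 also have "\<dots> = (\<Sum>l<n. (u l j * cnj (u l j)) * of_real c)"
 proof (rule sum.cong[OF refl])
  fix l assume l: "l \<in> {..<n}"
  have "(\<Sum>k<n. cnj (u l j) * u k j * (if l = k then of_real c else 0))
   = (\<Sum>k<n. if l = k then cnj (u l j) * u k j * of_real c else 0)"
  by (rule sum.cong) auto
  also have "\<dots> = cnj (u l j) * u l j * of_real c" using l by (subst sum.delta') auto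
  finally show "(\<Sum>k<n. cnj (u l j) * u k j * (if l = k then of_real c else 0)) = (u l j * cnj (u l j)) * of_real c"
  by (simp only: mult_ac)
 qed
 also have "\<dots> = of_real (S j * c)"
  by (simp only: sq of_real_mult[symmetric] of_real_sum[symmetric] sum_distrib_right[symmetric] S_def)
 finally have "(\<Sum>i<d. (cmod (w i))\<^sup>2) = S j * c" by (simp only: of_real_eq_iff)
 moreover have "(cmod (w j))\<^sup>2 \<le> (\<Sum>i<d. (cmod (w i))\<^sup>2)"
  by (rule member_le_sum) (use j in auto)
 moreover have S0: "S j \<ge> 0" by (simp add: S_def sum_nonneg)
 then have "cmod (w j) = S j" unfolding wj norm_of_real by simp
 ultimately have "S j * S j \<le> S j * c" by (simp add: power2_eq_square)
 with S0 show ?thesis using c by (cases "S j = 0") auto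
 qed
 have "real n * c = (\<Sum>l<n. \<Sum>j<d. (cmod (u l j))\<^sup>2)"
 proof -
 have "(\<Sum>j<d. (cmod (u l j))\<^sup>2) = c" if "l < n" for l
 proof -
  have "complex_of_real (\<Sum>j<d. (cmod (u l j))\<^sup>2) = of_real c"
  using u[OF that that] by (simp only: of_real_sum sq) simp
  then show ?thesis by (simp only: of_real_eq_iff)
 qed
 then show ?thesis by simp
 qed
 also have "\<dots> = (\<Sum>j<d. S j)" unfolding S_def by (rule sum.swap)
 also have "\<dots> \<le> (\<Sum>j<d. c)" by (rule sum_mono) (use S in auto)
 finally show ?thesis using c by simp
qed

context fibre
begin

text \<open>\<open>D l l' z\<close> is the Gram matrix of the vectors in the fibre over
  \<open>z\<close>. By Fourier uniqueness it is almost everywhere diagonal with all diagonal entries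
  equal to \<open>R 0 z\<close>, which is a density of \<kappa>. Where it is positive, the fibre
  contains \<open>n\<close> orthogonal vectors of equal nonzero length, which forces
  \<open>n <= m z\<close>.\<close>

theorem multiplicity_lower:
 assumes \<kappa>: "circle_measure \<kappa>" and n: "n > 0"
 and G: "!!l. l < n ==> G l \<in> L2 FM"
 and eq: "!!(k::nat) l l'. l < n ==> l' < n ==>
  L2_inner FM (%x. fst x ^ k * G l x) (G l') = (if l = l' then \<integral>z. z ^ k \<partial>\<kappa> else 0)"
 shows "absolutely_continuous \<rho> \<kappa>" "AE z in \<kappa>. enat n \<le> m z"
proof -
 define Q where "Q l l' x = indicator E x *\<^sub>R (G l x * cnj (G l' x))" for l l' x
 define D where "D l l' z = (\<integral>j. Q l l' (z, j) \<partial>count_space UNIV)" for l l' z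
 define R where "R l z = (\<integral>j. Re (Q l l (z, j)) \<partial>count_space UNIV)" for l z
 have Qi: "integrable PM (Q l l')" if "l < n" "l' < n" for l l'
 using L2_inner_integrable[OF G[OF that(1)] G[OF that(2)]] unfolding FM_integrable Q_def .
 have Di: "integrable \<rho> (D l l')" if "l < n" "l' < n" for l l'
 unfolding D_def by (rule pair.integrable_fst'[OF Qi[OF that]])
 have Qr: "Q l l x = of_real (Re (Q l l x))" "0 \<le> Re (Q l l x)" for l x
 proof -
 have "Q l l x = of_real (indicator E x * (cmod (G l x))\<^sup>2)"
  unfolding Q_def complex_norm_square[symmetric] by (simp add: scaleR_conv_of_real)
 then show "Q l l x = of_real (Re (Q l l x))" "0 \<le> Re (Q l l x)" by auto
 qed
 have DR: "D l l z = of_real (R l z)" for l z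
 unfolding D_def R_def by (subst Qr(1)) (rule integral_complex_of_real)
 have R0: "0 \<le> R l z" for l z unfolding R_def using Qr(2) by (intro integral_nonneg_AE) auto
 have Ri: "integrable \<rho> (R l)" if "l < n" for l
 using integrable_Re[OF Di[OF that that]] by (simp add: DR)
 have Rm [measurable]: "R l \<in> borel_measurable \<rho>" if "l < n" for l using Ri[OF that] by measurable
 have cnjD: "cnj (D l l' z) = D l' l z" for l l' z
 proof -
 have "cnj (D l l' z) = (\<integral>j. cnj (Q l l' (z, j)) \<partial>count_space UNIV)"
  unfolding D_def by (rule Bochner_Integration.integral_cnj[symmetric])
 then show ?thesis by (simp add: D_def Q_def mult.commute)
 qed
 have Dnat: "(\<integral>z. z ^ k * D l l' z \<partial>\<rho>) = (if l = l' then \<integral>z. z ^ k \<partial>\<kappa> else 0)" if l: "l < n" "l' < n" for k l l'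
 proof -
 have L: "(%x. fst x ^ k * G l x) \<in> L2 FM"
  using imap_in[OF mult_imap[OF FM_fst FM_AE_circle, of "int k"] G[OF l(1)]] by simp
 have i: "integrable PM (%x. fst x ^ k * Q l l' x)"
  using L2_inner_integrable[OF L G[OF l(2)]] unfolding FM_integrable Q_def
  by (simp add: mult.assoc)
 have "L2_inner FM (%x. fst x ^ k * G l x) (G l') = (\<integral>x. fst x ^ k * Q l l' x \<partial>PM)"
  unfolding L2_inner_def FM_integral Q_def by (simp add: mult.assoc)
 also have "\<dots> = (\<integral>z. (\<integral>j. z ^ k * Q l l' (z, j) \<partial>count_space UNIV) \<partial>\<rho>)"
  using pair.integral_fst'[OF i] by simp
 also have "\<dots> = (\<integral>z. z ^ k * D l l' z \<partial>\<rho>)" by (simp add: D_def)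
 finally show ?thesis using eq[OF l] by simp
 qed
 \<comment> \<open>Negative frequencies follow from the nonnegative ones by conjugation, which
   exchanges \<open>l\<close> and \<open>l'\<close>.\<close>
 have Dint: "(\<integral>z. z powi k * D l l' z \<partial>\<rho>) = (if l = l' then \<integral>z. z powi k \<partial>\<kappa> else 0)" if l: "l < n" "l' < n" for k l l'
 proof (cases "k \<ge> 0")
 case True
 then obtain i where "k = int i" using nonneg_int_cases by blast
 then show ?thesis using Dnat[OF l, of i] by simp
 next
 case False
 define i where "i = nat (- k)"
 have k: "k = - int i" using False by (simp add: i_def)
 have a: "(\<integral>z. z powi k * D l l' z \<partial>\<rho>) = cnj (\<integral>z. z ^ i * D l' l z \<partial>\<rho>)"
 proof -
  have "(\<integral>z. z powi k * D l l' z \<partial>\<rho>) = (\<integral>z. cnj (z ^ i * D l' l z) \<partial>\<rho>)"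
  proof (rule integral_cong_AE)
  have [measurable]: "D l l' \<in> borel_measurable \<rho>" "D l' l \<in> borel_measurable \<rho>"
   using Di[OF l] Di[OF l(2,1)] by measurable
  show "(%z. z powi k * D l l' z) \<in> borel_measurable \<rho>" by measurable
  show "(%z. cnj (z ^ i * D l' l z)) \<in> borel_measurable \<rho>"
   by (intro borel_measurable_continuous_on[where f=cnj] continuous_intros) measurable
  show "AE z in \<rho>. z powi k * D l l' z = cnj (z ^ i * D l' l z)"
   using circle_measureD(3)[OF \<rho>]
  proof eventually_elim
   case (elim z)
   show ?case using cnj_power_int_circle[OF elim, of "int i"] by (simp add: k cnjD)
  qed
  qed
  then show ?thesis by (simp only: Bochner_Integration.integral_cnj)
 qed
 have b: "(\<integral>z. z powi k \<partial>\<kappa>) = cnj (\<integral>z. z ^ i \<partial>\<kappa>)"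
 proof -
  note [measurable_cong] = circle_measureD(2)[OF \<kappa>]
  have "(\<integral>z. z powi k \<partial>\<kappa>) = (\<integral>z. cnj (z ^ i) \<partial>\<kappa>)"
  proof (rule integral_cong_AE)
  show "(%z. cnj (z ^ i)) \<in> borel_measurable \<kappa>"
   by (intro borel_measurable_continuous_on[where f=cnj] continuous_intros) measurable
  show "AE z in \<kappa>. z powi k = cnj (z ^ i)"
   using circle_measureD(3)[OF \<kappa>]
  proof eventually_elim
   case (elim z)
   show ?case using cnj_power_int_circle[OF elim, of "int i"] by (simp add: k)
  qed
  qed measurable
  then show ?thesis by (simp only: Bochner_Integration.integral_cnj)
 qed
 show ?thesis unfolding a b using Dnat[OF l(2,1), of i] by simp
 qed
 have dens: "circle_measure (density \<rho> (R 0))" and \<kappa>eq: "density \<rho> (R 0) = \<kappa>"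
 proof -
 have "emeasure (density \<rho> (R 0)) (space (density \<rho> (R 0))) = (\<integral>\<^sup>+z. ennreal (R 0 z) \<partial>\<rho>)"
  using n by (simp add: emeasure_density)
 also have "\<dots> = ennreal (\<integral>z. R 0 z \<partial>\<rho>)"
  using Ri[OF n] R0 by (intro nn_integral_eq_integral) auto
 finally have fin: "finite_measure (density \<rho> (R 0))" by (intro finite_measureI) simp
 have "AE z in density \<rho> (R 0). cmod z = 1"
  using n circle_measureD(3)[OF \<rho>] by (subst AE_density) auto
 then show c: "circle_measure (density \<rho> (R 0))" using fin by (simp add: circle_measure_def sets_\<rho>)
 show "density \<rho> (R 0) = \<kappa>"
 proof (rule circle_measure_eqI[OF c \<kappa>])
  fix k
  have "(\<integral>z. z powi k \<partial>density \<rho> (R 0)) = (\<integral>z. R 0 z *\<^sub>R z powi k \<partial>\<rho>)"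
  using n R0 by (intro integral_density) auto
  also have "\<dots> = (\<integral>z. z powi k * D 0 0 z \<partial>\<rho>)" by (simp add: DR scaleR_conv_of_real mult.commute)
  also have "\<dots> = (\<integral>z. z powi k \<partial>\<kappa>)" using Dint[OF n n] by simp
  finally show "(\<integral>z. z powi k \<partial>density \<rho> (R 0)) = (\<integral>z. z powi k \<partial>\<kappa>)" .
 qed
 qed
 show "absolutely_continuous \<rho> \<kappa>"
 unfolding \<kappa>eq[symmetric] using n by (intro absolutely_continuousI_density) simp
 have off: "AE z in \<rho>. D l l' z = 0" if "l < n" "l' < n" "l ~= l'" for l l'
 using circle_Fourier_unique[OF \<rho> Di[OF that(1,2)]] Dint[OF that(1,2)] that(3) by simp
 have diag: "AE z in \<rho>. D l l z - D 0 0 z = 0" if "l < n" for l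
 proof (rule circle_Fourier_unique[OF \<rho>])
 show "integrable \<rho> (%z. D l l z - D 0 0 z)" using Di that n by simp
 show "(\<integral>z. z powi k * (D l l z - D 0 0 z) \<partial>\<rho>) = 0" for k
  using power_int_integrable[OF \<rho> Di[OF that that]] power_int_integrable[OF \<rho> Di[OF n n]]
  Dint[OF that that, of k] Dint[OF n n, of k]
  by (simp add: right_diff_distrib)
 qed
 have off': "AE z in \<rho>. \<forall>l l'. l < n --> l' < n --> l ~= l' --> D l l' z = 0"
 unfolding AE_all_countable by (intro allI AE_impI off)
 have diag': "AE z in \<rho>. \<forall>l<n. D l l z - D 0 0 z = 0"
 unfolding AE_all_countable by (intro allI AE_impI diag)
 have "AE z in \<rho>. 0 < R 0 z --> enat n \<le> m z"
 using off' diag'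
 proof eventually_elim
 case (elim z)
 show ?case
 proof (intro impI, rule ccontr)
  assume pos: "0 < R 0 z" and "\<not> enat n \<le> m z"
  then have "m z < enat n" by simp
  then obtain d where d: "m z = enat d" "d < n" by (cases "m z") auto
  have "(\<Sum>j<d. G l (z, j) * cnj (G l' (z, j))) = D l l' z" for l l'
  proof -
  have Qz: "Q l l' (z, j) = (if j < d then G l (z, j) * cnj (G l' (z, j)) else 0)" for j
   by (simp add: Q_def E_def d)
  have fin: "finite {j. Q l l' (z, j) ~= 0}" by (rule finite_subset[of _ "{..<d}"]) (auto simp: Qz)
  then have "D l l' z = (\<Sum>j | Q l l' (z, j) ~= 0. Q l l' (z, j))"
   unfolding D_def by (subst lebesgue_integral_count_space_finite_support) auto
  also have "\<dots> = (\<Sum>j<d. G l (z, j) * cnj (G l' (z, j)))"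
   by (rule sum.mono_neutral_cong_left) (auto simp: Qz)
  finally show ?thesis by simp
  qed
  note sums = this
  have "n \<le> d"
  proof (rule orthogonal_family_card_le[OF pos, where u="%l j. G l (z, j)"])
  fix l k assume l: "l < n" "k < n"
  show "(\<Sum>j<d. G l (z, j) * cnj (G k (z, j))) = (if l = k then complex_of_real (R 0 z) else 0)"
   unfolding sums using elim(1)[rule_format, OF l] elim(2)[rule_format, OF l(1)] DR[of 0 z] by (cases "l = k") auto
  qed
  with d show False by simp
 qed
 qed
 then show "AE z in \<kappa>. enat n \<le> m z"
 unfolding \<kappa>eq[symmetric] using n by (subst AE_density) auto
qed

end

section \<open>Stacking cyclic vectors by rank: existence of a spectral representation\<close>

text \<open>The number of earlier indices active at \<open>z\<close>. An index active at
  \<open>z\<close> is placed on the sheet with this number, so that the sheets over \<open>z\<close>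
  are filled without gaps and their total is \<open>mult_count f z\<close>.\<close>

definition occ_rank :: "(nat => complex => real) => nat => complex => nat" where
 "occ_rank f i z = card {j. j < i & 0 < f j z}"

definition mult_count :: "(nat => complex => real) => complex => enat" where
 "mult_count f z = (SUP i. enat (occ_rank f i z))"

lemma occ_rank_0 [simp]: "occ_rank f 0 z = 0"
 by (simp add: occ_rank_def)

lemma occ_rank_Suc: "occ_rank f (Suc i) z = occ_rank f i z + (if 0 < f i z then 1 else 0)"
proof -
 have "{j. j < Suc i & 0 < f j z} = (if 0 < f i z then insert i {j. j < i & 0 < f j z} else {j. j < i & 0 < f j z})"
 by (auto simp: less_Suc_eq)
 then show ?thesis by (simp add: occ_rank_def)
qed

lemma occ_rank_mono: "i \<le> j ==> occ_rank f i z \<le> occ_rank f j z"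
 unfolding occ_rank_def by (intro card_mono) auto

lemma occ_rank_strict: "i < j ==> 0 < f i z ==> occ_rank f i z < occ_rank f j z"
 using occ_rank_mono[of "Suc i" j f z] occ_rank_Suc[of f i z] by simp

lemma occ_rank_less_mult_count: "0 < f i z ==> enat (occ_rank f i z) < mult_count f z"
proof -
 assume "0 < f i z"
 then have "enat (occ_rank f i z) < enat (occ_rank f (Suc i) z)" by (simp add: occ_rank_Suc)
 also have "\<dots> \<le> mult_count f z" unfolding mult_count_def by (rule SUP_upper) simp
 finally show ?thesis .
qed

text \<open>Ranks grow by at most one per index, so the index at which the rank first passes
  \<open>j\<close> is active and has rank exactly \<open>j\<close>.\<close>

lemma less_mult_count_imp_rank:
 assumes "enat j < mult_count f z" shows "\<exists>i. 0 < f i z & occ_rank f i z = j"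
proof -
 have "\<exists>i. j < occ_rank f i z" using assms by (auto simp: mult_count_def less_SUP_iff)
 define n where "n = (LEAST i. j < occ_rank f i z)"
 have n: "j < occ_rank f n z" unfolding n_def by (rule LeastI_ex) fact
 then obtain i where i: "n = Suc i" by (cases n) auto
 have "\<not> j < occ_rank f i z" using not_less_Least[of i "%i. j < occ_rank f i z"] i by (simp add: n_def)
 with n i show ?thesis by (intro exI[of _ i]) (auto simp: occ_rank_Suc split: if_splits)
qed

lemma occ_rank_measurable:
 assumes "!!i. f i \<in> borel_measurable borel"
 shows "occ_rank f i \<in> borel \<rightarrow>\<^sub>M count_space UNIV"
proof (induction i)
 case 0 show ?case unfolding occ_rank_0[abs_def] by simp
next
 case (Suc i)
 note [measurable] = assms Suc
 show ?case unfolding occ_rank_Suc[abs_def] by measurable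
qed

lemma mult_count_measurable:
 assumes f: "!!i. f i \<in> borel_measurable borel"
 shows "mult_count f \<in> borel \<rightarrow>\<^sub>M count_space UNIV"
proof -
 note [measurable] = occ_rank_measurable[OF f]
 have ge: "{z. enat k \<le> mult_count f z} \<in> sets borel" for k
 proof (cases k)
 case (Suc j)
 have "enat k \<le> mult_count f z \<longleftrightarrow> (\<exists>i. j < occ_rank f i z)" for z
  by (simp only: Suc Suc_ile_eq mult_count_def less_SUP_iff) simp
 then have "{z. enat k \<le> mult_count f z} = {z \<in> space borel. \<exists>i. j < occ_rank f i z}" by simp
 also have "\<dots> \<in> sets borel" by measurable
 finally show ?thesis .
 qed (simp add: zero_enat_def[symmetric])
 have "mult_count f -` {x} \<in> sets borel" for x
 proof (cases x)
 case (enat k)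
 have "mult_count f -` {x} = {z. enat k \<le> mult_count f z} - {z. enat (Suc k) \<le> mult_count f z}"
  by (auto simp: enat Suc_ile_eq not_less)
 then show ?thesis using ge by auto
 next
 case infinity
 have "mult_count f -` {x} = (\<Inter>k. {z. enat k \<le> mult_count f z})"
 proof -
  have "mult_count f z = \<infinity>" if "\<forall>k. enat k \<le> mult_count f z" for z
  proof (cases "mult_count f z")
  case (enat k) then show ?thesis using that[rule_format, of "Suc k"] by simp
  qed
  then show ?thesis by (auto simp: infinity)
 qed
 then show ?thesis using ge by auto
 qed
 then show ?thesis by (simp add: measurable_count_space_eq2_countable)
qed

context unitary_group
begin

text \<open>\<open>P n (v i)\<close> is sent to \<open>z powi n * sqrt (f i z)\<close> on the sheet
  of rank \<open>i\<close>. Distinct active indices occupy distinct sheets, which reproduces the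
  orthogonality. The images are total because every sheet of the fibre carries some active index,
  and Fourier uniqueness applies on it.\<close>

theorem fibre_representation:
 assumes \<mu>: "circle_measure \<mu>" and v: "!!i::nat. v i \<in> V" and d: "!!i. spectral_density \<mu> (v i) (f i)"
 and orth: "!!i j n. i ~= j ==> L2_inner M (P n (v i)) (v j) = 0"
 and t: "ltotal M V (orb (range v))"
 obtains W where "unitary_map M V (fibre_measure \<mu> (mult_count f)) (L2 (fibre_measure \<mu> (mult_count f))) W"
 "!!n u. u \<in> V ==> AE x in fibre_measure \<mu> (mult_count f). W (P n u) x = fst x powi n * W u x"
proof -
 have fm [measurable]: "f i \<in> borel_measurable borel" and fi: "integrable \<mu> (f i)" and f0: "!!z. 0 \<le> f i z"
 and feq: "!!n. L2_inner M (P n (v i)) (v i) = (\<integral>z. z powi n * of_real (f i z) \<partial>\<mu>)" for i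
 using d by (auto simp: spectral_density_def)
 have bm: "mult_count f \<in> \<mu> \<rightarrow>\<^sub>M count_space UNIV"
 using mult_count_measurable[OF fm] by (simp only: measurable_cong_sets[OF circle_measureD(2)[OF \<mu>] refl])
 interpret fibre \<mu> "mult_count f" by standard (use \<mu> bm in auto)
 have rk [measurable]: "occ_rank f i \<in> \<mu> \<rightarrow>\<^sub>M count_space UNIV" for i
 using occ_rank_measurable[OF fm] by (simp only: measurable_cong_sets[OF sets_\<rho> refl])
 have fmu [measurable]: "f i \<in> borel_measurable \<mu>" for i
 using fm by (simp only: measurable_cong_sets[OF sets_\<rho> refl])
 define A where "A i = {z. 0 < f i z}" for i
 have A [measurable]: "A i \<in> sets borel" for i
 proof -
 have "{z \<in> space borel. 0 < f i z} \<in> sets borel" by measurable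
 then show ?thesis by (simp add: A_def)
 qed
 define b where "b = (%(i, n) x. fst x powi n * (if fst x \<in> A i & snd x = occ_rank f i (fst x)
  then complex_of_real (sqrt (f i (fst x))) else 0))"
 have gr: "integrable FM (%x. if fst x \<in> A i & snd x = occ_rank f i (fst x) then \<phi> (fst x) else 0)"
 "(\<integral>x. (if fst x \<in> A i & snd x = occ_rank f i (fst x) then \<phi> (fst x) else 0) \<partial>FM) = (\<integral>z. (if z \<in> A i then \<phi> z else 0) \<partial>\<mu>)"
 if "integrable \<mu> \<phi>" for i and \<phi> :: "complex => complex"
 by (rule graph_integral[OF that A rk], simp add: A_def occ_rank_less_mult_count)+
 have bL: "b p \<in> L2 FM" for p
 proof (cases p)
 case (Pair i n)
 have bmeas: "b p \<in> borel_measurable FM"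
 proof (rule FM_measurable)
  have [measurable]: "fst \<in> borel_measurable PM" 
  using measurable_fst[of \<mu> "count_space UNIV"] by (simp only: measurable_cong_sets[OF refl sets_\<rho>])
  have [measurable]: "(%x. occ_rank f i (fst x)) \<in> PM \<rightarrow>\<^sub>M count_space UNIV" by measurable
  have preq: "(%x. snd x = occ_rank f i (fst x)) = (%x. \<exists>j. snd x = j & occ_rank f i (fst x) = j)" by auto
  have [measurable]: "Measurable.pred PM (%x. snd x = occ_rank f i (fst x))" unfolding preq by measurable
  show "b p \<in> borel_measurable PM" unfolding b_def Pair prod.case by measurable
 qed
 show ?thesis
 proof (rule L2_bound[OF bmeas])
  show "integrable FM (%x. Re (if fst x \<in> A i & snd x = occ_rank f i (fst x) then of_real (f i (fst x)) else 0))"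
  by (intro integrable_Re gr) (use fi in simp)
  show "AE x in FM. (cmod (b p x))\<^sup>2 \<le> Re (if fst x \<in> A i & snd x = occ_rank f i (fst x) then of_real (f i (fst x)) else 0)"
  using FM_AE_circle by eventually_elim (use f0 in \<open>simp add: b_def Pair norm_mult norm_power_int\<close>)
 qed
 qed
 have gram: "L2_inner M (P n (v i)) (P k (v j)) = L2_inner FM (b (i, n)) (b (j, k))" for i n j k
 proof (cases "i = j")
 case False
 have bz: "b (i, n) x * cnj (b (j, k) x) = 0" for x
 proof -
  have "i < j \<or> j < i" using False by auto
  then have "occ_rank f i (fst x) ~= occ_rank f j (fst x)" if "fst x \<in> A i" "fst x \<in> A j"
  using that occ_rank_strict[of i j f "fst x"] occ_rank_strict[of j i f "fst x"] by (auto simp: A_def)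
  then show ?thesis by (auto simp: b_def)
 qed
 have "L2_inner FM (b (i, n)) (b (j, k)) = 0" unfolding L2_inner_def bz by simp
 then show ?thesis using orth[OF False] v by (simp add: P_inner_shift)
 next
 case True
 let ?\<phi> = "%z. z powi (n - k) * complex_of_real (f i z)"
 have \<phi>: "integrable \<mu> ?\<phi>" using power_int_integrable[OF \<mu>, of "%z. of_real (f i z)"] fi by simp
 have "L2_inner FM (b (i, n)) (b (j, k))
  = (\<integral>x. (if fst x \<in> A i & snd x = occ_rank f i (fst x) then ?\<phi> (fst x) else 0) \<partial>FM)"
  unfolding L2_inner_def
 proof (rule integral_cong_AE)
  show "(%x. b (i, n) x * cnj (b (j, k) x)) \<in> borel_measurable FM"
  using L2_inner_integrable[OF bL bL] by (rule borel_measurable_integrable)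
  show "(%x. (if fst x \<in> A i & snd x = occ_rank f i (fst x) then ?\<phi> (fst x) else 0)) \<in> borel_measurable FM"
  using gr(1)[OF \<phi>] by (rule borel_measurable_integrable)
  show "AE x in FM. b (i, n) x * cnj (b (j, k) x) = (if fst x \<in> A i & snd x = occ_rank f i (fst x) then ?\<phi> (fst x) else 0)"
  using FM_AE_circle
  proof eventually_elim
  case (elim x)
  let ?z = "fst x" and ?s = "complex_of_real (sqrt (f i (fst x)))"
  have ss: "?s * ?s = of_real (f i ?z)" using f0[of i ?z] by (simp flip: of_real_mult)
  have "?z ~= 0" using elim by auto
  then have zz: "?z powi n * cnj (?z powi k) = ?z powi (n - k)"
   unfolding cnj_power_int_circle[OF elim] using power_int_add[of ?z n "- k"] by simp
  have "?z powi n * ?s * cnj (?z powi k * ?s) = (?z powi n * cnj (?z powi k)) * (?s * ?s)"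
   by (simp only: complex_cnj_mult complex_cnj_complex_of_real mult_ac)
  then have "?z powi n * ?s * cnj (?z powi k * ?s) = ?z powi (n - k) * of_real (f i ?z)" by (simp only: zz ss)
  then show ?case unfolding b_def True prod.case by (simp only: if_distrib[of "(*) _"]) auto
  qed
 qed
 also have "\<dots> = (\<integral>z. (if z \<in> A i then ?\<phi> z else 0) \<partial>\<mu>)" by (rule gr(2)[OF \<phi>])
 also have "\<dots> = (\<integral>z. ?\<phi> z \<partial>\<mu>)"
  using f0[of i] by (intro Bochner_Integration.integral_cong refl) (auto simp: A_def not_less antisym)
 also have "\<dots> = L2_inner M (P n (v i)) (P k (v j))" using v True by (simp add: P_inner_shift feq)
 finally show ?thesis by simp
 qed
 have tot: "ltotal FM (L2 FM) (range b)"
 unfolding ltotal_def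
 proof (intro conjI ballI impI)
 show "range b \<subseteq> L2 FM" using bL by auto
 fix G assume G: "G \<in> L2 FM" and 0: "\<forall>a\<in>range b. L2_inner FM G a = 0"
 define Gt where "Gt x = indicator E x *\<^sub>R G x" for x
 have Gm: "Gt \<in> borel_measurable PM"
  using L2_measurable[OF G] unfolding FM Gt_def by (subst (asm) borel_measurable_restrict_space_iff) auto
 have "AE z in \<mu>. 0 < f i z --> Gt (z, occ_rank f i z) = 0" for i
 proof -
  define \<psi> where "\<psi> z = (if z \<in> A i then Gt (z, occ_rank f i z) * of_real (sqrt (f i z)) else 0)" for z
  have Gi: "integrable PM (%x. indicator E x *\<^sub>R (G x * cnj (b (i, n) x)))" for n
  using L2_inner_integrable[OF G bL] unfolding FM_integrable .
  have point: "(\<integral>j. indicator E (z, j) *\<^sub>R (G (z, j) * cnj (b (i, n) (z, j))) \<partial>count_space UNIV)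
   = cnj (z powi n) * \<psi> z" for z n
  proof -
  have "indicator E (z, j) *\<^sub>R (G (z, j) * cnj (b (i, n) (z, j)))
   = (if z \<in> A i & j = occ_rank f i z then cnj (z powi n) * \<psi> z else 0)" for j
   by (auto simp: b_def Gt_def \<psi>_def)
  then show ?thesis by (simp add: integral_count_space_single) (simp add: \<psi>_def)
  qed
  have \<psi>i: "integrable \<mu> \<psi>"
  using pair.integrable_fst'[OF Gi[of 0]] unfolding point by simp
  have "(\<integral>z. z powi k * \<psi> z \<partial>\<mu>) = 0" for k
  proof -
  \<comment> \<open>The inner product conjugates its second argument, so the coefficient at
    frequency \<open>k\<close> is read off from the vector with index \<open>- k\<close>.\<close>
  have "0 = L2_inner FM G (b (i, - k))" using 0 by auto
  also have "\<dots> = (\<integral>z. cnj (z powi (- k)) * \<psi> z \<partial>\<mu>)"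
   unfolding L2_inner_def FM_integral using pair.integral_fst'[OF Gi[of "- k"]] unfolding point by simp
  also have "\<dots> = (\<integral>z. z powi k * \<psi> z \<partial>\<mu>)"
  proof (rule integral_cong_AE)
   have [measurable]: "\<psi> \<in> borel_measurable \<mu>" using \<psi>i by measurable
   show "(%z. cnj (z powi (- k)) * \<psi> z) \<in> borel_measurable \<mu>"
   by (intro borel_measurable_times borel_measurable_continuous_on[where f=cnj] continuous_intros) measurable
   show "(%z. z powi k * \<psi> z) \<in> borel_measurable \<mu>" by measurable
   show "AE z in \<mu>. cnj (z powi (- k)) * \<psi> z = z powi k * \<psi> z"
   using circle_measureD(3)[OF \<mu>]
   proof eventually_elim
   case (elim z)
   show ?case unfolding cnj_power_int_circle[OF elim] by simp
   qed
  qed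
  finally show ?thesis by simp
  qed
  then have "AE z in \<mu>. \<psi> z = 0" using circle_Fourier_unique[OF \<mu> \<psi>i] by simp
  then show ?thesis by eventually_elim (auto simp: \<psi>_def A_def)
 qed
 then have "AE z in \<mu>. \<forall>i. 0 < f i z --> Gt (z, occ_rank f i z) = 0" by (simp add: AE_all_countable)
 then have "AE z in \<mu>. AE j in count_space UNIV. Gt (z, j) = 0"
 proof eventually_elim
  case (elim z)
  have "Gt (z, j) = 0" for j
  proof (cases "(z, j) \<in> E")
  case True
  then have "enat j < mult_count f z" by (simp add: E_def)
  then obtain i where "0 < f i z" "occ_rank f i z = j" using less_mult_count_imp_rank by blast
  then show ?thesis using elim by auto
  qed (simp add: Gt_def)
  then show ?case by simp
 qed
 moreover have "{x \<in> space PM. Gt x = 0} \<in> sets PM" using Gm by measurable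
 ultimately have "AE x in PM. Gt x = 0" by (intro pair.AE_pair_measure)
 then have "AE x in PM. x \<in> E --> G x = 0" by eventually_elim (auto simp: Gt_def indicator_def)
 then show "AE x in FM. G x = 0" unfolding FM by (subst AE_restrict_space_iff) auto
 qed
 have orbeq: "orb (range v) = (%(i, n). P n (v i)) ` UNIV" by (auto simp: orb_def image_iff)
 obtain W where W: "isometric_map M V FM (L2 FM) W"
 "!!p. AE y in FM. W ((%(i, n). P n (v i)) p) y = b p y"
 "unitary_map M V FM (L2 FM) W"
 proof (rule imap_extension[OF V csub_UNIV[of FM], where I=UNIV and b=b and a="%(i, n). P n (v i)"])
 show "ltotal M V (range (%(i, n). P n (v i)))" using t orbeq by simp
 qed (use v P_in bL gram tot in auto)
 have "AE x in FM. W (P n u) x = fst x powi n * W u x" if "u \<in> V" for n u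
 proof (rule imap_agree[where ?W1.0="%u. W (P n u)" and ?W2.0="%u x. fst x powi n * W u x", OF _ _ V csub_UNIV t _ that])
 show "isometric_map M V FM (L2 FM) (%u. W (P n u))" by (rule imap_comp[OF P_imap W(1) V V csub_UNIV])
 show "isometric_map M V FM (L2 FM) (%u x. fst x powi n * W u x)"
  by (rule imap_comp[OF W(1) mult_imap[OF FM_fst FM_AE_circle] V csub_UNIV csub_UNIV])
 fix a assume "a \<in> orb (range v)"
 then obtain k i where a: "a = P k (v i)" by (auto simp: orb_def)
 have "AE x in FM. W (P n a) x = W (P (n + k) (v i)) x"
  unfolding a by (rule imap_cong[OF W(1) V csub_UNIV]) (use v P_in P_comp in auto)
 moreover have "AE x in FM. W (P (n + k) (v i)) x = b (i, n + k) x" using W(2)[of "(i, n + k)"] by simp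
 moreover have "AE x in FM. W a x = b (i, k) x" using W(2)[of "(i, k)"] a by simp
 ultimately show "AE x in FM. W (P n a) x = fst x powi n * W a x"
  using FM_AE_circle
 proof eventually_elim
  case (elim x)
  have "fst x ~= 0" using elim by auto
  then show ?case using elim(1,2,3) power_int_add[of "fst x" n k] by (simp add: b_def mult.assoc)
 qed
 qed
 with W(3) show thesis using that by blast
qed

end

section \<open>Characteristic functionals determine finite measures\<close>

text \<open>The value at 0 is the total mass. If it is positive, both measures are normalised and
  Levy's uniqueness theorem applies.\<close>

lemma finite_measure_char_eqI:
 fixes \<alpha> \<beta> :: "real measure"
 assumes fin: "finite_measure \<alpha>" "finite_measure \<beta>" and sets: "sets \<alpha> = sets borel" "sets \<beta> = sets borel"
 and eq: "!!t. char \<alpha> t = char \<beta> t"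
 shows "\<alpha> = \<beta>"
proof -
 interpret \<alpha>: finite_measure \<alpha> by (rule fin)
 interpret \<beta>: finite_measure \<beta> by (rule fin)
 have sp: "space \<alpha> = UNIV" "space \<beta> = UNIV" using sets_eq_imp_space_eq[OF sets(1)] sets_eq_imp_space_eq[OF sets(2)] by auto
 define c where "c = measure \<alpha> UNIV"
 have c\<beta>: "c = measure \<beta> UNIV"
 using eq[of 0] sp by (simp add: char_def c_def)
 show ?thesis
 proof (cases "c = 0")
 case True
 have "measure \<alpha> A \<le> 0" "measure \<beta> A \<le> 0" for A
  using True c\<beta> \<alpha>.bounded_measure[of A] \<beta>.bounded_measure[of A] sp by (simp_all add: c_def)
 then have "emeasure \<alpha> A = 0" "emeasure \<beta> A = 0" for A
  unfolding \<alpha>.emeasure_eq_measure \<beta>.emeasure_eq_measure by (simp_all add: ennreal_eq_0_iff)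
 then show ?thesis by (intro measure_eqI) (simp_all only: sets)
 next
 case False
 then have c: "c > 0" by (simp add: c_def zero_less_measure_iff)
 define N where "N \<gamma> = density \<gamma> (%_::real. ennreal (1 / c))" for \<gamma> :: "real measure"
 have N: "emeasure (N \<gamma>) A = ennreal (1 / c) * emeasure \<gamma> A" if "A \<in> sets \<gamma>" for \<gamma> A
  using that by (simp add: N_def emeasure_density nn_integral_cmult_indicator)
 have rd: "real_distribution (N \<gamma>)"
  if "finite_measure \<gamma>" "sets \<gamma> = sets borel" "measure \<gamma> UNIV = c" for \<gamma>
 proof -
  interpret finite_measure \<gamma> by (rule that)
  have sp: "space \<gamma> = UNIV" using sets_eq_imp_space_eq[OF that(2)] by auto
  have "emeasure (N \<gamma>) (space (N \<gamma>)) = ennreal (1 / c) * ennreal c"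
  using N[of UNIV \<gamma>] that(2,3) sp by (simp add: N_def emeasure_eq_measure)
  also have "\<dots> = 1" using c by (simp flip: ennreal_mult)
  finally have "prob_space (N \<gamma>)" by (intro prob_spaceI) simp
  then show ?thesis
  by (intro real_distribution.intro real_distribution_axioms.intro) (simp_all add: N_def that(2))
 qed
 have "char (N \<gamma>) t = of_real (1 / c) * char \<gamma> t" if "sets \<gamma> = sets borel" for \<gamma> t
 proof -
  note [measurable_cong] = that
  have "(\<integral>x. iexp (t * x) \<partial>N \<gamma>) = (\<integral>x. (1 / c) *\<^sub>R iexp (t * x) \<partial>\<gamma>)"
  unfolding N_def using c by (intro integral_density) auto
  then show ?thesis by (simp add: char_def scaleR_conv_of_real)
 qed
 then have "char (N \<alpha>) = char (N \<beta>)" using sets eq by (intro ext) simp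
 then have "N \<alpha> = N \<beta>"
  using rd[OF fin(1) sets(1)] rd[OF fin(2) sets(2)] c\<beta> by (intro Levy_uniqueness) (auto simp: c_def)
 then have "ennreal (1 / c) * emeasure \<alpha> A = ennreal (1 / c) * emeasure \<beta> A" if "A \<in> sets borel" for A
  using N[of A \<alpha>] N[of A \<beta>] that sets by simp
 note Neq = this
 have c': "ennreal (1 / c) ~= 0" "ennreal (1 / c) ~= top" using c by (auto simp: ennreal_eq_0_iff)
 have "emeasure \<alpha> A = emeasure \<beta> A" if "A \<in> sets borel" for A
  using Neq[OF that] c' unfolding ennreal_mult_cancel_left by blast
 then show ?thesis using sets by (intro measure_eqI) auto
 qed
qed

lemma integral_real_imag:
 assumes "integrable M (A :: 'a => real)" "integrable M (B :: 'a => real)"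
 shows "(\<integral>x. of_real (A x) + \<i> * of_real (B x) \<partial>M) = of_real (\<integral>x. A x \<partial>M) + \<i> * of_real (\<integral>x. B x \<partial>M)"
 using assms by simp

locale cramer_wold =
 fixes M :: "'a measure" and H :: "('a => real) set"
 assumes Hm: "h \<in> H ==> h \<in> borel_measurable M"
 and H_zero: "(%_. 0) \<in> H"
 and H_add: "h \<in> H ==> g \<in> H ==> (%x. h x + g x) \<in> H"
 and H_scale: "h \<in> H ==> (%x. c * h x) \<in> H"
begin

lemma H_diff: "h \<in> H ==> g \<in> H ==> (%x. h x - g x) \<in> H"
 using H_add[of h "%x. - 1 * g x"] H_scale[of g "- 1"] by simp

definition agree :: "'a measure => 'a measure => bool" where
 "agree \<mu> \<nu> \<longleftrightarrow> finite_measure \<mu> & finite_measure \<nu> & sets \<mu> = sets M & sets \<nu> = sets M &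
  (\<forall>h\<in>H. (\<integral>x. iexp (h x) \<partial>\<mu>) = (\<integral>x. iexp (h x) \<partial>\<nu>))"

lemma iexp_integrable:
 assumes "finite_measure \<mu>" "sets \<mu> = sets M" "h \<in> H"
 shows "integrable \<mu> (%x. iexp (h x))"
proof -
 interpret finite_measure \<mu> by (rule assms)
 have [measurable]: "h \<in> borel_measurable \<mu>"
 using Hm[OF assms(3)] by (simp only: measurable_cong_sets[OF assms(2) refl])
 show ?thesis by (rule integrable_const_bound[of _ 1]) auto
qed

text \<open>A nonnegative weight can be absorbed into the measure, and pushing forward by
  \<open>h0\<close> reduces the claim to uniqueness on the line.\<close>

lemma weighted_agree:
 assumes a: "agree \<mu> \<nu>" and h0: "h0 \<in> H" and C: "C \<in> sets borel"
 and w: "w \<in> borel_measurable M" "!!x. 0 \<le> w x" "!!x. w x \<le> B"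
 and eq: "!!t. (\<integral>x. of_real (w x) * iexp (t * h0 x) \<partial>\<mu>) = (\<integral>x. of_real (w x) * iexp (t * h0 x) \<partial>\<nu>)"
 shows "(\<integral>x. indicator C (h0 x) * w x \<partial>\<mu>) = (\<integral>x. indicator C (h0 x) * w x \<partial>\<nu>)"
proof -
 define D where "D \<gamma> = distr (density \<gamma> (%x. ennreal (w x))) borel h0" for \<gamma>
 have D: "finite_measure (D \<gamma>)" "char (D \<gamma>) t = (\<integral>x. of_real (w x) * iexp (t * h0 x) \<partial>\<gamma>)"
 "measure (D \<gamma>) C = (\<integral>x. indicator C (h0 x) * w x \<partial>\<gamma>)"
 if g: "finite_measure \<gamma>" "sets \<gamma> = sets M" for \<gamma> t
 proof -
 interpret finite_measure \<gamma> by (rule g)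
 have [measurable]: "h0 \<in> borel_measurable \<gamma>" "w \<in> borel_measurable \<gamma>"
  using Hm[OF h0] w(1) by (simp_all only: measurable_cong_sets[OF g(2) refl])
 have hm [measurable]: "h0 \<in> borel_measurable (density \<gamma> (%x. ennreal (w x)))" by simp
 have wi: "integrable \<gamma> w" by (rule integrable_const_bound[of _ B]) (use w in \<open>auto simp: abs_of_nonneg\<close>)
 have "emeasure (D \<gamma>) (space (D \<gamma>)) = (\<integral>\<^sup>+x. ennreal (w x) \<partial>\<gamma>)"
  by (simp add: D_def emeasure_distr emeasure_density space_density cong: nn_integral_cong)
 also have "\<dots> = ennreal (\<integral>x. w x \<partial>\<gamma>)" using wi w by (intro nn_integral_eq_integral) auto
 finally show fin: "finite_measure (D \<gamma>)" by (intro finite_measureI) simp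
 show "char (D \<gamma>) t = (\<integral>x. of_real (w x) * iexp (t * h0 x) \<partial>\<gamma>)"
  unfolding char_def D_def
  by (subst integral_distr, simp, simp, subst integral_density) (use w in \<open>auto simp: scaleR_conv_of_real\<close>)
 have "(\<integral>x. indicator C x \<partial>D \<gamma>) = (\<integral>x. w x *\<^sub>R (indicator C (h0 x) :: real) \<partial>\<gamma>)"
  unfolding D_def using C
  by (subst integral_distr, simp, simp, subst integral_density) (use w in auto)
 then show "measure (D \<gamma>) C = (\<integral>x. indicator C (h0 x) * w x \<partial>\<gamma>)"
  using C by (simp add: D_def mult.commute)
 qed
 have g: "finite_measure \<mu>" "sets \<mu> = sets M" "finite_measure \<nu>" "sets \<nu> = sets M"
 using a by (auto simp: agree_def)
 have "D \<mu> = D \<nu>"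
 by (rule finite_measure_char_eqI) (use D(1,2)[OF g(1,2)] D(1,2)[OF g(3,4)] eq in \<open>auto simp: D_def\<close>)
 then show ?thesis using D(3)[OF g(1,2)] D(3)[OF g(3,4)] by simp
qed

text \<open>Equality of the functionals survives restriction to a set \<open>h0 \<in> C\<close>. The
  function \<open>iexp h\<close> is not a legitimate density, but \<open>1\<close>,
  \<open>1 + cos h\<close> and \<open>1 + sin h\<close> are, and \<open>iexp h\<close> is a complex
  combination of them; their products with \<open>iexp (t * h0)\<close> expand into exponentials of
  members of \<open>H\<close>.\<close>

lemma agree_restrict:
 assumes a: "agree \<mu> \<nu>" and h0: "h0 \<in> H" and C: "C \<in> sets borel"
 shows "agree (density \<mu> (%x. indicator C (h0 x))) (density \<nu> (%x. indicator C (h0 x)))"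
proof -
 have g: "finite_measure \<mu>" "sets \<mu> = sets M" "finite_measure \<nu>" "sets \<nu> = sets M"
 using a by (auto simp: agree_def)
 have eqH: "(\<integral>x. iexp (h x) \<partial>\<mu>) = (\<integral>x. iexp (h x) \<partial>\<nu>)" if "h \<in> H" for h
 using a that by (auto simp: agree_def)
 note [measurable] = C
 have fin: "finite_measure (density \<gamma> (%x. indicator C (h0 x)))" if "finite_measure \<gamma>" "sets \<gamma> = sets M" for \<gamma>
 proof -
 interpret finite_measure \<gamma> by (rule that)
 have [measurable]: "h0 \<in> borel_measurable \<gamma>"
  using Hm[OF h0] by (simp only: measurable_cong_sets[OF that(2) refl])
 have "emeasure (density \<gamma> (%x. indicator C (h0 x))) (space \<gamma>) \<le> (\<integral>\<^sup>+x. 1 \<partial>\<gamma>)"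
  by (subst emeasure_density) (auto intro!: nn_integral_mono simp del: nn_integral_const split: split_indicator)
 also have "\<dots> < \<infinity>" by (simp add: emeasure_finite less_top[symmetric])
 finally show ?thesis by (intro finite_measureI) auto
 qed
 have "(\<integral>x. iexp (h x) \<partial>density \<mu> (%x. indicator C (h0 x))) = (\<integral>x. iexp (h x) \<partial>density \<nu> (%x. indicator C (h0 x)))"
 if h: "h \<in> H" for h
 proof -
 let ?J = "%\<gamma> w. \<integral>x. indicator C (h0 x) * (w x :: real) \<partial>\<gamma>"
 have ht: "(%x. t * h0 x) \<in> H" for t using H_scale[OF h0] .
 have ie: "iexp (a + b) = iexp a * iexp b" for a b
  by (simp add: distrib_left exp_add)
 have hm: "h \<in> borel_measurable M" by (rule Hm[OF h])
 have one: "?J \<mu> (%_. 1) = ?J \<nu> (%_. 1)"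
  by (rule weighted_agree[OF a h0 C, where B=1 and w="%_. 1"]) (use eqH[OF ht] in auto)
 have split: "(\<integral>x. of_real (1 + cos (h x)) * iexp (t * h0 x) \<partial>\<gamma>) = (\<integral>x. iexp (t * h0 x) \<partial>\<gamma>)
  + ((\<integral>x. iexp (t * h0 x + h x) \<partial>\<gamma>) + (\<integral>x. iexp (t * h0 x - h x) \<partial>\<gamma>)) / 2"
  "(\<integral>x. of_real (1 + sin (h x)) * iexp (t * h0 x) \<partial>\<gamma>) = (\<integral>x. iexp (t * h0 x) \<partial>\<gamma>)
  + (- \<i> / 2) * ((\<integral>x. iexp (t * h0 x + h x) \<partial>\<gamma>) - (\<integral>x. iexp (t * h0 x - h x) \<partial>\<gamma>))"
  if \<gamma>: "finite_measure \<gamma>" "sets \<gamma> = sets M" for t \<gamma>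
 proof -
  have i: "integrable \<gamma> (%x. iexp (t * h0 x))" "integrable \<gamma> (%x. iexp (t * h0 x + h x))"
  "integrable \<gamma> (%x. iexp (t * h0 x - h x))"
  using iexp_integrable[OF \<gamma> ht] iexp_integrable[OF \<gamma> H_add[OF ht h]]
   iexp_integrable[OF \<gamma> H_diff[OF ht h]] by auto
  have m: "iexp (a - b) = iexp a * iexp (- b)" for a b using ie[of a "- b"] by simp
  have c: "of_real (1 + cos b) * iexp a = iexp a + (iexp (a + b) + iexp (a - b)) / 2"
  "of_real (1 + sin b) * iexp a = iexp a + (- \<i> / 2) * (iexp (a + b) - iexp (a - b))" for a b
  unfolding cis_conv_exp[symmetric]
  by (simp_all add: complex_eq_iff cos_add cos_diff sin_add sin_diff field_simps)
  show "(\<integral>x. of_real (1 + cos (h x)) * iexp (t * h0 x) \<partial>\<gamma>) = (\<integral>x. iexp (t * h0 x) \<partial>\<gamma>)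
  + ((\<integral>x. iexp (t * h0 x + h x) \<partial>\<gamma>) + (\<integral>x. iexp (t * h0 x - h x) \<partial>\<gamma>)) / 2"
  "(\<integral>x. of_real (1 + sin (h x)) * iexp (t * h0 x) \<partial>\<gamma>) = (\<integral>x. iexp (t * h0 x) \<partial>\<gamma>)
  + (- \<i> / 2) * ((\<integral>x. iexp (t * h0 x + h x) \<partial>\<gamma>) - (\<integral>x. iexp (t * h0 x - h x) \<partial>\<gamma>))"
  unfolding c using i by simp_all
 qed
 have eqs: "(\<integral>x. iexp (t * h0 x) \<partial>\<mu>) = (\<integral>x. iexp (t * h0 x) \<partial>\<nu>)"
  "(\<integral>x. iexp (t * h0 x + h x) \<partial>\<mu>) = (\<integral>x. iexp (t * h0 x + h x) \<partial>\<nu>)"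
  "(\<integral>x. iexp (t * h0 x - h x) \<partial>\<mu>) = (\<integral>x. iexp (t * h0 x - h x) \<partial>\<nu>)" for t
  using eqH[OF ht] eqH[OF H_add[OF ht h]] eqH[OF H_diff[OF ht h]] by auto
 have cosJ: "?J \<mu> (%x. 1 + cos (h x)) = ?J \<nu> (%x. 1 + cos (h x))"
 proof (rule weighted_agree[OF a h0 C, where B=2 and w="%x. 1 + cos (h x)"])
  show "(%x. 1 + cos (h x)) \<in> borel_measurable M" using hm by measurable
  show "0 \<le> 1 + cos (h x)" "1 + cos (h x) \<le> 2" for x
  using cos_ge_minus_one[of "h x"] cos_le_one[of "h x"] by linarith+
 qed (simp only: split[OF g(1,2)] split[OF g(3,4)] eqs)
 have sinJ: "?J \<mu> (%x. 1 + sin (h x)) = ?J \<nu> (%x. 1 + sin (h x))"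
 proof (rule weighted_agree[OF a h0 C, where B=2 and w="%x. 1 + sin (h x)"])
  show "(%x. 1 + sin (h x)) \<in> borel_measurable M" using hm by measurable
  show "0 \<le> 1 + sin (h x)" "1 + sin (h x) \<le> 2" for x
  using sin_ge_minus_one[of "h x"] sin_le_one[of "h x"] by linarith+
 qed (simp only: split[OF g(1,2)] split[OF g(3,4)] eqs)
 have dec: "(\<integral>x. iexp (h x) \<partial>density \<gamma> (%x. indicator C (h0 x)))
  = of_real (?J \<gamma> (%x. 1 + cos (h x)) - ?J \<gamma> (%_. 1)) + \<i> * of_real (?J \<gamma> (%x. 1 + sin (h x)) - ?J \<gamma> (%_. 1))"
  if \<gamma>: "finite_measure \<gamma>" "sets \<gamma> = sets M" for \<gamma>
 proof -
  interpret finite_measure \<gamma> by (rule \<gamma>)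
  have [measurable]: "h0 \<in> borel_measurable \<gamma>" "h \<in> borel_measurable \<gamma>"
  using Hm[OF h0] Hm[OF h] by (simp_all only: measurable_cong_sets[OF \<gamma>(2) refl])
  have ic: "integrable \<gamma> (%x. indicator C (h0 x) * (1 + cos (h x)))"
  "integrable \<gamma> (%x. indicator C (h0 x) * (1 + sin (h x)))" "integrable \<gamma> (%x. indicator C (h0 x) * (1 :: real))"
  proof -
  have b: "\<bar>1 + cos y\<bar> \<le> 2" "\<bar>1 + sin y\<bar> \<le> 2" for y :: real
   using abs_cos_le_one[of y] abs_sin_le_one[of y] by linarith+
  have "\<bar>indicator C (h0 x) * y\<bar> \<le> 2" if "\<bar>y\<bar> \<le> 2" for x and y :: real
   using that by (simp split: split_indicator)
  note bd = this
  show "integrable \<gamma> (%x. indicator C (h0 x) * (1 + cos (h x)))"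
   by (rule integrable_const_bound[of _ 2]) (simp_all only: real_norm_def AE_I2 bd b, measurable)
  show "integrable \<gamma> (%x. indicator C (h0 x) * (1 + sin (h x)))"
   by (rule integrable_const_bound[of _ 2]) (simp_all only: real_norm_def AE_I2 bd b, measurable)
  show "integrable \<gamma> (%x. indicator C (h0 x) * (1 :: real))"
   by (rule integrable_const_bound[of _ 2]) (simp_all only: real_norm_def AE_I2 bd abs_one one_le_numeral, measurable)
  qed
  have "(\<integral>x. iexp (h x) \<partial>density \<gamma> (%x. indicator C (h0 x))) = (\<integral>x. iexp (h x) \<partial>density \<gamma> (%x. ennreal (indicator C (h0 x))))"
  proof -
  have "(%x. indicator C (h0 x) :: ennreal) = (%x. ennreal (indicator C (h0 x)))"
   by (rule ext) (simp split: split_indicator)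
  then show ?thesis by (simp only:)
  qed
  also have "\<dots> = (\<integral>x. (indicator C (h0 x) :: real) *\<^sub>R iexp (h x) \<partial>\<gamma>)"
  by (rule integral_density) auto
  also have "\<dots> = (\<integral>x. of_real (indicator C (h0 x) * (1 + cos (h x)) - indicator C (h0 x) * 1)
   + \<i> * of_real (indicator C (h0 x) * (1 + sin (h x)) - indicator C (h0 x) * 1) \<partial>\<gamma>)"
  proof (rule Bochner_Integration.integral_cong[OF refl])
  fix x
  show "(indicator C (h0 x) :: real) *\<^sub>R iexp (h x) = of_real (indicator C (h0 x) * (1 + cos (h x)) - indicator C (h0 x) * 1)
   + \<i> * of_real (indicator C (h0 x) * (1 + sin (h x)) - indicator C (h0 x) * 1)"
   by (simp add: cis_conv_exp[symmetric] complex_eq_iff algebra_simps)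
  qed
  also have "\<dots> = of_real (\<integral>x. indicator C (h0 x) * (1 + cos (h x)) - indicator C (h0 x) * 1 \<partial>\<gamma>)
   + \<i> * of_real (\<integral>x. indicator C (h0 x) * (1 + sin (h x)) - indicator C (h0 x) * 1 \<partial>\<gamma>)"
  proof -
  have "integrable \<gamma> (%x. indicator C (h0 x) * (1 + cos (h x)) - indicator C (h0 x) * 1)"
   "integrable \<gamma> (%x. indicator C (h0 x) * (1 + sin (h x)) - indicator C (h0 x) * 1)"
   using ic by (intro Bochner_Integration.integrable_diff; simp)+
  then show ?thesis by (rule integral_real_imag)
  qed
  finally show ?thesis using ic by (simp only: Bochner_Integration.integral_diff)
 qed
 show ?thesis unfolding dec[OF g(1,2)] dec[OF g(3,4)] one cosJ sinJ ..
 qed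
 then show ?thesis using fin g by (simp add: agree_def)
qed

text \<open>Cylinders are built one preimage at a time so that each step can be traded for a
  restriction of the two measures. For this reason the measures vary in the induction of
  \<open>agree_cyl\<close>.\<close>

inductive_set cyl :: "'a set set" where
 space: "space M \<in> cyl"
| vimage: "h \<in> H ==> C \<in> sets borel ==> B \<in> cyl ==> h -` C \<inter> B \<in> cyl"

lemma cyl_sub: "B \<in> cyl ==> B \<subseteq> space M"
 by (induction rule: cyl.induct) auto

lemma cyl_sets: "B \<in> cyl ==> B \<in> sets M"
proof (induction rule: cyl.induct)
 case (vimage h C B)
 have "h -` C \<inter> B = (h -` C \<inter> space M) \<inter> B" using cyl_sub[OF vimage(3)] by auto
 then show ?case using vimage Hm by (auto intro!: sets.Int measurable_sets)
qed auto

lemma cyl_Int: "A \<in> cyl ==> B \<in> cyl ==> A \<inter> B \<in> cyl"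
proof (induction rule: cyl.induct)
 case space then show ?case using cyl_sub[of B] by (simp add: Int_absorb1)
next
 case (vimage h C A)
 then show ?case using cyl.vimage[OF vimage(1,2), of "A \<inter> B"] by (simp add: Int_assoc)
qed

lemma agree_cyl: "B \<in> cyl ==> agree \<mu> \<nu> ==> emeasure \<mu> B = emeasure \<nu> B"
proof (induction arbitrary: \<mu> \<nu> rule: cyl.induct)
 case space
 then interpret \<mu>: finite_measure \<mu> by (simp add: agree_def)
 from space interpret \<nu>: finite_measure \<nu> by (simp add: agree_def)
 have "space \<mu> = space M" "space \<nu> = space M" using space sets_eq_imp_space_eq by (auto simp: agree_def)
 moreover have "\<forall>h\<in>H. (\<integral>x. iexp (h x) \<partial>\<mu>) = (\<integral>x. iexp (h x) \<partial>\<nu>)"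
 using space by (simp add: agree_def)
 from bspec[OF this H_zero] have "(\<integral>x. iexp 0 \<partial>\<mu>) = (\<integral>x. iexp 0 \<partial>\<nu>)" .
 ultimately show ?case by (simp add: \<mu>.emeasure_eq_measure \<nu>.emeasure_eq_measure)
next
 case (vimage h C B)
 have "emeasure \<gamma> (h -` C \<inter> B) = emeasure (density \<gamma> (%x. indicator C (h x))) B" if "sets \<gamma> = sets M" for \<gamma>
 proof -
 have [measurable]: "h \<in> borel_measurable \<gamma>"
  using Hm[OF vimage(1)] by (simp only: measurable_cong_sets[OF that refl])
 have B: "B \<in> sets \<gamma>" using cyl_sets[OF vimage(3)] that by simp
 have hB: "h -` C \<inter> B \<in> sets \<gamma>" using cyl_sets[OF cyl.vimage[OF vimage(1-3)]] that by simp
 have "emeasure (density \<gamma> (%x. indicator C (h x))) B = (\<integral>\<^sup>+x. indicator C (h x) * indicator B x \<partial>\<gamma>)"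
  using B vimage(2) by (intro emeasure_density) auto
 also have "\<dots> = (\<integral>\<^sup>+x. indicator (h -` C \<inter> B) x \<partial>\<gamma>)"
  by (intro nn_integral_cong) (auto simp: indicator_def)
 finally show ?thesis using hB by simp
 qed
 then show ?case using vimage.IH[OF agree_restrict[OF vimage.prems vimage(1,2)]] vimage.prems
 by (simp add: agree_def)
qed

theorem agree_sigma:
 assumes a: "agree \<mu> \<nu>"
 and B: "B \<in> sigma_sets (space M) {h -` C \<inter> space M | h C. h \<in> H & C \<in> sets borel}"
 shows "B \<in> sets M" "emeasure \<mu> B = emeasure \<nu> B"
proof -
 have g: "finite_measure \<mu>" "sets \<mu> = sets M" "finite_measure \<nu>" "sets \<nu> = sets M"
 using a by (auto simp: agree_def)
 interpret \<mu>: finite_measure \<mu> by (rule g)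
 interpret \<nu>: finite_measure \<nu> by (rule g)
 have sp: "space \<mu> = space M" "space \<nu> = space M" using sets_eq_imp_space_eq[OF g(2)] sets_eq_imp_space_eq[OF g(4)] by auto
 have "{h -` C \<inter> space M | h C. h \<in> H & C \<in> sets borel} \<subseteq> sigma_sets (space M) cyl"
 using cyl.vimage[OF _ _ cyl.space] by (auto intro: sigma_sets.Basic)
 then have Bc: "B \<in> sigma_sets (space M) cyl" using B sigma_sets_mono by blast
 have "Int_stable cyl" by (auto simp: Int_stable_def cyl_Int)
 moreover have "cyl \<subseteq> Pow (space M)" using cyl_sub by auto
 ultimately have "B \<in> sets M & emeasure \<mu> B = emeasure \<nu> B"
 using Bc
 proof (induction rule: sigma_sets_induct_disjoint)
 case (basic A) then show ?case using cyl_sets agree_cyl[OF _ a] by auto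
 next
 case (compl A)
 then have A: "A \<in> sets \<mu>" "A \<in> sets \<nu>" using g by auto
 have "emeasure \<mu> (space \<mu> - A) = emeasure \<mu> (space \<mu>) - emeasure \<mu> A"
  using A by (intro emeasure_compl \<mu>.emeasure_finite) auto
 moreover have "emeasure \<nu> (space \<nu> - A) = emeasure \<nu> (space \<nu>) - emeasure \<nu> A"
  using A by (intro emeasure_compl \<nu>.emeasure_finite) auto
 moreover have "emeasure \<mu> (space M) = emeasure \<nu> (space M)" by (rule agree_cyl[OF cyl.space a])
 ultimately show ?case using compl sp by auto
 next
 case (union A)
 then have r: "range A \<subseteq> sets \<mu>" "range A \<subseteq> sets \<nu>" using g by auto
 have "emeasure \<mu> (\<Union>i. A i) = emeasure \<nu> (\<Union>i. A i)"
  using suminf_emeasure[OF r(1) union(1)] suminf_emeasure[OF r(2) union(1)] union(3) by simp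
 then show ?case using r g by auto
 qed auto
 then show "B \<in> sets M" "emeasure \<mu> B = emeasure \<nu> B" by auto
qed

text \<open>The positive and negative parts of \<open>f\<close> are compared as densities.\<close>
lemma real_orthogonal_imp_zero:
 assumes M: "finite_measure M" and f: "integrable M f"
 and 0: "!!h. h \<in> H ==> (\<integral>x. of_real (f x) * iexp (h x) \<partial>M) = 0"
 and gen: "generates_mod_null M H"
 shows "AE x in M. f x = 0"
proof -
 interpret finite_measure M by (rule M)
 have [measurable]: "f \<in> borel_measurable M" using f by measurable
 define p n where "p = (%x. max 0 (f x))" and "n = (%x. max 0 (- f x))"
 have pn: "integrable M p" "integrable M n" "!!x. 0 \<le> p x" "!!x. 0 \<le> n x" "!!x. f x = p x - n x"
 unfolding p_def n_def using f by auto
 note [measurable] = borel_measurable_integrable[OF pn(1)] borel_measurable_integrable[OF pn(2)]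
 have fin: "finite_measure (density M (%x. ennreal (q x)))" if "integrable M q" "!!x. 0 \<le> q x" for q :: "'a => real"
 proof (rule finite_measureI)
 have [measurable]: "q \<in> borel_measurable M" using that by measurable
 have "emeasure (density M (%x. ennreal (q x))) (space M) = (\<integral>\<^sup>+x. ennreal (q x) \<partial>M)"
  by (subst emeasure_density) (auto intro!: nn_integral_cong)
 then show "emeasure (density M (%x. ennreal (q x))) (space (density M (%x. ennreal (q x)))) ~= \<infinity>"
  using that nn_integral_eq_integral[of M q] by simp
 qed
 have "agree (density M (%x. ennreal (p x))) (density M (%x. ennreal (n x)))"
 unfolding agree_def
 proof (intro conjI ballI)
 fix h assume h: "h \<in> H"
 have [measurable]: "h \<in> borel_measurable M" by (rule Hm[OF h])
 have i: "integrable M (%x. of_real (q x) * iexp (h x))" if "integrable M q" for q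
  by (rule Bochner_Integration.integrable_bound[OF that]) (use that in \<open>auto simp: norm_mult\<close>)
 have "(\<integral>x. of_real (p x) * iexp (h x) \<partial>M) - (\<integral>x. of_real (n x) * iexp (h x) \<partial>M)
  = (\<integral>x. of_real (p x) * iexp (h x) - of_real (n x) * iexp (h x) \<partial>M)"
  using i pn by simp
 also have "\<dots> = (\<integral>x. of_real (f x) * iexp (h x) \<partial>M)" by (simp add: pn(5) left_diff_distrib)
 finally have "(\<integral>x. of_real (p x) * iexp (h x) \<partial>M) = (\<integral>x. of_real (n x) * iexp (h x) \<partial>M)"
  using 0[OF h] by simp
 then show "(\<integral>x. iexp (h x) \<partial>density M (%x. ennreal (p x))) = (\<integral>x. iexp (h x) \<partial>density M (%x. ennreal (n x)))"
  using pn by (simp add: integral_density scaleR_conv_of_real)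
 qed (use fin pn in auto)
 note ag = agree_sigma[OF this]
 have "AE x in M. ennreal (p x) = ennreal (n x)"
 proof (rule density_unique_finite_measure)
 fix A assume A: "A \<in> sets M"
 then obtain B where B: "B \<in> sigma_sets (space M) {h -` C \<inter> space M | h C. h \<in> H & C \<in> sets borel}"
  and AB: "AE x in M. x \<in> A \<longleftrightarrow> x \<in> B" using gen unfolding generates_mod_null_def by blast
 have "(\<integral>\<^sup>+x. ennreal (q x) * indicator A x \<partial>M) = emeasure (density M (%x. ennreal (q x))) B"
  if [measurable]: "q \<in> borel_measurable M" for q
 proof -
  have "(\<integral>\<^sup>+x. ennreal (q x) * indicator A x \<partial>M) = (\<integral>\<^sup>+x. ennreal (q x) * indicator B x \<partial>M)"
  by (rule nn_integral_cong_AE) (use AB in eventually_elim, auto simp: indicator_def)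
  then show ?thesis using ag(1)[OF B] by (subst emeasure_density) auto
 qed
 then show "(\<integral>\<^sup>+x. ennreal (p x) * indicator A x \<partial>M) = (\<integral>\<^sup>+x. ennreal (n x) * indicator A x \<partial>M)"
  using ag(2)[OF B] by simp
 qed simp_all
 then show ?thesis by eventually_elim (use pn in \<open>auto simp: ennreal_inj\<close>)
qed

end

section \<open>Gaussian spaces and exponential vectors\<close>

lemma centered_gaussian_integrals:
 assumes "prob_space M" and g: "centered_gaussian M h"
 shows "(\<integral>x. iexp (h x) \<partial>M) = of_real (exp (- (\<integral>x. h x * h x \<partial>M) / 2))" "(\<integral>x. h x \<partial>M) = 0"
proof -
 interpret prob_space M by fact
 have [measurable]: "h \<in> borel_measurable M" using g by (simp add: centered_gaussian_def)
 consider "AE x in M. h x = 0" | s where "s > 0" "distributed M lborel h (normal_density 0 s)"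
 using g by (auto simp: centered_gaussian_def)
 then have "(\<integral>x. iexp (h x) \<partial>M) = of_real (exp (- (\<integral>x. h x * h x \<partial>M) / 2)) & (\<integral>x. h x \<partial>M) = 0"
 proof cases
 case 1
 have "(\<integral>x. h x * h x \<partial>M) = (\<integral>x. 0 \<partial>M)" "(\<integral>x. h x \<partial>M) = (\<integral>x. 0 \<partial>M)"
  by (rule integral_cong_AE; use 1 in auto)+
 moreover have "(\<integral>x. iexp (h x) \<partial>M) = (\<integral>x. 1 \<partial>M)"
  by (rule integral_cong_AE) (use 1 in auto)
 ultimately show ?thesis by (simp add: prob_space)
 next
 case 2
 define Y where "Y x = (h x - 0) / s" for x
 have Y: "distributed M lborel Y std_normal_density"
  using normal_standard_normal_convert[OF 2(1), of h 0] 2(2) by (simp add: Y_def[abs_def])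
 have Ym [measurable]: "Y \<in> borel_measurable M" unfolding Y_def by measurable
 have E: "expectation h = 0" using normal_distributed_expectation[OF 2] .
 have "variance h = s\<^sup>2" by (rule normal_distributed_variance[OF 2])
 then have V: "(\<integral>x. h x * h x \<partial>M) = s\<^sup>2" using E by (simp add: power2_eq_square)
 have "(\<integral>x. iexp (h x) \<partial>M) = (\<integral>x. iexp (s * Y x) \<partial>M)" using 2(1) by (simp add: Y_def)
 also have "\<dots> = (\<integral>y. iexp (s * y) \<partial>distr M lborel Y)" by (subst integral_distr) auto
 also have "\<dots> = char std_normal_distribution s"
  using distributed_distr_eq_density[OF Y] by (simp add: char_def)
 also have "\<dots> = of_real (exp (- (s\<^sup>2) / 2))" by (simp add: char_std_normal_distribution)
 finally show ?thesis using E V by simp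
 qed
 then show "(\<integral>x. iexp (h x) \<partial>M) = of_real (exp (- (\<integral>x. h x * h x \<partial>M) / 2))" "(\<integral>x. h x \<partial>M) = 0" by auto
qed

locale gaussian_space = prob_space M for M :: "'a measure" +
 fixes H :: "('a => real) set"
 assumes closed: "closed_real_subspace M H" and gauss: "h \<in> H ==> centered_gaussian M h"
begin

definition rip :: "('a => real) => ('a => real) => real" where
 "rip h g = (\<integral>x. h x * g x \<partial>M)"

definition cx :: "('a => real) => 'a => complex" where
 "cx h = (%x. of_real (h x))"

lemma HD:
 shows H_L2: "h \<in> H ==> h \<in> L2 M" and H_zero: "(%_. 0) \<in> H"
 and H_add: "h \<in> H ==> g \<in> H ==> (%x. h x + g x) \<in> H"
 and H_scale: "h \<in> H ==> (%x. c * h x) \<in> H"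
 using closed unfolding closed_real_subspace_def by blast+

lemma H_measurable: "h \<in> H ==> h \<in> borel_measurable M"
 using H_L2 by (auto simp: L2_def)

sublocale cramer_wold M H
 by standard (auto intro: H_measurable H_zero H_add H_scale)

lemma cx_L2: "h \<in> H ==> cx h \<in> L2 M"
 using H_L2[of h] by (auto simp: L2_def cx_def)

lemma H_mult_integrable:
 assumes "h \<in> H" "g \<in> H" shows "integrable M (%x. h x * g x)"
proof -
 have "integrable M (%x. Re (cx h x * cx g x))"
 by (intro integrable_Re L2_integrable_mult cx_L2 assms)
 then show ?thesis by (simp add: cx_def)
qed

lemma one_L2: "(%_. c) \<in> L2 M" for c :: complex
 by (simp add: L2_def)

lemma H_integrable:
 assumes "h \<in> H" shows "integrable M h"
proof -
 have "integrable M (%x. Re (cx h x * 1))"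
 by (intro integrable_Re L2_integrable_mult cx_L2 assms one_L2)
 then show ?thesis by (simp add: cx_def)
qed

lemma cx_inner: "L2_inner M (cx h) (cx g) = of_real (rip h g)"
proof -
 have "L2_inner M (cx h) (cx g) = (\<integral>x. complex_of_real (h x * g x) \<partial>M)" by (simp add: L2_inner_def cx_def)
 then show ?thesis by (simp only: integral_complex_of_real rip_def)
qed

lemma rip_commute: "rip h g = rip g h"
 by (simp add: rip_def mult.commute)

lemma rip_add_left:
 assumes "h \<in> H" "h' \<in> H" "g \<in> H" shows "rip (%x. h x + h' x) g = rip h g + rip h' g"
 using assms by (simp add: rip_def distrib_right H_mult_integrable)

lemma rip_scale_left: "rip (%x. c * h x) g = c * rip h g"
 by (simp add: rip_def mult.assoc)

lemma rip_linear:
 assumes "h \<in> H" "g \<in> H"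
 shows "rip (%x. h x + t * g x) (%x. h x + t * g x) = rip h h + 2 * t * rip h g + t\<^sup>2 * rip g g"
proof -
 have tg: "(%x. t * g x) \<in> H" using H_scale assms by simp
 have "rip (%x. h x + t * g x) k = rip h k + t * rip g k" if "k \<in> H" for k
 using rip_add_left[OF assms(1) tg that] by (simp add: rip_scale_left)
 then show ?thesis
 using assms H_add[OF assms(1) tg]
 by (simp add: rip_commute[of h "%x. h x + t * g x"] rip_commute[of g "%x. h x + t * g x"]
  rip_commute[of g h] power2_eq_square algebra_simps)
qed

lemma iexp_integral:
 assumes "h \<in> H" shows "(\<integral>x. iexp (h x) \<partial>M) = of_real (exp (- rip h h / 2))"
 using centered_gaussian_integrals(1)[OF prob_space_axioms gauss[OF assms]] by (simp add: rip_def)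

text \<open>Differentiate the expectation of \<open>iexp (h + t * g)\<close> at
  \<open>t = 0\<close>, along \<open>t = 1 / (n + 1)\<close>. The difference quotients are bounded
  by the modulus of \<open>g\<close>, which is integrable.\<close>

lemma iexp_mult_integral:
 assumes h: "h \<in> H" and g: "g \<in> H"
 shows "(\<integral>x. iexp (h x) * of_real (g x) \<partial>M) = \<i> * of_real (rip h g * exp (- rip h h / 2))"
proof -
 note [measurable] = H_measurable[OF h] H_measurable[OF g]
 define t where "t n = 1 / real (Suc n)" for n
 have t0: "t n ~= 0" for n by (simp add: t_def)
 have t: "t \<longlonglongrightarrow> 0" unfolding t_def by (rule LIMSEQ_Suc[OF lim_1_over_n])
 have tat: "filterlim t (at 0) sequentially"
 using t t0 by (simp add: filterlim_at)
 define D where "D n x = (iexp (h x + t n * g x) - iexp (h x)) / (\<i> * of_real (t n))" for n x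
 have Dx: "D n x = iexp (h x) * ((iexp (t n * g x) - 1) / (\<i> * of_real (t n)))" for n x
 by (simp add: D_def distrib_left exp_add algebra_simps diff_divide_distrib)
 have lim: "(%n. D n x) \<longlonglongrightarrow> iexp (h x) * of_real (g x)" for x
 proof (cases "g x = 0")
 case False
 let ?z = "%n. \<i> * of_real (t n * g x)"
 have "?z \<longlonglongrightarrow> \<i> * of_real (0 * g x)" by (intro tendsto_intros t)
 then have "filterlim ?z (at 0) sequentially" using t0 False by (simp add: filterlim_at)
 then have "(%n. (exp (?z n) - 1) / ?z n) \<longlonglongrightarrow> 1"
  by (rule filterlim_compose[OF lim_exp_minus_1])
 then have "(%n. iexp (h x) * (of_real (g x) * ((exp (?z n) - 1) / ?z n))) \<longlonglongrightarrow> iexp (h x) * (of_real (g x) * 1)"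
  by (intro tendsto_mult tendsto_const)
 moreover have "iexp (h x) * (of_real (g x) * ((exp (?z n) - 1) / ?z n)) = D n x" for n
  using False t0[of n] by (simp add: Dx)
 ultimately show ?thesis by (simp only: mult_1_right)
 qed (simp add: Dx)
 have "(%n. \<integral>x. D n x \<partial>M) \<longlonglongrightarrow> (\<integral>x. iexp (h x) * of_real (g x) \<partial>M)"
 proof (rule integral_dominated_convergence[where w="%x. \<bar>g x\<bar>"])
 show "AE x in M. norm (D n x) \<le> \<bar>g x\<bar>" for n
 proof (rule AE_I2)
  fix x
  have "cmod (iexp (t n * g x) - 1) \<le> \<bar>t n * g x\<bar>"
  using iexp_approx1[of "t n * g x" 0] by simp
  then show "norm (D n x) \<le> \<bar>g x\<bar>"
  using t0[of n] by (simp add: Dx norm_mult norm_divide abs_mult divide_le_eq mult.commute)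
 qed
 show "(%x. iexp (h x) * of_real (g x)) \<in> borel_measurable M" by measurable
 show "D n \<in> borel_measurable M" for n unfolding D_def by measurable
 qed (use lim H_integrable[OF g] in auto)
 moreover have "(\<integral>x. D n x \<partial>M) = of_real ((exp (- (rip h h + 2 * t n * rip h g + (t n)\<^sup>2 * rip g g) / 2)
  - exp (- rip h h / 2)) / t n) / \<i>" for n
 proof -
 have k: "(%x. h x + t n * g x) \<in> H" by (intro H_add H_scale h g)
 have i: "integrable M (%x. iexp (h x + t n * g x))" "integrable M (%x. iexp (h x))"
  by (rule integrable_const_bound[of _ 1]; auto)+
 have "(\<integral>x. D n x \<partial>M) = ((\<integral>x. iexp (h x + t n * g x) \<partial>M) - (\<integral>x. iexp (h x) \<partial>M)) / (\<i> * of_real (t n))"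
  using i by (simp add: D_def)
 then show ?thesis unfolding iexp_integral[OF k] iexp_integral[OF h] rip_linear[OF h g]
  by (simp only: of_real_diff of_real_divide divide_divide_eq_left mult.commute[of \<i>])
 qed
 moreover have "(%n. of_real ((exp (- (rip h h + 2 * t n * rip h g + (t n)\<^sup>2 * rip g g) / 2)
  - exp (- rip h h / 2)) / t n) / \<i>) \<longlonglongrightarrow> of_real (- (rip h g * exp (- rip h h / 2))) / \<i>"
 proof (intro tendsto_divide tendsto_of_real tendsto_const)
 define \<phi> where "\<phi> y = exp (- (rip h h + 2 * y * rip h g + y\<^sup>2 * rip g g) / 2)" for y
 have "DERIV \<phi> 0 :> - (rip h g * exp (- rip h h / 2))"
  unfolding \<phi>_def by (rule derivative_eq_intros refl | simp)+
 then have "((%y. (\<phi> (0 + y) - \<phi> 0) / y) \<longlongrightarrow> - (rip h g * exp (- rip h h / 2))) (at 0)"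
  by (simp add: DERIV_def)
 from filterlim_compose[OF this tat]
 show "(%n. (exp (- (rip h h + 2 * t n * rip h g + (t n)\<^sup>2 * rip g g) / 2) - exp (- rip h h / 2)) / t n)
  \<longlonglongrightarrow> - (rip h g * exp (- rip h h / 2))" by (simp add: \<phi>_def)
 qed auto
 ultimately have "(\<integral>x. iexp (h x) * of_real (g x) \<partial>M) = of_real (- (rip h g * exp (- rip h h / 2))) / \<i>"
 using LIMSEQ_unique by simp
 then show ?thesis by (simp add: complex_eq_iff)
qed

text \<open>The exponential vector of \<open>\<i> * h\<close>, normalised so that inner products
  become \<open>exp (rip h g)\<close>. Its chaos components are the normalised Wick powers of
  \<open>\<i> * h\<close>; \<open>wick\<close> drops those of order 0 and 1.\<close>

definition gexp :: "('a => real) => 'a => complex" where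
 "gexp h x = iexp (h x) * of_real (exp (rip h h / 2))"

definition wick :: "('a => real) => 'a => complex" where
 "wick h = (%x. gexp h x - 1 - \<i> * cx h x)"

lemma gexp_L2: "h \<in> H ==> gexp h \<in> L2 M"
 using H_measurable[of h]
 by (intro L2_bound[where g="%_. (exp (rip h h / 2))\<^sup>2"]) (auto simp: gexp_def[abs_def] norm_mult)

lemma gexp_zero: "gexp (%_. 0) = (%_. 1)"
 by (rule ext) (simp add: gexp_def rip_def)

lemma gexp_inner:
 assumes h: "h \<in> H" and g: "g \<in> H"
 shows "L2_inner M (gexp h) (gexp g) = exp (of_real (rip h g))"
proof -
 have k: "(%x. h x + - 1 * g x) \<in> H" by (intro H_add H_scale h g)
 have "gexp h x * cnj (gexp g x) = iexp (h x + - 1 * g x) * of_real (exp (rip h h / 2) * exp (rip g g / 2))" for x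
 proof -
 have "iexp (h x) * cnj (iexp (g x)) = iexp (h x + - 1 * g x)"
  by (simp add: exp_cnj exp_add[symmetric] algebra_simps)
 moreover have "gexp h x * cnj (gexp g x) = (iexp (h x) * cnj (iexp (g x))) * of_real (exp (rip h h / 2) * exp (rip g g / 2))"
  by (simp add: gexp_def mult_ac)
 ultimately show ?thesis by simp
 qed
 then have "L2_inner M (gexp h) (gexp g)
  = (\<integral>x. iexp (h x + - 1 * g x) \<partial>M) * of_real (exp (rip h h / 2) * exp (rip g g / 2))"
 unfolding L2_inner_def by simp
 also have "\<dots> = of_real (exp (- (rip h h + 2 * (-1) * rip h g + (-1)\<^sup>2 * rip g g) / 2) * (exp (rip h h / 2) * exp (rip g g / 2)))"
 unfolding iexp_integral[OF k] rip_linear[OF h g] by simp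
 also have "exp (- (rip h h + 2 * (-1) * rip h g + (-1)\<^sup>2 * rip g g) / 2) * (exp (rip h h / 2) * exp (rip g g / 2)) = exp (rip h g)"
 unfolding exp_add[symmetric] by (simp add: field_simps)
 finally show ?thesis by (simp add: exp_of_real)
qed

lemma gexp_cx_inner:
 assumes h: "h \<in> H" and g: "g \<in> H"
 shows "L2_inner M (gexp h) (cx g) = \<i> * of_real (rip h g)"
proof -
 have "gexp h x * cnj (cx g x) = of_real (exp (rip h h / 2)) * (iexp (h x) * of_real (g x))" for x
 by (simp add: gexp_def cx_def)
 then have "L2_inner M (gexp h) (cx g) = of_real (exp (rip h h / 2)) * (\<integral>x. iexp (h x) * of_real (g x) \<partial>M)"
 unfolding L2_inner_def by simp
 also have "\<dots> = \<i> * of_real (rip h g * (exp (rip h h / 2) * exp (- rip h h / 2)))"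
 by (simp add: iexp_mult_integral[OF h g])
 finally show ?thesis by (simp add: exp_add[symmetric])
qed

lemma cx_gexp_inner:
 assumes h: "h \<in> H" and g: "g \<in> H"
 shows "L2_inner M (cx g) (gexp h) = - \<i> * of_real (rip h g)"
 by (subst L2_inner_commute) (simp add: gexp_cx_inner[OF h g])

lemma wick_L2: "h \<in> H ==> wick h \<in> L2 M"
 unfolding wick_def by (intro L2_diff gexp_L2 one_L2 L2_scale cx_L2)

lemma one_inner:
 assumes "h \<in> H"
 shows "L2_inner M (%_. 1) (gexp h) = 1" "L2_inner M (gexp h) (%_. 1) = 1"
 "L2_inner M (%_. 1) (cx h) = 0" "L2_inner M (cx h) (%_. 1) = 0" "L2_inner M (%_. 1) (%_. 1) = 1"
 using gexp_inner[OF H_zero assms] gexp_inner[OF assms H_zero] gexp_cx_inner[OF H_zero assms]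
 cx_gexp_inner[OF H_zero assms] gexp_inner[OF H_zero H_zero]
 by (simp_all add: gexp_zero rip_def)

text \<open>The correlation is the exponential series from the quadratic term on. Through it the
  spectral measures of all chaoses of order at least 2 enter as a single sum of convolution
  powers.\<close>

lemma wick_inner:
 assumes h: "h \<in> H" and g: "g \<in> H"
 shows "L2_inner M (wick h) (wick g) = exp (of_real (rip h g)) - 1 - of_real (rip h g)"
 "L2_inner M (wick h) (%_. 1) = 0" "L2_inner M (wick h) (cx g) = 0"
proof -
 note L = gexp_L2[OF h] gexp_L2[OF g] cx_L2[OF h] cx_L2[OF g] one_L2[of 1] L2_scale[OF cx_L2[OF h], of \<i>]
 L2_scale[OF cx_L2[OF g], of \<i>] wick_L2[OF h] L2_diff[OF gexp_L2[OF h] one_L2[of 1]] L2_diff[OF gexp_L2[OF g] one_L2[of 1]]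
 have w: "L2_inner M (wick h) k = L2_inner M (gexp h) k - L2_inner M (%_. 1) k - \<i> * L2_inner M (cx h) k"
 if "k \<in> L2 M" for k
 unfolding wick_def using L that by (simp add: L2_inner_diff_left L2_inner_scale_left)
 show 1: "L2_inner M (wick h) (%_. 1) = 0" using L by (simp add: w one_inner[OF h])
 show 2: "L2_inner M (wick h) (cx g) = 0"
 using L by (simp add: w one_inner[OF g] gexp_cx_inner[OF h g] cx_inner)
 have "L2_inner M (wick h) (gexp g) = exp (of_real (rip h g)) - 1 - of_real (rip h g)"
 using L by (simp add: w one_inner[OF g] gexp_inner[OF h g] cx_gexp_inner[OF g h] rip_commute[of g h])
 then have "L2_inner M (wick h) (%x. gexp g x - 1 - \<i> * cx g x) = exp (of_real (rip h g)) - 1 - of_real (rip h g)"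
 using L 1 2 by (simp add: L2_inner_diff_right L2_inner_scale_right)
 then show "L2_inner M (wick h) (wick g) = exp (of_real (rip h g)) - 1 - of_real (rip h g)"
 by (simp add: wick_def[of g])
qed

text \<open>\<open>H\<close> contains \<open>- h\<close> with \<open>h\<close>, so orthogonality of
  \<open>f\<close> to all exponentials passes to the conjugate of \<open>f\<close> and thus to its
  real and imaginary parts, to which the real statement applies.\<close>

lemma gexp_total:
 assumes gen: "generates_mod_null M H" and f: "f \<in> L2 M"
 and 0: "!!h. h \<in> H ==> L2_inner M f (gexp h) = 0"
 shows "AE x in M. f x = 0"
proof -
 have fi: "integrable M f" using L2_integrable_mult[OF f one_L2[of 1]] by simp
 have fie: "integrable M (%x. f x * iexp (h x))" if "h \<in> H" for h
 proof (rule Bochner_Integration.integrable_bound[OF fi])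
 have [measurable]: "h \<in> borel_measurable M" "f \<in> borel_measurable M" using H_measurable that fi by auto
 show "(%x. f x * iexp (h x)) \<in> borel_measurable M" by measurable
 qed (simp add: norm_mult)
 have m: "(%x. - 1 * h x) \<in> H" if "h \<in> H" for h using H_scale[OF that] .
 have 1: "(\<integral>x. f x * iexp (h x) \<partial>M) = 0" if h: "h \<in> H" for h
 proof -
 have eq: "f x * cnj (gexp (%x. - 1 * h x) x) = of_real (exp (rip (%x. - 1 * h x) (%x. - 1 * h x) / 2)) * (f x * iexp (h x))" for x
  by (simp add: gexp_def exp_cnj)
 have "L2_inner M f (gexp (%x. - 1 * h x))
  = of_real (exp (rip (%x. - 1 * h x) (%x. - 1 * h x) / 2)) * (\<integral>x. f x * iexp (h x) \<partial>M)"
  unfolding L2_inner_def eq by (rule integral_mult_right_zero)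
 then show ?thesis using 0[OF m[OF h]] by simp
 qed
 have 2: "(\<integral>x. cnj (f x) * iexp (h x) \<partial>M) = 0" if h: "h \<in> H" for h
 proof -
 have "cnj (f x) * iexp (h x) = cnj (f x * iexp (- 1 * h x))" for x by (simp add: exp_cnj)
 then have "(\<integral>x. cnj (f x) * iexp (h x) \<partial>M) = cnj (\<integral>x. f x * iexp (- 1 * h x) \<partial>M)"
  by (simp only: Bochner_Integration.integral_cnj)
 then show ?thesis using 1[OF m[OF h]] by simp
 qed
 have ci: "integrable M (%x. cnj (f x) * iexp (h x))" if h: "h \<in> H" for h
 proof -
 have "cnj (f x) * iexp (h x) = cnj (f x * iexp (- 1 * h x))" for x by (simp add: exp_cnj)
 then show ?thesis using fie[OF m[OF h]] by (simp only: integrable_cnj)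
 qed
 have re: "of_real (Re (f x)) * y = (f x * y + cnj (f x) * y) / 2"
 "of_real (Im (f x)) * y = (f x * y - cnj (f x) * y) / (2 * \<i>)" for x y
 by (simp_all add: complex_eq_iff Re_divide Im_divide power2_eq_square)
 have "AE x in M. Re (f x) = 0"
 by (rule real_orthogonal_imp_zero[OF finite_measure_axioms _ _ gen])
  (use fi fie ci 1 2 in \<open>simp_all add: re\<close>)
 moreover have "AE x in M. Im (f x) = 0"
 by (rule real_orthogonal_imp_zero[OF finite_measure_axioms _ _ gen])
  (use fi fie ci 1 2 in \<open>simp_all add: re\<close>)
 ultimately show ?thesis by eventually_elim (simp add: complex_eq_iff)
qed

lemma gexp_tendsto:
 assumes d: "!!n. d n \<in> H" and h: "h \<in> H" and lim: "l2lim M (%n. cx (d n)) (cx h)"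
 shows "l2lim M (%n. gexp (d n)) (gexp h)"
proof -
 have "(%n. L2_inner M (cx (d n)) (cx h)) \<longlonglongrightarrow> L2_inner M (cx h) (cx h)"
 by (intro L2_inner_tendsto cx_L2 d h lim)
 then have "(%n. Re (L2_inner M (cx (d n)) (cx h))) \<longlonglongrightarrow> Re (L2_inner M (cx h) (cx h))" by (rule tendsto_Re)
 then have 1: "(%n. rip (d n) h) \<longlonglongrightarrow> rip h h" by (simp add: cx_inner)
 have "(%n. l2sq M (cx (d n))) \<longlonglongrightarrow> l2sq M (cx h)"
 by (intro l2lim_norm cx_L2 d h lim)
 then have 2: "(%n. rip (d n) (d n)) \<longlonglongrightarrow> rip h h" by (simp add: l2sq_inner cx_inner)
 have "(%n. exp (rip (d n) (d n)) + exp (rip h h) - 2 * exp (rip (d n) h)) \<longlonglongrightarrow> exp (rip h h) + exp (rip h h) - 2 * exp (rip h h)"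
 by (intro tendsto_intros 1 2)
 moreover have "l2sq M (%x. gexp (d n) x - gexp h x) = exp (rip (d n) (d n)) + exp (rip h h) - 2 * exp (rip (d n) h)" for n
 using d h by (simp add: l2sq_diff gexp_L2) (simp add: l2sq_inner gexp_inner exp_of_real)
 ultimately show ?thesis by simp
qed

text \<open>Exponential vectors depend continuously on \<open>h\<close>, so a dense subset of
  \<open>H\<close> suffices. A countable one is wanted because the cyclic decomposition starts from
  a sequence of vectors.\<close>

lemma gexp_total_dense:
 assumes gen: "generates_mod_null M H" and f: "f \<in> L2 M"
 and D: "D \<subseteq> H" "!!h. h \<in> H ==> \<exists>d. (\<forall>n. d n \<in> D) & l2lim M (%n. cx (d n)) (cx h)"
 and 0: "!!h. h \<in> D ==> L2_inner M f (gexp h) = 0"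
 shows "AE x in M. f x = 0"
proof (rule gexp_total[OF gen f])
 fix h assume h: "h \<in> H"
 then obtain d where d: "!!n. d n \<in> D" "l2lim M (%n. cx (d n)) (cx h)" using D by blast
 have dH: "d n \<in> H" for n using d D by auto
 have "(%n. L2_inner M f (gexp (d n))) \<longlonglongrightarrow> L2_inner M f (gexp h)"
 by (intro L2_inner_tendsto2 gexp_L2 dH h f gexp_tendsto d)
 then show "L2_inner M f (gexp h) = 0" using 0[OF d(1)] by (simp add: LIMSEQ_const_iff)
qed

end

section \<open>Measure-preserving maps and the Koopman group\<close>

definition mpres :: "'a measure => ('a => 'a) => bool" where
 "mpres M T \<longleftrightarrow> T \<in> M \<rightarrow>\<^sub>M M & distr M M T = M"

lemma mpres_AE:
 assumes T: "mpres M T" and Q: "AE x in M. Q x" shows "AE x in M. Q (T x)"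
proof -
 have m: "T \<in> M \<rightarrow>\<^sub>M M" and d: "distr M M T = M" using T by (auto simp: mpres_def)
 have "AE x in distr M M T. Q x" unfolding d by (rule Q)
 then show ?thesis by (rule AE_distrD[OF m])
qed

lemma mpres_id: "mpres M (%x. x)"
 by (simp add: mpres_def)

lemma mpres_comp:
 assumes "mpres M T" "mpres M S" shows "mpres M (%x. T (S x))"
proof -
 have "distr (distr M M S) M T = distr M M (T \<circ> S)"
 using assms by (intro distr_distr) (auto simp: mpres_def)
 then show ?thesis using assms by (auto simp: mpres_def comp_def)
qed

lemma mpres_funpow: "mpres M T ==> mpres M (T ^^ n)"
proof (induction n)
 case 0 then show ?case using mpres_id by (simp add: id_def)
next
 case (Suc n) then show ?case using mpres_comp[of M T "T ^^ n"] by (simp add: comp_def)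
qed

lemma mpres_inverse:
 assumes T: "mpres M T" and S: "S \<in> M \<rightarrow>\<^sub>M M" and inv: "AE x in M. S (T x) = x"
 shows "mpres M S"
proof -
 have m: "T \<in> M \<rightarrow>\<^sub>M M" and d: "distr M M T = M" using T by (auto simp: mpres_def)
 have "distr M M S = distr (distr M M T) M S" by (simp add: d)
 also have "\<dots> = distr M M (S \<circ> T)" using S m by (rule distr_distr)
 also have "\<dots> = distr M M (%x. x)"
 by (rule distr_cong_AE) (use inv S m in \<open>auto simp: comp_def intro: measurable_compose\<close>)
 finally show ?thesis using S by (simp add: mpres_def)
qed

lemma mpres_integral:
 fixes f :: "'a => 'b::{banach, second_countable_topology}"
 assumes T: "mpres M T" and f: "f \<in> borel_measurable M"
 shows "(\<integral>x. f (T x) \<partial>M) = (\<integral>x. f x \<partial>M)"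
proof -
 have m: "T \<in> M \<rightarrow>\<^sub>M M" and d: "distr M M T = M" using T by (auto simp: mpres_def)
 show ?thesis using integral_distr[OF m f] unfolding d by simp
qed

lemma mpres_L2:
 fixes f :: "'a => 'b::real_normed_vector"
 assumes T: "mpres M T" and f: "f \<in> L2 M"
 shows "(%x. f (T x)) \<in> L2 M"
proof -
 have m: "T \<in> M \<rightarrow>\<^sub>M M" and d: "distr M M T = M" using T by (auto simp: mpres_def)
 have fm: "f \<in> borel_measurable M" using f by (simp add: L2_def)
 have "(%x. f (T x)) \<in> borel_measurable M" by (rule measurable_compose[OF m fm])
 moreover have "integrable M (%x. (norm (f (T x)))\<^sup>2)"
 using integrable_distr_eq[OF m, of "%x. (norm (f x))\<^sup>2"] f fm unfolding d by (simp add: L2_def)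
 ultimately show ?thesis by (simp add: L2_def)
qed

lemma mpres_inner:
 assumes T: "mpres M T" and f: "f \<in> L2 M" "g \<in> L2 M"
 shows "L2_inner M (%x. f (T x)) (%x. g (T x)) = L2_inner M f g"
 unfolding L2_inner_def
 by (rule mpres_integral[OF T borel_measurable_integrable[OF L2_inner_integrable[OF f]]])

locale invertible_mpres =
 fixes M :: "'a measure" and T S :: "'a => 'a"
 assumes M: "prob_space M" and T: "mpres M T" and S: "S \<in> M \<rightarrow>\<^sub>M M"
 and ST: "AE x in M. S (T x) = x" and TS: "AE x in M. T (S x) = x"
begin

lemma mS: "mpres M S" using mpres_inverse[OF T S ST] .

text \<open>Negative iterates use an inverse that is valid only almost everywhere, so
  \<open>tau\<close> is a group action up to null sets.\<close>

definition tau :: "int => 'a => 'a" where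
 "tau n = (if 0 \<le> n then T ^^ nat n else S ^^ nat (- n))"

lemma tau_mpres: "mpres M (tau n)"
 unfolding tau_def using mpres_funpow[OF T] mpres_funpow[OF mS] by simp

lemma tau_T: "AE x in M. tau k (T x) = tau (k + 1) x"
proof (cases "0 \<le> k")
 case True
 then have "nat (k + 1) = Suc (nat k)" by simp
 then show ?thesis using True by (simp add: tau_def funpow_swap1)
next
 case False
 define j where "j = nat (- k) - 1"
 have j: "nat (- k) = Suc j" "k + 1 = - int j" using False by (auto simp: j_def)
 have e1: "tau k (T x) = (S ^^ j) (S (T x))" for x
 using False j by (simp add: tau_def funpow_swap1)
 have e2: "tau (k + 1) x = (S ^^ j) x" for x unfolding j by (cases "j = 0") (auto simp: tau_def)
 show ?thesis unfolding e1 e2 using ST by eventually_elim simp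
qed

lemma tau_S: "AE x in M. tau k (S x) = tau (k - 1) x"
proof (cases "k \<le> 0")
 case True
 then have "nat (- (k - 1)) = Suc (nat (- k))" by simp
 moreover have "tau k x = (S ^^ nat (- k)) x" for x using True by (cases "k = 0") (auto simp: tau_def)
 ultimately show ?thesis using True by (simp add: tau_def funpow_swap1)
next
 case False
 define j where "j = nat k - 1"
 have j: "nat k = Suc j" "k - 1 = int j" using False by (auto simp: j_def)
 have e1: "tau k (S x) = (T ^^ j) (T (S x))" for x
 using False j by (simp add: tau_def funpow_swap1)
 have e2: "tau (k - 1) x = (T ^^ j) x" for x unfolding j by (auto simp: tau_def)
 show ?thesis unfolding e1 e2 using TS by eventually_elim simp
qed

lemma tau_T_pow: "AE x in M. tau k ((T ^^ n) x) = tau (k + int n) x"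
proof (induction n arbitrary: k)
 case (Suc n)
 have "AE x in M. tau k (T ((T ^^ n) x)) = tau (k + 1) ((T ^^ n) x)"
 by (rule mpres_AE[OF mpres_funpow[OF T] tau_T])
 with Suc[of "k + 1"] show ?case by eventually_elim (simp add: add_ac)
qed simp

lemma tau_S_pow: "AE x in M. tau k ((S ^^ n) x) = tau (k - int n) x"
proof (induction n arbitrary: k)
 case (Suc n)
 have "AE x in M. tau k (S ((S ^^ n) x)) = tau (k - 1) ((S ^^ n) x)"
 by (rule mpres_AE[OF mpres_funpow[OF mS] tau_S])
 with Suc[of "k - 1"] show ?case by eventually_elim (simp add: algebra_simps)
qed simp

lemma tau_add: "AE x in M. tau k (tau n x) = tau (n + k) x"
proof (cases "0 \<le> n")
 case True then show ?thesis using tau_T_pow[of k "nat n"] by (simp add: tau_def[of n] add.commute)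
next
 case False then show ?thesis using tau_S_pow[of k "nat (- n)"] by (simp add: tau_def[of n] add.commute)
qed

definition P :: "int => ('a => complex) => 'a => complex" where
 "P n f = (%x. f (tau n x))"

lemma csub_L2_orth: "csub M (L2_orth_constants M)"
proof -
 interpret prob_space M by (rule M)
 have c: "(%_. c) \<in> L2 M" for c :: complex by (simp add: L2_def)
 have sc: "L2_inner M f (%_. c) = cnj c * L2_inner M f (%_. 1)" for f c
 using L2_inner_scale_right[of M f c "%_. 1"] by simp
 have "(\<forall>c. L2_inner M f (%_. c) = 0) \<longleftrightarrow> L2_inner M f (%_. 1) = 0" for f
 proof
 assume "L2_inner M f (%_. 1) = 0"
 then show "\<forall>c. L2_inner M f (%_. c) = 0" by (intro allI) (subst sc, simp)
 qed blast
 then have "L2_orth_constants M = {f \<in> L2 M. L2_inner M f (%_. 1) = 0}"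
 by (simp add: L2_orth_constants_def)
 then show ?thesis using csub_orth[OF c] by simp
qed

sublocale unitary_group M "L2_orth_constants M" P
proof
 interpret prob_space M by (rule M)
 have c: "(%_. c) \<in> L2 M" for c :: complex by (simp add: L2_def)
 show "csub M (L2_orth_constants M)" by (rule csub_L2_orth)
 show "P n f \<in> L2_orth_constants M" if "f \<in> L2_orth_constants M" for n f
 proof -
 have f: "f \<in> L2 M" "!!c. L2_inner M f (%_. c) = 0" using that by (auto simp: L2_orth_constants_def)
 have "L2_inner M (P n f) (%_. c) = 0" for c
  using mpres_inner[OF tau_mpres[of n] f(1) c[of c]] f(2) by (simp add: P_def)
 then show ?thesis using mpres_L2[OF tau_mpres f(1)] by (simp add: L2_orth_constants_def P_def)
 qed
 show "P n (%x. f x + g x) = (%x. P n f x + P n g x)" for n f g by (simp add: P_def)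
 show "P n (%x. c * f x) = (%x. c * P n f x)" for n c f by (simp add: P_def)
 show "L2_inner M (P n f) (P n g) = L2_inner M f g"
 if "f \<in> L2_orth_constants M" "g \<in> L2_orth_constants M" for n f g
 unfolding P_def using that by (intro mpres_inner tau_mpres) (auto simp: L2_orth_constants_def)
 show "AE x in M. P n (P k f) x = P (n + k) f x" for n k f
 using tau_add[of k n] by eventually_elim (simp add: P_def)
 show "AE x in M. P 0 f x = f x" for f by (simp add: P_def tau_def)
qed

lemma P_nat: "P (int n) f = (%x. f ((T ^^ n) x))"
 by (simp add: P_def tau_def)

lemma P_1: "P 1 f = koopman T f"
 using P_nat[of 1 f] by (simp add: koopman_def)

end

lemma automorphismE:
 assumes "automorphism M T"
 obtains S where "invertible_mpres M T S"
proof -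
 from assms obtain S where "S \<in> M \<rightarrow>\<^sub>M M" "AE x in M. S (T x) = x" "AE x in M. T (S x) = x"
 unfolding automorphism_def by blast
 moreover have "prob_space M" "mpres M T"
 using assms by (auto simp: automorphism_def standard_probability_space_def mpres_def)
 ultimately show thesis by (intro that[of S] invertible_mpres.intro)
qed

section \<open>The random ternary expansion and its Fourier transform\<close>

text \<open>Two bits per digit: the binomial weights on -1, 0, 1 arise from the uniform distribution
  on four points.\<close>

definition digit :: "bool \<times> bool => real" where
 "digit ab = (if fst ab then 1 / 2 else - 1 / 2) + (if snd ab then 1 / 2 else - 1 / 2)"

abbreviation "bits \<equiv> measure_pmf (pmf_of_set (UNIV :: (bool \<times> bool) set))"

definition expansion :: "(nat => bool \<times> bool) => real" where
 "expansion \<omega> = (\<Sum>i. digit (\<omega> i) / 3 ^ Suc i)"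

definition \<xi> :: "real measure" where
 "\<xi> = distr (\<Pi>\<^sub>M i\<in>(UNIV::nat set). bits) borel expansion"

interpretation seq: sequence_space bits ..

lemma digit_bound: "\<bar>digit ab\<bar> \<le> 1"
 by (auto simp: digit_def)

lemma expansion_summable: "summable (%i. digit (\<omega> i) / 3 ^ Suc i)"
proof (rule summable_comparison_test')
 show "summable (%i. (1 / 3) ^ i * (1 / 3 :: real))" by (intro summable_mult2 summable_geometric) simp
 show "norm (digit (\<omega> i) / 3 ^ Suc i) \<le> (1 / 3) ^ i * (1 / 3)" if "0 \<le> i" for i
 using digit_bound[of "\<omega> i"] by (simp add: power_one_over divide_simps)
qed

lemma expansion_bound: "\<bar>expansion \<omega>\<bar> \<le> 1 / 2"
proof -
 have s: "(%i. (1 / 3) ^ i * (1 / 3 :: real)) sums (1 / (1 - 1 / 3) * (1 / 3))"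
 by (intro sums_mult2 geometric_sums) simp
 have "norm (digit (\<omega> i) / 3 ^ Suc i) \<le> (1 / 3) ^ i * (1 / 3)" for i
 using digit_bound[of "\<omega> i"] by (simp add: power_one_over divide_simps)
 then have "norm (expansion \<omega>) \<le> (\<Sum>i. (1 / 3) ^ i * (1 / 3))"
 unfolding expansion_def by (intro norm_suminf_le sums_summable[OF s])
 then show ?thesis using sums_unique[OF s] by simp
qed

lemma expansion_case_nat: "expansion (case_nat ab \<omega>) = (digit ab + expansion \<omega>) / 3"
proof -
 have "expansion (case_nat ab \<omega>) = (\<Sum>i. digit (case_nat ab \<omega> (Suc i)) / 3 ^ Suc (Suc i)) + digit ab / 3"
 unfolding expansion_def using suminf_split_head[OF expansion_summable[of "case_nat ab \<omega>"]] by simp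
 also have "(\<Sum>i. digit (case_nat ab \<omega> (Suc i)) / 3 ^ Suc (Suc i)) = (\<Sum>i. (digit (\<omega> i) / 3 ^ Suc i) / 3)"
 by (simp add: mult.commute)
 also have "\<dots> = expansion \<omega> / 3"
 unfolding expansion_def by (rule suminf_divide[OF expansion_summable])
 finally show ?thesis by (simp add: add_divide_distrib)
qed

lemma expansion_measurable [measurable]: "expansion \<in> borel_measurable (\<Pi>\<^sub>M i\<in>(UNIV::nat set). bits)"
proof -
 have [measurable]: "digit \<in> borel_measurable bits" by simp
 have [measurable]: "(%\<omega>. digit (\<omega> i)) \<in> borel_measurable (\<Pi>\<^sub>M i\<in>(UNIV::nat set). bits)" for i
 by (rule measurable_compose[OF measurable_component_singleton]) auto
 show ?thesis unfolding expansion_def by measurable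
qed

interpretation \<xi>: real_distribution \<xi>
 unfolding \<xi>_def by (intro seq.real_distribution_distr expansion_measurable)

text \<open>Self-similarity: the law of a sequence is that of an independent head and tail, and
  dropping the first digit leaves an expansion with the same law. The two bit pairs with digit 0
  account for the factor 2.\<close>

lemma \<xi>_step:
 fixes g :: "real => complex"
 assumes [measurable]: "g \<in> borel_measurable borel" and B: "!!x. norm (g x) \<le> B"
 shows "(\<integral>x. g x \<partial>\<xi>) = ((\<integral>y. g ((1 + y) / 3) \<partial>\<xi>) + 2 * (\<integral>y. g (y / 3) \<partial>\<xi>) + (\<integral>y. g ((- 1 + y) / 3) \<partial>\<xi>)) / 4"
proof -
 interpret pp: pair_prob_space bits seq.S ..
 define G where "G s = (\<integral>y. g ((digit s + y) / 3) \<partial>\<xi>)" for s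
 have m: "(%p. g ((digit (fst p) + expansion (snd p)) / 3)) \<in> borel_measurable (bits \<Otimes>\<^sub>M seq.S)"
 proof -
 have [measurable]: "digit \<in> borel_measurable bits" by simp
 show ?thesis by measurable
 qed
 have cm: "(%(s, \<omega>). case_nat s \<omega>) \<in> bits \<Otimes>\<^sub>M seq.S \<rightarrow>\<^sub>M seq.S"
 unfolding split_beta' by (intro measurable_case_nat') measurable
 have "(\<integral>x. g x \<partial>\<xi>) = (\<integral>\<omega>. g (expansion \<omega>) \<partial>seq.S)"
 unfolding \<xi>_def by (subst integral_distr) auto
 also have "\<dots> = (\<integral>\<omega>. g (expansion \<omega>) \<partial>distr (bits \<Otimes>\<^sub>M seq.S) seq.S (%(s, \<omega>). case_nat s \<omega>))"
 unfolding seq.PiM_iter ..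
 also have "\<dots> = (\<integral>p. g ((digit (fst p) + expansion (snd p)) / 3) \<partial>(bits \<Otimes>\<^sub>M seq.S))"
 by (subst integral_distr[OF cm]) (auto simp: split_beta' expansion_case_nat)
 also have "\<dots> = (\<integral>s. (\<integral>\<omega>. g ((digit s + expansion \<omega>) / 3) \<partial>seq.S) \<partial>bits)"
 using pp.integral_fst'[of "%p. g ((digit (fst p) + expansion (snd p)) / 3)"] m
 by (simp add: pp.P.integrable_const_bound[of _ B] B)
 also have "\<dots> = (\<integral>s. G s \<partial>bits)"
 unfolding G_def \<xi>_def by (subst integral_distr) auto
 also have "\<dots> = (\<Sum>s\<in>UNIV. G s) / 4"
 proof -
 have "card (UNIV :: (bool \<times> bool) set) = 4"
  by (simp only: UNIV_Times_UNIV[symmetric] card_cartesian_product) simp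
 then have "pmf (pmf_of_set UNIV) s = 1 / 4" for s :: "bool \<times> bool" by simp
 then show ?thesis
  by (subst integral_measure_pmf[of UNIV]) (auto simp: scaleR_conv_of_real sum_divide_distrib)
 qed
 also have "(\<Sum>s\<in>UNIV. G s) = G (True, True) + G (True, False) + G (False, True) + G (False, False)"
 by (simp add: UNIV_Times_UNIV[symmetric] UNIV_bool sum.cartesian_product[symmetric] del: UNIV_Times_UNIV)
 finally show ?thesis by (simp add: G_def digit_def algebra_simps)
qed

lemma \<xi>_AE_bound: "AE x in \<xi>. \<bar>x\<bar> \<le> 1 / 2"
proof -
 have "AE \<omega> in (\<Pi>\<^sub>M i\<in>(UNIV::nat set). bits). \<bar>expansion \<omega>\<bar> \<le> 1 / 2"
 by (intro AE_I2 expansion_bound)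
 then show ?thesis unfolding \<xi>_def by (subst AE_distr_iff) auto
qed

lemma \<xi>_step_measure:
 assumes A: "A \<in> sets borel"
 shows "measure \<xi> A = (measure \<xi> {y. (1 + y) / 3 \<in> A} + 2 * measure \<xi> {y. y / 3 \<in> A} + measure \<xi> {y. (- 1 + y) / 3 \<in> A}) / 4"
proof -
 note [measurable] = A
 have s: "{y. (c + y) / 3 \<in> A} \<in> sets borel" for c :: real
 proof -
 have "{y \<in> space borel. (c + y) / 3 \<in> A} \<in> sets borel" by measurable
 then show ?thesis by simp
 qed
 have i: "(\<integral>y. indicator A ((c + y) / 3) \<partial>\<xi>) = complex_of_real (measure \<xi> {y. (c + y) / 3 \<in> A})" for c
 proof -
 have "(\<integral>y. indicator A ((c + y) / 3) \<partial>\<xi>) = (\<integral>y. complex_of_real (indicator {y. (c + y) / 3 \<in> A} y) \<partial>\<xi>)"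
  by (intro Bochner_Integration.integral_cong) (auto simp: indicator_def)
 then show ?thesis using s[of c] by simp
 qed
 have 0: "(\<integral>y. indicator A y \<partial>\<xi>) = complex_of_real (measure \<xi> A)"
 proof -
 have "(\<integral>y. indicator A y \<partial>\<xi>) = (\<integral>y. complex_of_real (indicator A y) \<partial>\<xi>)"
  by (intro Bochner_Integration.integral_cong) (auto simp: indicator_def)
 then show ?thesis using A by simp
 qed
 have "(\<integral>x. indicator A x \<partial>\<xi>) = ((\<integral>y. indicator A ((1 + y) / 3) \<partial>\<xi>) + 2 * (\<integral>y. indicator A ((0 + y) / 3) \<partial>\<xi>)
 + (\<integral>y. indicator A ((- 1 + y) / 3) \<partial>\<xi>)) / (4 :: complex)"
 using \<xi>_step[of "indicator A" 1] by (simp add: indicator_def)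
 then have "complex_of_real (measure \<xi> A) = of_real ((measure \<xi> {y. (1 + y) / 3 \<in> A} + 2 * measure \<xi> {y. (0 + y) / 3 \<in> A} + measure \<xi> {y. (- 1 + y) / 3 \<in> A}) / 4)"
 unfolding 0 i by simp
 then show ?thesis by (simp only: of_real_eq_iff) simp
qed

text \<open>The supremum \<open>s\<close> of the point masses satisfies \<open>s \<le> 3/4 * s\<close>, as at most two of the three
 branches meet the support.\<close>
lemma \<xi>_no_atom: "measure \<xi> {a} = 0"
proof -
 define s where "s = (SUP a. measure \<xi> {a})"
 have bdd: "bdd_above (range (%a. measure \<xi> {a}))"
 by (intro bdd_aboveI2[of _ _ 1]) simp
 have le: "measure \<xi> {a} \<le> s" for a unfolding s_def by (rule cSUP_upper[OF _ bdd]) simp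
 have s0: "0 \<le> s" using le[of 0] measure_nonneg order_trans by blast
 have out: "measure \<xi> {a} = 0" if "1 / 2 < \<bar>a\<bar>" for a
 proof -
 have "AE x in \<xi>. x \<notin> {a}" using \<xi>_AE_bound by eventually_elim (use that in auto)
 then have "{a} \<in> null_sets \<xi>" using AE_iff_null_sets[of "{a}" \<xi>] by simp
 then show ?thesis by (simp add: measure_def null_setsD1)
 qed
 have "measure \<xi> {a} \<le> 3 / 4 * s" for a
 proof -
 have e: "{y::real. (c + y) / 3 \<in> {a}} = {3 * a - c}" for c by auto
 have e0: "{y::real. y / 3 \<in> {a}} = {3 * a}" by auto
 have ab: "{a} \<in> sets borel" by simp
 have m: "measure \<xi> {a} = (measure \<xi> {3 * a - 1} + 2 * measure \<xi> {3 * a} + measure \<xi> {3 * a - (- 1)}) / 4"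
  by (rule \<xi>_step_measure[OF ab, unfolded e e0])
 have "1 / 2 < \<bar>3 * a - 1\<bar> \<or> 1 / 2 < \<bar>3 * a - (- 1)\<bar>" by linarith
 then show ?thesis
 proof
  assume *: "1 / 2 < \<bar>3 * a - 1\<bar>"
  have "(0 + 2 * y + z) / 4 \<le> 3 / 4 * s" if "y \<le> s" "z \<le> s" for y z :: real using that by simp
  then show ?thesis unfolding m out[OF *] using le by blast
 next
  assume *: "1 / 2 < \<bar>3 * a - (- 1)\<bar>"
  have "(z + 2 * y + 0) / 4 \<le> 3 / 4 * s" if "y \<le> s" "z \<le> s" for y z :: real using that by simp
  then show ?thesis unfolding m out[OF *] using le by blast
 qed
 qed
 then have "s \<le> 3 / 4 * s" unfolding s_def by (intro cSUP_least) (auto simp: s_def)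
 then have "s = 0" using s0 by simp
 then show ?thesis using le[of a] measure_nonneg[of \<xi> "{a}"] by linarith
qed

lemma \<xi>_AE_neq: "AE x in \<xi>. x ~= a"
proof -
 have "{a} \<in> null_sets \<xi>" using \<xi>_no_atom[of a] by (auto simp: null_sets_def \<xi>.emeasure_eq_measure)
 from AE_not_in[OF this] show ?thesis by simp
qed

lemma \<xi>_AE_strict: "AE x in \<xi>. \<bar>x\<bar> < 1 / 2"
proof -
 show ?thesis using \<xi>_AE_bound \<xi>_AE_neq[of "1/2"] \<xi>_AE_neq[of "-1/2"] by eventually_elim (auto simp: abs_real_def split: if_splits)
qed

text \<open>The characteristic function of one digit at \<open>2 * pi * t\<close>. The transform
  \<open>F\<close> is the product of \<open>\<phi> (t / 3 ^ j)\<close> over \<open>j >= 1\<close>;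
  only its functional equation \<open>F_step\<close> is used below.\<close>

definition \<phi> :: "real => real" where "\<phi> t = (1 + cos (2 * pi * t)) / 2"
definition F :: "real => complex" where "F t = char \<xi> (2 * pi * t)"

lemma F_step: "F t = of_real (\<phi> (t / 3)) * F (t / 3)"
proof -
 let ?e = "%u x. iexp (2 * pi * u * x)"
 have e: "(\<integral>y. ?e t ((c + y) / 3) \<partial>\<xi>) = iexp (2 * pi * (t / 3) * c) * F (t / 3)" for c
 proof -
 have "?e t ((c + y) / 3) = iexp (2 * pi * (t / 3) * c) * ?e (t / 3) y" for y
  by (simp add: exp_add[symmetric] field_simps)
 then have "(\<integral>y. ?e t ((c + y) / 3) \<partial>\<xi>) = (\<integral>y. iexp (2 * pi * (t / 3) * c) * ?e (t / 3) y \<partial>\<xi>)" by (simp only:)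
 also have "\<dots> = iexp (2 * pi * (t / 3) * c) * (\<integral>y. ?e (t / 3) y \<partial>\<xi>)" by (rule integral_mult_right_zero)
 finally show ?thesis by (simp add: F_def char_def)
 qed
 have e0: "(\<integral>y. ?e t (y / 3) \<partial>\<xi>) = F (t / 3)" by (simp add: F_def char_def)
 have "F t = (\<integral>x. ?e t x \<partial>\<xi>)" by (simp add: F_def char_def)
 also have "\<dots> = ((\<integral>y. ?e t ((1 + y) / 3) \<partial>\<xi>) + 2 * (\<integral>y. ?e t (y / 3) \<partial>\<xi>) + (\<integral>y. ?e t ((- 1 + y) / 3) \<partial>\<xi>)) / 4"
 by (rule \<xi>_step[where B=1]) auto
 also have "\<dots> = (iexp (2 * pi * (t / 3) * 1) + 2 + iexp (2 * pi * (t / 3) * - 1)) / 4 * F (t / 3)"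
 unfolding e e0 by (simp add: distrib_right)
 also have "(iexp (2 * pi * (t / 3) * 1) + 2 + iexp (2 * pi * (t / 3) * - 1)) / 4 = of_real (\<phi> (t / 3))"
 unfolding cis_conv_exp[symmetric] by (simp add: \<phi>_def complex_eq_iff)
 finally show ?thesis .
qed

lemma F_0: "F 0 = 1" by (simp add: F_def \<xi>.char_zero)

lemma F_cont: "isCont F t"
 unfolding F_def[abs_def] by (rule isCont_o2[OF _ \<xi>.isCont_char]) (intro continuous_intros)

lemma F_iter: "F (3 ^ d * t) = of_real (\<Prod>i<d. \<phi> (3 ^ i * t)) * F t"
proof (induction d)
 case (Suc d)
 have "F (3 ^ Suc d * t) = of_real (\<phi> (3 ^ d * t)) * F (3 ^ d * t)"
 using F_step[of "3 ^ Suc d * t"] by simp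
 then show ?case by (simp add: Suc)
qed simp

lemma inverse_power_tendsto: "(%d. 1 / 3 ^ d :: real) \<longlonglongrightarrow> 0"
 using LIMSEQ_power_zero[of "1 / 3 :: real"] by (simp add: power_one_over)

text \<open>The factors are real and bounded by 1 in modulus, so the imaginary part at
  \<open>t\<close> is at most that at \<open>t / 3 ^ d\<close>, which tends to the imaginary part of
  \<open>F 0 = 1\<close>.\<close>

lemma F_real: "Im (F t) = 0"
proof -
 have Feq: "F t = of_real (\<Prod>i<d. \<phi> (3 ^ i * (t / 3 ^ d))) * F (t / 3 ^ d)" for d
 using F_iter[of d "t / 3 ^ d"] by simp
 have imr: "Im (complex_of_real r * z) = r * Im z" for r z by simp
 note eq = arg_cong[OF Feq, of Im, unfolded imr]
 have "(1 + y) / 2 \<le> 1 & - ((1 + y) / 2) \<le> 1" if "y \<le> 1" "- 1 \<le> y" for y :: real using that by auto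
 then have "\<bar>\<phi> u\<bar> \<le> 1" for u unfolding \<phi>_def abs_le_iff using cos_le_one cos_ge_minus_one by blast
 then have "\<bar>\<Prod>i<d. \<phi> (3 ^ i * (t / 3 ^ d))\<bar> \<le> 1" for d
 unfolding abs_prod by (intro prod_le_1) auto
 then have le: "\<bar>Im (F t)\<bar> \<le> \<bar>Im (F (t / 3 ^ d))\<bar>" for d
 unfolding eq[of d] abs_mult using mult_right_mono[of "\<bar>\<Prod>i<d. \<phi> (3 ^ i * (t / 3 ^ d))\<bar>" 1 "\<bar>Im (F (t / 3 ^ d))\<bar>"]
 by simp
 have "(%d. t * (1 / 3 ^ d)) \<longlonglongrightarrow> t * 0" by (intro tendsto_intros inverse_power_tendsto)
 then have "(%d. F (t / 3 ^ d)) \<longlonglongrightarrow> F 0" using isCont_tendsto_compose[OF F_cont[of 0]] by simp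
 then have "(%d. \<bar>Im (F (t / 3 ^ d))\<bar>) \<longlonglongrightarrow> \<bar>Im (F 0)\<bar>" by (intro tendsto_intros)
 then have "\<bar>Im (F t)\<bar> \<le> \<bar>Im (F 0)\<bar>" by (rule LIMSEQ_le_const) (use le in auto)
 then show ?thesis by (simp add: F_0)
qed

definition c1 :: real where "c1 = Re (F 1)"

lemma F_1: "F 1 = of_real c1"
 by (simp add: c1_def complex_eq_iff F_real)

lemma \<xi>_UNIV: "measure \<xi> UNIV = 1"
 using \<xi>.prob_space by simp

text \<open>\<open>F 1\<close> is \<open>\<phi> (1 / 3) = 1 / 4\<close> times
  \<open>F (1 / 3)\<close>. As \<open>|x| <= 1 / 2\<close> almost surely, the cosine integrated for
  \<open>F (1 / 3)\<close> is at least \<open>cos (pi / 3) = 1 / 2\<close>, so \<open>c1\<close>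
  lies between 1/8 and 1/4.\<close>

lemma c1_bounds: "0 < c1" "c1 < 1"
proof -
 have "cos (2 * pi * (1 / 3)) = - (1 / 2 :: real)" using cos_120 by (simp add: mult.commute)
 then have p: "\<phi> (1 / 3) = 1 / 4" by (simp add: \<phi>_def)
 then have c: "c1 = 1 / 4 * Re (F (1 / 3))" using F_step[of 1] by (simp add: c1_def)
 have "Re (F (1 / 3)) = (\<integral>x. Re (iexp (2 * pi * (1 / 3) * x)) \<partial>\<xi>)"
 unfolding F_def char_def by (rule integral_Re[symmetric]) (auto intro: \<xi>.integrable_const_bound[of _ 1])
 then have R: "Re (F (1 / 3)) = (\<integral>x. cos (2 * pi * (1 / 3) * x) \<partial>\<xi>)" by (simp only: cis_conv_exp[symmetric] cis.sel)
 have i: "integrable \<xi> (%x. cos (2 * pi * (1 / 3) * x))" by (rule \<xi>.integrable_const_bound[of _ 1]) auto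
 have "(\<integral>x. 1 / 2 \<partial>\<xi>) \<le> (\<integral>x. cos (2 * pi * (1 / 3) * x) \<partial>\<xi>)"
 proof (rule integral_mono_AE[OF _ i])
 show "AE x in \<xi>. 1 / 2 \<le> cos (2 * pi * (1 / 3) * x)"
  using \<xi>_AE_bound
 proof eventually_elim
  case (elim x)
  have "cos (pi / 3) \<le> cos \<bar>2 * pi * (1 / 3) * x\<bar>"
  proof (rule cos_monotone_0_pi_le)
  have "\<bar>2 * pi * (1 / 3) * x\<bar> = (2 * pi / 3) * \<bar>x\<bar>" by (simp add: abs_mult)
  also have "\<dots> \<le> (2 * pi / 3) * (1 / 2)" using elim by (intro mult_left_mono) auto
  finally show "\<bar>2 * pi * (1 / 3) * x\<bar> \<le> pi / 3" by simp
  qed auto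
  then have "cos (pi / 3) \<le> cos (2 * pi * (1 / 3) * x)" by (simp only: cos_abs_real)
  then show ?case by (simp only: cos_60)
 qed
 qed simp
 then have "1 / 2 \<le> Re (F (1 / 3))" using R by (simp add: \<xi>_UNIV)
 then show "0 < c1" using c by simp
 have "(\<integral>x. cos (2 * pi * (1 / 3) * x) \<partial>\<xi>) \<le> (\<integral>x. 1 \<partial>\<xi>)" by (rule integral_mono[OF i]) auto
 then show "c1 < 1" using c R by (simp add: \<xi>_UNIV)
qed

lemma \<phi>_int: "\<phi> (real_of_int n) = 1"
 by (simp add: \<phi>_def cos_int_2pin)

lemma F_3: "F (3 * real_of_int n) = F (real_of_int n)"
 using F_step[of "3 * real_of_int n"] by (simp add: \<phi>_int)

lemma F_minus: "F (- t) = F t"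
proof -
 have "F (- t) = cnj (F t)"
 proof -
 have "F (- t) = (\<integral>x. cnj (iexp (2 * pi * t * x)) \<partial>\<xi>)" by (simp add: F_def char_def exp_cnj)
 then show ?thesis by (simp only: Bochner_Integration.integral_cnj) (simp add: F_def char_def)
 qed
 then show ?thesis using F_real[of t] by (simp add: complex_eq_iff)
qed

text \<open>Asymptotic decorrelation of \<open>z\<close> and \<open>z ^ 3 ^ d\<close>. Write
  \<open>3 ^ d - 1\<close> and \<open>1\<close> as \<open>3 ^ d\<close> times
  \<open>1 - 1 / 3 ^ d\<close> and \<open>1 / 3 ^ d\<close>. Since \<phi> is even and has period 1,
  the two finite products of \<open>F_iter\<close> coincide, and \<open>F (3 ^ d - 1)\<close> equals
  \<open>F 1 * F (1 - 1 / 3 ^ d) / F (1 / 3 ^ d)\<close>, which tends to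
  \<open>(F 1)^2\<close>.\<close>

lemma F_correlation: "(%d. F (3 ^ d - 1)) \<longlonglongrightarrow> of_real (c1\<^sup>2)"
proof -
 have shift: "\<phi> (3 ^ i * (1 - 1 / 3 ^ d)) = \<phi> (3 ^ i * (1 / 3 ^ d))" for i d
 proof -
 have "cos (2 * pi * (3 ^ i * (1 - 1 / 3 ^ d))) = cos (2 * pi * (3 ^ i * (1 / 3 ^ d)) - 2 * pi * real_of_int (3 ^ i))"
  by (subst cos_minus[symmetric]) (simp add: algebra_simps)
 also have "\<dots> = cos (2 * pi * (3 ^ i * (1 / 3 ^ d)))"
  unfolding cos_diff cos_int_2pin sin_int_2pin by simp
 finally show ?thesis by (simp add: \<phi>_def)
 qed
 have eq: "F (3 ^ d - 1) * F (1 / 3 ^ d) = F 1 * F (1 - 1 / 3 ^ d)" for d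
 proof -
 have "F (3 ^ d - 1) = of_real (\<Prod>i<d. \<phi> (3 ^ i * (1 - 1 / 3 ^ d))) * F (1 - 1 / 3 ^ d)"
  using F_iter[of d "1 - 1 / 3 ^ d"] by (simp add: right_diff_distrib)
 moreover have "F 1 = of_real (\<Prod>i<d. \<phi> (3 ^ i * (1 / 3 ^ d))) * F (1 / 3 ^ d)"
  using F_iter[of d "1 / 3 ^ d"] by simp
 ultimately show ?thesis unfolding shift by simp
 qed
 have l0: "(%d. F (1 / 3 ^ d)) \<longlonglongrightarrow> 1"
 using isCont_tendsto_compose[OF F_cont inverse_power_tendsto] by (simp add: F_0)
 have "(%d. 1 - 1 / 3 ^ d) \<longlonglongrightarrow> (1 - 0 :: real)" by (intro tendsto_intros inverse_power_tendsto)
 then have l1: "(%d. F (1 - 1 / 3 ^ d)) \<longlonglongrightarrow> F 1" using isCont_tendsto_compose[OF F_cont[of 1]] by simp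
 have "(%d. F 1 * F (1 - 1 / 3 ^ d) / F (1 / 3 ^ d)) \<longlonglongrightarrow> F 1 * F 1 / 1"
 by (intro tendsto_intros l0 l1) simp
 moreover have "\<forall>\<^sub>F d in sequentially. F (1 / 3 ^ d) ~= 0"
 using tendsto_imp_eventually_ne[OF l0, of 0] by simp
 then have "\<forall>\<^sub>F d in sequentially. F 1 * F (1 - 1 / 3 ^ d) / F (1 / 3 ^ d) = F (3 ^ d - 1)"
 by eventually_elim (simp add: eq[symmetric])
 ultimately have "(%d. F (3 ^ d - 1)) \<longlonglongrightarrow> F 1 * F 1 / 1" by (rule Lim_transform_eventually)
 then show ?thesis by (simp add: F_1 power2_eq_square)
qed

section \<open>The measure \<sigma> on the circle and the branches of cubing\<close>

definition \<sigma> :: "complex measure" where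
 "\<sigma> = distr \<xi> borel (%x. cis (2 * pi * x))"

lemma cis_measurable [measurable]: "(%x. cis (2 * pi * x)) \<in> borel_measurable borel"
 by (intro borel_measurable_continuous_onI continuous_intros)

lemma \<sigma>_prob: "prob_space \<sigma>"
 unfolding \<sigma>_def by (rule \<xi>.prob_space_distr) simp

lemma \<sigma>_circle: "circle_measure \<sigma>"
proof -
 interpret prob_space \<sigma> by (rule \<sigma>_prob)
 have "AE z in \<sigma>. cmod z = 1" unfolding \<sigma>_def by (subst AE_distr_iff) auto
 moreover have "sets \<sigma> = sets borel" by (simp add: \<sigma>_def)
 ultimately show ?thesis using finite_measure_axioms by (simp add: circle_measure_def)
qed

lemma \<sigma>_Fourier: "(\<integral>z. z powi n \<partial>\<sigma>) = F (real_of_int n)"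
 unfolding \<sigma>_def F_def char_def
 by (subst integral_distr) (auto simp: cis_conv_exp exp_power_int mult_ac)

text \<open>For \<open>z = cis (2 * pi * x)\<close> the three regions say that the first digit of
  \<open>x\<close> is 0, 1 or -1: the borders \<open>x = 1/6\<close> and \<open>x = -1/6\<close> are
  the points with real part 1/2 and nonzero imaginary part. The constants \<open>sqrt 2\<close> and
  \<open>2\<close> are the inverse square roots of the digit weights 1/2 and 1/4.\<close>

definition w :: "int => complex => complex" where
 "w d z = (if d = 0 then indicator {z. 1 / 2 < Re z} z * of_real (sqrt 2)
 else if d = 1 then indicator {z. Re z < 1 / 2 & 0 < Im z} z * 2
 else if d = - 1 then indicator {z. Re z < 1 / 2 & Im z < 0} z * 2 else 0)"

lemma w_measurable [measurable]: "w d \<in> borel_measurable borel"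
 unfolding w_def by (cases "d = 0"; cases "d = 1"; cases "d = -1"; simp)

lemma w_bound: "cmod (w d z) \<le> 2"
proof -
 have "sqrt 2 \<le> 2" by (rule real_le_lsqrt) auto
 then show ?thesis by (simp add: w_def norm_mult split: split_indicator)
qed

lemma w_branch:
 assumes y: "\<bar>y\<bar> < 1 / 2" and d: "d \<in> {-1, 0, 1}" and e: "e \<in> {-1, 0, 1}"
 shows "w e (cis (2 * pi * ((real_of_int d + y) / 3))) = (if e = d then if d = 0 then of_real (sqrt 2) else 2 else 0)"
proof -
 let ?x = "(real_of_int d + y) / 3"
 have x0: "1 / 2 < cos (2 * pi * x)" if "\<bar>x\<bar> < 1 / 6" for x :: real
 proof -
 have "cos (pi / 3) < cos \<bar>2 * pi * x\<bar>"
 proof (rule cos_monotone_0_pi)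
  have "2 * pi * \<bar>x\<bar> < 2 * pi * (1 / 6)" using that by (intro mult_strict_left_mono) auto
  then show "\<bar>2 * pi * x\<bar> < pi / 3" by (simp add: abs_mult)
 qed auto
 then show ?thesis by (simp add: cos_60)
 qed
 have x1: "cos (2 * pi * x) < 1 / 2 & 0 < sin (2 * pi * x)" if "1 / 6 < x" "x < 1 / 2" for x :: real
 proof -
 have "2 * pi * (1 / 6) < 2 * pi * x" "2 * pi * x < 2 * pi * (1 / 2)"
  using that by (auto intro!: mult_strict_left_mono)
 then have a: "pi / 3 < 2 * pi * x" "2 * pi * x < pi" by auto
 have "cos (2 * pi * x) < cos (pi / 3)" using a by (intro cos_monotone_0_pi) auto
 moreover have "0 < sin (2 * pi * x)" using a pi_gt_zero by (intro sin_gt_zero) linarith+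
 ultimately show ?thesis by (simp add: cos_60)
 qed
 consider "d = 0" | "d = 1" | "d = -1" using d by auto
 then show ?thesis
 proof cases
 case 1
 then have "1 / 2 < cos (2 * pi * ?x)" using y by (intro x0) auto
 with 1 e show ?thesis by (auto simp: w_def indicator_def)
 next
 case 2
 then have "cos (2 * pi * ?x) < 1 / 2 & 0 < sin (2 * pi * ?x)" using y by (intro x1) auto
 with 2 e show ?thesis by (auto simp: w_def indicator_def)
 next
 case 3
 then have "cos (2 * pi * (- ?x)) < 1 / 2 & 0 < sin (2 * pi * (- ?x))" using y by (intro x1) auto
 then have "cos (2 * pi * ?x) < 1 / 2 & sin (2 * pi * ?x) < 0" by simp
 with 3 e show ?thesis by (auto simp: w_def indicator_def)
 qed
qed

text \<open>Hence \<open>f z\<close> goes to \<open>w d z * f (z ^ 3)\<close> isometrically on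
  \<open>L2 \<sigma>\<close>, and the three values of \<open>d\<close> give orthogonal ranges. By
  \<open>\<xi>_step\<close> the integral is a weighted sum over branches, and on branch
  \<open>b\<close> both factors vanish unless \<open>d = e = b\<close>.\<close>

lemma w_orthonormal:
 assumes d: "d \<in> {-1, 0, 1}" "e \<in> {-1, 0, 1}"
 and g [measurable]: "g \<in> borel_measurable borel" and B: "!!z. cmod (g z) \<le> B"
 shows "(\<integral>z. w d z * cnj (w e z) * g (z ^ 3) \<partial>\<sigma>) = (if d = e then \<integral>z. g z \<partial>\<sigma> else 0)"
proof -
 let ?W = "%z. w d z * cnj (w e z) * g (z ^ 3)" and ?c = "%x. cis (2 * pi * x)"
 have cm [measurable]: "(%z. cnj (w e z)) \<in> borel_measurable borel"
 by (rule borel_measurable_continuous_on[where f=cnj]) (auto intro: continuous_intros)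
 have [measurable]: "?W \<in> borel_measurable borel" by measurable
 have B0: "0 \<le> B" using B[of 0] norm_ge_zero order_trans by blast
 have Wb: "cmod (?W z) \<le> 2 * 2 * B" for z
 unfolding norm_mult complex_mod_cnj by (intro mult_mono w_bound B mult_nonneg_nonneg) auto
 have branch: "(\<integral>y. ?W (?c ((real_of_int b + y) / 3)) \<partial>\<xi>)
  = (if d = b & e = b then if b = 0 then 2 else 4 else 0) * (\<integral>y. g (?c y) \<partial>\<xi>)" if b: "b \<in> {-1, 0, 1}" for b
 proof -
 have "(\<integral>y. ?W (?c ((real_of_int b + y) / 3)) \<partial>\<xi>)
  = (\<integral>y. (if d = b & e = b then if b = 0 then 2 else 4 else 0) * g (?c y) \<partial>\<xi>)"
 proof (rule integral_cong_AE)
  show "AE y in \<xi>. ?W (?c ((real_of_int b + y) / 3)) = (if d = b & e = b then if b = 0 then 2 else 4 else 0) * g (?c y)"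
  using \<xi>_AE_strict
  proof eventually_elim
  case (elim y)
  have "?c ((real_of_int b + y) / 3) ^ 3 = cis (2 * pi * real_of_int b + 2 * pi * y)"
  proof -
   have "real 3 * (2 * pi * ((real_of_int b + y) / 3)) = 2 * pi * real_of_int b + 2 * pi * y"
   by (simp add: algebra_simps)
   then show ?thesis by (simp only: Complex.DeMoivre)
  qed
  also have "\<dots> = cis (2 * pi * y)" by (simp add: cis_mult[symmetric] cis_multiple_2pi)
  finally have c3: "?c ((real_of_int b + y) / 3) ^ 3 = ?c y" .
  have "complex_of_real (sqrt 2) * complex_of_real (sqrt 2) = 2" by (simp flip: of_real_mult)
  then show ?case unfolding c3 w_branch[OF elim b d(1)] w_branch[OF elim b d(2)] by auto
  qed
 qed measurable
 then show ?thesis by simp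
 qed
 have "(\<integral>z. ?W z \<partial>\<sigma>) = (\<integral>x. ?W (?c x) \<partial>\<xi>)"
 unfolding \<sigma>_def by (subst integral_distr) auto
 also have "\<dots> = ((\<integral>y. ?W (?c ((1 + y) / 3)) \<partial>\<xi>) + 2 * (\<integral>y. ?W (?c (y / 3)) \<partial>\<xi>) + (\<integral>y. ?W (?c ((- 1 + y) / 3)) \<partial>\<xi>)) / 4"
 by (rule \<xi>_step[where B="2 * 2 * B"]) (use Wb in auto)
 also have "\<dots> = (if d = e then \<integral>y. g (?c y) \<partial>\<xi> else 0)"
 using branch[of 1] branch[of 0] branch[of "-1"] d by auto
 also have "(\<integral>y. g (?c y) \<partial>\<xi>) = (\<integral>z. g z \<partial>\<sigma>)" unfolding \<sigma>_def by (subst integral_distr) auto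
 finally show ?thesis .
qed

lemma \<sigma>_no_atom: "emeasure \<sigma> {a} = 0"
proof -
 have "countable {x. cis (2 * pi * x) = a}"
 proof (cases "\<exists>x0. cis (2 * pi * x0) = a")
 case True
 then obtain x0 where x0: "cis (2 * pi * x0) = a" by blast
 have "{x. cis (2 * pi * x) = a} \<subseteq> range (%k::int. x0 + of_int k)"
 proof
  fix x assume "x \<in> {x. cis (2 * pi * x) = a}"
  then have "cis (2 * pi * x) = cis (2 * pi * x0)" using x0 by simp
  then have "cos (2 * pi * x) = cos (2 * pi * x0) & sin (2 * pi * x) = sin (2 * pi * x0)"
  by (simp add: complex_eq_iff)
  then obtain k :: int where "2 * pi * x = 2 * pi * x0 + 2 * pi * of_int k"
  using sin_cos_eq_iff[of "2 * pi * x" "2 * pi * x0"] by (auto simp: mult_ac)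
  then have "2 * pi * x = 2 * pi * (x0 + of_int k)" by (simp add: distrib_left)
  then show "x \<in> range (%k::int. x0 + of_int k)" by auto
 qed
 then show ?thesis by (rule countable_subset) auto
 qed auto
 then have "AE x in \<xi>. \<forall>b\<in>{x. cis (2 * pi * x) = a}. x ~= b"
 by (subst AE_ball_countable) (auto intro: \<xi>_AE_neq)
 then have "AE x in \<xi>. cis (2 * pi * x) ~= a" by eventually_elim auto
 then have "AE z in \<sigma>. z ~= a" unfolding \<sigma>_def by (subst AE_distr_iff) auto
 then have "{a} \<in> null_sets \<sigma>" using AE_iff_null_sets[of "{a}" \<sigma>] by (simp add: \<sigma>_def)
 then show ?thesis by (rule null_setsD1)
qed

section \<open>Convolution powers of \<sigma> and their singularity to \<sigma>\<close>

text \<open>The index is one less than the number of factors: \<open>conv_pow 0\<close> is \<sigma>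
  itself, and convolving indices \<open>n\<close> and \<open>m\<close> gives index
  \<open>n + m + 1\<close>.\<close>

definition conv_pow :: "nat => complex measure" where
 "conv_pow n = ((%\<nu>. distr (\<sigma> \<Otimes>\<^sub>M \<nu>) borel (%p. fst p * snd p)) ^^ n) \<sigma>"

definition mconv :: "complex measure => complex measure => complex measure" where
 "mconv \<mu> \<nu> = distr (\<mu> \<Otimes>\<^sub>M \<nu>) borel (%p. fst p * snd p)"

lemma conv_pow_0: "conv_pow 0 = \<sigma>" and conv_pow_Suc: "conv_pow (Suc n) = mconv \<sigma> (conv_pow n)"
 by (simp_all add: conv_pow_def mconv_def)

lemma mconv_circle:
 assumes \<mu>: "circle_measure \<mu>" and \<nu>: "circle_measure \<nu>"
 shows "circle_measure (mconv \<mu> \<nu>)"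
 and "(\<integral>z. z powi n \<partial>mconv \<mu> \<nu>) = (\<integral>z. z powi n \<partial>\<mu>) * (\<integral>z. z powi n \<partial>\<nu>)"
 and "A \<in> sets borel ==> emeasure (mconv \<mu> \<nu>) A = (\<integral>\<^sup>+z. emeasure \<nu> {w. z * w \<in> A} \<partial>\<mu>)"
proof -
 interpret \<mu>: finite_measure \<mu> by (rule circle_measureD[OF \<mu>])
 interpret \<nu>: finite_measure \<nu> by (rule circle_measureD[OF \<nu>])
 interpret pair_sigma_finite \<mu> \<nu> ..
 note [measurable_cong] = circle_measureD(2)[OF \<mu>] circle_measureD(2)[OF \<nu>]
 note sp = circle_measureD(4)[OF \<mu>] circle_measureD(4)[OF \<nu>]
 have fs [measurable]: "fst \<in> borel_measurable (\<mu> \<Otimes>\<^sub>M \<nu>)" "snd \<in> borel_measurable (\<mu> \<Otimes>\<^sub>M \<nu>)"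
 using measurable_fst[of \<mu> \<nu>] measurable_snd[of \<mu> \<nu>]
 by (simp_all only: measurable_cong_sets[OF refl circle_measureD(2)[OF \<mu>]] measurable_cong_sets[OF refl circle_measureD(2)[OF \<nu>]])
 have m [measurable]: "(%p. fst p * snd p) \<in> borel_measurable (\<mu> \<Otimes>\<^sub>M \<nu>)" by measurable
 have AEp: "AE p in \<mu> \<Otimes>\<^sub>M \<nu>. cmod (fst p) = 1 & cmod (snd p) = 1"
 proof (rule AE_pair_measure)
 show "{p \<in> space (\<mu> \<Otimes>\<^sub>M \<nu>). cmod (fst p) = 1 & cmod (snd p) = 1} \<in> sets (\<mu> \<Otimes>\<^sub>M \<nu>)" by measurable
 show "AE x in \<mu>. AE y in \<nu>. cmod (fst (x, y)) = 1 & cmod (snd (x, y)) = 1"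
  using circle_measureD(3)[OF \<mu>]
 proof eventually_elim
  case (elim x) show ?case using circle_measureD(3)[OF \<nu>] by eventually_elim (simp add: elim)
 qed
 qed
 have fin: "finite_measure (\<mu> \<Otimes>\<^sub>M \<nu>)"
 using \<nu>.finite_measure_axioms \<mu>.finite_measure_axioms by (rule finite_measure_pair_measure)
 then interpret pm: finite_measure "\<mu> \<Otimes>\<^sub>M \<nu>" .
 have "finite_measure (mconv \<mu> \<nu>)" unfolding mconv_def by (rule pm.finite_measure_distr) simp
 moreover have "AE z in mconv \<mu> \<nu>. cmod z = 1"
 unfolding mconv_def by (subst AE_distr_iff) (use AEp in \<open>auto simp: norm_mult elim!: AE_mp\<close>)
 moreover have "sets (mconv \<mu> \<nu>) = sets borel" by (simp add: mconv_def)
 ultimately show "circle_measure (mconv \<mu> \<nu>)" by (simp add: circle_measure_def)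
 have i: "integrable (\<mu> \<Otimes>\<^sub>M \<nu>) (%p. fst p powi n * snd p powi n)"
 proof (rule pm.integrable_const_bound[of _ 1])
 show "AE p in \<mu> \<Otimes>\<^sub>M \<nu>. norm (fst p powi n * snd p powi n) \<le> 1"
  using AEp by eventually_elim (simp add: norm_mult norm_power_int)
 qed measurable
 have "(\<integral>z. z powi n \<partial>mconv \<mu> \<nu>) = (\<integral>p. (fst p * snd p) powi n \<partial>(\<mu> \<Otimes>\<^sub>M \<nu>))"
 unfolding mconv_def by (subst integral_distr) auto
 also have "\<dots> = (\<integral>p. fst p powi n * snd p powi n \<partial>(\<mu> \<Otimes>\<^sub>M \<nu>))"
 by (simp add: power_int_mult_distrib)
 also have "\<dots> = (\<integral>x. (\<integral>y. x powi n * y powi n \<partial>\<nu>) \<partial>\<mu>)"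
 using integral_fst'[OF i] by simp
 finally show "(\<integral>z. z powi n \<partial>mconv \<mu> \<nu>) = (\<integral>z. z powi n \<partial>\<mu>) * (\<integral>z. z powi n \<partial>\<nu>)" by simp
 assume A [measurable]: "A \<in> sets borel"
 have "emeasure (mconv \<mu> \<nu>) A = emeasure (\<mu> \<Otimes>\<^sub>M \<nu>) ((%p. fst p * snd p) -` A \<inter> space (\<mu> \<Otimes>\<^sub>M \<nu>))"
 unfolding mconv_def by (subst emeasure_distr) auto
 also have "\<dots> = (\<integral>\<^sup>+z. emeasure \<nu> (Pair z -` ((%p. fst p * snd p) -` A \<inter> space (\<mu> \<Otimes>\<^sub>M \<nu>))) \<partial>\<mu>)"
 by (rule \<nu>.emeasure_pair_measure_alt) measurable
 also have "\<dots> = (\<integral>\<^sup>+z. emeasure \<nu> {w. z * w \<in> A} \<partial>\<mu>)"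
 by (intro nn_integral_cong arg_cong[where f="emeasure \<nu>"]) (auto simp: space_pair_measure sp)
 finally show "emeasure (mconv \<mu> \<nu>) A = (\<integral>\<^sup>+z. emeasure \<nu> {w. z * w \<in> A} \<partial>\<mu>)" .
qed

lemma conv_pow_circle: "circle_measure (conv_pow n)"
 by (induction n) (simp_all add: conv_pow_0 conv_pow_Suc \<sigma>_circle mconv_circle(1)[OF \<sigma>_circle])

lemma conv_pow_Fourier: "(\<integral>z. z powi k \<partial>conv_pow n) = F (real_of_int k) ^ Suc n"
proof (induction n)
 case (Suc n)
 show ?case unfolding conv_pow_Suc mconv_circle(2)[OF \<sigma>_circle conv_pow_circle] Suc \<sigma>_Fourier by simp
qed (simp add: conv_pow_0 \<sigma>_Fourier)

lemma mconv_conv_pow: "mconv (conv_pow n) (conv_pow m) = conv_pow (Suc (n + m))"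
 by (rule circle_measure_eqI[OF mconv_circle(1)[OF conv_pow_circle conv_pow_circle] conv_pow_circle])
  (simp add: mconv_circle(2)[OF conv_pow_circle conv_pow_circle] conv_pow_Fourier power_add[symmetric] add.commute)

lemma conv_pow_prob: "prob_space (conv_pow n)"
proof (rule prob_spaceI)
 interpret finite_measure "conv_pow n" by (rule circle_measureD[OF conv_pow_circle])
 have "complex_of_real (measure (conv_pow n) (space (conv_pow n))) = 1"
 using conv_pow_Fourier[where k=0 and n=n] by (simp add: F_0 scaleR_conv_of_real)
 then show "emeasure (conv_pow n) (space (conv_pow n)) = 1" by (simp add: emeasure_eq_measure)
qed

lemma circle_image_Fourier:
 assumes \<mu>: "circle_measure \<mu>"
 shows "circle_measure (distr \<mu> borel (%z. z ^ 3))" "circle_measure (distr \<mu> borel cnj)"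
 "(\<integral>z. z powi n \<partial>distr \<mu> borel (%z. z ^ 3)) = (\<integral>z. z powi (3 * n) \<partial>\<mu>)"
 "(\<integral>z. z powi n \<partial>distr \<mu> borel cnj) = cnj (\<integral>z. z powi n \<partial>\<mu>)"
proof -
 interpret finite_measure \<mu> by (rule circle_measureD[OF \<mu>])
 note [measurable_cong] = circle_measureD(2)[OF \<mu>]
 have [measurable]: "cnj \<in> borel_measurable borel"
 by (intro borel_measurable_continuous_onI continuous_intros)
 have fin: "finite_measure (distr \<mu> borel (%z. z ^ 3))" "finite_measure (distr \<mu> borel cnj)"
 by (intro finite_measure_distr; simp)+
 have "AE z in \<mu>. cmod (z ^ 3) = 1"
 using circle_measureD(3)[OF \<mu>] by eventually_elim (simp add: norm_power)
 then have "AE z in distr \<mu> borel (%z. z ^ 3). cmod z = 1" by (subst AE_distr_iff) simp_all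
 then show "circle_measure (distr \<mu> borel (%z. z ^ 3))" using fin by (simp add: circle_measure_def)
 have "AE z in \<mu>. cmod (cnj z) = 1" using circle_measureD(3)[OF \<mu>] by simp
 then have "AE z in distr \<mu> borel cnj. cmod z = 1" by (subst AE_distr_iff) simp_all
 then show "circle_measure (distr \<mu> borel cnj)" using fin by (simp add: circle_measure_def)
 have "(z ^ 3) powi n = z powi (3 * n)" for z :: complex
 using power_int_mult[of z 3 n] by simp
 then show "(\<integral>z. z powi n \<partial>distr \<mu> borel (%z. z ^ 3)) = (\<integral>z. z powi (3 * n) \<partial>\<mu>)"
 by (subst integral_distr) simp_all
 have c: "cnj z powi n = cnj (z powi n)" for z :: complex by (simp add: power_int_def)
 have "(\<integral>z. z powi n \<partial>distr \<mu> borel cnj) = (\<integral>z. cnj z powi n \<partial>\<mu>)"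
 by (rule integral_distr) simp_all
 then show "(\<integral>z. z powi n \<partial>distr \<mu> borel cnj) = cnj (\<integral>z. z powi n \<partial>\<mu>)"
 by (simp only: c Bochner_Integration.integral_cnj)
qed

lemma conv_pow_cube: "distr (conv_pow n) borel (%z. z ^ 3) = conv_pow n"
 by (rule circle_measure_eqI[OF circle_image_Fourier(1)[OF conv_pow_circle] conv_pow_circle])
  (simp add: circle_image_Fourier(3)[OF conv_pow_circle] conv_pow_Fourier F_3)

lemma conv_pow_cnj: "distr (conv_pow n) borel cnj = conv_pow n"
proof (rule circle_measure_eqI[OF circle_image_Fourier(2)[OF conv_pow_circle] conv_pow_circle])
 fix k
 have "cnj (F t) = F t" for t using F_real[of t] by (simp add: complex_eq_iff)
 then show "(\<integral>z. z powi k \<partial>distr (conv_pow n) borel cnj) = (\<integral>z. z powi k \<partial>conv_pow n)"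
 by (simp add: circle_image_Fourier(4)[OF conv_pow_circle] conv_pow_Fourier)
qed

lemma conv_pow_no_atom: "emeasure (conv_pow n) {a} = 0"
proof (induction n arbitrary: a)
 case (Suc n)
 have z: "emeasure (conv_pow n) {w. z * w \<in> {a}} = 0" if "cmod z = 1" for z
 proof -
 have "z ~= 0" using that by auto
 then have "{w. z * w \<in> {a}} = {a / z}" by (auto simp: field_simps)
 then show ?thesis using Suc by simp
 qed
 have "emeasure (conv_pow (Suc n)) {a} = (\<integral>\<^sup>+z. emeasure (conv_pow n) {w. z * w \<in> {a}} \<partial>\<sigma>)"
 unfolding conv_pow_Suc by (rule mconv_circle(3)[OF \<sigma>_circle conv_pow_circle]) simp
 also have "\<dots> = (\<integral>\<^sup>+z. 0 \<partial>\<sigma>)"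
 by (rule nn_integral_cong_AE) (use circle_measureD(3)[OF \<sigma>_circle] in eventually_elim, simp only: z)
 finally show ?case by simp
qed (simp add: conv_pow_0 \<sigma>_no_atom)

text \<open>The averages use the gap \<open>N\<close> between exponents, so that distinct terms decorrelate
 uniformly as \<open>N\<close> grows.\<close>
definition avg :: "nat => complex => complex" where
 "avg N z = (\<Sum>i<N. z ^ (3 ^ (i * N))) / of_nat N"

lemma avg_measurable: "avg N \<in> borel_measurable borel"
proof -
 have "(%z::complex. \<Sum>i<N. z ^ (3 ^ (i * N))) \<in> borel_measurable borel"
 by (intro borel_measurable_continuous_onI continuous_intros)
 then show ?thesis unfolding avg_def by (rule borel_measurable_divide[OF _ borel_measurable_const])
qed

text \<open>On integers \<open>F\<close> is even and unchanged by a factor 3, so the correlation of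
  two powers depends only on the gap between their exponents.\<close>

lemma F_power_diff:
 "F (3 ^ i - 3 ^ j) = F (3 ^ (max i j - min i j) - 1)"
proof -
 have a: "F (real_of_int (3 ^ i * k)) = F (real_of_int k)" for i k
 by (induction i) (simp_all add: mult.assoc F_3[of "3 ^ _ * k", simplified])
 have b: "F (3 ^ i - 3 ^ j) = F (3 ^ (i - j) - 1)" if "j \<le> i" for i j
 proof -
 have "(3 :: real) ^ i - 3 ^ j = real_of_int (3 ^ j * (3 ^ (i - j) - 1))"
  using that by (simp add: right_diff_distrib power_add[symmetric])
 then show ?thesis using a[of j "3 ^ (i - j) - 1"] by simp
 qed
 show ?thesis
 proof (cases "j \<le> i")
 case False
 then have "F (3 ^ i - 3 ^ j) = F (3 ^ j - 3 ^ i)" using F_minus[of "3 ^ j - 3 ^ i"] by simp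
 then show ?thesis using b[of i j] False by (simp add: max_def min_def)
 qed (use b in \<open>simp add: max_def min_def\<close>)
qed

text \<open>A variance estimate. Of the \<open>N^2\<close> covariances the \<open>N\<close> diagonal
  ones are at most 1; all others belong to gaps of at least \<open>N\<close> and are uniformly small
  by \<open>F_correlation\<close>.\<close>

lemma avg_L2_tendsto:
 "(%N. \<integral>z. (cmod (avg N z - of_real (c1 ^ Suc n)))\<^sup>2 \<partial>conv_pow n) \<longlonglongrightarrow> 0"
proof -
 let ?s = "conv_pow n" and ?C = "c1 ^ Suc n"
 interpret prob_space ?s by (rule conv_pow_prob)
 note cm = conv_pow_circle[of n]
 note [measurable_cong] = circle_measureD(2)[OF cm]
 define A where "A d = Re (F (3 ^ d - 1)) ^ Suc n" for d
 have AL: "A \<longlonglongrightarrow> ?C\<^sup>2"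
 proof -
 have "(%d. Re (F (3 ^ d - 1)) ^ Suc n) \<longlonglongrightarrow> Re (of_real (c1\<^sup>2)) ^ Suc n"
  by (intro tendsto_intros F_correlation)
 moreover have "Re (of_real (c1\<^sup>2)) ^ Suc n = ?C\<^sup>2" by (simp only: Re_complex_of_real power_mult[symmetric] mult.commute)
 ultimately show ?thesis by (simp only: A_def[abs_def])
 qed
 have oneL: "(%_. c) \<in> L2 ?s" for c :: complex by (simp add: L2_def)
 have e: "(%z. z ^ k) \<in> L2 ?s" for k
 proof (rule L2_bound[where g="%_. 1"])
 show "AE z in ?s. (norm (z ^ k))\<^sup>2 \<le> 1"
  using circle_measureD(3)[OF cm] by eventually_elim (simp add: norm_power)
 qed auto
 have FR: "F t = of_real (Re (F t))" for t using F_real[of t] by (simp add: complex_eq_iff)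
 have ip: "L2_inner ?s (%z. z ^ j) (%z. z ^ k) = F (real j - real k) ^ Suc n" for j k
 proof -
 have "L2_inner ?s (%z. z ^ j) (%z. z ^ k) = (\<integral>z. z powi (int j - int k) \<partial>?s)"
  unfolding L2_inner_def
 proof (rule integral_cong_AE)
  show "(%z. z ^ j * cnj (z ^ k)) \<in> borel_measurable ?s"
  using L2_inner_integrable[OF e e] by (rule borel_measurable_integrable)
  show "AE z in ?s. z ^ j * cnj (z ^ k) = z powi (int j - int k)"
  using circle_measureD(3)[OF cm]
  proof eventually_elim
  case (elim z)
  then have "z ~= 0" by auto
  then show ?case using cnj_power_int_circle[OF elim, of "int k"] power_int_add[of z "int j" "- int k"] by simp
  qed
 qed measurable
 then show ?thesis using conv_pow_Fourier[where k="int j - int k" and n=n] by simp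
 qed
 have sq: "(\<integral>z. (cmod (avg N z - of_real ?C))\<^sup>2 \<partial>?s)
  = (\<Sum>i<N. \<Sum>j<N. A (max (i * N) (j * N) - min (i * N) (j * N)) - ?C\<^sup>2) / (real N)\<^sup>2" if N: "N > 0" for N
 proof -
 define g where "g i z = z ^ (3 ^ (i * N)) - complex_of_real ?C" for i z
 have gL: "g i \<in> L2 ?s" for i unfolding g_def by (intro L2_diff e oneL)
 have gi: "L2_inner ?s (g i) (g j) = of_real (A (max (i * N) (j * N) - min (i * N) (j * N)) - ?C\<^sup>2)" for i j
 proof -
  have one: "L2_inner ?s (%z. z ^ (3 ^ k)) (%_. 1) = of_real ?C" for k
  proof -
  have "F (real_of_int (3 ^ k)) = F 1"
   by (induction k) (simp_all add: F_3[of "3 ^ _", simplified])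
  then show ?thesis using ip[of "3 ^ k" 0] by (simp add: F_1 del: power_Suc)
  qed
  have one': "L2_inner ?s (%_. 1) (%z. z ^ (3 ^ k)) = of_real ?C" for k
  by (subst L2_inner_commute) (simp only: one complex_cnj_complex_of_real)
  have c: "L2_inner ?s f (%_. of_real ?C) = of_real ?C * L2_inner ?s f (%_. 1)" for f
  using L2_inner_scale_right[of ?s f "of_real ?C" "%_. 1"] by simp
  have c': "L2_inner ?s (%_. of_real ?C) f = of_real ?C * L2_inner ?s (%_. 1) f" for f
  using L2_inner_scale_left[of ?s "of_real ?C" "%_. 1" f] by simp
  have oo: "L2_inner ?s (%_. 1) (%_. 1) = 1" using ip[of 0 0] by (simp add: F_0)
  have "L2_inner ?s (g i) (g j) = L2_inner ?s (%z. z ^ (3 ^ (i * N))) (%z. z ^ (3 ^ (j * N))) - of_real (?C\<^sup>2)"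
  unfolding g_def
  by (simp only: L2_inner_diff_left[OF e oneL L2_diff[OF e oneL]] L2_inner_diff_right[OF e oneL e]
   L2_inner_diff_right[OF e oneL oneL] c c' one one' oo) (simp add: power2_eq_square)
  also have "L2_inner ?s (%z. z ^ (3 ^ (i * N))) (%z. z ^ (3 ^ (j * N))) = of_real (A (max (i * N) (j * N) - min (i * N) (j * N)))"
  unfolding ip A_def of_real_power FR[symmetric] using F_power_diff[of "i * N" "j * N"] by (simp del: power_Suc)
  finally show ?thesis by simp
 qed
 have av: "avg N z - of_real ?C = (1 / of_nat N) * (\<Sum>i<N. g i z)" for z
  using N by (simp add: avg_def g_def sum_subtractf field_simps)
 have "(\<integral>z. (cmod (avg N z - of_real ?C))\<^sup>2 \<partial>?s) = l2sq ?s (%z. (1 / of_nat N) * (\<Sum>i<N. g i z))"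
  by (simp only: l2sq_def av)
 also have "\<dots> = (1 / (real N)\<^sup>2) * Re (L2_inner ?s (%z. \<Sum>i<N. g i z) (%z. \<Sum>i<N. g i z))"
  unfolding l2sq_scale by (simp add: l2sq_inner norm_divide power_divide)
 also have "L2_inner ?s (%z. \<Sum>i<N. g i z) (%z. \<Sum>i<N. g i z)
  = of_real (\<Sum>i<N. \<Sum>j<N. A (max (i * N) (j * N) - min (i * N) (j * N)) - ?C\<^sup>2)"
  by (simp add: L2_inner_sum_left L2_inner_sum_right L2_sum gL gi)
 finally show ?thesis by simp
 qed
 have c: "0 < ?C" "?C < 1" using c1_bounds by (intro zero_less_power power_Suc_less_one; simp)+
 show ?thesis
 proof (rule LIMSEQ_I)
 fix e :: real assume e0: "e > 0"
 obtain K where K: "!!d. d \<ge> K ==> norm (A d - ?C\<^sup>2) < e / 2"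
  using LIMSEQ_D[OF AL, of "e / 2"] e0 by auto
 obtain L where L: "2 / e < real L" using reals_Archimedean2 by blast
 show "\<exists>no. \<forall>N\<ge>no. norm ((\<integral>z. (cmod (avg N z - of_real ?C))\<^sup>2 \<partial>?s) - 0) < e"
 proof (intro exI allI impI)
  fix N assume N: "max (Suc K) (Suc L) \<le> N"
  then have N0: "N > 0" and NK: "N \<ge> K" and NL: "2 / e < real N" using L by auto
  have A0: "A 0 = 1 \<or> A 0 - ?C\<^sup>2 \<le> 1" by (simp add: A_def F_0)
  have bound: "A (max (i * N) (j * N) - min (i * N) (j * N)) - ?C\<^sup>2 \<le> (if i = j then 1 else 0) + e / 2" for i j
  proof (cases "i = j")
  case True
  then have "A (max (i * N) (j * N) - min (i * N) (j * N)) = 1" by (simp add: A_def F_0)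
  moreover have "0 \<le> ?C\<^sup>2" by simp
  ultimately show ?thesis unfolding if_P[OF True] using e0 by linarith
  next
  case False
  then have "max (i * N) (j * N) - min (i * N) (j * N) = (max i j - min i j) * N"
   by (cases "i \<le> j") (auto simp: max_def min_def diff_mult_distrib)
  moreover have "1 \<le> max i j - min i j" using False by (auto simp: max_def min_def)
  ultimately have "N \<le> max (i * N) (j * N) - min (i * N) (j * N)"
   using mult_right_mono[of 1 "max i j - min i j" N] by simp
  then have "norm (A (max (i * N) (j * N) - min (i * N) (j * N)) - ?C\<^sup>2) < e / 2"
   by (intro K order_trans[OF NK])
  then show ?thesis
   using abs_ge_self[of "A (max (i * N) (j * N) - min (i * N) (j * N)) - ?C\<^sup>2"]
   unfolding if_not_P[OF False] real_norm_def by linarith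
  qed
  have "(\<Sum>i<N. \<Sum>j<N. A (max (i * N) (j * N) - min (i * N) (j * N)) - ?C\<^sup>2)
   \<le> (\<Sum>i<N. \<Sum>j<N. (if i = j then 1 else 0) + e / 2)"
  by (intro sum_mono bound)
  also have "\<dots> = real N + real N * (real N * (e / 2))"
  by (simp add: sum.distrib distrib_left)
  finally have "(\<integral>z. (cmod (avg N z - of_real ?C))\<^sup>2 \<partial>?s) \<le> (real N + real N * (real N * (e / 2))) / (real N)\<^sup>2"
  unfolding sq[OF N0] by (intro divide_right_mono) auto
  also have "\<dots> = 1 / real N + e / 2" using N0 by (simp add: power2_eq_square field_simps)
  also have "\<dots> < e" using NL e0 N0 by (simp add: field_simps)
  finally show "norm ((\<integral>z. (cmod (avg N z - of_real ?C))\<^sup>2 \<partial>?s) - 0) < e" by simp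
 qed
 qed
qed

text \<open>Convergence in mean gives almost everywhere convergence along a subsequence. One is
  chosen for \<sigma> and a further one inside it for \<open>conv_pow n\<close>, so that along the
  same sequence the limits are \<open>c1\<close> and \<open>c1 ^ Suc n\<close>, which differ because
  \<open>0 < c1 < 1\<close>.\<close>

lemma conv_pow_singular:
 assumes "0 < n"
 shows "\<exists>S\<in>sets borel. emeasure \<sigma> (- S) = 0 & emeasure (conv_pow n) S = 0"
proof -
 note meas = avg_measurable
 have i: "integrable (conv_pow n) (%z. (cmod (avg N z - of_real (c1 ^ Suc n)))\<^sup>2)" for n N
 proof -
 interpret prob_space "conv_pow n" by (rule conv_pow_prob)
 note cm = conv_pow_circle[of n]
 note [measurable_cong] = circle_measureD(2)[OF cm]
 note [measurable] = meas
 show ?thesis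
 proof (rule integrable_const_bound[of _ "4"])
  show "AE z in conv_pow n. norm ((cmod (avg N z - of_real (c1 ^ Suc n)))\<^sup>2) \<le> 4"
  using circle_measureD(3)[OF cm]
  proof eventually_elim
  case (elim z)
  have "cmod (\<Sum>i<N. z ^ (3 ^ (i * N))) \<le> (\<Sum>i<N. 1)"
   by (rule order_trans[OF norm_sum]) (simp add: norm_power elim)
  then have a: "cmod (avg N z) \<le> 1" by (cases "N = 0") (simp_all add: avg_def norm_divide divide_le_eq)
  have "cmod (avg N z - of_real (c1 ^ Suc n)) \<le> cmod (avg N z) + cmod (of_real (c1 ^ Suc n))"
   by (rule norm_triangle_ineq4)
  also have "\<dots> \<le> 1 + 1" using a c1_bounds
   by (intro add_mono) (simp_all add: norm_power power_le_one del: power_Suc)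
  finally have "(cmod (avg N z - of_real (c1 ^ Suc n)))\<^sup>2 \<le> 2\<^sup>2" by (intro power_mono) auto
  then show ?case by simp
  qed
 qed measurable
 qed
 have sub: "\<exists>q::nat=>nat. strict_mono q & (AE z in conv_pow n. (%k. avg (r (q k)) z) \<longlonglongrightarrow> of_real (c1 ^ Suc n))"
 if r: "strict_mono r" for r :: "nat => nat" and n
 proof -
 define u where "u k z = (cmod (avg (r k) z - of_real (c1 ^ Suc n)))\<^sup>2" for k z
 have u: "integrable (conv_pow n) (u k)" for k unfolding u_def by (rule i)
 have un: "norm (u k z) = u k z" for k z by (simp add: u_def)
 have "(%k. \<integral>z. u k z \<partial>conv_pow n) \<longlonglongrightarrow> 0"
  using LIMSEQ_subseq_LIMSEQ[OF avg_L2_tendsto[of n] r] unfolding u_def comp_def .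
 then have "(%k. \<integral>z. norm (u k z) \<partial>conv_pow n) \<longlonglongrightarrow> 0" unfolding un .
 from tendsto_L1_AE_subseq[OF u this]
 have "\<exists>q::nat => nat. strict_mono q &
  (AE z in conv_pow n. (%k. (cmod (avg (r (q k)) z - of_real (c1 ^ Suc n)))\<^sup>2) \<longlonglongrightarrow> 0)"
  unfolding u_def .
 then obtain q :: "nat => nat" where q: "strict_mono q"
  "AE z in conv_pow n. (%k. (cmod (avg (r (q k)) z - of_real (c1 ^ Suc n)))\<^sup>2) \<longlonglongrightarrow> 0" by blast
 have "AE z in conv_pow n. (%k. avg (r (q k)) z) \<longlonglongrightarrow> of_real (c1 ^ Suc n)"
  using q(2)
 proof eventually_elim
  case (elim z)
  then have "(%k. sqrt ((cmod (avg (r (q k)) z - of_real (c1 ^ Suc n)))\<^sup>2)) \<longlonglongrightarrow> sqrt 0"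
  by (intro tendsto_real_sqrt)
  then have "(%k. cmod (avg (r (q k)) z - of_real (c1 ^ Suc n))) \<longlonglongrightarrow> 0" by simp
  then show ?case by (rule LIM_zero_cancel[OF tendsto_norm_zero_cancel])
 qed
 with q(1) show ?thesis by (intro exI[of _ q] conjI)
 qed
 have "strict_mono (%k::nat. k)" by (simp add: strict_mono_def)
 from sub[OF this, of 0] obtain q :: "nat => nat"
 where q: "strict_mono q & (AE z in conv_pow 0. (%k. avg (q k) z) \<longlonglongrightarrow> of_real (c1 ^ Suc 0))" ..
 from sub[OF conjunct1[OF q], of n] obtain p :: "nat => nat"
 where p: "strict_mono p & (AE z in conv_pow n. (%k. avg (q (p k)) z) \<longlonglongrightarrow> of_real (c1 ^ Suc n))" ..
 have "AE z in \<sigma>. (%k. avg (q (p k)) z) \<longlonglongrightarrow> of_real c1"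
 using conjunct2[OF q] unfolding conv_pow_0
 proof eventually_elim
 case (elim z)
 show ?case using LIMSEQ_subseq_LIMSEQ[OF elim conjunct1[OF p]] by (simp add: comp_def)
 qed
 from AE_E[OF this] obtain N where N: "{z \<in> space \<sigma>. \<not> (%k. avg (q (p k)) z) \<longlonglongrightarrow> of_real c1} \<subseteq> N"
 "emeasure \<sigma> N = 0" "N \<in> sets \<sigma>" .
 have ne: "c1 ^ Suc n ~= c1"
 proof
 assume "c1 ^ Suc n = c1"
 then have "c1 * c1 ^ n = c1 * 1" by simp
 then have "c1 ^ n = 1" using c1_bounds by (simp only: mult_cancel_left) auto
 moreover have "c1 ^ n < c1 ^ 0" by (rule power_strict_decreasing[OF assms c1_bounds])
 ultimately show False by simp
 qed
 have Nb: "N \<in> sets borel" using N(3) circle_measureD(2)[OF \<sigma>_circle] by simp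
 have "AE z in conv_pow n. z \<notin> - N"
 using conjunct2[OF p]
 proof eventually_elim
 case (elim z)
 show ?case
 proof
  assume "z \<in> - N"
  then have "(%k. avg (q (p k)) z) \<longlonglongrightarrow> of_real c1" using N(1) circle_measureD(4)[OF \<sigma>_circle] by auto
  then have "complex_of_real (c1 ^ Suc n) = of_real c1" by (rule LIMSEQ_unique[OF elim])
  then show False using ne by (simp only: of_real_eq_iff)
 qed
 qed
 moreover have cN: "- N \<in> sets (conv_pow n)" using Nb circle_measureD(2)[OF conv_pow_circle] by auto
 ultimately have "- N \<in> null_sets (conv_pow n)" using AE_iff_null_sets[OF cN] by simp
 then have "emeasure (conv_pow n) (- N) = 0" by (rule null_setsD1)
 then show ?thesis using N(2) Nb by (intro bexI[of _ "- N"]) auto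
qed

lemma singular_set_exists: "\<exists>S\<in>sets borel. emeasure \<sigma> (- S) = 0 & (\<forall>n>0. emeasure (conv_pow n) S = 0)"
proof -
 have "\<exists>S. \<forall>n. S n \<in> sets borel & (0 < n --> emeasure \<sigma> (- S n) = 0 & emeasure (conv_pow n) (S n) = 0)"
 proof (rule choice, rule allI)
 fix n :: nat
 show "\<exists>S. S \<in> sets borel & (0 < n --> emeasure \<sigma> (- S) = 0 & emeasure (conv_pow n) S = 0)"
 proof (cases "0 < n")
  case True then show ?thesis using conv_pow_singular[OF True] by blast
 next
  case False then show ?thesis by (intro exI[of _ "{}"]) simp
 qed
 qed
 then obtain S where S: "!!n. S n \<in> sets borel" "!!n. 0 < n ==> emeasure \<sigma> (- S n) = 0"
 "!!n. 0 < n ==> emeasure (conv_pow n) (S n) = 0" by blast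
 have sb: "sets \<sigma> = sets borel" "!!n. sets (conv_pow n) = sets borel"
 using circle_measureD(2) \<sigma>_circle conv_pow_circle by auto
 have "(\<Union>n. - S (Suc n)) \<in> null_sets \<sigma>"
 by (intro null_sets_UN null_setsI S(2)) (simp_all only: sb borel_comp S(1) zero_less_Suc)
 moreover have "(\<Union>n. - S (Suc n)) = - (\<Inter>n. S (Suc n))" by auto
 ultimately have 1: "emeasure \<sigma> (- (\<Inter>n. S (Suc n))) = 0" by (simp only: null_setsD1)
 have 2: "emeasure (conv_pow n) (\<Inter>n. S (Suc n)) = 0" if n: "0 < n" for n
 proof -
 obtain j where "n = Suc j" using n gr0_conv_Suc by blast
 then have "emeasure (conv_pow n) (\<Inter>n. S (Suc n)) \<le> emeasure (conv_pow n) (S n)"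
  by (intro emeasure_mono INF_lower2[of j]) (simp_all add: sb S(1))
 then show ?thesis using S(3)[OF n] by simp
 qed
 have "(\<Inter>n. S (Suc n)) \<in> sets borel" by (intro sets.countable_INT) (use S(1) in blast)+
 with 1 2 show ?thesis by blast
qed

section \<open>The separating set and the reference measure \<theta>\<close>

definition S :: "complex set" where
 "S = (SOME S. S \<in> sets borel & emeasure \<sigma> (- S) = 0 & (\<forall>n>0. emeasure (conv_pow n) S = 0))"

lemma S_borel [measurable]: "S \<in> sets borel" and \<sigma>_S: "emeasure \<sigma> (- S) = 0"
 and conv_pow_S: "0 < n ==> emeasure (conv_pow n) S = 0"
proof -
 have "\<exists>S. S \<in> sets borel & emeasure \<sigma> (- S) = 0 & (\<forall>n>0. emeasure (conv_pow n) S = 0)"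
 using singular_set_exists by blast
 from someI_ex[OF this] show "S \<in> sets borel" "emeasure \<sigma> (- S) = 0" "0 < n ==> emeasure (conv_pow n) S = 0"
 unfolding S_def[symmetric] by auto
qed

abbreviation "geo \<equiv> measure_pmf (geometric_pmf (1 / 2))"

text \<open>Geometric weights charge every convolution power, so \<theta>-null means null for all of
  them. The weight 1/2 of index 0 reappears as the factor 2 in \<open>dn\<close>.\<close>

definition \<theta> :: "complex measure" where
 "\<theta> = geo \<bind> conv_pow"

lemma sets_conv_pow: "sets (conv_pow n) = sets borel"
 using circle_measureD(2)[OF conv_pow_circle] .

lemma conv_pow_kernel: "conv_pow \<in> geo \<rightarrow>\<^sub>M subprob_algebra borel"
 by (simp add: measurable_cong_sets[OF sets_measure_pmf_count_space refl] space_subprob_algebra sets_conv_pow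
  prob_space_imp_subprob_space[OF conv_pow_prob])

lemma sets_\<theta> [measurable_cong]: "sets \<theta> = sets borel"
 unfolding \<theta>_def by (rule sets_bind) (auto simp: sets_conv_pow)

lemma \<theta>_emeasure: "A \<in> sets borel ==> emeasure \<theta> A = (\<integral>\<^sup>+n. emeasure (conv_pow n) A \<partial>geo)"
 unfolding \<theta>_def by (rule emeasure_bind[OF _ conv_pow_kernel]) auto

lemma \<theta>_prob: "prob_space \<theta>"
 unfolding \<theta>_def
 by (rule prob_space.prob_space_bind[OF prob_space_measure_pmf _ conv_pow_kernel]) (simp add: conv_pow_prob)

interpretation \<theta>: prob_space \<theta> by (rule \<theta>_prob)

lemma \<theta>_AE:
 assumes "Measurable.pred borel Q"
 shows "(AE z in \<theta>. Q z) \<longleftrightarrow> (\<forall>n. AE z in conv_pow n. Q z)"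
 unfolding \<theta>_def AE_bind[OF conv_pow_kernel assms] by (subst AE_measure_pmf_iff) (simp add: set_pmf_geometric)

lemma \<theta>_null:
 assumes "A \<in> sets borel"
 shows "emeasure \<theta> A = 0 \<longleftrightarrow> (\<forall>n. emeasure (conv_pow n) A = 0)"
 unfolding \<theta>_emeasure[OF assms]
 by (subst nn_integral_0_iff_AE) (auto simp: AE_measure_pmf_iff set_pmf_geometric)

lemma \<theta>_circle: "circle_measure \<theta>"
proof -
 have "AE z in \<theta>. cmod z = 1"
 by (subst \<theta>_AE) (auto intro: circle_measureD(3)[OF conv_pow_circle])
 then show ?thesis using \<theta>.finite_measure_axioms by (simp add: circle_measure_def sets_\<theta>)
qed

lemma \<theta>_no_atom: "emeasure \<theta> {a} = 0"
 by (subst \<theta>_null) (auto simp: conv_pow_no_atom)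

lemma image_invariant:
 assumes f [measurable]: "f \<in> borel_measurable borel" and inv: "!!n. distr (conv_pow n) borel f = conv_pow n"
 and A [measurable]: "A \<in> sets borel"
 shows "emeasure \<theta> (f -` A) = emeasure \<theta> A"
proof -
 have fA: "f -` A \<in> sets borel" using measurable_sets[OF f A] by simp
 have "emeasure (conv_pow n) (f -` A) = emeasure (conv_pow n) A" for n
 proof -
 have fm: "f \<in> conv_pow n \<rightarrow>\<^sub>M borel" using f by (simp add: measurable_cong_sets[OF sets_conv_pow refl])
 have "emeasure (distr (conv_pow n) borel f) A = emeasure (conv_pow n) (f -` A \<inter> space (conv_pow n))"
  by (rule emeasure_distr[OF fm A])
 then show ?thesis using inv[of n] circle_measureD(4)[OF conv_pow_circle, of n] by simp
 qed
 then show ?thesis by (simp add: \<theta>_emeasure[OF A] \<theta>_emeasure[OF fA])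
qed

lemma \<theta>_inter: 
 assumes A: "A \<in> sets borel"
 shows "emeasure \<theta> (A \<inter> S) = emeasure \<sigma> A / 2"
proof -
 have "emeasure (conv_pow n) (A \<inter> S) = emeasure \<sigma> A * indicator {0} n" for n
 proof (cases "n = 0")
 case True
 have "emeasure \<sigma> A = emeasure \<sigma> (A \<inter> S)"
 proof (rule emeasure_eq_AE)
  have "- S \<in> null_sets \<sigma>" using \<sigma>_S circle_measureD(2)[OF \<sigma>_circle] by (auto simp: null_sets_def)
  from AE_not_in[OF this] show "AE x in \<sigma>. x \<in> A \<longleftrightarrow> x \<in> A \<inter> S" by eventually_elim auto
 qed (use A circle_measureD(2)[OF \<sigma>_circle] in auto)
 with True show ?thesis by (simp add: conv_pow_0)
 next
 case False
 have "emeasure (conv_pow n) (A \<inter> S) \<le> emeasure (conv_pow n) S"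
  by (rule emeasure_mono) (simp_all only: Int_lower2 sets_conv_pow S_borel)
 then show ?thesis using False conv_pow_S[of n] by simp
 qed
 then have "emeasure \<theta> (A \<inter> S) = (\<integral>\<^sup>+n. emeasure \<sigma> A * indicator {0} n \<partial>geo)"
 using A by (subst \<theta>_emeasure) auto
 also have "\<dots> = emeasure \<sigma> A * emeasure geo {0}" by (subst nn_integral_cmult_indicator) auto
 also have "emeasure geo {0} = ennreal (1 / 2)" by (subst emeasure_pmf_single) simp
 also have "emeasure \<sigma> A * ennreal (1 / 2) = emeasure \<sigma> A / 2"
 using inverse_ennreal[of 2] by (simp add: divide_ennreal_def inverse_eq_divide)
 finally show ?thesis .
qed

text \<open>Index 0 selects the part of \<theta> on \<open>S\<close>, all other indices the part off
  \<open>S\<close>: these are the infinitely many copies that make the multiplicity off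
  \<open>S\<close> infinite. The factor 2 turns \<open>rho 0\<close> into \<sigma> and gives every
  \<open>rho i\<close> mass 1.\<close>

definition dn :: "nat => complex => real" where
 "dn i z = 2 * indicator (if i = 0 then S else - S) z"

definition rho :: "nat => complex measure" where
 "rho i = density \<theta> (%z. ennreal (dn i z))"

lemma dn_measurable [measurable]: "dn i \<in> borel_measurable borel"
 unfolding dn_def by (cases "i = 0") auto

lemma dn_nonneg: "0 \<le> dn i z"
 by (simp add: dn_def)

lemma dn_integrable: "integrable \<theta> (dn i)"
 by (rule \<theta>.integrable_const_bound[of _ 2]) (auto simp: dn_def indicator_def)

lemma sets_rho: "sets (rho i) = sets borel"
 by (simp add: rho_def sets_\<theta>)

lemma rho_emeasure:
 assumes A: "A \<in> sets borel"
 shows "emeasure (rho i) A = 2 * emeasure \<theta> (A \<inter> (if i = 0 then S else - S))"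
proof -
 have "emeasure (rho i) A = (\<integral>\<^sup>+z. ennreal (dn i z) * indicator A z \<partial>\<theta>)"
 unfolding rho_def by (rule emeasure_density) (use A in \<open>auto simp: sets_\<theta>\<close>)
 also have "\<dots> = (\<integral>\<^sup>+z. 2 * indicator (A \<inter> (if i = 0 then S else - S)) z \<partial>\<theta>)"
 by (intro nn_integral_cong) (auto simp: dn_def indicator_def)
 also have "\<dots> = 2 * emeasure \<theta> (A \<inter> (if i = 0 then S else - S))"
 by (rule nn_integral_cmult_indicator) (use A in \<open>auto simp: sets_\<theta>\<close>)
 finally show ?thesis .
qed

lemma ennreal_double_half: "2 * (x / 2 :: ennreal) = x"
 by (simp add: ennreal_times_divide mult.commute[of 2] mult_divide_eq_ennreal)

lemma rho_0: "rho 0 = \<sigma>"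
proof (rule measure_eqI)
 fix A assume "A \<in> sets (rho 0)"
 then have A: "A \<in> sets borel" by (simp add: sets_rho)
 then show "emeasure (rho 0) A = emeasure \<sigma> A"
 by (simp add: rho_emeasure \<theta>_inter ennreal_double_half)
qed (simp add: sets_rho circle_measureD(2)[OF \<sigma>_circle])

lemma rho_Suc: "rho (Suc i) = rho 1"
 unfolding rho_def by (simp add: dn_def)

lemma rho_split:
 assumes A: "A \<in> sets borel"
 shows "2 * emeasure \<theta> A = emeasure \<sigma> A + emeasure (rho 1) A"
proof -
 have "emeasure \<theta> A = emeasure \<theta> (A \<inter> S) + emeasure \<theta> (A \<inter> - S)"
 by (subst plus_emeasure) (use A in \<open>auto simp: sets_\<theta> intro!: arg_cong[where f="emeasure \<theta>"]\<close>)
 then show ?thesis using rho_emeasure[OF A, of 0] rho_emeasure[OF A, of 1] by (simp add: rho_0 distrib_left)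
qed

text \<open>The set \<open>S\<close> itself is not known to be invariant. But \<sigma> and \<theta>
  are, and \<sigma> can be cancelled from \<open>2 * \<theta> = \<sigma> + rho 1\<close> because it
  is finite.\<close>

lemma rho_image_invariant:
 assumes f [measurable]: "f \<in> borel_measurable borel" and inv: "!!n. distr (conv_pow n) borel f = conv_pow n"
 shows "distr (rho i) borel f = rho i"
proof (cases i)
 case 0 then show ?thesis using inv[of 0] by (simp add: rho_0 conv_pow_0)
next
 case (Suc j)
 have fm: "f \<in> rho 1 \<rightarrow>\<^sub>M borel" using f by (simp add: measurable_cong_sets[OF sets_rho refl])
 have "distr (rho 1) borel f = rho 1"
 proof (rule measure_eqI)
 fix A assume "A \<in> sets (distr (rho 1) borel f)"
 then have A: "A \<in> sets borel" by simp
 have fA: "f -` A \<in> sets borel" using measurable_sets[OF f A] by simp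
 have "emeasure (distr \<sigma> borel f) A = emeasure \<sigma> A" using inv[of 0] by (simp add: conv_pow_0)
 then have s: "emeasure \<sigma> (f -` A) = emeasure \<sigma> A"
  using f A circle_measureD(4)[OF \<sigma>_circle]
  by (subst (asm) emeasure_distr) (auto simp: measurable_cong_sets[OF circle_measureD(2)[OF \<sigma>_circle] refl])
 have eq: "emeasure \<sigma> A + emeasure (rho 1) (f -` A) = emeasure \<sigma> A + emeasure (rho 1) A"
  by (rule trans[OF rho_split[OF fA, unfolded image_invariant[OF f inv A] s, symmetric] rho_split[OF A]])
 interpret p: prob_space \<sigma> by (rule \<sigma>_prob)
 have ne: "emeasure \<sigma> A ~= \<infinity>" unfolding infinity_ennreal_def by (rule p.emeasure_finite)
 have "emeasure (rho 1) (f -` A) = emeasure (rho 1) A"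
  by (rule disjE[OF iffD1[OF ennreal_add_left_cancel eq]]) (rule notE[OF ne], assumption, assumption)
 moreover have "space (rho 1) = UNIV" using sets_eq_imp_space_eq[OF sets_rho] by simp
 ultimately show "emeasure (distr (rho 1) borel f) A = emeasure (rho 1) A"
  using emeasure_distr[OF fm A] by simp
 qed (simp add: sets_rho)
 then show ?thesis by (simp only: Suc rho_Suc)
qed

lemma rho_finite: "finite_measure (rho i)"
proof (rule finite_measureI)
 have "space (rho i) = UNIV" using sets_eq_imp_space_eq[OF sets_rho] by simp
 then show "emeasure (rho i) (space (rho i)) ~= \<infinity>"
 by (simp add: rho_emeasure ennreal_mult_eq_top_iff)
qed

lemma AE_densityI:
 assumes "f \<in> borel_measurable M" "AE x in M. Q x" shows "AE x in density M f. Q x"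
 unfolding AE_density[OF assms(1)] using assms(2) by eventually_elim (rule impI)

lemma rho_AE: "(AE z in \<theta>. Q z) ==> AE z in rho i. Q z"
 unfolding rho_def by (subst AE_density) (auto elim!: AE_mp)

lemma rho_circle: "circle_measure (rho i)"
 using rho_finite rho_AE[OF circle_measureD(3)[OF \<theta>_circle]] by (simp add: circle_measure_def sets_rho)

lemma cnj_borel [measurable]: "cnj \<in> borel_measurable borel"
 by (intro borel_measurable_continuous_onI continuous_intros)

lemma rho_Fourier_3: "(\<integral>z. z powi (3 * n) \<partial>rho i) = (\<integral>z. z powi n \<partial>rho i)"
 using circle_image_Fourier(3)[OF rho_circle, of i n] rho_image_invariant[of "%z. z ^ 3" i] conv_pow_cube by simp

lemma rho_Fourier_power: "(\<integral>z. z powi (3 ^ k * n) \<partial>rho i) = (\<integral>z. z powi n \<partial>rho i)"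
 by (induction k) (simp_all add: mult.assoc rho_Fourier_3)

lemma rho_Fourier_real: "Im (\<integral>z. z powi n \<partial>rho i) = 0"
 using circle_image_Fourier(4)[OF rho_circle, of i n] rho_image_invariant[of cnj i] conv_pow_cnj
 by (simp add: complex_eq_iff)

lemma rho_no_atom: "emeasure (rho i) {a} = 0"
proof -
 have "emeasure \<theta> ({a} \<inter> B) = 0" for B
 by (rule order_antisym[OF order_trans[OF emeasure_mono[of _ "{a}"]]]) (auto simp: \<theta>_no_atom sets_\<theta>)
 then show ?thesis by (subst rho_emeasure) auto
qed

lemma rho_total: "measure (rho i) UNIV = 1"
proof -
 interpret s: prob_space \<sigma> by (rule \<sigma>_prob)
 interpret r: finite_measure "rho 1" by (rule rho_finite)
 have e\<sigma>: "emeasure \<sigma> UNIV = 1" using s.emeasure_space_1 circle_measureD(4)[OF \<sigma>_circle] by simp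
 have e\<theta>: "emeasure \<theta> UNIV = 1" using \<theta>.emeasure_space_1 circle_measureD(4)[OF \<theta>_circle] by simp
 have "2 * emeasure \<theta> UNIV = emeasure \<sigma> UNIV + emeasure (rho 1) UNIV" by (rule rho_split) simp
 from this[unfolded e\<sigma> e\<theta>] have "1 + emeasure (rho 1) UNIV = 1 + 1" by (rule trans[OF sym]) (rule mult_2)
 from iffD1[OF ennreal_add_left_cancel this] have "emeasure (rho 1) UNIV = 1"
 by (rule disjE) (simp only: ennreal_one_neq_top infinity_ennreal_def)
 then have "measure (rho 1) UNIV = 1" by (simp add: measure_def)
 moreover have "measure (rho 0) UNIV = 1" using e\<sigma> by (simp add: rho_0 measure_def)
 ultimately show ?thesis by (cases i) (simp_all only: rho_Suc)
qed

lemma rho_integral: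
 fixes g :: "complex => complex"
 assumes "g \<in> borel_measurable borel"
 shows "(\<integral>z. g z \<partial>rho i) = (\<integral>z. of_real (dn i z) * g z \<partial>\<theta>)"
proof -
 have "(\<integral>z. g z \<partial>rho i) = (\<integral>z. dn i z *\<^sub>R g z \<partial>\<theta>)"
 unfolding rho_def by (rule integral_density) (use assms dn_nonneg in \<open>auto simp: measurable_cong_sets[OF sets_\<theta> refl]\<close>)
 then show ?thesis by (simp add: scaleR_conv_of_real)
qed

lemma circle_density:
 assumes f: "f \<in> borel_measurable borel" "integrable \<theta> f" "!!z. 0 \<le> f z"
 shows "circle_measure (density \<theta> (%z. ennreal (f z)))"
 and "(\<integral>z. z powi n \<partial>density \<theta> (%z. ennreal (f z))) = (\<integral>z. z powi n * of_real (f z) \<partial>\<theta>)"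
proof -
 note [measurable] = f(1)
 have "emeasure (density \<theta> (%z. ennreal (f z))) (space (density \<theta> (%z. ennreal (f z)))) = (\<integral>\<^sup>+z. ennreal (f z) \<partial>\<theta>)"
 by (simp add: emeasure_density space_density cong: nn_integral_cong)
 also have "\<dots> = ennreal (\<integral>z. f z \<partial>\<theta>)" using f by (intro nn_integral_eq_integral) auto
 finally have "finite_measure (density \<theta> (%z. ennreal (f z)))" by (intro finite_measureI) simp
 moreover have "AE z in density \<theta> (%z. ennreal (f z)). cmod z = 1"
 using circle_measureD(3)[OF \<theta>_circle] by (subst AE_density) (auto elim!: AE_mp)
 ultimately show "circle_measure (density \<theta> (%z. ennreal (f z)))" by (simp add: circle_measure_def sets_\<theta>)
 have "(\<integral>z. z powi n \<partial>density \<theta> (%z. ennreal (f z))) = (\<integral>z. f z *\<^sub>R z powi n \<partial>\<theta>)"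
 by (rule integral_density) (use f in auto)
 then show "(\<integral>z. z powi n \<partial>density \<theta> (%z. ennreal (f z))) = (\<integral>z. z powi n * of_real (f z) \<partial>\<theta>)"
 by (simp add: scaleR_conv_of_real mult.commute)
qed

section \<open>Densities of convolutions, images and exponentials with respect to \<theta>\<close>

text \<open>Radon-Nikodym with a version that is finite everywhere and identically zero on
  \<open>B\<close>. The set is \<open>S\<close> for convolutions and empty for images under
  cubing.\<close>

lemma density_of_ac:
 assumes \<kappa>: "circle_measure \<kappa>" and ac: "!!A. A \<in> sets borel ==> emeasure \<theta> (A - B) = 0 ==> emeasure \<kappa> A = 0"
 and B [measurable]: "B \<in> sets borel"
 obtains d where "d \<in> borel_measurable borel" "integrable \<theta> d" "!!z. 0 \<le> d z" "!!z. z \<in> B ==> d z = 0"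
 "!!n. (\<integral>z. z powi n * of_real (d z) \<partial>\<theta>) = (\<integral>z. z powi n \<partial>\<kappa>)"
proof -
 interpret \<kappa>: finite_measure \<kappa> by (rule circle_measureD[OF \<kappa>])
 note sk = circle_measureD(2)[OF \<kappa>]
 have "absolutely_continuous \<theta> \<kappa>"
 unfolding absolutely_continuous_def
 proof
 fix A assume "A \<in> null_sets \<theta>"
 then have A: "A \<in> sets borel" "emeasure \<theta> A = 0" by (auto simp: null_sets_def sets_\<theta>)
 have "emeasure \<theta> (A - B) \<le> emeasure \<theta> A" by (rule emeasure_mono) (use A in \<open>auto simp: sets_\<theta>\<close>)
 then have "emeasure \<kappa> A = 0" using A by (intro ac) auto
 then show "A \<in> null_sets \<kappa>" using A sk by (auto simp: null_sets_def)
 qed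
 then obtain D where D [measurable]: "D \<in> borel_measurable \<theta>" and Dk: "density \<theta> D = \<kappa>"
 using \<theta>.Radon_Nikodym[of \<kappa>] sk sets_\<theta> by auto
 have "(\<integral>\<^sup>+z. D z \<partial>\<theta>) = emeasure \<kappa> (space \<theta>)"
 unfolding Dk[symmetric] by (subst emeasure_density) (auto intro!: nn_integral_cong)
 then have "(\<integral>\<^sup>+z. D z \<partial>\<theta>) ~= \<infinity>" by simp
 then have fin: "AE z in \<theta>. D z ~= \<infinity>" by (rule nn_integral_PInf_AE[OF D])
 \<comment> \<open>The hypothesis applies to \<open>B\<close> itself since \<open>B - B\<close> is
   empty.\<close>
 have "emeasure \<kappa> B = 0" by (rule ac[OF B]) simp
 then have "(\<integral>\<^sup>+z. D z * indicator B z \<partial>\<theta>) = 0"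
 unfolding Dk[symmetric] by (subst (asm) emeasure_density) (auto simp: sets_\<theta>)
 then have zero: "AE z in \<theta>. D z * indicator B z = 0"
 by (subst (asm) nn_integral_0_iff_AE) auto
 define d where "d z = indicator (- B) z * enn2real (D z)" for z
 have dm: "d \<in> borel_measurable borel"
 proof -
 have "d \<in> borel_measurable \<theta>" unfolding d_def by measurable
 then show ?thesis by (simp only: measurable_cong_sets[OF sets_\<theta> refl])
 qed
 have d0: "0 \<le> d z" for z by (simp add: d_def)
 have eqD: "AE z in \<theta>. ennreal (d z) = D z"
 using fin zero by eventually_elim (auto simp: d_def indicator_def less_top split: if_splits)
 have "(\<integral>\<^sup>+z. ennreal (d z) \<partial>\<theta>) = (\<integral>\<^sup>+z. D z \<partial>\<theta>)" by (rule nn_integral_cong_AE[OF eqD])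
 then have di: "integrable \<theta> d"
 using \<open>(\<integral>\<^sup>+z. D z \<partial>\<theta>) ~= \<infinity>\<close> dm d0 by (intro integrableI_nonneg) (auto simp: less_top)
 have "density \<theta> (%z. ennreal (d z)) = \<kappa>"
 unfolding Dk[symmetric] by (rule density_cong) (use eqD dm in auto)
 then have "(\<integral>z. z powi n * of_real (d z) \<partial>\<theta>) = (\<integral>z. z powi n \<partial>\<kappa>)" for n
 using circle_density(2)[OF dm di d0] by simp
 moreover have "d z = 0" if "z \<in> B" for z using that by (simp add: d_def)
 ultimately show thesis using that dm di d0 by blast
qed

text \<open>This is where the choice of \<theta> pays off. If \<open>A - S\<close> is \<theta>-null,
  then \<open>A\<close> is null for every convolution power with at least two factors. Each
  \<open>conv_pow n\<close> convolved with \<open>conv_pow m\<close> is such a power, so almost all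
  sections of \<open>A\<close> are null for every \<open>conv_pow m\<close>, hence for \<theta> and
  for everything absolutely continuous to it.\<close>

lemma conv_density:
 assumes f: "f \<in> borel_measurable borel" "integrable \<theta> f" "!!z. 0 \<le> f z"
 and g: "g \<in> borel_measurable borel" "integrable \<theta> g" "!!z. 0 \<le> g z"
 obtains d where "d \<in> borel_measurable borel" "integrable \<theta> d" "!!z. 0 \<le> d z" "!!z. z \<in> S ==> d z = 0"
 "!!n. (\<integral>z. z powi n * of_real (d z) \<partial>\<theta>) = (\<integral>z. z powi n * of_real (f z) \<partial>\<theta>) * (\<integral>z. z powi n * of_real (g z) \<partial>\<theta>)"
proof -
 let ?f = "density \<theta> (%z. ennreal (f z))" and ?g = "density \<theta> (%z. ennreal (g z))"
 note cf = circle_density[OF f] and cg = circle_density[OF g]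
 have fm [measurable]: "f \<in> borel_measurable borel" and gm [measurable]: "g \<in> borel_measurable borel"
 using f g by auto
 have "emeasure (mconv ?f ?g) A = 0" if A [measurable]: "A \<in> sets borel" and 0: "emeasure \<theta> (A - S) = 0" for A
 proof -
 have cA: "emeasure (conv_pow (Suc n)) A = 0" for n
 proof -
  have "emeasure (conv_pow (Suc n)) (A - S) = 0" using 0 \<theta>_null[of "A - S"] by auto
  moreover have "emeasure (conv_pow (Suc n)) A \<le> emeasure (conv_pow (Suc n)) (A - S) + emeasure (conv_pow (Suc n)) S"
  by (rule order_trans[OF emeasure_mono emeasure_subadditive]) (auto simp: sets_conv_pow)
  ultimately show ?thesis using conv_pow_S[of "Suc n"] by simp
 qed
 have sec: "{w. z * w \<in> A} \<in> sets borel" for z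
 proof -
  have "{w \<in> space borel. z * w \<in> A} \<in> sets borel" by measurable
  then show ?thesis by simp
 qed
 have em: "(%z. emeasure (conv_pow m) {w. z * w \<in> A}) \<in> borel_measurable borel" for m
 proof -
  interpret prob_space "conv_pow m" by (rule conv_pow_prob)
  have "(%p. fst p * snd p) -` A \<inter> space (borel \<Otimes>\<^sub>M conv_pow m) \<in> sets (borel \<Otimes>\<^sub>M conv_pow m)"
  proof -
  have "(%p. fst p * snd p) \<in> borel_measurable (borel \<Otimes>\<^sub>M borel :: (complex \<times> complex) measure)" by measurable
  then have "(%p. fst p * snd p) \<in> borel_measurable (borel \<Otimes>\<^sub>M conv_pow m)"
   by (simp only: measurable_cong_sets[OF sets_pair_measure_cong[OF refl sets_conv_pow] refl])
  then show ?thesis by (rule measurable_sets) simp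
  qed
  from measurable_emeasure_Pair[OF this]
  have "(%z. emeasure (conv_pow m) (Pair z -` ((%p. fst p * snd p) -` A \<inter> space (borel \<Otimes>\<^sub>M conv_pow m)))) \<in> borel_measurable borel" .
  moreover have "Pair z -` ((%p. fst p * snd p) -` A \<inter> space (borel \<Otimes>\<^sub>M conv_pow m)) = {w. z * w \<in> A}" for z
  using circle_measureD(4)[OF conv_pow_circle, of m] by (auto simp: space_pair_measure)
  ultimately show ?thesis by simp
 qed
 have 1: "AE z in conv_pow n. emeasure (conv_pow m) {w. z * w \<in> A} = 0" for n m
 proof -
  have "(\<integral>\<^sup>+z. emeasure (conv_pow m) {w. z * w \<in> A} \<partial>conv_pow n) = 0"
  using mconv_circle(3)[OF conv_pow_circle conv_pow_circle A, of n m] cA mconv_conv_pow[of n m] by simp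
  then show ?thesis
  using em by (subst (asm) nn_integral_0_iff_AE) (auto simp: measurable_cong_sets[OF sets_conv_pow refl])
 qed
 have "AE z in \<theta>. \<forall>m. emeasure (conv_pow m) {w. z * w \<in> A} = 0"
  unfolding AE_all_countable
 proof
  fix m
  have "Measurable.pred borel (%z. emeasure (conv_pow m) {w. z * w \<in> A} = 0)" using em by measurable
  then show "AE z in \<theta>. emeasure (conv_pow m) {w. z * w \<in> A} = 0" using 1 by (simp add: \<theta>_AE)
 qed
 then have 2: "AE z in \<theta>. emeasure ?g {w. z * w \<in> A} = 0"
 proof eventually_elim
  case (elim z)
  then have "emeasure \<theta> {w. z * w \<in> A} = 0" using \<theta>_null[OF sec] by simp
  then have "{w. z * w \<in> A} \<in> null_sets \<theta>" using sec by (auto simp: null_sets_def sets_\<theta>)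
  then have "AE w in \<theta>. w \<notin> {w. z * w \<in> A}" by (rule AE_not_in)
  then have "AE w in ?g. w \<notin> {w. z * w \<in> A}" by (subst AE_density) (auto elim!: AE_mp)
  then have "{w. z * w \<in> A} \<in> null_sets ?g" using sec by (subst AE_iff_null_sets) (auto simp: sets_\<theta>)
  then show ?case by (rule null_setsD1)
 qed
 have "emeasure (mconv ?f ?g) A = (\<integral>\<^sup>+z. emeasure ?g {w. z * w \<in> A} \<partial>?f)"
  by (rule mconv_circle(3)[OF cf(1) cg(1) A])
 also have "\<dots> = (\<integral>\<^sup>+z. 0 \<partial>?f)"
  by (rule nn_integral_cong_AE) (use 2 in \<open>subst AE_density, auto elim!: AE_mp\<close>)
 finally show ?thesis by simp
 qed
 from density_of_ac[OF mconv_circle(1)[OF cf(1) cg(1)] this S_borel]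
 show thesis using that unfolding mconv_circle(2)[OF cf(1) cg(1)] cf(2) cg(2) by blast
qed

text \<open>\<open>f\<close> is a density of the image of \<open>R\<close> times \<theta> under
  \<open>z ^ 3 ^ k\<close>. The image stays absolutely continuous because cubing preserves \<theta>;
  the induction cubes once per step.\<close>

lemma push_density:
 assumes R: "R \<in> borel_measurable borel" "integrable \<theta> R" "!!z. 0 \<le> R z"
 obtains f where "f \<in> borel_measurable borel" "integrable \<theta> f" "!!z. 0 \<le> f z"
 "!!n. (\<integral>z. z powi n * of_real (f z) \<partial>\<theta>) = (\<integral>z. z powi (3 ^ k * n) * of_real (R z) \<partial>\<theta>)"
proof (induction k arbitrary: thesis)
 case 0
 then show ?case using R by simp
next
 case (Suc k)
 obtain f where f: "f \<in> borel_measurable borel" "integrable \<theta> f" "!!z. 0 \<le> f z"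
 "!!n. (\<integral>z. z powi n * of_real (f z) \<partial>\<theta>) = (\<integral>z. z powi (3 ^ k * n) * of_real (R z) \<partial>\<theta>)"
 using Suc.IH by blast
 let ?f = "density \<theta> (%z. ennreal (f z))"
 note cf = circle_density[OF f(1-3)]
 note ci = circle_image_Fourier[OF cf(1)]
 have ac: "emeasure (distr ?f borel (%z. z ^ 3)) A = 0" if A: "A \<in> sets borel" and 0: "emeasure \<theta> (A - {}) = 0" for A
 proof -
 have pm: "(%z::complex. z ^ 3) \<in> borel_measurable borel" by measurable
 have A3: "(%z. z ^ 3) -` A \<in> sets borel" using measurable_sets[OF pm A] by simp
 have "emeasure \<theta> ((%z. z ^ 3) -` A) = 0" using image_invariant[OF pm conv_pow_cube A] 0 by simp
 then have "(%z. z ^ 3) -` A \<in> null_sets \<theta>" using A3 by (auto simp: null_sets_def sets_\<theta>)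
 then have "AE w in \<theta>. w \<notin> (%z. z ^ 3) -` A" by (rule AE_not_in)
 then have "AE w in ?f. w \<notin> (%z. z ^ 3) -` A"
  by (intro AE_densityI) (use f(1) in measurable)
 then have "(%z. z ^ 3) -` A \<in> null_sets ?f" using A3 by (subst AE_iff_null_sets) (auto simp: sets_\<theta>)
 then show ?thesis using A pm circle_measureD(4)[OF cf(1)]
  by (subst emeasure_distr) (auto simp: measurable_cong_sets[OF circle_measureD(2)[OF cf(1)] refl] dest: null_setsD1)
 qed
 show ?case
 proof (rule density_of_ac[OF ci(1) ac sets.empty_sets])
 fix d assume d: "d \<in> borel_measurable borel" "integrable \<theta> d" "!!z. 0 \<le> d z"
  "!!n. (\<integral>z. z powi n * of_real (d z) \<partial>\<theta>) = (\<integral>z. z powi n \<partial>distr ?f borel (%z. z ^ 3))"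
 have "3 ^ Suc k * n = 3 ^ k * (3 * n)" for n :: int by simp
 then show ?case by (intro Suc.prems[OF d(1-3)]) (simp only: d(4) ci(3) cf(2) f(4))
 qed
qed

text \<open>The exponential series without its first two terms is realised termwise by densities of
  iterated convolutions of \<open>f\<close> with itself. Each of these vanishes on \<open>S\<close>,
  and their sum converges because the total masses form an exponential series.\<close>

lemma exp_density:
 assumes f: "f \<in> borel_measurable borel" "integrable \<theta> f" "!!z. 0 \<le> f z"
 defines "c \<equiv> %n. \<integral>z. z powi n * of_real (f z) \<partial>\<theta>"
 obtains d where "d \<in> borel_measurable borel" "integrable \<theta> d" "!!z. 0 \<le> d z" "!!z. z \<in> S ==> d z = 0"
 "!!n. (\<integral>z. z powi n * of_real (d z) \<partial>\<theta>) = exp (c n) - 1 - c n"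
proof -
 have c: "(\<integral>z. z powi n * of_real (f z) \<partial>\<theta>) = c n" for n by (simp only: c_def)
 \<comment> \<open>\<open>m\<close> stands for the power \<open>m + 2\<close>: with the constant and
   linear terms gone, the induction starts from a genuine convolution, which already vanishes on
   \<open>S\<close>.\<close>
 define good where "good m d \<longleftrightarrow> d \<in> borel_measurable borel & integrable \<theta> d & (\<forall>z. 0 \<le> d z) & (\<forall>z\<in>S. d z = 0) &
 (\<forall>n. (\<integral>z. z powi n * of_real (d z) \<partial>\<theta>) = c n ^ (m + 2))" for m and d :: "complex => real"
 have "\<exists>d. good m d" for m
 proof (induction m)
 case 0
 show ?case
 proof (rule conv_density[OF f f, unfolded c])
  fix d assume "d \<in> borel_measurable borel" "integrable \<theta> d" "!!z. 0 \<le> d z" "!!z. z \<in> S ==> d z = 0"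
  "!!n. (\<integral>z. z powi n * of_real (d z) \<partial>\<theta>) = c n * c n"
  then have "good 0 d" by (simp add: good_def power2_eq_square)
  then show ?case by blast
 qed
 next
 case (Suc m)
 then obtain e where e: "e \<in> borel_measurable borel" "integrable \<theta> e" "!!z. 0 \<le> e z"
  "!!n. (\<integral>z. z powi n * of_real (e z) \<partial>\<theta>) = c n ^ (m + 2)" by (auto simp: good_def)
 show ?case
 proof (rule conv_density[OF f e(1-3), unfolded c e(4)])
  fix d assume "d \<in> borel_measurable borel" "integrable \<theta> d" "!!z. 0 \<le> d z" "!!z. z \<in> S ==> d z = 0"
  "!!n. (\<integral>z. z powi n * of_real (d z) \<partial>\<theta>) = c n * c n ^ (m + 2)"
  then have "good (Suc m) d" by (simp add: good_def)
  then show ?case by blast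
 qed
 qed
 then obtain D where D: "!!m. good m (D m)" by metis
 have Dm [measurable]: "D m \<in> borel_measurable borel" and Di: "integrable \<theta> (D m)" and D0: "0 \<le> D m z"
 and DS: "z \<in> S ==> D m z = 0" and Dc: "(\<integral>z. z powi n * of_real (D m z) \<partial>\<theta>) = c n ^ (m + 2)" for m n z
 using D[of m] by (auto simp: good_def)
 \<comment> \<open>Frequency 0 gives total masses; since the densities are nonnegative, these are
   their L1 norms and control the convergence of the series.\<close>
 define C where "C = (\<integral>z. f z \<partial>\<theta>)"
 have c0: "c 0 = of_real C" by (simp add: c_def C_def)
 have DC: "(\<integral>z. D m z \<partial>\<theta>) = C ^ (m + 2)" for m
 proof -
 have "complex_of_real (\<integral>z. D m z \<partial>\<theta>) = of_real (C ^ (m + 2))" using Dc[of 0 m] c0 by simp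
 then show ?thesis by (simp only: of_real_eq_iff)
 qed
 have expsum: "(%m. x ^ (m + 2) / fact (m + 2)) sums (exp x - 1 - x)" for x :: complex
 proof -
 have "(%n. x ^ n / fact n) sums exp x" using exp_converges[of x] by (simp add: scaleR_conv_of_real field_simps)
 from sums_split_initial_segment[OF this, of 2] show ?thesis by (simp add: numeral_2_eq_2 algebra_simps)
 qed
 have summ: "summable (%m. C ^ (m + 2) / fact (m + 2))"
 using summable_exp[of C] summable_ignore_initial_segment[of "%n. inverse (fact n) * C ^ n" 2]
 by (simp add: field_simps)
 define h where "h m z = D m z / fact (m + 2)" for m z
 have hm [measurable]: "h m \<in> borel_measurable borel" for m unfolding h_def by measurable
 have h0: "0 \<le> h m z" for m z by (simp add: h_def D0)
 have hi: "integrable \<theta> (h m)" for m unfolding h_def using Di by simp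
 have hC: "(\<integral>z. h m z \<partial>\<theta>) = C ^ (m + 2) / fact (m + 2)" for m unfolding h_def by (simp only: integral_divide_zero DC)
 have hC0: "0 \<le> C ^ (m + 2) / fact (m + 2)" for m
 unfolding hC[symmetric] by (rule integral_nonneg_AE) (simp add: h0)
 have "(\<integral>\<^sup>+z. (\<Sum>m. ennreal (h m z)) \<partial>\<theta>) = (\<Sum>m. \<integral>\<^sup>+z. ennreal (h m z) \<partial>\<theta>)"
 by (rule nn_integral_suminf) measurable
 also have "\<dots> = (\<Sum>m. ennreal (C ^ (m + 2) / fact (m + 2)))"
 using hi h0 by (intro suminf_cong) (simp only: hC[symmetric], intro nn_integral_eq_integral, auto)
 also have "\<dots> ~= \<infinity>"
 by (subst suminf_ennreal2[OF hC0 summ]) simp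
 finally have "AE z in \<theta>. (\<Sum>m. ennreal (h m z)) ~= \<infinity>"
 by (intro nn_integral_PInf_AE) auto
 then have hs: "AE z in \<theta>. summable (%m. h m z)"
 by eventually_elim (intro summable_suminf_not_top h0, auto)
 define d where "d z = enn2real (\<Sum>m. ennreal (h m z))" for z
 have dm: "d \<in> borel_measurable borel" unfolding d_def by measurable
 have dh: "AE z in \<theta>. d z = (\<Sum>m. h m z)"
 using hs by eventually_elim (simp add: d_def suminf_ennreal2 h0 suminf_nonneg)
 have hn: "(\<integral>z. norm (h m z) \<partial>\<theta>) = C ^ (m + 2) / fact (m + 2)" for m
 by (simp only: real_norm_def abs_of_nonneg[OF h0] hC)
 have hsum: "integrable \<theta> (%z. \<Sum>m. h m z)"
 proof (rule integrable_suminf[OF hi])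
 show "AE z in \<theta>. summable (%m. norm (h m z))" using hs by (simp only: real_norm_def abs_of_nonneg[OF h0])
 show "summable (%m. \<integral>z. norm (h m z) \<partial>\<theta>)" using summ by (simp only: hn)
 qed
 have di: "integrable \<theta> d"
 proof (rule iffD2[OF integrable_cong_AE[OF _ _ dh] hsum])
 show "d \<in> borel_measurable \<theta>" using dm by (simp only: measurable_cong_sets[OF sets_\<theta> refl])
 qed measurable
 have "(\<integral>z. z powi n * of_real (d z) \<partial>\<theta>) = exp (c n) - 1 - c n" for n
 proof -
 define k where "k m z = z powi n * complex_of_real (h m z)" for m z
 have ki: "integrable \<theta> (k m)" for m
  unfolding k_def by (rule power_int_integrable[OF \<theta>_circle]) (use hi in simp)
 have kn: "AE z in \<theta>. norm (k m z) = h m z" for m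
  using circle_measureD(3)[OF \<theta>_circle] by eventually_elim (simp add: k_def norm_mult norm_power_int h0)
 have "AE z in \<theta>. \<forall>m. norm (k m z) = h m z" unfolding AE_all_countable using kn by (intro allI)
 then have ks: "AE z in \<theta>. summable (%m. norm (k m z))" using hs by eventually_elim simp
 have kint: "(\<integral>z. norm (k m z) \<partial>\<theta>) = C ^ (m + 2) / fact (m + 2)" for m
 proof -
  have "(\<integral>z. norm (k m z) \<partial>\<theta>) = (\<integral>z. h m z \<partial>\<theta>)"
  by (rule integral_cong_AE) (use ki kn hi in auto)
  then show ?thesis by (simp only: hC)
 qed
 have "(\<integral>z. z powi n * of_real (d z) \<partial>\<theta>) = (\<integral>z. (\<Sum>m. k m z) \<partial>\<theta>)"
 proof (rule integral_cong_AE)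
  show "(%z. z powi n * of_real (d z)) \<in> borel_measurable \<theta>"
  using dm by measurable
  show "(%z. \<Sum>m. k m z) \<in> borel_measurable \<theta>" using ki by measurable
  show "AE z in \<theta>. z powi n * of_real (d z) = (\<Sum>m. k m z)"
  using dh hs
  proof eventually_elim
  case (elim z)
  have "(%m. z powi n * complex_of_real (h m z)) sums (z powi n * of_real (\<Sum>m. h m z))"
   by (intro sums_mult sums_of_real summable_sums elim)
  then show ?case unfolding elim k_def by (rule sums_unique)
  qed
 qed
 also have "\<dots> = (\<Sum>m. \<integral>z. k m z \<partial>\<theta>)"
  by (rule integral_suminf[OF ki ks]) (simp only: kint summ)
 also have "\<dots> = (\<Sum>m. c n ^ (m + 2) / fact (m + 2))"
 proof (rule suminf_cong)
  fix m
  have "(\<integral>z. k m z \<partial>\<theta>) = (\<integral>z. z powi n * of_real (D m z) / fact (m + 2) \<partial>\<theta>)"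
  by (simp add: k_def h_def)
  then show "(\<integral>z. k m z \<partial>\<theta>) = c n ^ (m + 2) / fact (m + 2)" by (simp only: integral_divide_zero Dc)
 qed
 also have "\<dots> = exp (c n) - 1 - c n" using sums_unique[OF expsum] by simp
 finally show ?thesis .
 qed
 moreover have "d z = 0" if "z \<in> S" for z using that by (simp add: d_def h_def DS)
 moreover have "0 \<le> d z" for z by (simp add: d_def)
 ultimately show thesis using that dm di by blast
qed

section \<open>Orthonormal branch functions for the iterated cubing map\<close>

text \<open>The ternary digits of \<open>l\<close>, lowest first, choose a branch at each of
  \<open>k\<close> successive cubings; \<open>mod 3 - 1\<close> shifts the digits 0, 1, 2 to the
  index set -1, 0, 1 of \<open>w\<close>.\<close>

fun wk :: "nat => nat => complex => complex" where
 "wk 0 l z = 1"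
| "wk (Suc k) l z = w (int (l mod 3) - 1) z * wk k (l div 3) (z ^ 3)"

lemma wk_measurable [measurable]: "wk k l \<in> borel_measurable borel"
proof (induction k arbitrary: l)
 case (Suc k)
 note [measurable] = Suc[of "l div 3"]
 have "(%z. w (int (l mod 3) - 1) z * wk k (l div 3) (z ^ 3)) \<in> borel_measurable borel" by measurable
 then show ?case by simp
next
 case 0
 have "wk 0 l = (%_. 1)" by (rule ext) simp
 then show ?case by simp
qed

lemma wk_bound: "cmod (wk k l z) \<le> 2 ^ k"
 by (induction k arbitrary: l z) (auto simp: norm_mult intro!: mult_mono w_bound)

text \<open>\<open>w_orthonormal\<close> removes the lowest digit, with the remaining product as its
  bounded function of \<open>z ^ 3\<close>; this is why a bound on \<open>g\<close> is carried
  along.\<close>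

lemma wk_orthonormal:
 assumes "l < 3 ^ k" "l' < 3 ^ k" "g \<in> borel_measurable borel" "!!z. cmod (g z) \<le> B"
 shows "(\<integral>z. wk k l z * cnj (wk k l' z) * g (z ^ (3 ^ k)) \<partial>\<sigma>) = (if l = l' then \<integral>z. g z \<partial>\<sigma> else 0)"
 using assms
proof (induction k arbitrary: l l')
 case (Suc k)
 note [measurable] = Suc.prems(3)
 have d: "int (j mod 3) - 1 \<in> {-1, 0, 1}" for j :: nat
 proof -
 have "j mod 3 < 3" by simp
 then have "j mod 3 = 0 \<or> j mod 3 = 1 \<or> j mod 3 = 2" by linarith
 then show ?thesis by auto
 qed
 have l3: "l div 3 < 3 ^ k" "l' div 3 < 3 ^ k"
 using Suc.prems(1,2) by (simp_all add: less_mult_imp_div_less mult.commute)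
 define G where "G z = wk k (l div 3) z * cnj (wk k (l' div 3) z) * g (z ^ (3 ^ k))" for z
 have [measurable]: "(%z. cnj (wk k (l' div 3) z)) \<in> borel_measurable borel"
 by (rule measurable_compose[OF wk_measurable cnj_borel])
 have Gm: "G \<in> borel_measurable borel" unfolding G_def by measurable
 have B0: "0 \<le> B" by (rule order_trans[OF norm_ge_zero Suc.prems(4)[of 0]])
 have Gb: "cmod (G z) \<le> 2 ^ k * 2 ^ k * B" for z
 unfolding G_def norm_mult complex_mod_cnj using B0
 by (intro mult_mono wk_bound Suc.prems(4) mult_nonneg_nonneg) auto
 have "wk (Suc k) l z * cnj (wk (Suc k) l' z) * g (z ^ (3 ^ Suc k))
  = w (int (l mod 3) - 1) z * cnj (w (int (l' mod 3) - 1) z) * G (z ^ 3)" for z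
 proof -
 have e: "z ^ (3 ^ Suc k) = (z ^ 3) ^ (3 ^ k)" by (simp only: power_Suc power_mult)
 show ?thesis unfolding G_def e wk.simps complex_cnj_mult by (simp only: mult_ac)
 qed
 then have "(\<integral>z. wk (Suc k) l z * cnj (wk (Suc k) l' z) * g (z ^ (3 ^ Suc k)) \<partial>\<sigma>)
  = (\<integral>z. w (int (l mod 3) - 1) z * cnj (w (int (l' mod 3) - 1) z) * G (z ^ 3) \<partial>\<sigma>)" by (simp only:)
 also have "\<dots> = (if int (l mod 3) - 1 = int (l' mod 3) - 1 then \<integral>z. G z \<partial>\<sigma> else 0)"
 by (rule w_orthonormal[OF d d Gm Gb])
 also have "(\<integral>z. G z \<partial>\<sigma>) = (if l div 3 = l' div 3 then \<integral>z. g z \<partial>\<sigma> else 0)"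
 unfolding G_def by (rule Suc.IH[OF l3 Suc.prems(3,4)])
 also have "(if int (l mod 3) - 1 = int (l' mod 3) - 1 then if l div 3 = l' div 3 then \<integral>z. g z \<partial>\<sigma> else 0 else 0)
  = (if l = l' then \<integral>z. g z \<partial>\<sigma> else 0)"
 proof -
 have "l = l' \<longleftrightarrow> l mod 3 = l' mod 3 & l div 3 = l' div 3" by (metis div_mult_mod_eq)
 then show ?thesis by simp
 qed
 finally show ?case .
qed simp

section \<open>Cholesky factorisation of an infinite positive definite matrix\<close>

lemma lower_triangular_solve:
 fixes a :: "nat => nat => real"
 assumes "!!j l. j < l ==> a j l = 0" "!!j. j < n ==> a j j ~= 0"
 shows "\<exists>b. (\<forall>l\<ge>n. b l = 0) & (\<forall>j<n. (\<Sum>l<n. a j l * b l) = r j)"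
 using assms(2)
proof (induct n)
 case (Suc n)
 then obtain b where b: "\<forall>l\<ge>n. b l = 0" "!!j. j < n ==> (\<Sum>l<n. a j l * b l) = r j" by (metis less_SucI)
 define b' where "b' = b(n := (r n - (\<Sum>l<n. a n l * b l)) / a n n)"
 have e: "(\<Sum>l<n. a j l * b' l) = (\<Sum>l<n. a j l * b l)" for j by (rule sum.cong) (auto simp: b'_def)
 have "(\<Sum>l<Suc n. a j l * b' l) = r j" if "j < Suc n" for j
 proof (cases "j = n")
 case True with Suc(2)[of n] show ?thesis by (simp add: e) (simp add: b'_def)
 next
 case False with that b(2)[of j] assms(1)[of j n] show ?thesis by (simp add: e)
 qed
 then show ?case using b(1) by (intro exI[of _ b']) (simp add: b'_def)
qed auto

lemma upper_triangular_solve: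
 fixes a :: "nat => nat => real"
 assumes "!!j l. j < l ==> a j l = 0" "!!j. j < n ==> a j j ~= 0"
 shows "\<exists>c. \<forall>l<n. (\<Sum>j<n. c j * a j l) = r l"
 using assms(2)
proof (induct n arbitrary: r)
 case (Suc n)
 obtain c where c: "!!l. l < n ==> (\<Sum>j<n. c j * a j l) = r l - r n / a n n * a n l"
 using Suc(1)[of "%l. r l - r n / a n n * a n l"] Suc(2) by auto
 define c' where "c' = c(n := r n / a n n)"
 have e: "(\<Sum>j<n. c' j * a j l) = (\<Sum>j<n. c j * a j l)" for l by (rule sum.cong) (auto simp: c'_def)
 have z: "(\<Sum>j<n. c j * a j n) = 0" by (rule sum.neutral) (simp add: assms(1))
 have "(\<Sum>j<Suc n. c' j * a j l) = r l" if "l < Suc n" for l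
 proof (cases "l = n")
 case True with Suc(2)[of n] z show ?thesis by (simp add: e) (simp add: c'_def)
 next
 case False with that c[of l] show ?thesis by (simp add: e) (simp add: c'_def)
 qed
 then show ?case by blast
qed auto

text \<open>The new row \<open>b\<close> solves a triangular system. Choosing \<open>c\<close> with
  \<open>c n = 1\<close> that solves the transposed system for \<open>- b\<close>, the quadratic
  form at \<open>c\<close> equals \<open>K n n\<close> minus the squared length of \<open>b\<close>.
  This Schur complement is positive by hypothesis, and its root is the new diagonal entry.\<close>

lemma cholesky_step:
 fixes a K :: "nat => nat => real"
 assumes a: "!!j l. j < l ==> a j l = 0" "!!j. j < n ==> a j j ~= 0"
 and K: "!!i j. i < n ==> j < n ==> (\<Sum>l<n. a i l * a j l) = K i j"
 and sym: "!!i j. K i j = K j i"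
 and pos: "!!c. c n = 1 ==> 0 < (\<Sum>i\<le>n. \<Sum>j\<le>n. c i * c j * K i j)"
 shows "\<exists>b. (\<forall>l>n. b l = 0) & b n ~= 0 & (\<forall>j<n. (\<Sum>l<n. a j l * b l) = K n j) & (\<Sum>l\<le>n. b l * b l) = K n n"
proof -
 obtain b where b: "!!l. l \<ge> n ==> b l = 0" "!!j. j < n ==> (\<Sum>l<n. a j l * b l) = K n j"
 using lower_triangular_solve[of a n "K n"] a by metis
 obtain c0 where c0: "!!l. l < n ==> (\<Sum>j<n. c0 j * a j l) = - b l"
 using upper_triangular_solve[of a n "%l. - b l"] a by metis
 define c where "c = c0(n := 1)"
 have c: "c n = 1" "!!l. l < n ==> (\<Sum>j<n. c j * a j l) = - b l"
 proof -
 fix l assume "l < n"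
 have "(\<Sum>j<n. c j * a j l) = (\<Sum>j<n. c0 j * a j l)" by (rule sum.cong) (auto simp: c_def)
 with c0[OF \<open>l < n\<close>] show "(\<Sum>j<n. c j * a j l) = - b l" by simp
 qed (simp add: c_def)
 have 1: "(\<Sum>j<n. c j * K n j) = - (\<Sum>l<n. b l * b l)"
 proof -
 have "(\<Sum>j<n. c j * K n j) = (\<Sum>j<n. \<Sum>l<n. c j * (a j l * b l))"
  by (intro sum.cong refl) (simp add: b(2)[symmetric] sum_distrib_left)
 also have "\<dots> = (\<Sum>l<n. (\<Sum>j<n. c j * a j l) * b l)"
  by (subst sum.swap) (simp add: sum_distrib_right mult.assoc)
 also have "\<dots> = - (\<Sum>l<n. b l * b l)" by (simp add: c(2) sum_negf)
 finally show ?thesis .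
 qed
 have 2: "(\<Sum>i<n. \<Sum>j<n. c i * c j * K i j) = (\<Sum>l<n. b l * b l)"
 proof -
 have "(\<Sum>i<n. \<Sum>j<n. c i * c j * K i j) = (\<Sum>i<n. \<Sum>j<n. \<Sum>l<n. (c i * a i l) * (c j * a j l))"
  by (intro sum.cong refl) (simp add: K[symmetric] sum_distrib_left mult_ac)
 also have "\<dots> = (\<Sum>i<n. \<Sum>l<n. (c i * a i l) * (\<Sum>j<n. c j * a j l))"
  by (rule sum.cong[OF refl], subst sum.swap) (simp add: sum_distrib_left)
 also have "\<dots> = (\<Sum>l<n. (\<Sum>i<n. c i * a i l) * (\<Sum>j<n. c j * a j l))"
  by (subst sum.swap) (simp add: sum_distrib_right)
 also have "\<dots> = (\<Sum>l<n. b l * b l)" by (intro sum.cong refl) (simp add: c(2))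
 finally show ?thesis .
 qed
 have "(\<Sum>i\<le>n. \<Sum>j\<le>n. c i * c j * K i j) = (\<Sum>i<n. \<Sum>j<n. c i * c j * K i j) + 2 * (\<Sum>j<n. c j * K n j) + K n n"
 proof -
 have "(\<Sum>i<n. c i * K i n) = (\<Sum>j<n. c j * K n j)" by (rule sum.cong[OF refl]) (metis sym)
 then show ?thesis by (simp add: lessThan_Suc_atMost[symmetric] sum.distrib c(1))
 qed
 with pos[of c] c(1) 1 2 have p: "0 < K n n - (\<Sum>l<n. b l * b l)" by simp
 define b' where "b' = b(n := sqrt (K n n - (\<Sum>l<n. b l * b l)))"
 have e: "(\<Sum>l<n. f l * b' l) = (\<Sum>l<n. f l * b l)" "(\<Sum>l<n. b' l * b' l) = (\<Sum>l<n. b l * b l)" for f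
 by (auto intro!: sum.cong simp: b'_def)
 have "(\<Sum>l\<le>n. b' l * b' l) = K n n"
 using p by (simp add: lessThan_Suc_atMost[symmetric] e) (simp add: b'_def)
 moreover have "b' n ~= 0" using p by (simp add: b'_def)
 moreover have "\<forall>l>n. b' l = 0" using b(1) by (simp add: b'_def)
 ultimately show ?thesis using b(2) e(1) by metis
qed

text \<open>Rows are added one at a time and never altered, so the finite factors fit together to an
  infinite triangular matrix. Its rows serve twice: as vectors of \<open>ell2\<close> on which
  \<open>U\<close> is defined and as the coefficients of a Gaussian process.\<close>

theorem cholesky:
 fixes K :: "nat => nat => real"
 assumes sym: "!!i j. K i j = K j i"
 and pos: "!!n c. c n = 1 ==> 0 < (\<Sum>i\<le>n. \<Sum>j\<le>n. c i * c j * K i j)"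
 obtains a where "!!j l. j < l ==> a j l = 0" "!!j. a j j ~= 0"
 "!!i j m. i \<le> m ==> j \<le> m ==> (\<Sum>l\<le>m. a i l * a j l) = K i j"
proof -
 define good where "good n a \<longleftrightarrow> (\<forall>j l. j < l \<or> n \<le> j --> a j l = 0) & (\<forall>j<n. a j j ~= 0) &
  (\<forall>i<n. \<forall>j<n. (\<Sum>l<n. a i l * a j l) = K i j)" for n and a :: "nat => nat => real"
 have step: "\<exists>b. good (Suc n) (a(n := b))" if g: "good n a" for n a
 proof -
 have t: "!!j l. j < l ==> a j l = 0" "!!j l. n \<le> j ==> a j l = 0" "!!j. j < n ==> a j j ~= 0"
  "!!i j. i < n ==> j < n ==> (\<Sum>l<n. a i l * a j l) = K i j" using g unfolding good_def by blast+
 obtain b where b: "\<forall>l>n. b l = 0" "b n ~= 0" "!!j. j < n ==> (\<Sum>l<n. a j l * b l) = K n j" "(\<Sum>l\<le>n. b l * b l) = K n n"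
  using cholesky_step[of a n K, OF t(1,3,4) sym pos] by metis
 have "(\<Sum>l<Suc n. (a(n := b)) i l * (a(n := b)) j l) = K i j" if "i < Suc n" "j < Suc n" for i j
 proof -
  consider "i < n" "j < n" | "i = n" "j < n" | "i < n" "j = n" | "i = n" "j = n" using \<open>i < Suc n\<close> \<open>j < Suc n\<close> by linarith
  then show ?thesis
  proof cases
  case 1 then show ?thesis using t(4)[of i j] t(1)[of i n] by simp
  next
  case 2 then show ?thesis using b(3)[of j] t(1)[of j n] by (simp add: mult.commute)
  next
  case 3 then show ?thesis using b(3)[of i] t(1)[of i n] sym[of i n] by simp
  next
  case 4 then show ?thesis using b(4) by (simp add: lessThan_Suc_atMost)
  qed
 qed
 then show ?thesis using t b(1,2) unfolding good_def by (intro exI[of _ b]) (auto simp: less_Suc_eq)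
 qed
 define A where "A = rec_nat (%_ _. 0) (%n a. a(n := SOME b. good (Suc n) (a(n := b))))"
 have A: "A 0 = (%_ _. 0)" "A (Suc n) = (A n)(n := SOME b. good (Suc n) ((A n)(n := b)))" for n
 by (simp_all add: A_def)
 have g: "good n (A n)" for n
 proof (induct n)
 case (Suc n) from someI_ex[OF step[OF Suc]] show ?case unfolding A(2) .
 qed (simp add: A(1) good_def)
 have e: "A (n + k) j = A n j" if "j < n" for n k j by (induct k) (use that in \<open>simp_all add: A(2)\<close>)
 define a where "a j = A (Suc j) j" for j
 have e2: "A n j = a j" if "j < n" for n j using e[of j "Suc j" "n - Suc j"] that by (simp add: a_def)
 show thesis
 proof (rule that[of a])
 show "a j l = 0" if "j < l" for j l using g[of "Suc j"] that by (simp add: good_def a_def)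
 show "a j j ~= 0" for j using g[of "Suc j"] by (simp add: good_def a_def)
 show "(\<Sum>l\<le>m. a i l * a j l) = K i j" if "i \<le> m" "j \<le> m" for i j m
 proof -
  from g[of "Suc m"] have "\<forall>i<Suc m. \<forall>j<Suc m. (\<Sum>l<Suc m. A (Suc m) i l * A (Suc m) j l) = K i j"
  unfolding good_def by (rule conjunct2[OF conjunct2])
  with that have "(\<Sum>l<Suc m. A (Suc m) i l * A (Suc m) j l) = K i j" by (simp only: less_Suc_eq_le)
  with e2[of i "Suc m"] e2[of j "Suc m"] that show ?thesis by (simp add: lessThan_Suc_atMost)
 qed
 qed
qed

section \<open>The covariance kernel and its two models\<close>

text \<open>A natural number encodes a component \<open>i\<close> and an integer time
  \<open>n\<close>: it names the \<open>n\<close>-th translate of the cyclic vector with spectral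
  measure \<open>rho i\<close>. The operator to be built is the time shift.\<close>

definition comp :: "nat => nat" where "comp p = fst (prod_decode p)"
definition time :: "nat => int" where "time p = int_decode (snd (prod_decode p))"
definition idx :: "nat => int => nat" where "idx i n = prod_encode (i, int_encode n)"
definition shift :: "int => nat => nat" where "shift N p = idx (comp p) (time p + N)"

lemma idx_simps [simp]: "comp (idx i n) = i" "time (idx i n) = n" "idx (comp p) (time p) = p"
 "comp (shift N p) = comp p" "time (shift N p) = time p + N"
 by (simp_all add: comp_def time_def idx_def shift_def)

lemma idx_eqI: "comp p = comp q ==> time p = time q ==> p = q"
 by (metis idx_simps(3))

lemma shift_shift [simp]: "shift a (shift b p) = shift (a + b) p"
 by (rule idx_eqI; simp)

lemma shift_0 [simp]: "shift 0 p = p"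
 by (rule idx_eqI; simp)

text \<open>The Gram matrix of these translates in the orthogonal sum of the \<open>rho i\<close>.
  Taking the real part loses nothing, since each \<open>rho i\<close> is invariant under
  conjugation.\<close>

definition kern :: "nat => nat => real" where
 "kern p q = (if comp p = comp q then Re (\<integral>z. z powi (time p - time q) \<partial>rho (comp p)) else 0)"

lemma of_real_kern:
 "complex_of_real (kern p q) = (if comp p = comp q then \<integral>z. z powi (time p - time q) \<partial>rho (comp p) else 0)"
 by (simp add: kern_def complex_eq_iff rho_Fourier_real)

lemma kern_shift [simp]: "kern (shift N p) (shift N q) = kern p q"
 by (simp add: kern_def)

lemma rho_AE_neq: "AE z in rho i. z ~= a" and \<theta>_AE_neq: "AE z in \<theta>. z ~= a"
 using AE_not_in[of "{a}" "rho i"] AE_not_in[of "{a}" \<theta>] rho_no_atom[of i a] \<theta>_no_atom[of a]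
 by (auto simp: null_sets_def sets_rho sets_\<theta>)

interpretation mod: fibre \<theta> "%_. \<infinity>"
 by standard (use \<theta>_circle in auto)

text \<open>Vectors with Gram matrix \<open>kern\<close> in the countable direct sum of copies of
  \<open>L2 \<theta>\<close>, one sheet per component. In this model the time shift is
  multiplication by \<open>z\<close>.\<close>

definition yv :: "nat => int => complex \<times> nat => complex" where
 "yv i n x = (if snd x = i then fst x powi n * of_real (sqrt (dn i (fst x))) else 0)"

lemma slice_integral:
 assumes "integrable \<theta> (g :: complex => complex)"
 shows "integrable mod.FM (%x. if snd x = i then g (fst x) else 0)"
 and "(\<integral>x. (if snd x = i then g (fst x) else 0) \<partial>mod.FM) = (\<integral>z. g z \<partial>\<theta>)"
 using mod.graph_integral[OF assms, of UNIV "%_. i"] by simp_all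

lemma yv_L2: "yv i n \<in> L2 mod.FM"
 and yv_inner: "L2_inner mod.FM (yv i n) (yv j l) = (if i = j then \<integral>z. z powi (n - l) \<partial>rho i else 0)"
proof -
 have m: "yv i n \<in> borel_measurable mod.FM" for i n
 by (rule mod.FM_measurable) (unfold yv_def, measurable)
 have g: "integrable \<theta> (%z. z powi n * cnj (z powi l) * of_real (dn i z))" for i n l
 proof (rule Bochner_Integration.integrable_bound[of _ "%z. dn i z"])
 show "AE z in \<theta>. norm (z powi n * cnj (z powi l) * of_real (dn i z)) \<le> norm (dn i z)"
  using circle_measureD(3)[OF \<theta>_circle] by eventually_elim (simp add: norm_mult norm_power_int)
 show "(%z. z powi n * cnj (z powi l) * of_real (dn i z)) \<in> borel_measurable \<theta>" by measurable
 qed (rule dn_integrable)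
 have sq: "yv i n x * cnj (yv i l x) = (if snd x = i then fst x powi n * cnj (fst x powi l) * of_real (dn i (fst x)) else 0)" for i n l x
 using dn_nonneg[of i "fst x"] by (simp add: yv_def of_real_mult[symmetric] mult_ac del: of_real_mult)
 have "integrable mod.FM (%x. yv i n x * cnj (yv i n x))" for i n unfolding sq by (rule slice_integral(1)[OF g])
 then have "integrable mod.FM (%x. Re (yv i n x * cnj (yv i n x)))" for i n by (intro integrable_Re)
 then have i: "integrable mod.FM (%x. (norm (yv i n x))\<^sup>2)" for i n
 unfolding complex_norm_square[symmetric] by (simp only: Re_complex_of_real)
 show "yv i n \<in> L2 mod.FM" using m i by (simp add: L2_def)
 show "L2_inner mod.FM (yv i n) (yv j l) = (if i = j then \<integral>z. z powi (n - l) \<partial>rho i else 0)"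
 proof (cases "i = j")
 case True
 have "L2_inner mod.FM (yv i n) (yv i l) = (\<integral>z. z powi n * cnj (z powi l) * of_real (dn i z) \<partial>\<theta>)"
  unfolding L2_inner_def sq by (rule slice_integral(2)[OF g])
 also have "\<dots> = (\<integral>z. of_real (dn i z) * z powi (n - l) \<partial>\<theta>)"
 proof (rule integral_cong_AE)
  show "AE z in \<theta>. z powi n * cnj (z powi l) * of_real (dn i z) = of_real (dn i z) * z powi (n - l)"
  using circle_measureD(3)[OF \<theta>_circle]
  proof eventually_elim
  case (elim z)
  then have "z ~= 0" by auto
  then show ?case unfolding cnj_power_int_circle[OF elim] by (simp add: power_int_add[symmetric] mult.commute)
  qed
 qed measurable
 also have "\<dots> = (\<integral>z. z powi (n - l) \<partial>rho i)" by (rule rho_integral[symmetric]) measurable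
 finally show ?thesis using True by simp
 next
 case False
 then have "(%x. yv i n x * cnj (yv j l x)) = (%_. 0)" by (auto simp: yv_def)
 then show ?thesis using False by (simp add: L2_inner_def)
 qed
qed

lemma yv_kern: "L2_inner mod.FM (yv (comp p) (time p)) (yv (comp q) (time q)) = of_real (kern p q)"
 unfolding yv_inner of_real_kern ..

lemma kern_sym: "kern p q = kern q p"
proof -
 have "complex_of_real (kern p q) = cnj (of_real (kern q p))" unfolding yv_kern[symmetric] by (rule L2_inner_commute)
 then show ?thesis by simp
qed

lemma trig_poly_roots_finite:
 fixes c :: "'i => complex" and t :: "'i => int"
 assumes A: "finite A" and inj: "inj_on t A" and p: "p0 \<in> A" "c p0 ~= 0"
 shows "finite {z. z ~= 0 & (\<Sum>p\<in>A. c p * z powi t p) = 0}"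
proof -
 \<comment> \<open>Multiplying by \<open>z powi L\<close>, with \<open>L\<close> the sum of the
   moduli, makes all exponents nonnegative and leaves a polynomial.\<close>
 define L where "L = (\<Sum>p\<in>A. \<bar>t p\<bar>)"
 have L: "0 \<le> t p + L" if "p \<in> A" for p
 using member_le_sum[of p A "%p. \<bar>t p\<bar>"] that A unfolding L_def by simp
 define q where "q = (\<Sum>p\<in>A. monom (c p) (nat (t p + L)))"
 have "coeff q (nat (t p0 + L)) = (\<Sum>p\<in>A. if p = p0 then c p else 0)"
 unfolding q_def coeff_sum
 proof (rule sum.cong[OF refl])
 fix p assume "p \<in> A"
 then have "nat (t p + L) = nat (t p0 + L) \<longleftrightarrow> p = p0"
  using L[of p] L[OF p(1)] inj_on_eq_iff[OF inj \<open>p \<in> A\<close> p(1)] by auto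
 then show "coeff (monom (c p) (nat (t p + L))) (nat (t p0 + L)) = (if p = p0 then c p else 0)" by simp
 qed
 also have "\<dots> = c p0" using A p(1) by simp
 finally have "q ~= 0" using p(2) by auto
 then have fin: "finite {z. poly q z = 0}" by (rule poly_roots_finite)
 have e: "poly q z = z powi L * (\<Sum>p\<in>A. c p * z powi t p)" if "z ~= 0" for z
 unfolding q_def poly_sum sum_distrib_left
 proof (rule sum.cong[OF refl])
 fix p assume "p \<in> A"
 have "z ^ nat (t p + L) = z powi (t p + L)" using L[OF \<open>p \<in> A\<close>] by (simp add: power_int_def)
 then show "poly (monom (c p) (nat (t p + L))) z = z powi L * (c p * z powi t p)"
  using that by (simp add: poly_monom power_int_add mult_ac)
 qed
 show ?thesis by (rule finite_subset[OF _ fin]) (auto simp: e)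
qed

text \<open>The form is a squared norm in the model. If it vanished, the part in the component of
  \<open>N\<close> would be a trigonometric polynomial with coefficient \<open>c N = 1\<close> that
  is zero almost everywhere for \<open>rho i\<close>; it has only finitely many zeros on the circle,
  while \<open>rho i\<close> has mass 1 and no atoms.\<close>

lemma kern_positive:
 assumes c: "c N = (1::real)"
 shows "0 < (\<Sum>p\<le>N. \<Sum>q\<le>N. c p * c q * kern p q)"
proof -
 define f where "f x = (\<Sum>p\<le>N. of_real (c p) * yv (comp p) (time p) x)" for x
 have L: "(%x. of_real (c p) * yv (comp p) (time p) x) \<in> L2 mod.FM" for p by (rule L2_scale[OF yv_L2])
 have fL: "f \<in> L2 mod.FM" unfolding f_def by (rule L2_sum[OF L])
 have "L2_inner mod.FM f f = of_real (\<Sum>p\<le>N. \<Sum>q\<le>N. c p * c q * kern p q)"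
 unfolding f_def
 by (subst L2_inner_sum_left[OF L L2_sum[OF L]], subst L2_inner_sum_right[OF L L])
  (simp add: L2_inner_scale_left L2_inner_scale_right yv_kern mult.assoc)
 then have e: "(\<Sum>p\<le>N. \<Sum>q\<le>N. c p * c q * kern p q) = l2sq mod.FM f" by (simp only: l2sq_inner Re_complex_of_real)
 have "l2sq mod.FM f ~= 0"
 proof
 assume "l2sq mod.FM f = 0"
 then have z: "AE x in mod.FM. f x = 0" by (simp only: l2sq_zero_iff[OF fL])
 define i where "i = comp N"
 define A where "A = {p. p \<le> N & comp p = i}"
 have A: "finite A" "N \<in> A" "inj_on time A" by (auto simp: A_def i_def inj_on_def intro: idx_eqI)
 define T where "T z = (\<Sum>p\<in>A. of_real (c p) * z powi time p)" for z :: complex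
 have Tm [measurable]: "T \<in> borel_measurable borel" unfolding T_def by measurable
 have fT: "f x = of_real (sqrt (dn i (fst x))) * T (fst x)" if "snd x = i" for x
 proof -
  have "f x = (\<Sum>p\<le>N. if p \<in> A then of_real (sqrt (dn i (fst x))) * (of_real (c p) * fst x powi time p) else 0)"
  unfolding f_def by (rule sum.cong) (auto simp: A_def yv_def that)
  also have "\<dots> = (\<Sum>p\<in>A. of_real (sqrt (dn i (fst x))) * (of_real (c p) * fst x powi time p))"
  by (subst sum.inter_restrict[symmetric]) (auto simp: A_def intro!: sum.cong)
  finally show ?thesis by (simp only: T_def sum_distrib_left)
 qed
 define \<psi> where "\<psi> z = dn i z * (cmod (T z))\<^sup>2" for z
 have "T \<in> trig" unfolding T_def
 proof (rule finite_ne_induct[of A "%A. (%z. \<Sum>p\<in>A. complex_of_real (c p) * z powi time p) \<in> trig"])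
  show "A ~= {}" using A(2) by auto
  show "(%z. \<Sum>p\<in>{p}. complex_of_real (c p) * z powi time p) \<in> trig" for p
  using trig.scale[OF trig.base] by simp
  show "(%z. \<Sum>p\<in>insert p F. complex_of_real (c p) * z powi time p) \<in> trig"
  if "finite F" "p \<notin> F" "(%z. \<Sum>p\<in>F. complex_of_real (c p) * z powi time p) \<in> trig" for p F
  using trig.add[OF trig.scale[OF trig.base] that(3)] that(1,2) by simp
 qed (rule A(1))
 then obtain B where B: "!!z. cmod z = 1 ==> cmod (T z) \<le> B" using trig_bounded by blast
 have "integrable \<theta> (%z. complex_of_real (\<psi> z))"
 proof (rule Bochner_Integration.integrable_bound[of _ "%z. dn i z * B\<^sup>2"])
  show "AE z in \<theta>. norm (complex_of_real (\<psi> z)) \<le> norm (dn i z * B\<^sup>2)"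
  using circle_measureD(3)[OF \<theta>_circle]
  proof eventually_elim
  case (elim z)
  have "(cmod (T z))\<^sup>2 \<le> B\<^sup>2" using B[OF elim] by (rule power_mono) simp
  then have "\<psi> z \<le> dn i z * B\<^sup>2" unfolding \<psi>_def by (rule mult_left_mono) (rule dn_nonneg)
  moreover have "0 \<le> \<psi> z" by (simp add: \<psi>_def dn_nonneg)
  ultimately show ?case unfolding norm_of_real real_norm_def by linarith
  qed
  show "(%z. complex_of_real (\<psi> z)) \<in> borel_measurable \<theta>" unfolding \<psi>_def by measurable
 qed (use dn_integrable in simp)
 note g = this
 have "(\<integral>z. complex_of_real (\<psi> z) \<partial>\<theta>) = (\<integral>x. (if snd x = i then complex_of_real (\<psi> (fst x)) else 0) \<partial>mod.FM)"
  by (rule slice_integral(2)[OF g, symmetric])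
 also have "\<dots> = (\<integral>x. 0 \<partial>mod.FM)"
 proof (rule integral_cong_AE)
  show "AE x in mod.FM. (if snd x = i then complex_of_real (\<psi> (fst x)) else 0) = 0"
  using z
  proof eventually_elim
  case (elim x)
  then show ?case using fT[of x] by (auto simp: \<psi>_def)
  qed
  show "(%x. if snd x = i then complex_of_real (\<psi> (fst x)) else 0) \<in> borel_measurable mod.FM"
  by (rule mod.FM_measurable) (unfold \<psi>_def, measurable)
 qed simp
 finally have "(\<integral>z. \<psi> z \<partial>\<theta>) = 0" by simp
 moreover have "integrable \<theta> \<psi>" using integrable_Re[OF g] by simp
 moreover have "AE z in \<theta>. 0 \<le> \<psi> z" by (simp add: \<psi>_def dn_nonneg)
 ultimately have "AE z in \<theta>. \<psi> z = 0" by (simp add: integral_nonneg_eq_0_iff_AE)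
 then have "AE z in \<theta>. 0 < ennreal (dn i z) --> T z = 0"
  by eventually_elim (auto simp: \<psi>_def)
 then have T0: "AE z in rho i. T z = 0"
  unfolding rho_def by (subst AE_density) (simp_all add: measurable_cong_sets[OF sets_\<theta> refl])
 have fin: "finite {z. z ~= 0 & T z = 0}"
  unfolding T_def by (rule trig_poly_roots_finite[OF A(1,3,2)]) (simp add: c)
 have "AE z in rho i. \<forall>a\<in>{z. z ~= 0 & T z = 0}. z ~= a" using fin rho_AE_neq by (intro AE_finite_allI)
 with T0 rho_AE_neq[where a = 0 and i = i] have "AE z in rho i. False" by eventually_elim auto
 then have "emeasure (rho i) (space (rho i)) = 0" 
  using AE_iff_measurable[of "space (rho i)" "rho i" "%_. False"] by simp
 then show False using rho_total[of i] circle_measureD(4)[OF rho_circle, of i] by (simp add: measure_def)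
 qed
 then show ?thesis unfolding e by (simp add: order_less_le)
qed

definition chol :: "nat => nat => real" where
 "chol = (SOME a. (\<forall>j l. j < l --> a j l = 0) & (\<forall>j. a j j ~= 0) &
  (\<forall>i j m. i \<le> m --> j \<le> m --> (\<Sum>l\<le>m. a i l * a j l) = kern i j))"

lemma chol_upper: "j < l ==> chol j l = 0" and chol_diag: "chol j j ~= 0"
 and chol_kern: "i \<le> m ==> j \<le> m ==> (\<Sum>l\<le>m. chol i l * chol j l) = kern i j"
proof -
 have "\<exists>a. (\<forall>j l. j < l --> a j l = (0::real)) & (\<forall>j. a j j ~= 0) &
  (\<forall>i j m. i \<le> m --> j \<le> m --> (\<Sum>l\<le>m. a i l * a j l) = kern i j)"
 by (rule cholesky[of kern, OF kern_sym kern_positive]) blast+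
 note * = someI_ex[OF this, folded chol_def]
 show "j < l ==> chol j l = 0" "chol j j ~= 0"
 "i \<le> m ==> j \<le> m ==> (\<Sum>l\<le>m. chol i l * chol j l) = kern i j" using * by blast+
qed

text \<open>The rows of the Cholesky factor as finitely supported vectors, with Gram matrix
  \<open>kern\<close>.\<close>

definition uv :: "nat => nat => complex" where "uv p l = of_real (chol p l)"

lemma uv_ell2: "uv p \<in> ell2"
 and uv_pair: "L2_inner counting f (uv p) = (\<Sum>l\<le>p. f l * uv p l)"
proof -
 have s: "{l \<in> UNIV. g l ~= 0} \<subseteq> {..p}" if "!!l. p < l ==> g l = 0" for g :: "nat => 'z::zero"
 using that by (auto simp: not_less[symmetric])
 show "uv p \<in> ell2" unfolding L2_def
 proof (intro CollectI conjI)
 show "integrable counting (%l. (norm (uv p l))\<^sup>2)"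
  unfolding integrable_count_space_nat_iff by (rule summable_finite[of "{..p}"]) (auto simp: uv_def chol_upper)
 qed simp
 have "L2_inner counting f (uv p) = (\<Sum>l | l \<in> UNIV & f l * cnj (uv p l) ~= 0. f l * cnj (uv p l))"
 unfolding L2_inner_def by (rule lebesgue_integral_count_space_finite_support)
  (rule finite_subset[OF s], auto simp: uv_def chol_upper)
 also have "\<dots> = (\<Sum>l\<le>p. f l * cnj (uv p l))"
 by (rule sum.mono_neutral_left[OF _ s]) (auto simp: uv_def chol_upper)
 finally show "L2_inner counting f (uv p) = (\<Sum>l\<le>p. f l * uv p l)" by (simp add: uv_def)
qed

lemma uv_inner: "L2_inner counting (uv p) (uv q) = of_real (kern p q)"
proof -
 have "(\<Sum>l\<le>q. chol p l * chol q l) = (\<Sum>l\<le>max p q. chol p l * chol q l)"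
 by (rule sum.mono_neutral_left) (auto simp: chol_upper)
 also have "\<dots> = kern p q" by (rule chol_kern) auto
 finally show ?thesis by (simp add: uv_pair uv_def flip: of_real_mult of_real_sum)
qed

text \<open>\<open>uv p\<close> involves only coordinates up to \<open>p\<close>, the last with a
  nonzero coefficient, so a vector orthogonal to all of them vanishes one coordinate after the
  other.\<close>

lemma uv_total: "ltotal counting ell2 (range uv)"
 unfolding ltotal_def
proof (intro conjI ballI impI)
 show "range uv \<subseteq> ell2" using uv_ell2 by auto
 fix f assume "f \<in> ell2" and 0: "\<forall>a\<in>range uv. L2_inner counting f a = 0"
 have "f p = 0" for p
 proof (induct p rule: less_induct)
 case (less p)
 have "(\<Sum>l\<le>p. f l * uv p l) = f p * uv p p"
  using less by (subst sum.remove[of _ p]) (auto intro!: sum.neutral)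
 then show ?case using 0 uv_pair[of f p] chol_diag[of p] by (simp add: uv_def)
 qed
 then show "AE x in counting. f x = 0" by simp
qed

hide_const (open) F \<phi> w c1

section \<open>Countable dense families and recognition of Gaussian variables\<close>

text \<open>Lists with Gaussian rational coefficients form a countable type, so these combinations
  can be enumerated when a countable dense family is wanted.\<close>

definition qcomb :: "(nat => 'a => complex) => ((rat \<times> rat) \<times> nat) list => 'a => complex" where
 "qcomb b L x = (\<Sum>(q, n)\<leftarrow>L. Complex (of_rat (fst q)) (of_rat (snd q)) * b n x)"

lemma qcomb_Nil: "qcomb b [] x = 0"
 and qcomb_Cons: "qcomb b (((r, s), n) # L) x = Complex (of_rat r) (of_rat s) * b n x + qcomb b L x"
 and qcomb_append: "qcomb b (L @ L') x = qcomb b L x + qcomb b L' x"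
 by (simp_all add: qcomb_def)

lemma qcomb_scale: "\<exists>L'. \<forall>x. qcomb b L' x = Complex (of_rat r) (of_rat s) * qcomb b L x"
proof (induct L)
 case (Cons a L)
 obtain r' s' n where a: "a = ((r', s'), n)" by (metis prod.exhaust)
 obtain L' where L': "!!x. qcomb b L' x = Complex (of_rat r) (of_rat s) * qcomb b L x" using Cons by blast
 have "Complex (of_rat r) (of_rat s) * Complex (of_rat r') (of_rat s')
  = Complex (of_rat (r * r' - s * s')) (of_rat (r * s' + s * r'))"
 by (simp add: complex_eq_iff of_rat_diff of_rat_add of_rat_mult)
 then show ?case
 by (intro exI[of _ "((r * r' - s * s', r * s' + s * r'), n) # L'"])
  (simp add: a qcomb_Cons L' distrib_left mult.assoc[symmetric])
qed (auto simp: qcomb_Nil intro: exI[of _ "[]"])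

lemma qcomb_csub:
 assumes "csub M V" "!!n. b n \<in> V" shows "qcomb b L \<in> V"
proof (induct L)
 case Nil
 have "qcomb b [] = (%_. 0)" by (rule ext) (rule qcomb_Nil)
 then show ?case using csub_zero[OF assms(1)] by simp
next
 case (Cons a L)
 obtain r s n where a: "a = ((r, s), n)" by (metis prod.exhaust)
 have "qcomb b (a # L) = (%x. Complex (of_rat r) (of_rat s) * b n x + qcomb b L x)"
 by (rule ext) (simp only: a qcomb_Cons)
 then show ?case using csub_add[OF assms(1) csub_scale[OF assms(1,2)] Cons] by simp
qed

lemma rational_complex_dense:
 assumes "0 < (e::real)"
 shows "\<exists>r s. cmod (c - Complex (of_rat r) (of_rat s)) < e"
proof -
 obtain r s where r: "Re c < of_rat r" "of_rat r < Re c + e / 2" and s: "Im c < of_rat s" "of_rat s < Im c + e / 2"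
 using of_rat_dense[of "Re c" "Re c + e / 2"] of_rat_dense[of "Im c" "Im c + e / 2"] assms by auto
 have "cmod (c - Complex (of_rat r) (of_rat s)) \<le> \<bar>Re c - of_rat r\<bar> + \<bar>Im c - of_rat s\<bar>"
 using cmod_le[of "c - Complex (of_rat r) (of_rat s)"] by simp
 also have "\<dots> < e" using r s by linarith
 finally show ?thesis by blast
qed

text \<open>The vectors that can be approximated form a closed subspace containing all
  \<open>b n\<close>.\<close>

lemma cspan_approx:
 assumes b: "!!n. b n \<in> L2 M" and F: "F \<in> cspan M (range b)"
 obtains L where "l2lim M (%n. qcomb b (L n)) F"
proof -
 have q: "qcomb b L \<in> L2 M" for L by (rule qcomb_csub[OF csub_UNIV b])
 define D where "D = {F \<in> L2 M. \<forall>e>0. \<exists>L. l2sq M (%x. F x - qcomb b L x) < e}"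
 have Dd: "F \<in> D ==> F \<in> L2 M" "F \<in> D ==> 0 < e ==> \<exists>L. l2sq M (%x. F x - qcomb b L x) < e" for F e
 by (simp_all add: D_def)
 have "csub M D" unfolding csub_def
 proof (intro conjI ballI allI impI)
 show "D \<subseteq> L2 M" using Dd(1) by blast
 have "l2sq M (%x. 0 - qcomb b [] x) = 0" by (simp add: qcomb_Nil l2sq_def)
 then show "(%_. 0) \<in> D" unfolding D_def by (intro CollectI conjI L2_zero allI impI) (metis (no_types))
 next
 fix f g assume f: "f \<in> D" and g: "g \<in> D"
 show "(%x. f x + g x) \<in> D" unfolding D_def
 proof (intro CollectI conjI allI impI L2_add Dd(1) f g)
  fix e :: real assume e: "0 < e"
  obtain L L' where L: "l2sq M (%x. f x - qcomb b L x) < e / 4" "l2sq M (%x. g x - qcomb b L' x) < e / 4"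
  using Dd(2)[OF f, of "e / 4"] Dd(2)[OF g, of "e / 4"] e by auto
  have "l2sq M (%x. f x + g x - qcomb b (L @ L') x) = l2sq M (%x. (f x - qcomb b L x) + (g x - qcomb b L' x))"
  by (simp add: qcomb_append algebra_simps)
  also have "\<dots> \<le> 2 * l2sq M (%x. f x - qcomb b L x) + 2 * l2sq M (%x. g x - qcomb b L' x)"
  by (intro l2sq_add_le L2_diff Dd(1) f g q)
  also have "\<dots> < e" using L by linarith
  finally show "\<exists>L. l2sq M (%x. f x + g x - qcomb b L x) < e" by blast
 qed
 next
 fix c f assume f: "f \<in> D"
 show "(%x. c * f x) \<in> D" unfolding D_def
 proof (intro CollectI conjI allI impI L2_scale Dd(1) f)
  fix e :: real assume e: "0 < e"
  \<comment> \<open>The 1 added here and in \<open>G\<close> keeps the divisors of the error budget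
    positive when \<open>c\<close> or the combination is zero.\<close>
  define C where "C = (cmod c)\<^sup>2 + 1"
  have C: "(cmod c)\<^sup>2 \<le> C" "0 < C" unfolding C_def by (auto intro: add_nonneg_pos)
  obtain L where L: "l2sq M (%x. f x - qcomb b L x) < e / (4 * C)" using Dd(2)[OF f, of "e / (4 * C)"] e C by auto
  define G where "G = l2sq M (qcomb b L) + 1"
  have G: "l2sq M (qcomb b L) \<le> G" "0 < G" using l2sq_nonneg[of M "qcomb b L"] unfolding G_def by linarith+
  obtain r s where rs: "cmod (c - Complex (of_rat r) (of_rat s)) < sqrt (e / (4 * G))"
  using rational_complex_dense[of "sqrt (e / (4 * G))" c] e G by auto
  let ?d = "c - Complex (of_rat r) (of_rat s)"
  have "(cmod ?d)\<^sup>2 < (sqrt (e / (4 * G)))\<^sup>2" using rs by (intro power_strict_mono) auto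
  then have d: "(cmod ?d)\<^sup>2 < e / (4 * G)" using e G by simp
  obtain L' where L': "!!x. qcomb b L' x = Complex (of_rat r) (of_rat s) * qcomb b L x" using qcomb_scale by blast
  have "l2sq M (%x. c * f x - qcomb b L' x) = l2sq M (%x. c * (f x - qcomb b L x) + ?d * qcomb b L x)"
  by (simp add: L' algebra_simps)
  also have "\<dots> \<le> 2 * l2sq M (%x. c * (f x - qcomb b L x)) + 2 * l2sq M (%x. ?d * qcomb b L x)"
  by (intro l2sq_add_le L2_scale L2_diff Dd(1) f q)
  also have "\<dots> < e"
  proof -
  have "l2sq M (%x. c * (f x - qcomb b L x)) \<le> C * (e / (4 * C))"
   unfolding l2sq_scale using L C by (intro mult_mono) auto
  moreover have "C * (e / (4 * C)) = e / 4" using C by simp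
  moreover have "l2sq M (%x. ?d * qcomb b L x) \<le> (cmod ?d)\<^sup>2 * G"
   unfolding l2sq_scale using G by (intro mult_left_mono) auto
  moreover have "(cmod ?d)\<^sup>2 * G < e / (4 * G) * G" using d G(2) by (rule mult_strict_right_mono)
  moreover have "e / (4 * G) * G = e / 4" using G by simp
  ultimately show ?thesis by linarith
  qed
  finally show "\<exists>L. l2sq M (%x. c * f x - qcomb b L x) < e" by blast
 qed
 next
 fix h f assume "(\<forall>n. h n \<in> D)" and f: "f \<in> L2 M" and lim: "l2lim M h f"
 then have h: "h n \<in> D" for n by blast
 show "f \<in> D" unfolding D_def
 proof (intro CollectI conjI allI impI f)
  fix e :: real assume e: "0 < e"
  then have "eventually (%n. l2sq M (%x. h n x - f x) < e / 4) sequentially"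
  using order_tendstoD(2)[OF lim, of "e / 4"] by simp
  then obtain n where n: "l2sq M (%x. h n x - f x) < e / 4" unfolding eventually_sequentially by blast
  obtain L where L: "l2sq M (%x. h n x - qcomb b L x) < e / 4" using Dd(2)[OF h, of "e / 4"] e by auto
  have "l2sq M (%x. f x - qcomb b L x) = l2sq M (%x. (f x - h n x) + (h n x - qcomb b L x))" by simp
  also have "\<dots> \<le> 2 * l2sq M (%x. f x - h n x) + 2 * l2sq M (%x. h n x - qcomb b L x)"
  by (intro l2sq_add_le L2_diff Dd(1) f h q)
  also have "\<dots> < e" using n L by (simp add: l2sq_commute[of M f])
  finally show "\<exists>L. l2sq M (%x. f x - qcomb b L x) < e" by blast
 qed
 qed
 moreover have "range b \<subseteq> D"
 proof
 fix f assume "f \<in> range b"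
 then obtain n where f: "f = b n" by blast
 have "Complex 1 0 = 1" by (simp add: complex_eq_iff)
 then have 0: "l2sq M (%x. f x - qcomb b [((1, 0), n)] x) = 0"
  by (simp add: f qcomb_Cons qcomb_Nil l2sq_def)
 show "f \<in> D" unfolding D_def
 proof (intro CollectI conjI allI impI)
  show "f \<in> L2 M" unfolding f by (rule b)
  fix e :: real assume "0 < e"
  with 0 show "\<exists>L. l2sq M (%x. f x - qcomb b L x) < e" by (metis (no_types))
 qed
 qed
 ultimately have "F \<in> D" by (rule subsetD[OF cspan_least F])
 then have "\<exists>L. l2sq M (%x. F x - qcomb b L x) < 1 / real (Suc n)" for n using Dd(2)[of F] by simp
 then obtain L where L: "!!n. l2sq M (%x. F x - qcomb b (L n) x) < 1 / real (Suc n)" by metis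
 have "l2lim M (%n. qcomb b (L n)) F"
 proof (rule tendsto_sandwich[OF _ _ tendsto_const lim_inverse_n'[THEN LIMSEQ_Suc]])
 show "eventually (%n. l2sq M (%x. qcomb b (L n) x - F x) \<le> 1 / real (Suc n)) sequentially"
  using L by (intro always_eventually allI) (simp add: l2sq_commute[of M _ F] less_imp_le)
 qed simp
 then show thesis by (rule that)
qed

text \<open>Levy's uniqueness theorem identifies the law. Variance 0 is separate because it gives
  the point mass at 0 instead of a density.\<close>

lemma gaussian_of_char:
 assumes M: "prob_space M" and h [measurable]: "h \<in> borel_measurable M" and v: "0 \<le> v"
 and char: "!!t. (\<integral>x. iexp (t * h x) \<partial>M) = complex_of_real (exp (- (t\<^sup>2 * v) / 2))"
 shows "centered_gaussian M h" "integrable M (%x. (h x)\<^sup>2)" "(\<integral>x. (h x)\<^sup>2 \<partial>M) = v"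
proof -
 interpret prob_space M by (rule M)
 have "centered_gaussian M h & integrable M (%x. (h x)\<^sup>2) & (\<integral>x. (h x)\<^sup>2 \<partial>M) = v"
 proof (cases "v = 0")
 case True
 have "distr M borel h = return borel 0"
 proof (rule Levy_uniqueness)
  show "real_distribution (distr M borel h)" by (rule real_distribution_distr) measurable
  show "real_distribution (return borel 0)"
  by (intro real_distribution.intro prob_space_return real_distribution_axioms.intro) auto
  show "char (distr M borel h) = char (return borel 0)"
  by (rule ext) (simp add: char_def integral_distr integral_return char[simplified] True)
 qed
 then have "AE y in distr M borel h. y = 0" by (rule ssubst) (rule iffD2[OF AE_return], simp_all)
 then have 0: "AE x in M. h x = 0" by (rule AE_distrD[OF h])
 have "integrable M (%x. (h x)\<^sup>2) \<longleftrightarrow> integrable M (%_. 0::real)" "(\<integral>x. (h x)\<^sup>2 \<partial>M) = (\<integral>x. 0 \<partial>M)"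
  by (rule integrable_cong_AE integral_cong_AE; use 0 in simp)+
 with 0 show ?thesis by (simp add: centered_gaussian_def True)
 next
 case False
 define s where "s = sqrt v"
 have s: "0 < s" "s\<^sup>2 = v" using v False by (auto simp: s_def)
 define Y where "Y x = (h x - 0) / s" for x
 have Ym [measurable]: "Y \<in> borel_measurable M" unfolding Y_def by measurable
 have D: "distr M borel Y = std_normal_distribution"
 proof (rule Levy_uniqueness)
  show "real_distribution (distr M borel Y)" by (rule real_distribution_distr) measurable
  show "real_distribution std_normal_distribution" by (rule real_dist_normal_dist)
  show "char (distr M borel Y) = char std_normal_distribution"
  proof
  fix t
  have "char (distr M borel Y) t = (\<integral>x. iexp (t / s * h x) \<partial>M)"
   by (simp add: char_def integral_distr Y_def)
  also have "\<dots> = of_real (exp (- (t\<^sup>2) / 2))" unfolding char using s False by (simp add: power_divide)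
  finally show "char (distr M borel Y) t = char std_normal_distribution t"
   by (simp add: char_std_normal_distribution)
  qed
 qed
 have "distr M lborel Y = distr M borel Y" by (rule distr_cong) auto
 then have "distributed M lborel Y std_normal_density" using D by (simp add: distributed_def)
 then have dh: "distributed M lborel h (normal_density 0 s)"
  unfolding normal_standard_normal_convert[OF s(1)] Y_def[abs_def] .
 have E: "expectation h = 0" using normal_distributed_expectation[OF s(1) dh] .
 have "variance h = s\<^sup>2" by (rule normal_distributed_variance[OF s(1) dh])
 then have V: "(\<integral>x. (h x)\<^sup>2 \<partial>M) = v" using E s by simp
 \<comment> \<open>A function that is not integrable has integral 0 by convention, so the value
   \<open>v ~= 0\<close> proves integrability.\<close>
 then have "integrable M (%x. (h x)\<^sup>2)" using not_integrable_integral_eq False by metis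
 with V show ?thesis using dh s h by (auto simp: centered_gaussian_def)
 qed
 then show "centered_gaussian M h" "integrable M (%x. (h x)\<^sup>2)" "(\<integral>x. (h x)\<^sup>2 \<partial>M) = v" by blast+
qed

section \<open>A Gaussian realisation on sequence space\<close>

abbreviation "RP \<equiv> \<Pi>\<^sub>M i\<in>(UNIV :: nat set). (borel :: real measure)"
abbreviation "SP \<equiv> \<Pi>\<^sub>M i\<in>(UNIV :: nat set). std_normal_distribution"

text \<open>The Cholesky factor applied to independent standard normals has covariance
  \<open>kern\<close>; \<open>GM\<close> is the law of this process. Triangularity keeps every sum
  finite.\<close>

definition proc :: "(nat => real) => nat => real" where
 "proc \<omega> p = (\<Sum>l\<le>p. chol p l * \<omega> l)"
definition GM :: "(nat => real) measure" where
 "GM = distr SP RP proc"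

lemma SP_prob: "prob_space SP"
 by (intro prob_space_PiM prob_space_normal_density) simp

lemma SP_coord [measurable]: "(%\<omega>. \<omega> l) \<in> borel_measurable SP"
 by (rule measurable_compose[OF measurable_component_singleton[of l UNIV]]) (auto intro: measurable_ident_sets)

lemma proc_measurable [measurable]: "proc \<in> SP \<rightarrow>\<^sub>M RP"
proof -
 have "(%\<omega>. proc \<omega> i) \<in> borel_measurable SP" for i
 unfolding proc_def by (intro borel_measurable_sum borel_measurable_times borel_measurable_const SP_coord)
 then have "(%\<omega> i. proc \<omega> i) \<in> SP \<rightarrow>\<^sub>M RP"
 by (rule measurable_PiM_single') simp
 then show ?thesis .
qed

lemma GM_prob: "prob_space GM"
 unfolding GM_def by (rule prob_space.prob_space_distr[OF SP_prob proc_measurable])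

lemma sets_GM [measurable_cong]: "sets GM = sets RP" and space_GM [simp]: "space GM = UNIV"
 by (simp_all add: GM_def space_PiM)

lemma SP_char: "(\<integral>\<omega>. iexp (\<Sum>l\<le>m. b l * \<omega> l) \<partial>SP) = of_real (exp (- (\<Sum>l\<le>m. (b l)\<^sup>2) / 2))"
proof -
 interpret prob_space SP by (rule SP_prob)
 have c: "distr SP borel (%\<omega>. \<omega> l) = std_normal_distribution" for l
 proof -
 have "distr SP borel (%\<omega>. \<omega> l) = distr SP std_normal_distribution (%\<omega>. \<omega> l)" by (rule distr_cong) auto
 also have "\<dots> = std_normal_distribution"
  by (rule distr_PiM_component) (auto intro: prob_space_normal_density)
 finally show ?thesis .
 qed
 have "indep_vars (%_. borel) (%l \<omega>. \<omega> l) (UNIV :: nat set)"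
 proof (subst indep_vars_iff_distr_eq_PiM)
 have "distr SP RP (%x. \<lambda>i\<in>UNIV. x i) = distr SP SP (%x. x)"
  by (rule distr_cong) (auto intro!: sets_PiM_cong)
 then show "distr SP RP (%x. \<lambda>i\<in>UNIV. x i) = (\<Pi>\<^sub>M i\<in>UNIV. distr SP borel (%\<omega>. \<omega> i))" by (simp add: c)
 qed auto
 then have "indep_vars (%_. borel) (%l \<omega>. \<omega> l) {..m}" by (rule indep_vars_subset) auto
 then have "indep_vars (%_. borel) (%l \<omega>. b l * \<omega> l) {..m}" by (rule indep_vars_compose2) auto
 from char_distr_sum[OF this, of 1]
 have "(\<integral>\<omega>. iexp (\<Sum>l\<le>m. b l * \<omega> l) \<partial>SP) = (\<Prod>l\<le>m. char (distr SP borel (%\<omega>. b l * \<omega> l)) 1)"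
 by (subst (asm) char_def, subst (asm) integral_distr) simp_all
 also have "\<dots> = (\<Prod>l\<le>m. of_real (exp (- ((b l)\<^sup>2) / 2)))"
 proof (rule prod.cong[OF refl])
 fix l
 have "char (distr SP borel (%\<omega>. b l * \<omega> l)) 1 = (\<integral>\<omega>. iexp (b l * \<omega> l) \<partial>SP)"
  by (subst char_def, subst integral_distr) simp_all
 also have "\<dots> = (\<integral>y. iexp (b l * y) \<partial>distr SP borel (%\<omega>. \<omega> l))" by (subst integral_distr) simp_all
 also have "\<dots> = of_real (exp (- ((b l)\<^sup>2) / 2))"
  unfolding c using char_std_normal_distribution by (simp add: char_def fun_eq_iff)
 finally show "char (distr SP borel (%\<omega>. b l * \<omega> l)) 1 = of_real (exp (- ((b l)\<^sup>2) / 2))" .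
 qed
 also have "\<dots> = of_real (exp (- (\<Sum>l\<le>m. (b l)\<^sup>2) / 2))"
 by (simp add: exp_sum[symmetric] sum_negf[symmetric] sum_divide_distrib del: of_real_exp flip: of_real_prod)
 finally show ?thesis .
qed

lemma proc_char:
 assumes F: "finite F"
 shows "(\<integral>\<omega>. iexp (\<Sum>p\<in>F. c p * proc \<omega> (s p)) \<partial>SP)
 = of_real (exp (- (\<Sum>p\<in>F. \<Sum>q\<in>F. c p * c q * kern (s p) (s q)) / 2))"
proof -
 obtain m where m: "!!p. p \<in> F ==> s p \<le> m" using Max_ge[of "s ` F"] F by (metis finite_imageI imageI)
 define b where "b l = (\<Sum>p\<in>F. c p * chol (s p) l)" for l
 have pr: "proc \<omega> (s p) = (\<Sum>l\<le>m. chol (s p) l * \<omega> l)" if "p \<in> F" for p \<omega>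
 unfolding proc_def by (rule sum.mono_neutral_left) (use m[OF that] chol_upper in auto)
 have "(\<Sum>p\<in>F. c p * proc \<omega> (s p)) = (\<Sum>p\<in>F. \<Sum>l\<le>m. c p * chol (s p) l * \<omega> l)" for \<omega>
 by (rule sum.cong) (simp_all add: pr sum_distrib_left mult.assoc)
 also have "(\<Sum>p\<in>F. \<Sum>l\<le>m. c p * chol (s p) l * \<omega> l) = (\<Sum>l\<le>m. b l * \<omega> l)" for \<omega>
 unfolding b_def sum_distrib_right by (rule sum.swap)
 finally have 1: "(\<Sum>p\<in>F. c p * proc \<omega> (s p)) = (\<Sum>l\<le>m. b l * \<omega> l)" for \<omega> .
 have "(\<Sum>l\<le>m. (b l)\<^sup>2) = (\<Sum>l\<le>m. \<Sum>p\<in>F. \<Sum>q\<in>F. c p * c q * (chol (s p) l * chol (s q) l))"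
 unfolding b_def power2_eq_square sum_product by (simp add: mult_ac)
 also have "\<dots> = (\<Sum>p\<in>F. \<Sum>q\<in>F. \<Sum>l\<le>m. c p * c q * (chol (s p) l * chol (s q) l))"
 by (subst sum.swap, rule sum.cong[OF refl], rule sum.swap)
 also have "\<dots> = (\<Sum>p\<in>F. \<Sum>q\<in>F. c p * c q * kern (s p) (s q))"
 by (intro sum.cong refl) (simp add: sum_distrib_left[symmetric] chol_kern m)
 finally show ?thesis unfolding 1 SP_char by simp
qed

text \<open>Finite linear combinations of coordinates already generate the product sigma-algebra, so
  they serve as test functions for equality of laws.\<close>

definition comb :: "((nat => real) => real) set" where
 "comb = {h. \<exists>F c. finite F & h = (%x. \<Sum>p\<in>F. c p * x p)}"

lemma coord_measurable: "(%x. x p) \<in> borel_measurable RP"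
 by (rule measurable_component_singleton) simp

lemma comb_coord: "(%x. x p) \<in> comb"
 unfolding comb_def by (intro CollectI exI[of _ "{p}"] exI[of _ "%_. 1"]) simp

lemma comb_cramer_wold: "cramer_wold RP comb"
proof (rule cramer_wold.intro)
 show "h \<in> borel_measurable RP" if "h \<in> comb" for h using that
 by (auto simp: comb_def intro!: borel_measurable_sum borel_measurable_times borel_measurable_const coord_measurable)
 show "(%_. 0) \<in> comb" unfolding comb_def by (auto intro!: exI[of _ "{}"])
 show "(%x. c * h x) \<in> comb" if h: "h \<in> comb" for h c
 proof -
 obtain F d where "finite F" "h = (%x. \<Sum>p\<in>F. d p * x p)" using h by (auto simp: comb_def)
 then show ?thesis unfolding comb_def
  by (auto intro!: exI[of _ F] exI[of _ "%p. c * d p"] simp: sum_distrib_left mult.assoc)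
 qed
 show "(%x. h x + g x) \<in> comb" if h: "h \<in> comb" and g: "g \<in> comb" for h g
 proof -
 obtain F c where F: "finite F" "h = (%x. \<Sum>p\<in>F. c p * x p)" using h by (auto simp: comb_def)
 obtain G d where G: "finite G" "g = (%x. \<Sum>p\<in>G. d p * x p)" using g by (auto simp: comb_def)
 define e where "e p = (if p \<in> F then c p else 0) + (if p \<in> G then d p else 0)" for p
 have "h x = (\<Sum>p\<in>F \<union> G. (if p \<in> F then c p else 0) * x p)" "g x = (\<Sum>p\<in>F \<union> G. (if p \<in> G then d p else 0) * x p)" for x
  unfolding F(2) G(2) using F(1) G(1) by (auto intro!: sum.mono_neutral_cong_left)
 then have "(%x. h x + g x) = (%x. \<Sum>p\<in>F \<union> G. e p * x p)"
  by (simp add: e_def sum.distrib distrib_right)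
 then show ?thesis unfolding comb_def using F(1) G(1) by blast
 qed
qed

interpretation comb: cramer_wold RP comb by (rule comb_cramer_wold)

lemma GM_char:
 assumes "finite F"
 shows "(\<integral>x. iexp (\<Sum>p\<in>F. c p * x (s p)) \<partial>GM) = of_real (exp (- (\<Sum>p\<in>F. \<Sum>q\<in>F. c p * c q * kern (s p) (s q)) / 2))"
proof -
 have "(%x. iexp (\<Sum>p\<in>F. c p * x (s p))) \<in> borel_measurable RP" by measurable
 then have "(\<integral>x. iexp (\<Sum>p\<in>F. c p * x (s p)) \<partial>GM) = (\<integral>\<omega>. iexp (\<Sum>p\<in>F. c p * proc \<omega> (s p)) \<partial>SP)"
 unfolding GM_def by (rule integral_distr[OF proc_measurable])
 also note proc_char[OF assms]
 finally show ?thesis .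
qed

lemma cylinder_generates:
 fixes H :: "((nat => real) => real) set"
 assumes "A \<in> sets RP" and "!!p. (%x. x p) \<in> H"
 shows "A \<in> sigma_sets UNIV {h -` C \<inter> UNIV | h C. h \<in> H & C \<in> sets borel}"
proof -
 have "A \<in> sigma_sets UNIV {{f :: nat => real. f i \<in> B} | i B. B \<in> sets borel}"
 using assms(1) unfolding sets_PiM_single by simp
 moreover have "{{f :: nat => real. f i \<in> B} | i B. B \<in> sets borel} \<subseteq> {h -` C \<inter> UNIV | h C. h \<in> H & C \<in> sets borel}"
 proof
 fix Z assume "Z \<in> {{f :: nat => real. f i \<in> B} | i B. B \<in> sets borel}"
 then obtain i B where "Z = {f. f i \<in> B}" "B \<in> sets borel" by blast
 then have "Z = (%x. x i) -` B \<inter> UNIV" "B \<in> sets borel" by auto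
 with assms(2) show "Z \<in> {h -` C \<inter> UNIV | h C. h \<in> H & C \<in> sets borel}" by blast
 qed
 ultimately show ?thesis by (rule rev_subsetD[OF _ sigma_sets_mono'])
qed

definition cshift :: "int => (nat => real) => nat => real" where
 "cshift N x p = x (shift N p)"

lemma cshift_measurable [measurable]: "cshift N \<in> GM \<rightarrow>\<^sub>M GM"
proof -
 have "(%x p. cshift N x p) \<in> RP \<rightarrow>\<^sub>M RP"
 unfolding cshift_def by (rule measurable_PiM_single'[OF coord_measurable]) simp
 then show ?thesis by (simp add: measurable_cong_sets[OF sets_GM sets_GM])
qed

text \<open>\<open>kern\<close> depends only on time differences, so the shifted process has the
  same characteristic functional and therefore the same law.\<close>

lemma cshift_mpres: "mpres GM (cshift N)"
proof -
 have "distr GM GM (cshift N) = GM"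
 proof (rule measure_eqI)
 interpret d: prob_space "distr GM GM (cshift N)" by (rule prob_space.prob_space_distr[OF GM_prob cshift_measurable])
 interpret g: prob_space GM by (rule GM_prob)
 have a: "comb.agree (distr GM GM (cshift N)) GM" unfolding comb.agree_def
 proof (intro conjI ballI)
  fix h assume "h \<in> comb"
  then obtain F c where F: "finite F" "h = (%x. \<Sum>p\<in>F. c p * x p)" by (auto simp: comb_def)
  have "(\<integral>x. iexp (h x) \<partial>distr GM GM (cshift N)) = (\<integral>x. iexp (\<Sum>p\<in>F. c p * x (shift N p)) \<partial>GM)"
  unfolding F(2) by (subst integral_distr) (measurable, simp add: cshift_def)
  also have "\<dots> = (\<integral>x. iexp (h x) \<partial>GM)"
  using GM_char[OF F(1), of c "shift N"] GM_char[OF F(1), of c "%p. p"] by (simp add: F(2))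
  finally show "(\<integral>x. iexp (h x) \<partial>distr GM GM (cshift N)) = (\<integral>x. iexp (h x) \<partial>GM)" .
 qed (auto simp: sets_GM d.finite_measure_axioms g.finite_measure_axioms)
 fix A assume "A \<in> sets (distr GM GM (cshift N))"
 then have "A \<in> sets RP" by (simp add: sets_GM)
 from cylinder_generates[OF this comb_coord] comb.agree_sigma(2)[OF a, of A]
 show "emeasure (distr GM GM (cshift N)) A = emeasure GM A" by (simp add: space_PiM)
 qed simp
 then show ?thesis by (simp add: mpres_def)
qed

lemma GM_standard: "standard_probability_space GM"
 unfolding standard_probability_space_def
proof (intro conjI GM_prob exI[of _ euclidean])
 show "completely_metrizable_space (euclidean :: (nat => real) topology)"
 by (rule completely_metrizable_space_euclidean)
 obtain B :: "(nat => real) set set" where B: "countable B" "topological_basis B" using ex_countable_basis by blast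
 show "second_countable (euclidean :: (nat => real) topology)" unfolding second_countable_def
 proof (intro exI[of _ B] conjI B(1) ballI allI impI)
 show "openin euclidean V" if "V \<in> B" for V using topological_basis_open[OF B(2) that] by simp
 fix U x assume "openin euclidean (U :: (nat => real) set) & x \<in> U"
 then show "\<exists>V\<in>B. x \<in> V & V \<subseteq> U" using topological_basisE[OF B(2)] by (metis open_openin)
 qed
 show "sets GM = sigma_sets (space GM) {U. openin euclidean U}"
 unfolding sets_GM sets_PiM_equal_borel by (simp add: borel_def)
qed simp

lemma cshift_automorphism: "automorphism GM (cshift N)"
 unfolding automorphism_def
proof (intro conjI GM_standard cshift_measurable bexI[of _ "cshift (- N)"])
 show "distr GM GM (cshift N) = GM" using cshift_mpres by (simp add: mpres_def)
 show "AE x in GM. cshift (- N) (cshift N x) = x" "AE x in GM. cshift N (cshift (- N) x) = x"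
 by (auto simp: cshift_def fun_eq_iff)
qed

lemma comb_gaussian:
 assumes F: "finite F"
 shows "centered_gaussian GM (%x. \<Sum>p\<in>F. c p * x p)" "integrable GM (%x. (\<Sum>p\<in>F. c p * x p)\<^sup>2)"
 "(\<integral>x. (\<Sum>p\<in>F. c p * x p)\<^sup>2 \<partial>GM) = (\<Sum>p\<in>F. \<Sum>q\<in>F. c p * c q * kern p q)"
proof -
 define v where "v = (\<Sum>p\<in>F. \<Sum>q\<in>F. c p * c q * kern p q)"
 have ch: "(\<integral>x. iexp (t * (\<Sum>p\<in>F. c p * x p)) \<partial>GM) = complex_of_real (exp (- (t\<^sup>2 * v) / 2))" for t
 proof -
 have "(\<Sum>p\<in>F. \<Sum>q\<in>F. (t * c p) * (t * c q) * kern p q) = t\<^sup>2 * v"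
  unfolding v_def sum_distrib_left by (intro sum.cong refl) (simp add: power2_eq_square)
 with GM_char[OF F, of "%p. t * c p" "%p. p"] show ?thesis
  by (simp only: sum_distrib_left mult.assoc)
 qed
 interpret prob_space GM by (rule GM_prob)
 have m: "(%x. \<Sum>p\<in>F. c p * x p) \<in> borel_measurable GM" by measurable
 \<comment> \<open>Nonnegativity of the variance is read off from the characteristic function, whose
   modulus is at most 1.\<close>
 have "norm (\<integral>x. iexp (1 * (\<Sum>p\<in>F. c p * x p)) \<partial>GM) \<le> (\<integral>x. norm (iexp (1 * (\<Sum>p\<in>F. c p * x p))) \<partial>GM)"
 by (rule integral_norm_bound)
 moreover have "measure GM UNIV = 1" using prob_space by simp
 ultimately have "exp (- v / 2) \<le> 1" unfolding ch by simp
 then have v: "0 \<le> v" by simp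
 from gaussian_of_char[OF GM_prob m v ch]
 show "centered_gaussian GM (%x. \<Sum>p\<in>F. c p * x p)" "integrable GM (%x. (\<Sum>p\<in>F. c p * x p)\<^sup>2)"
 "(\<integral>x. (\<Sum>p\<in>F. c p * x p)\<^sup>2 \<partial>GM) = (\<Sum>p\<in>F. \<Sum>q\<in>F. c p * c q * kern p q)" unfolding v_def by blast+
qed

definition cc :: "nat => (nat => real) => complex" where "cc p x = of_real (x p)"

lemma cc_L2: "cc p \<in> L2 GM"
proof -
 have "cc p \<in> borel_measurable GM" unfolding cc_def by measurable
 moreover have "integrable GM (%x. (norm (cc p x))\<^sup>2)"
 using comb_gaussian(2)[of "{p}" "%_. 1"] by (simp add: cc_def)
 ultimately show ?thesis by (simp add: L2_def)
qed

text \<open>Off-diagonal covariances come from the variance of \<open>x p + x q\<close> by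
  polarisation.\<close>

lemma cc_inner: "L2_inner GM (cc p) (cc q) = of_real (kern p q)"
proof -
 have i: "L2_inner GM (cc p) (cc q) = of_real (\<integral>x. x p * x q \<partial>GM)" for p q
 unfolding L2_inner_def cc_def by (simp flip: of_real_mult integral_complex_of_real)
 have s: "l2sq GM (cc p) = kern p p" for p
 using comb_gaussian(3)[of "{p}" "%_. 1"] by (simp add: l2sq_def cc_def)
 show ?thesis
 proof (cases "p = q")
 case True then show ?thesis by (simp add: L2_inner_self s)
 next
 case False
 have "l2sq GM (%x. cc p x + cc q x) = (\<integral>x. (x p + x q)\<^sup>2 \<partial>GM)"
  by (simp add: l2sq_def cc_def flip: of_real_add)
 also have "\<dots> = kern p p + kern q q + 2 * kern p q"
  using comb_gaussian(3)[of "{p, q}" "%_. 1"] False kern_sym[of q p] by simp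
 finally have "Re (L2_inner GM (cc p) (cc q)) = kern p q"
  unfolding l2sq_add[OF cc_L2 cc_L2] s by linarith
 then show ?thesis unfolding i by simp
 qed
qed

definition HC :: "((nat => real) => complex) set" where "HC = cspan GM (range cc)"
definition GH :: "((nat => real) => real) set" where "GH = {f. (%x. complex_of_real (f x)) \<in> HC}"

lemma HC_csub: "csub GM HC" and HC_total: "ltotal GM HC (range cc)" and cc_HC: "cc p \<in> HC"
 unfolding HC_def using cspan_csub[of "range cc" GM] ltotal_cspan[of "range cc" GM] cc_L2
 by (auto intro: cspan.base)

lemma HC_cnj: "F \<in> HC ==> (%x. cnj (F x)) \<in> HC"
 unfolding HC_def
proof (induct rule: cspan.induct)
 case (base a)
 then obtain p where "a = cc p" by blast
 then have "(%x. cnj (a x)) = cc p" by (simp add: cc_def fun_eq_iff)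
 then show ?case using cspan.base[of "cc p" "range cc"] by simp
next
 case (lim h f)
 have "l2sq GM (%x. cnj (h n x) - cnj (f x)) = l2sq GM (%x. h n x - f x)" for n
 unfolding l2sq_def complex_cnj_diff[symmetric] complex_mod_cnj ..
 note e = this
 show ?case
 proof (rule cspan.lim[of "%n x. cnj (h n x)"])
 show "(%x. cnj (h n x)) \<in> cspan GM (range cc)" for n by (rule lim.hyps(2))
 show "(%x. cnj (f x)) \<in> L2 GM" by (rule L2_cnj[OF lim.hyps(3)])
 show "l2lim GM (%n x. cnj (h n x)) (%x. cnj (f x))" unfolding e by (rule lim.hyps(4))
 qed
next
 case (add f g) then show ?case using cspan.add[OF add(2,4)] by simp
next
 case (scale f c) then show ?case using cspan.scale[OF scale(2), of "cnj c"] by simp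
qed (simp add: cspan.zero)

lemma HC_Re: "F \<in> HC ==> (%x. complex_of_real (Re (F x))) \<in> HC"
 and HC_Im: "F \<in> HC ==> (%x. complex_of_real (Im (F x))) \<in> HC"
proof -
 assume F: "F \<in> HC"
 have "(%x. complex_of_real (Re (F x))) = (%x. (1 / 2) * (F x + cnj (F x)))"
 by (simp add: fun_eq_iff complex_eq_iff)
 also have "\<dots> \<in> HC" by (intro csub_scale[OF HC_csub] csub_add[OF HC_csub] HC_cnj F)
 finally show "(%x. complex_of_real (Re (F x))) \<in> HC" .
 have "(%x. complex_of_real (Im (F x))) = (%x. (- \<i> / 2) * (F x + (- 1) * cnj (F x)))"
 by (simp add: fun_eq_iff complex_eq_iff)
 also have "\<dots> \<in> HC" by (intro csub_scale[OF HC_csub] csub_add[OF HC_csub] HC_cnj F)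
 finally show "(%x. complex_of_real (Im (F x))) \<in> HC" .
qed

lemma complexification_iff: "F \<in> complexification H \<longleftrightarrow> (%x. Re (F x)) \<in> H & (%x. Im (F x)) \<in> H"
proof
 assume "F \<in> complexification H"
 then obtain u v where "F = (%x. Complex (u x) (v x))" "u \<in> H" "v \<in> H" unfolding complexification_def by blast
 then show "(%x. Re (F x)) \<in> H & (%x. Im (F x)) \<in> H" by simp
next
 assume "(%x. Re (F x)) \<in> H & (%x. Im (F x)) \<in> H"
 then show "F \<in> complexification H" unfolding complexification_def
 by (intro CollectI exI[of _ "%x. Re (F x)"] exI[of _ "%x. Im (F x)"]) simp
qed

text \<open>The generators \<open>cc p\<close> are real, so \<open>HC\<close> is invariant under
  conjugation and contains real and imaginary parts of its members.\<close>

lemma complexification_GH: "complexification GH = HC"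
proof (intro equalityI subsetI)
 fix F assume F: "F \<in> complexification GH"
 have "F = (%x. complex_of_real (Re (F x)) + \<i> * complex_of_real (Im (F x)))"
 by (simp add: fun_eq_iff complex_eq_iff)
 also have "\<dots> \<in> HC" using F unfolding complexification_iff GH_def
 by (intro csub_add[OF HC_csub] csub_scale[OF HC_csub]) simp_all
 finally show "F \<in> HC" .
qed (simp add: complexification_iff GH_def HC_Re HC_Im)

lemma GH_L2: "f \<in> GH ==> f \<in> L2 GM"
proof -
 assume "f \<in> GH"
 then have F: "(%x. complex_of_real (f x)) \<in> L2 GM" using csub_L2[OF HC_csub] by (simp add: GH_def)
 then have "(%x. Re (complex_of_real (f x))) \<in> borel_measurable GM" using L2_measurable[OF F] by measurable
 then show ?thesis using L2_integrable[OF F] by (simp add: L2_def)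
qed

lemma GH_closed: "closed_real_subspace GM GH"
 unfolding closed_real_subspace_def
proof (intro conjI ballI allI impI)
 show "GH \<subseteq> L2 GM" using GH_L2 by blast
 show "(%_. 0) \<in> GH" using csub_zero[OF HC_csub] by (simp add: GH_def)
 show "(%x. f x + g x) \<in> GH" if "f \<in> GH" "g \<in> GH" for f g
 using csub_add[OF HC_csub, of "%x. of_real (f x)" "%x. of_real (g x)"] that by (simp add: GH_def)
 show "(%x. c * f x) \<in> GH" if "f \<in> GH" for c f
 using csub_scale[OF HC_csub, of "%x. of_real (f x)" "of_real c"] that by (simp add: GH_def)
 fix h f assume a: "(\<forall>n. h n \<in> GH) & f \<in> L2 GM & (%n. \<integral>x. (h n x - f x)\<^sup>2 \<partial>GM) \<longlonglongrightarrow> 0"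
 then have fm: "f \<in> borel_measurable GM" and fi: "integrable GM (%x. (norm (f x))\<^sup>2)" by (simp_all add: L2_def)
 have "(%x. complex_of_real (f x)) \<in> HC"
 proof (rule csub_lim[OF HC_csub, of "%n x. of_real (h n x)"])
 show "(%x. complex_of_real (h n x)) \<in> HC" for n using a by (simp add: GH_def)
 show "(%x. complex_of_real (f x)) \<in> L2 GM" using fm fi by (simp add: L2_def)
 show "l2lim GM (%n x. complex_of_real (h n x)) (%x. complex_of_real (f x))"
  using a by (simp add: l2sq_def flip: of_real_diff)
 qed
 then show "f \<in> GH" by (simp add: GH_def)
qed

lemma HC_shift: "F \<in> HC ==> (%x. F (cshift N x)) \<in> HC"
 unfolding HC_def
proof (induct rule: cspan.induct)
 case (base a)
 then obtain p where "a = cc p" by blast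
 then have "(%x. a (cshift N x)) = cc (shift N p)" by (simp add: cc_def fun_eq_iff cshift_def)
 then show ?case using cspan.base[of "cc (shift N p)" "range cc"] by simp
next
 case (lim h f)
 have hL: "h n \<in> L2 GM" for n using lim(1)[of n] csub_L2[OF HC_csub] by (simp add: HC_def)
 have "l2sq GM (%x. h n (cshift N x) - f (cshift N x)) = l2sq GM (%x. h n x - f x)" for n
 unfolding l2sq_def
 by (rule mpres_integral[OF cshift_mpres]) (use L2_measurable[OF L2_diff[OF hL lim.hyps(3)]] in measurable)
 note e = this
 show ?case
 proof (rule cspan.lim[of "%n x. h n (cshift N x)"])
 show "(%x. h n (cshift N x)) \<in> cspan GM (range cc)" for n by (rule lim.hyps(2))
 show "(%x. f (cshift N x)) \<in> L2 GM" by (rule mpres_L2[OF cshift_mpres lim.hyps(3)])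
 show "l2lim GM (%n x. h n (cshift N x)) (%x. f (cshift N x))" unfolding e by (rule lim.hyps(4))
 qed
next
 case (add f g) show ?case by (rule cspan.add[OF add(2,4)])
next
 case (scale f c) show ?case by (rule cspan.scale[OF scale(2)])
qed (rule cspan.zero)

lemma iexp_diff_bound: "cmod (iexp a - iexp b) \<le> \<bar>a - b\<bar>"
proof -
 have "iexp a - iexp b = iexp b * (iexp (a - b) - 1)" by (simp add: algebra_simps exp_diff)
 then have "cmod (iexp a - iexp b) = cmod (iexp (a - b) - 1)" by (simp add: norm_mult)
 also have "\<dots> \<le> \<bar>a - b\<bar>" using iexp_approx1[of "a - b" 0] by simp
 finally show ?thesis .
qed

lemma qcomb_Re: "\<exists>F c. finite F & (\<forall>x. Re (qcomb cc L x) = (\<Sum>p\<in>F. c p * x p))"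
proof -
 have "(%x. Re (qcomb cc L x)) \<in> comb"
 proof (induct L)
 case (Cons a L)
 obtain r s n where a: "a = ((r, s), n)" by (metis prod.exhaust)
 have "(%x. Re (qcomb cc (a # L) x)) = (%x. of_rat r * x n + Re (qcomb cc L x))"
  by (simp add: a qcomb_Cons cc_def fun_eq_iff)
 also have "\<dots> \<in> comb" by (rule comb.H_add[OF comb.H_scale[OF comb_coord] Cons])
 finally show ?case .
 next
 case Nil
 show ?case using comb.H_zero by (simp only: qcomb_Nil zero_complex.sel)
 qed
 then obtain F c where F: "finite F" "(%x. Re (qcomb cc L x)) = (%x. \<Sum>p\<in>F. c p * x p)" unfolding comb_def by blast
 show ?thesis by (intro exI[of _ F] exI[of _ c] conjI allI F(1) fun_cong[OF F(2)])
qed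

lemma char_tendsto:
 fixes g :: "nat => 'a => real"
 assumes M: "prob_space M" and gm [measurable]: "!!n. g n \<in> borel_measurable M" and fm [measurable]: "f \<in> borel_measurable M"
 and gL: "!!n. (%x. complex_of_real (g n x)) \<in> L2 M" and FL: "(%x. complex_of_real (f x)) \<in> L2 M"
 and lim: "l2lim M (%n x. complex_of_real (g n x)) (%x. complex_of_real (f x))"
 shows "(%n. \<integral>x. iexp (t * g n x) \<partial>M) \<longlonglongrightarrow> (\<integral>x. iexp (t * f x) \<partial>M)"
proof -
 interpret prob_space M by (rule M)
 have one: "(%_. 1) \<in> L2 M" by (simp add: L2_def)
 show ?thesis
 proof (rule iffD2[OF tendsto_dist_iff], rule tendsto_sandwich[OF _ _ tendsto_const])
  have "(%n. \<bar>t\<bar> * sqrt (l2sq M (%x. complex_of_real (g n x) - of_real (f x)))) \<longlonglongrightarrow> \<bar>t\<bar> * sqrt 0"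
  by (intro tendsto_intros lim)
  then show "(%n. \<bar>t\<bar> * sqrt (l2sq M (%x. complex_of_real (g n x) - of_real (f x)))) \<longlonglongrightarrow> 0" by simp
  show "\<forall>\<^sub>F n in sequentially. dist (\<integral>x. iexp (t * g n x) \<partial>M) (\<integral>x. iexp (t * f x) \<partial>M)
   \<le> \<bar>t\<bar> * sqrt (l2sq M (%x. complex_of_real (g n x) - of_real (f x)))"
  proof (intro always_eventually allI)
  fix n
  define k where "k x = complex_of_real \<bar>g n x - f x\<bar>" for x
  have km: "k \<in> borel_measurable M" unfolding k_def by measurable
  have kn: "norm (k x) = norm (complex_of_real (g n x) - of_real (f x))" for x
   by (simp add: k_def flip: of_real_diff)
  have kL: "k \<in> L2 M" using km L2_integrable[OF L2_diff[OF gL FL]] by (simp add: L2_def kn)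
  have ki: "integrable M (%x. \<bar>g n x - f x\<bar>)"
   using integrable_Re[OF L2_integrable_mult[OF kL one]] by (simp add: k_def)
  have ie: "integrable M (%x. iexp (h x))" if [measurable]: "h \<in> borel_measurable M" for h :: "_ => real"
   by (rule integrable_const_bound[of _ 1]) auto
  have mg: "(%x. t * g n x) \<in> borel_measurable M" "(%x. t * f x) \<in> borel_measurable M" by measurable
  have "dist (\<integral>x. iexp (t * g n x) \<partial>M) (\<integral>x. iexp (t * f x) \<partial>M) = cmod (\<integral>x. iexp (t * g n x) - iexp (t * f x) \<partial>M)"
   unfolding dist_norm
   by (subst Bochner_Integration.integral_diff[OF ie[OF mg(1)] ie[OF mg(2)]]) (rule refl)
  also have "\<dots> \<le> (\<integral>x. \<bar>t\<bar> * \<bar>g n x - f x\<bar> \<partial>M)"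
  proof (rule order_trans[OF integral_norm_bound integral_mono])
   show "integrable M (%x. cmod (iexp (t * g n x) - iexp (t * f x)))"
   by (intro integrable_norm Bochner_Integration.integrable_diff ie mg)
   show "integrable M (%x. \<bar>t\<bar> * \<bar>g n x - f x\<bar>)" using ki by simp
   show "cmod (iexp (t * g n x) - iexp (t * f x)) \<le> \<bar>t\<bar> * \<bar>g n x - f x\<bar>" for x
   using iexp_diff_bound[of "t * g n x" "t * f x"] by (simp only: right_diff_distrib[symmetric] abs_mult)
  qed
  also have "\<dots> = \<bar>t\<bar> * (\<integral>x. \<bar>g n x - f x\<bar> \<partial>M)" by simp
  also have "(\<integral>x. \<bar>g n x - f x\<bar> \<partial>M) \<le> sqrt (l2sq M k)"
  proof (rule real_le_rsqrt)
   have "L2_inner M k (%_. 1) = of_real (\<integral>x. \<bar>g n x - f x\<bar> \<partial>M)"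
   by (simp add: L2_inner_def k_def flip: integral_complex_of_real)
   then show "(\<integral>x. \<bar>g n x - f x\<bar> \<partial>M)\<^sup>2 \<le> l2sq M k"
   using L2_Cauchy_Schwarz[OF kL one] by (simp add: l2sq_def prob_space)
  qed
  also have "l2sq M k = l2sq M (%x. complex_of_real (g n x) - of_real (f x))"
   unfolding l2sq_def kn ..
  finally show "dist (\<integral>x. iexp (t * g n x) \<partial>M) (\<integral>x. iexp (t * f x) \<partial>M)
   \<le> \<bar>t\<bar> * sqrt (l2sq M (%x. complex_of_real (g n x) - of_real (f x)))" by (simp add: mult_left_mono)
  qed
 qed simp
qed

text \<open>L2 limits of centred Gaussians are Gaussian: characteristic functions and variances both
  converge. The approximants are real parts of rational combinations, hence real combinations of
  coordinates, whose laws are known.\<close>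

lemma GH_gaussian:
 assumes f: "f \<in> GH" shows "centered_gaussian GM f"
proof -
 interpret prob_space GM by (rule GM_prob)
 let ?F = "%x. complex_of_real (f x)"
 have F: "?F \<in> HC" using f by (simp add: GH_def)
 note FL = csub_L2[OF HC_csub F]
 have fm [measurable]: "f \<in> borel_measurable GM" using GH_L2[OF f] by (simp add: L2_def)
 obtain L where L: "l2lim GM (%n. qcomb cc (L n)) ?F" using cspan_approx[OF cc_L2 F[unfolded HC_def]] .
 have qL: "qcomb cc (L n) \<in> L2 GM" for n by (rule qcomb_csub[OF csub_UNIV cc_L2])
 define g where "g n x = Re (qcomb cc (L n) x)" for n x
 have "\<exists>r. finite (fst r) & (\<forall>x. g n x = (\<Sum>p\<in>fst r. snd r p * x p))" for n
 proof -
 obtain F c where "finite F" "\<forall>x. Re (qcomb cc (L n) x) = (\<Sum>p\<in>F. c p * x p)" using qcomb_Re by blast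
 then show ?thesis unfolding g_def by (intro exI[of _ "(F, c)"]) simp
 qed
 from choice[OF allI[OF this]] obtain r where
 r: "\<forall>n. finite (fst (r n)) & (\<forall>x. g n x = (\<Sum>p\<in>fst (r n). snd (r n) p * x p))" ..
 define A c where "A n = fst (r n)" and "c n = snd (r n)" for n
 have A: "finite (A n)" and gA: "g n x = (\<Sum>p\<in>A n. c n p * x p)" for n x
 using r unfolding A_def c_def by blast+
 have gA': "g n = (%x. \<Sum>p\<in>A n. c n p * x p)" for n by (simp add: gA fun_eq_iff)
 define v where "v n = (\<integral>x. (g n x)\<^sup>2 \<partial>GM)" for n
 have gL: "(%x. complex_of_real (g n x)) \<in> L2 GM" for n
 unfolding g_def by (rule csub_L2[OF HC_csub HC_Re[OF qcomb_csub[where b = cc, OF HC_csub cc_HC]]])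
 have gm [measurable]: "g n \<in> borel_measurable GM" for n unfolding gA' by measurable
 have lim: "l2lim GM (%n x. complex_of_real (g n x)) ?F"
 proof (rule tendsto_sandwich[OF _ _ tendsto_const L])
 show "\<forall>\<^sub>F n in sequentially. l2sq GM (%x. complex_of_real (g n x) - of_real (f x)) \<le> l2sq GM (%x. qcomb cc (L n) x - of_real (f x))"
 proof (intro always_eventually allI l2sq_mono L2_diff qL FL AE_I2)
  fix n x
  have "\<bar>Re (qcomb cc (L n) x - of_real (f x))\<bar> \<le> cmod (qcomb cc (L n) x - of_real (f x))" by (rule abs_Re_le_cmod)
  then show "cmod (complex_of_real (g n x) - of_real (f x)) \<le> cmod (qcomb cc (L n) x - of_real (f x))"
  by (simp add: g_def flip: of_real_diff)
 qed measurable
 qed simp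
 have sq: "l2sq GM (%x. complex_of_real (k x)) = (\<integral>x. (k x)\<^sup>2 \<partial>GM)" for k by (simp add: l2sq_def)
 have v: "v \<longlonglongrightarrow> (\<integral>x. (f x)\<^sup>2 \<partial>GM)"
 using l2lim_norm[OF gL FL lim] by (simp only: sq v_def[abs_def])
 have ch: "(\<integral>x. iexp (t * f x) \<partial>GM) = complex_of_real (exp (- (t\<^sup>2 * (\<integral>x. (f x)\<^sup>2 \<partial>GM)) / 2))" for t
 proof (rule LIMSEQ_unique)
 have "(\<integral>x. iexp (t * g n x) \<partial>GM) = of_real (exp (- (t\<^sup>2 * v n) / 2))" for n
 proof -
  have "centered_gaussian GM (%x. t * g n x)"
  using comb_gaussian(1)[OF A[of n], of "%p. t * c n p"] by (simp add: gA sum_distrib_left mult.assoc)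
  moreover have "(%x. (t * g n x) * (t * g n x)) = (%x. t\<^sup>2 * (g n x)\<^sup>2)"
  by (rule ext) (simp add: power2_eq_square)
  ultimately show ?thesis using centered_gaussian_integrals(1)[OF GM_prob, of "%x. t * g n x"]
  by (simp only: v_def Bochner_Integration.integral_mult_right_zero)
 qed
 moreover have "(%n. complex_of_real (exp (- (t\<^sup>2 * v n) / 2))) \<longlonglongrightarrow> of_real (exp (- (t\<^sup>2 * (\<integral>x. (f x)\<^sup>2 \<partial>GM)) / 2))"
  by (intro tendsto_intros v) simp
 ultimately show "(%n. \<integral>x. iexp (t * g n x) \<partial>GM) \<longlonglongrightarrow> of_real (exp (- (t\<^sup>2 * (\<integral>x. (f x)\<^sup>2 \<partial>GM)) / 2))" by (simp only:)
 show "(%n. \<integral>x. iexp (t * g n x) \<partial>GM) \<longlonglongrightarrow> (\<integral>x. iexp (t * f x) \<partial>GM)"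
  by (rule char_tendsto[OF GM_prob gm fm gL FL lim])
 qed
 show ?thesis by (rule gaussian_of_char(1)[OF GM_prob fm _ ch]) simp
qed

lemma GH_generates: "generates_mod_null GM GH"
 unfolding generates_mod_null_def
proof (intro ballI bexI)
 fix A assume "A \<in> sets GM"
 moreover have "(%x. x p) \<in> GH" for p using cc_HC[of p] by (simp add: GH_def cc_def[abs_def])
 ultimately show "A \<in> sigma_sets (space GM) {h -` C \<inter> space GM |h C. h \<in> GH & C \<in> sets borel}"
 using cylinder_generates[of A GH] by (simp add: sets_GM)
qed simp

section \<open>The unitary operator U and the equivalence with the shift\<close>

lemma shift_range: "range (%p. uv (shift N p)) = range uv"
proof -
 have "uv p = uv (shift N (shift (- N) p))" for p by simp
 then show ?thesis by blast
qed

text \<open>The time shift preserves the Gram matrix, and since it permutes the indices, the shifted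
  family is again total; so the extension is unitary. Over counting measure almost everywhere
  equality is equality, so the action on \<open>uv\<close> holds literally.\<close>

lemma U_exists: "\<exists>U. unitary_map counting ell2 counting ell2 U & (\<forall>p. U (uv p) = uv (shift 1 p))"
proof (rule imap_extension[OF csub_UNIV csub_UNIV, of UNIV uv counting "%p. uv (shift 1 p)" counting])
 fix W assume W: "!!p. p \<in> UNIV ==> AE y in counting. W (uv p) y = uv (shift 1 p) y"
 "ltotal counting ell2 ((%p. uv (shift 1 p)) ` UNIV) ==> unitary_map counting ell2 counting ell2 W"
 have "W (uv p) = uv (shift 1 p)" for p using W(1)[of p] by (simp add: AE_count_space fun_eq_iff)
 with W(2) show ?thesis unfolding shift_range using uv_total by blast
qed (auto simp: uv_ell2 uv_inner uv_total)

definition U :: "(nat => complex) => nat => complex" where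
 "U = (SOME U. unitary_map counting ell2 counting ell2 U & (\<forall>p. U (uv p) = uv (shift 1 p)))"

lemma U_unitary: "unitary_map counting ell2 counting ell2 U" and U_uv: "U (uv p) = uv (shift 1 p)"
 using someI_ex[OF U_exists] unfolding U_def[symmetric] by blast+

lemma U_imap: "isometric_map counting ell2 counting ell2 U"
 using U_unitary by (simp add: unitary_map_iff)

lemma Upow_imap: "isometric_map counting ell2 counting ell2 (U ^^ N)"
proof (induct N)
 case (Suc N)
 from imap_comp[OF Suc U_imap csub_UNIV csub_UNIV csub_UNIV] show ?case by (simp add: comp_def)
qed (simp add: isometric_map_def)

lemma Upow_uv: "(U ^^ N) (uv p) = uv (shift (int N) p)"
 by (induct N) (simp_all add: U_uv add.commute)

text \<open>In the model over \<theta> the operator is multiplication by \<open>z\<close>, so an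
  eigenvector for \<open>c\<close> is supported on the fibre over \<open>c\<close>, a null set
  because \<theta> has no atoms.\<close>

lemma U_continuous: "continuous_spectrum counting ell2 U"
 unfolding continuous_spectrum_def
proof (intro allI ballI impI)
 fix c f assume f: "f \<in> ell2" and e: "AE x in counting. U f x = c * f x"
 then have Uf: "U f = (%x. c * f x)" by (simp add: AE_count_space fun_eq_iff)
 show "AE x in counting. f x = 0"
 proof (rule imap_extension[OF csub_UNIV csub_UNIV, of UNIV uv counting "%p. yv (comp p) (time p)" mod.FM])
 fix W assume W: "isometric_map counting ell2 mod.FM (L2 mod.FM) W"
  "!!p. p \<in> UNIV ==> AE y in mod.FM. W (uv p) y = yv (comp p) (time p) y"
 note CC = csub_UNIV[of counting] csub_UNIV[of mod.FM]
 note m1 = mult_imap[OF mod.FM_fst mod.FM_AE_circle, of 1]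
 have "AE y in mod.FM. W (U f) y = fst y powi 1 * W f y"
 proof (rule imap_agree[OF imap_comp[OF U_imap W(1) CC(1) CC] imap_comp[OF W(1) m1 CC(1,2,2)] CC uv_total _ f])
  fix a assume "a \<in> range uv"
  then obtain p where a: "a = uv p" by blast
  have "AE y in mod.FM. W (uv (shift 1 p)) y = yv (comp p) (time p + 1) y" using W(2)[of "shift 1 p"] by simp
  moreover have "AE y in mod.FM. W (uv p) y = yv (comp p) (time p) y" using W(2) by simp
  ultimately show "AE y in mod.FM. W (U a) y = fst y powi 1 * W a y"
  unfolding a U_uv using mod.FM_AE_circle
  proof eventually_elim
  case (elim y)
  then have "fst y ~= 0" by auto
  then show ?case unfolding elim by (simp add: yv_def power_int_add)
  qed
 qed
 moreover have "AE y in mod.FM. W (U f) y = c * W f y" unfolding Uf by (rule imap_scale[OF W(1) f])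
 moreover have "AE y in mod.FM. fst y ~= c" by (rule mod.FM_AE[OF mod.PM_AE_fst[OF \<theta>_AE_neq]])
 ultimately have "AE y in mod.FM. W f y = 0" by eventually_elim auto
 then have "l2sq mod.FM (W f) = 0" using l2sq_zero_iff[OF imap_in[OF W(1) f]] by simp
 then have "l2sq counting f = 0" by (simp only: l2sq_inner imap_inner[OF W(1) f f])
 then show ?thesis by (simp only: l2sq_zero_iff[OF f])
 qed (auto simp: uv_ell2 uv_inner uv_total yv_L2 yv_kern)
qed

text \<open>The families \<open>cc\<close> and \<open>uv\<close> share the Gram matrix
  \<open>kern\<close>, and on both sides the operator advances time by \<open>N\<close>.\<close>

lemma GM_equivalent: "unitarily_equivalent GM (complexification GH) (koopman (cshift (int N))) counting ell2 (U ^^ N)"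
 unfolding complexification_GH unitarily_equivalent_def
proof (rule imap_extension[OF HC_csub csub_UNIV, of UNIV cc uv counting])
 fix W assume W: "isometric_map GM HC counting ell2 W" "!!p. p \<in> UNIV ==> AE y in counting. W (cc p) y = uv p y"
 "ltotal counting ell2 (uv ` UNIV) ==> unitary_map GM HC counting ell2 W"
 have Wp: "W (cc p) = uv p" for p using W(2)[of p] by (simp add: AE_count_space fun_eq_iff)
 have T: "isometric_map GM HC GM HC (koopman (cshift (int N)))"
 unfolding isometric_map_def koopman_def
 using HC_shift mpres_inner[OF cshift_mpres] csub_L2[OF HC_csub] by auto
 have "\<forall>f\<in>HC. AE y in counting. W (koopman (cshift (int N)) f) y = (U ^^ N) (W f) y"
 proof
 fix f assume f: "f \<in> HC"
 show "AE y in counting. W (koopman (cshift (int N)) f) y = (U ^^ N) (W f) y"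
 proof (rule imap_agree[OF imap_comp[OF T W(1) HC_csub HC_csub csub_UNIV]
   imap_comp[OF W(1) Upow_imap HC_csub csub_UNIV csub_UNIV] HC_csub csub_UNIV HC_total _ f])
  fix a assume "a \<in> range cc"
  then obtain p where a: "a = cc p" by blast
  have "koopman (cshift (int N)) (cc p) = cc (shift (int N) p)" by (simp add: koopman_def cc_def cshift_def fun_eq_iff)
  then show "AE y in counting. W (koopman (cshift (int N)) a) y = (U ^^ N) (W a) y"
  by (simp add: a Wp Upow_uv)
 qed
 qed
 then show "\<exists>W. unitary_map GM HC counting ell2 W & (\<forall>f\<in>HC. AE y in counting. W (koopman (cshift (int N)) f) y = (U ^^ N) (W f) y)"
 using W(3)[OF uv_total] by blast
qed (auto simp: cc_HC uv_ell2 uv_inner cc_inner HC_total)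

lemma GH_koopman: "h \<in> GH ==> koopman (cshift N) h \<in> GH"
 using HC_shift[of "%x. complex_of_real (h x)"] by (simp add: GH_def koopman_def)

section \<open>The characters as a total family in L2 of a circle measure\<close>

context
 fixes \<mu> :: "complex measure"
 assumes \<mu>: "circle_measure \<mu>"
begin

lemma circle_measurable: "f \<in> borel_measurable borel ==> (f :: complex => complex) \<in> borel_measurable \<mu>"
 by (simp only: measurable_cong_sets[OF circle_measureD(2)[OF \<mu>] refl])

lemma circle_bounded_L2:
 fixes f :: "complex => complex"
 assumes "f \<in> borel_measurable borel" "AE z in \<mu>. cmod (f z) \<le> B"
 shows "f \<in> L2 \<mu>"
proof (rule L2_bound[OF circle_measurable[OF assms(1)], of "%_. B\<^sup>2"])
 interpret finite_measure \<mu> using circle_measureD(1)[OF \<mu>] .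
 show "integrable \<mu> (%_. B\<^sup>2)" by simp
 show "AE z in \<mu>. (norm (f z))\<^sup>2 \<le> B\<^sup>2" using assms(2) by eventually_elim (rule power_mono, simp_all)
qed

lemma circle_power_L2: "(%z. z powi n) \<in> L2 \<mu>"
proof (rule circle_bounded_L2[OF power_int_measurable])
 show "AE z in \<mu>. cmod (z powi n) \<le> 1"
 using circle_measureD(3)[OF \<mu>] by eventually_elim (simp add: norm_power_int)
qed

lemma circle_power_inner: "L2_inner \<mu> (%z. z powi n) (%z. z powi l) = (\<integral>z. z powi (n - l) \<partial>\<mu>)"
 unfolding L2_inner_def
proof (rule integral_cong_AE)
 show "(%z. z powi n * cnj (z powi l)) \<in> borel_measurable \<mu>" "(%z. z powi (n - l)) \<in> borel_measurable \<mu>"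
 by (rule circle_measurable, measurable)+
 show "AE z in \<mu>. z powi n * cnj (z powi l) = z powi (n - l)" using circle_measureD(3)[OF \<mu>]
 proof eventually_elim
 case (elim z)
 then have "z ~= 0" by auto
 then show ?case unfolding cnj_power_int_circle[OF elim] by (simp add: power_int_add[symmetric])
 qed
qed

lemma circle_power_total: "ltotal \<mu> (L2 \<mu>) (range (%n z. z powi n))"
 unfolding ltotal_def
proof (intro conjI ballI impI)
 show "range (%n z. z powi n) \<subseteq> L2 \<mu>" using circle_power_L2 by auto
 fix f assume f: "f \<in> L2 \<mu>" and 0: "\<forall>a\<in>range (%n z. z powi n). L2_inner \<mu> f a = 0"
 have fi: "integrable \<mu> f" using L2_integrable_mult[OF f circle_power_L2[of 0]] by simp
 show "AE z in \<mu>. f z = 0"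
 proof (rule circle_Fourier_unique[OF \<mu> fi])
 fix n
 note pm = circle_measurable[OF power_int_measurable] and fm = L2_measurable[OF f]
 have "(\<integral>z. z powi n * f z \<partial>\<mu>) = L2_inner \<mu> f (%z. z powi (- n))" unfolding L2_inner_def
 proof (rule integral_cong_AE)
  show "(%z. z powi n * f z) \<in> borel_measurable \<mu>" by (rule borel_measurable_times[OF pm fm])
  show "(%z. f z * cnj (z powi - n)) \<in> borel_measurable \<mu>"
  by (rule borel_measurable_times[OF fm]) (rule circle_measurable, measurable)
  show "AE z in \<mu>. z powi n * f z = f z * cnj (z powi - n)" using circle_measureD(3)[OF \<mu>]
  proof eventually_elim
  case (elim z)
  show ?case unfolding cnj_power_int_circle[OF elim] by (simp add: mult.commute)
  qed
 qed
 then show "(\<integral>z. z powi n * f z \<partial>\<mu>) = 0" using 0 by auto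
 qed
qed

end

section \<open>The complexified first chaos\<close>

context gaussian_space
begin

abbreviation "HCH \<equiv> complexification H"

lemma HCH_split: "F = (%x. cx (%x. Re (F x)) x + \<i> * cx (%x. Im (F x)) x)"
 by (simp add: cx_def fun_eq_iff complex_eq_iff)

lemma HCH_L2: "F \<in> HCH ==> F \<in> L2 M"
 unfolding complexification_iff by (subst HCH_split) (intro L2_add L2_scale cx_L2, simp_all)

lemma cx_HCH: "h \<in> H ==> cx h \<in> HCH"
 by (simp add: complexification_iff cx_def H_zero)

lemma HCH_csub: "csub M HCH"
 unfolding csub_def
proof (intro conjI ballI allI impI)
 show "HCH \<subseteq> L2 M" using HCH_L2 by blast
 show "(%_. 0) \<in> HCH" by (simp add: complexification_iff H_zero)
 show "(%x. f x + g x) \<in> HCH" if "f \<in> HCH" "g \<in> HCH" for f g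
 using that H_add by (simp add: complexification_iff)
 show "(%x. c * f x) \<in> HCH" if f: "f \<in> HCH" for c f
 proof -
 have "(%x. Re c * Re (f x) + (- Im c) * Im (f x)) \<in> H" "(%x. Re c * Im (f x) + Im c * Re (f x)) \<in> H"
  using f by (intro H_add H_scale; simp add: complexification_iff)+
 then show ?thesis by (simp add: complexification_iff)
 qed
 fix h f assume h: "\<forall>n. h n \<in> HCH" and f: "f \<in> L2 M" and lim: "l2lim M h f"
 have cl: "p \<in> H" if "!!n. q n \<in> H" "p \<in> L2 M" "(%n. \<integral>x. (q n x - p x)\<^sup>2 \<partial>M) \<longlonglongrightarrow> 0" for p and q :: "nat => _"
 using closed that unfolding closed_real_subspace_def by blast
 have hf: "(%x. h n x - f x) \<in> L2 M" for n using h f HCH_L2 L2_diff by blast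
 have fm [measurable]: "f \<in> borel_measurable M" "!!n. h n \<in> borel_measurable M"
 using f h HCH_L2 by (auto simp: L2_def)
 have b: "(%n. \<integral>x. (r (h n x) - r (f x))\<^sup>2 \<partial>M) \<longlonglongrightarrow> 0" "(%x. r (f x)) \<in> L2 M"
 if r: "!!a b. r (a - b) = r a - (r b :: real)" "!!a. \<bar>r a\<bar> \<le> cmod a" and [measurable]: "r \<in> borel_measurable borel" for r
 proof -
 have r2: "(r a)\<^sup>2 \<le> (cmod a)\<^sup>2" for a using r(2)[of a] by (simp add: power2_le_iff_abs_le)
 show "(%n. \<integral>x. (r (h n x) - r (f x))\<^sup>2 \<partial>M) \<longlonglongrightarrow> 0"
 proof (rule tendsto_sandwich[OF _ _ tendsto_const lim]; intro always_eventually allI)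
  fix n
  show "(\<integral>x. (r (h n x) - r (f x))\<^sup>2 \<partial>M) \<le> l2sq M (%x. h n x - f x)" unfolding l2sq_def r(1)[symmetric]
  proof (rule integral_mono)
  show "integrable M (%x. (r (h n x - f x))\<^sup>2)"
   by (rule Bochner_Integration.integrable_bound[OF L2_integrable[OF hf[of n]]]) (use r2 in auto)
  qed (use L2_integrable[OF hf[of n]] r2 in auto)
 qed simp
 show "(%x. r (f x)) \<in> L2 M"
  by (rule L2_bound[OF _ L2_integrable[OF f]]) (use r2 in auto)
 qed
 have re: "\<bar>Re a\<bar> \<le> cmod a" and im: "\<bar>Im a\<bar> \<le> cmod a" for a by (rule abs_Re_le_cmod, rule abs_Im_le_cmod)
 have "(%x. Re (f x)) \<in> H"
 by (rule cl[of "%n x. Re (h n x)"]) (use h b[of Re, OF _ re] in \<open>simp_all add: complexification_iff\<close>)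
 moreover have "(%x. Im (f x)) \<in> H"
 by (rule cl[of "%n x. Im (h n x)"]) (use h b[of Im, OF _ im] in \<open>simp_all add: complexification_iff\<close>)
 ultimately show "f \<in> HCH" by (simp add: complexification_iff)
qed

lemma HCH_orth_one: "F \<in> HCH ==> L2_inner M F (%_. 1) = 0"
 unfolding complexification_iff
 by (subst HCH_split) (simp add: L2_inner_add_left cx_L2 L2_scale one_L2 L2_inner_scale_left one_inner)

lemma HCH_Re_lim:
 assumes "!!n. q n \<in> HCH" "h \<in> H" "l2lim M q (cx h)"
 shows "l2lim M (%n. cx (%x. Re (q n x))) (cx h)"
proof (rule tendsto_sandwich[OF _ _ tendsto_const assms(3)]; intro always_eventually allI)
 fix n
 have "cx (%x. Re (q n x)) \<in> L2 M" using assms(1) by (intro cx_L2) (simp add: complexification_iff)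
 note L = L2_diff[OF HCH_L2[OF assms(1)[of n]] cx_L2[OF assms(2)]] L2_diff[OF this cx_L2[OF assms(2)]]
 show "l2sq M (%x. cx (%x. Re (q n x)) x - cx h x) \<le> l2sq M (%x. q n x - cx h x)"
 proof (rule l2sq_mono[OF L(1) L2_measurable[OF L(2)]], rule AE_I2)
 fix x
 show "cmod (cx (%x. Re (q n x)) x - cx h x) \<le> cmod (q n x - cx h x)"
  using abs_Re_le_cmod[of "q n x - cx h x"] by (simp add: cx_def flip: of_real_diff)
 qed
qed simp

end

section \<open>The Koopman operator of an arbitrary realisation\<close>

text \<open>The realisation is arbitrary: all that is known is the intertwiner \<open>W\<close> from
  the first chaos to \<open>ell2\<close>. The concrete space \<open>GM\<close> will be one instance,
  so existence and the statement about all realisations share this analysis.\<close>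

locale gaussian_core = invertible_mpres M T R + gaussian_space M H
 for M :: "'a measure" and T R H +
 fixes k :: nat and W
 assumes gen: "generates_mod_null M H"
 and W: "unitary_map M (complexification H) counting ell2 W"
 and inv: "h \<in> H ==> koopman T h \<in> H"
 and WT: "f \<in> complexification H ==> AE y in counting. W (koopman T f) y = (U ^^ (3 ^ k)) (W f) y"
begin

abbreviation "VV \<equiv> L2_orth_constants M"
abbreviation "N \<equiv> (3 ^ k :: nat)"

lemma W_imap: "isometric_map M HCH counting ell2 W" using W by (simp add: unitary_map_iff)

lemma HCH_VV: "F \<in> HCH ==> F \<in> VV"
 using HCH_orth_one[of F] L2_inner_scale_right[of M F _ "%_. 1"]
 by (simp add: L2_orth_constants_def HCH_L2)

text \<open>The vectors of the first chaos that correspond to \<open>uv p\<close>. Their Gram matrix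
  is \<open>kern\<close>, and \<open>T\<close> moves them by \<open>3 ^ k\<close> time
  steps.\<close>

definition xv :: "nat => 'a => complex" where "xv p = (SOME F. F \<in> HCH & W F = uv p)"

lemma xv_HCH: "xv p \<in> HCH" and W_xv: "W (xv p) = uv p"
proof -
 have "\<exists>F\<in>HCH. AE y in counting. W F y = uv p y" using W uv_ell2 unfolding unitary_map_iff by blast
 then have "\<exists>F. F \<in> HCH & W F = uv p" by (auto simp: AE_count_space fun_eq_iff)
 from someI_ex[OF this] show "xv p \<in> HCH" "W (xv p) = uv p" unfolding xv_def by blast+
qed

lemma xv_VV: "xv p \<in> VV" using HCH_VV xv_HCH by blast
lemma xv_L2: "xv p \<in> L2 M" using HCH_L2 xv_HCH by blast

lemma xv_inner: "L2_inner M (xv p) (xv q) = of_real (kern p q)"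
 using imap_inner[OF W_imap xv_HCH xv_HCH, of p q] by (simp add: W_xv uv_inner)

lemma xv_total: "ltotal M HCH (range xv)"
 unfolding ltotal_def
proof (intro conjI ballI impI)
 show "range xv \<subseteq> HCH" using xv_HCH by auto
 fix f assume f: "f \<in> HCH" and 0: "\<forall>a\<in>range xv. L2_inner M f a = 0"
 have "L2_inner counting (W f) (uv p) = 0" for p
 using imap_inner[OF W_imap f xv_HCH[of p]] 0 by (simp add: W_xv)
 then have "AE y in counting. W f y = 0"
 using uv_total imap_in[OF W_imap f] unfolding ltotal_def by blast
 then have "l2sq counting (W f) = 0" using l2sq_zero_iff[OF imap_in[OF W_imap f]] by simp
 then have "l2sq M f = 0" by (simp only: l2sq_inner imap_inner[OF W_imap f f])
 then show "AE x in M. f x = 0" by (simp only: l2sq_zero_iff[OF HCH_L2[OF f]])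
qed

lemma HCH_span: "cspan M (range xv) = HCH"
 by (rule total_cspan[OF HCH_csub xv_total])

lemma P1_xv: "AE x in M. P 1 (xv p) x = xv (shift (int N) p) x"
proof -
 have "koopman T (xv p) \<in> HCH"
 using inv[of "%x. Re (xv p x)"] inv[of "%x. Im (xv p x)"] xv_HCH[of p] by (simp add: complexification_iff koopman_def)
 moreover have "AE y in counting. W (koopman T (xv p)) y = W (xv (shift (int N) p)) y"
 using WT[OF xv_HCH[of p]] unfolding W_xv Upow_uv by simp
 ultimately show ?thesis
 unfolding P_1 by (rule imap_inj[OF W_imap HCH_csub csub_UNIV _ xv_HCH])
qed

lemma P_cong: "f \<in> VV ==> g \<in> VV ==> AE x in M. f x = g x ==> AE x in M. P n f x = P n g x"
 by (rule imap_cong[OF P_imap V V])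

lemma P_step: "AE x in M. P (n + 1) (xv p) x = P n (xv (shift (int N) p)) x"
 using P_comp[OF xv_VV, of n 1 p] P_cong[OF P_in[OF xv_VV] xv_VV P1_xv, of n p] by eventually_elim simp

lemma P_xv: "AE x in M. P n (xv p) x = xv (shift (n * int N) p) x"
proof (induct n arbitrary: p rule: int_induct[where k = 0])
 case base then show ?case using P_zero[OF xv_VV, of p] by simp
next
 case (step1 i)
 show ?case using P_step[of i p] step1(2)[of "shift (int N) p"]
 by eventually_elim (simp add: algebra_simps)
next
 case (step2 i)
 show ?case using P_step[of "i - 1" "shift (- int N) p"] step2(2)[of "shift (- int N) p"]
 by eventually_elim (simp add: algebra_simps)
qed

lemma P_xv_inner: "L2_inner M (P n (xv p)) (xv q) = of_real (kern (shift (n * int N) p) q)"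
 using L2_inner_cong_AE[OF VL[OF P_in[OF xv_VV]] xv_L2 xv_L2 xv_L2 P_xv, of q q n p] by (simp add: xv_inner)

text \<open>Only forward invariance of \<open>H\<close> is given. Backward invariance is inherited
  from the \<open>xv p\<close>, which the group permutes up to null sets and which span the first
  chaos.\<close>

lemma P_HCH: "F \<in> HCH ==> P n F \<in> HCH"
proof -
 have "csub M {F \<in> HCH. P n F \<in> HCH}"
 unfolding csub_def
 proof (intro conjI ballI allI impI)
 show "{F \<in> HCH. P n F \<in> HCH} \<subseteq> L2 M" using HCH_L2 by blast
 show "(%_. 0) \<in> {F \<in> HCH. P n F \<in> HCH}" using csub_zero[OF HCH_csub] by (simp add: P_def)
 show "(%x. f x + g x) \<in> {F \<in> HCH. P n F \<in> HCH}"
  if "f \<in> {F \<in> HCH. P n F \<in> HCH}" "g \<in> {F \<in> HCH. P n F \<in> HCH}" for f g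
  using that csub_add[OF HCH_csub] by (simp add: P_add)
 show "(%x. c * f x) \<in> {F \<in> HCH. P n F \<in> HCH}" if "f \<in> {F \<in> HCH. P n F \<in> HCH}" for c f
  using that csub_scale[OF HCH_csub] by (simp add: P_scale)
 fix h f assume h: "\<forall>i. h i \<in> {F \<in> HCH. P n F \<in> HCH}" and f: "f \<in> L2 M" and lim: "l2lim M h f"
 have hi: "h i \<in> HCH" "P n (h i) \<in> HCH" for i using h by auto
 have fH: "f \<in> HCH" by (rule csub_lim[OF HCH_csub hi(1) f lim])
 have "l2lim M (%i. P n (h i)) (P n f)"
  by (rule imap_lim[OF P_imap V V HCH_VV[OF hi(1)] HCH_VV[OF fH] lim])
 then have "P n f \<in> HCH" by (rule csub_lim[OF HCH_csub hi(2) VL[OF P_in[OF HCH_VV[OF fH]]]])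
 with fH show "f \<in> {F \<in> HCH. P n F \<in> HCH}" by simp
 qed
 moreover have "range xv \<subseteq> {F \<in> HCH. P n F \<in> HCH}"
 proof -
 have "P n (xv p) \<in> HCH" for p
  by (rule csub_AE[OF HCH_csub xv_HCH]) (use VL[OF P_in[OF xv_VV]] P_xv[of n p] in \<open>auto simp: L2_def eq_commute\<close>)
 then show ?thesis using xv_HCH by auto
 qed
 ultimately have "cspan M (range xv) \<subseteq> {F \<in> HCH. P n F \<in> HCH}" by (rule cspan_least)
 then show "F \<in> HCH ==> P n F \<in> HCH" unfolding HCH_span by blast
qed

text \<open>The first chaos embeds into the model over \<theta> so that \<open>P n\<close> becomes
  multiplication by \<open>z powi (n * N)\<close>. There \<kappa> is the spectral measure of
  \<open>F\<close> for multiplication by \<open>z\<close>; it is absolutely continuous to \<theta>,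
  and the spectral measure for \<open>T\<close> is its image under \<open>z ^ 3 ^ k\<close>, handled
  by \<open>push_density\<close>.\<close>

lemma HCH_density:
 assumes F: "F \<in> HCH"
 obtains f where "f \<in> borel_measurable borel" "integrable \<theta> f" "!!z. 0 \<le> f z"
 "!!n. (\<integral>z. z powi n * of_real (f z) \<partial>\<theta>) = L2_inner M (P n F) F"
proof -
 note L2F = csub_UNIV[of mod.FM]
 obtain J where J: "isometric_map M HCH mod.FM (L2 mod.FM) J" "!!p. AE y in mod.FM. J (xv p) y = yv (comp p) (time p) y"
 by (rule imap_extension[OF HCH_csub L2F, of UNIV xv "%p. yv (comp p) (time p)"])
  (auto simp: xv_HCH yv_L2 xv_inner yv_kern xv_total)
 have PI: "isometric_map M HCH M HCH (P n)" for n
 unfolding isometric_map_def using P_HCH HCH_VV by (auto simp: P_add P_scale P_inner)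
 have JP: "AE y in mod.FM. J (P n F) y = fst y powi (n * int N) * J F y" for n
 proof (rule imap_agree[OF imap_comp[OF PI J(1) HCH_csub HCH_csub L2F]
  imap_comp[OF J(1) mult_imap[OF mod.FM_fst mod.FM_AE_circle] HCH_csub L2F L2F] HCH_csub L2F xv_total _ F])
 fix a assume "a \<in> range xv"
 then obtain p where a: "a = xv p" by blast
 have "AE y in mod.FM. J (P n (xv p)) y = J (xv (shift (n * int N) p)) y"
  by (rule imap_cong[OF J(1) HCH_csub L2F P_HCH[OF xv_HCH] xv_HCH P_xv])
 then show "AE y in mod.FM. J (P n a) y = fst y powi (n * int N) * J a y"
  using J(2)[of p] J(2)[of "shift (n * int N) p"] mod.FM_AE_circle unfolding a
 proof eventually_elim
  case (elim y)
  then have "fst y ~= 0" by auto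
  then show ?case unfolding elim(1,2,3) by (simp add: yv_def power_int_add)
 qed
 qed
 note JF = imap_in[OF J(1) F]
 have Jm [measurable]: "J F \<in> borel_measurable mod.FM" using JF by (simp add: L2_def)
 have jm [measurable]: "(%y. (cmod (J F y))\<^sup>2) \<in> borel_measurable mod.FM"
 by (rule borel_measurable_integrable[OF L2_integrable[OF JF]])
 define D where "D = density mod.FM (%y. ennreal ((cmod (J F y))\<^sup>2))"
 have fD [measurable]: "fst \<in> borel_measurable D" unfolding D_def using mod.FM_fst by simp
 have Dfin: "finite_measure D"
 proof (rule finite_measureI)
 have "emeasure D (space D) = (\<integral>\<^sup>+y. ennreal ((cmod (J F y))\<^sup>2) \<partial>mod.FM)"
  unfolding D_def by (subst emeasure_density) (auto intro!: nn_integral_cong)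
 also have "\<dots> < \<infinity>" using L2_integrable[OF JF] unfolding integrable_iff_bounded by (simp add: less_top)
 finally show "emeasure D (space D) ~= \<infinity>" by simp
 qed
 define \<kappa> where "\<kappa> = distr D borel fst"
 have DAE: "AE y in D. Q y" if "AE y in mod.FM. Q y" for Q
 unfolding D_def by (rule AE_densityI[OF _ that]) measurable
 have ck: "circle_measure \<kappa>"
 unfolding circle_measure_def
 proof (intro conjI)
 show "finite_measure \<kappa>" unfolding \<kappa>_def by (rule finite_measure.finite_measure_distr[OF Dfin fD])
 show "AE z in \<kappa>. cmod z = 1" unfolding \<kappa>_def
  by (subst AE_distr_iff[OF fD]) (measurable, rule DAE[OF mod.FM_AE_circle])
 qed (simp add: \<kappa>_def)
 have ac: "emeasure \<kappa> A = 0" if A: "A \<in> sets borel" and 0: "emeasure \<theta> (A - {}) = 0" for A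
 proof -
 have "A \<in> null_sets \<theta>" using A 0 by (simp add: null_sets_def sets_\<theta>)
 then have "AE z in \<theta>. z \<notin> A" by (rule AE_not_in)
 then have "AE y in D. fst y \<notin> A" by (intro DAE mod.FM_AE mod.PM_AE_fst)
 then have "emeasure D (fst -` A \<inter> space D) = 0"
  by (subst AE_iff_measurable[OF measurable_sets[OF fD A], symmetric, of "%y. fst y \<notin> A"]) auto
 then show ?thesis unfolding \<kappa>_def by (simp add: emeasure_distr[OF fD A])
 qed
 obtain r where r: "r \<in> borel_measurable borel" "integrable \<theta> r" "!!z. 0 \<le> r z"
 "!!n. (\<integral>z. z powi n * of_real (r z) \<partial>\<theta>) = (\<integral>z. z powi n \<partial>\<kappa>)"
 using density_of_ac[OF ck ac sets.empty_sets] by metis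
 obtain f where f: "f \<in> borel_measurable borel" "integrable \<theta> f" "!!z. 0 \<le> f z"
 "!!n. (\<integral>z. z powi n * of_real (f z) \<partial>\<theta>) = (\<integral>z. z powi (3 ^ k * n) * of_real (r z) \<partial>\<theta>)"
 using push_density[OF r(1-3)] by metis
 have "(\<integral>z. z powi n * of_real (f z) \<partial>\<theta>) = L2_inner M (P n F) F" for n
 proof -
 have "(\<integral>z. z powi n * of_real (f z) \<partial>\<theta>) = (\<integral>y. fst y powi (3 ^ k * n) \<partial>D)"
  unfolding f(4) r(4) \<kappa>_def by (rule integral_distr[OF fD]) measurable
 also have "\<dots> = (\<integral>y. (cmod (J F y))\<^sup>2 *\<^sub>R (fst y powi (3 ^ k * n)) \<partial>mod.FM)"
  unfolding D_def
 proof (rule integral_density)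
  show "(%y. fst y powi (3 ^ k * n)) \<in> borel_measurable mod.FM"
  by (rule measurable_compose[OF mod.FM_fst power_int_measurable])
  show "(%y. (cmod (J F y))\<^sup>2) \<in> borel_measurable mod.FM"
  by (rule jm)
 qed simp
 also have "\<dots> = (\<integral>y. fst y powi (n * int N) * J F y * cnj (J F y) \<partial>mod.FM)"
  by (simp add: scaleR_conv_of_real complex_norm_square mult_ac del: of_real_power)
 also have "\<dots> = L2_inner mod.FM (J (P n F)) (J F)"
  unfolding L2_inner_def[symmetric]
  by (rule L2_inner_cong_AE[OF imap_in[OF mult_imap[OF mod.FM_fst mod.FM_AE_circle] JF] imap_in[OF J(1) P_HCH[OF F]] JF JF])
  (use JP[of n] in eventually_elim, simp_all)
 also have "\<dots> = L2_inner M (P n F) F" by (rule imap_inner[OF J(1) P_HCH[OF F] F])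
 finally show ?thesis .
 qed
 with f(1-3) show thesis by (rule that)
qed

text \<open>The group maps \<open>H\<close> into itself isometrically, so a translate of
  \<open>wick h\<close> is \<open>wick\<close> of the translate. The correlations are then
  \<open>exp c - 1 - c\<close> for the correlations \<open>c\<close> of \<open>h\<close>, and
  \<open>exp_density\<close> yields a density that is zero on \<open>S\<close>.\<close>

lemma wick_density:
 assumes h: "h \<in> H"
 obtains f where "spectral_density \<theta> (wick h) f" "!!z. z \<in> S ==> f z = 0"
proof -
 obtain f where f: "f \<in> borel_measurable borel" "integrable \<theta> f" "!!z. 0 \<le> f z"
 "!!n. (\<integral>z. z powi n * of_real (f z) \<partial>\<theta>) = L2_inner M (P n (cx h)) (cx h)"
 by (rule HCH_density[OF cx_HCH[OF h]]; blast)
 obtain d where d: "d \<in> borel_measurable borel" "integrable \<theta> d" "!!z. 0 \<le> d z" "!!z. z \<in> S ==> d z = 0"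
 "!!n. (\<integral>z. z powi n * of_real (d z) \<partial>\<theta>) = exp (L2_inner M (P n (cx h)) (cx h)) - 1 - L2_inner M (P n (cx h)) (cx h)"
 by (rule exp_density[OF f(1-3), unfolded f(4)]; blast)
 have "L2_inner M (P n (wick h)) (wick h) = (\<integral>z. z powi n * of_real (d z) \<partial>\<theta>)" for n
 proof -
 let ?g = "%x. h (tau n x)"
 have Pc: "P n (cx h) = cx ?g" by (simp add: P_def cx_def)
 have g: "?g \<in> H" using P_HCH[OF cx_HCH[OF h], of n] by (simp add: Pc complexification_iff) (simp add: cx_def)
 have "rip ?g ?g = rip h h"
  unfolding rip_def by (rule mpres_integral[OF tau_mpres]) (use H_measurable[OF h] in measurable)
 then have Pw: "P n (wick h) = wick ?g" by (simp add: P_def wick_def gexp_def cx_def fun_eq_iff)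
 show ?thesis unfolding d(5) Pw Pc wick_inner(1)[OF g h] cx_inner ..
 qed
 then have "spectral_density \<theta> (wick h) d" unfolding spectral_density_def using d(1-3) by simp
 then show thesis using d(4) by (rule that)
qed

definition dd :: "nat => 'a => real" where "dd j = (%x. Re (qcomb xv (Countable.from_nat j) x))"

lemma dd_H: "dd j \<in> H"
 using qcomb_csub[where b = xv and L = "Countable.from_nat j", OF HCH_csub xv_HCH] by (simp add: complexification_iff dd_def)

lemma dd_dense:
 assumes h: "h \<in> H" shows "\<exists>d. (\<forall>n. d n \<in> range dd) & l2lim M (%n. cx (d n)) (cx h)"
proof -
 have "cx h \<in> cspan M (range xv)" unfolding HCH_span by (rule cx_HCH[OF h])
 then obtain L where L: "l2lim M (%n. qcomb xv (L n)) (cx h)" using cspan_approx[of xv M "cx h", OF xv_L2] by blast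
 have "(%x. Re (qcomb xv (L n) x)) = dd (Countable.to_nat (L n))" for n by (simp add: dd_def)
 then have "l2lim M (%n. cx (dd (Countable.to_nat (L n)))) (cx h)"
 using HCH_Re_lim[OF qcomb_csub[where b = xv, OF HCH_csub xv_HCH] h L] by simp
 then show ?thesis by (intro exI[of _ "%n. dd (Countable.to_nat (L n))"]) simp
qed

text \<open>A sequence generating the complement of the constants under the group. Even indices
  carry \<open>xv\<close> at times \<open>0..<3 ^ k\<close>: as \<open>T\<close> moves time by
  \<open>3 ^ k\<close>, one time per residue suffices, and the other codes are filled with 0. Odd
  indices carry the \<open>wick\<close> vectors of a countable dense subset of
  \<open>H\<close>.\<close>

definition fam :: "nat => 'a => complex" where
 "fam j = (if even j then if snd (prod_decode (j div 2)) < N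
  then xv (idx (fst (prod_decode (j div 2))) (int (snd (prod_decode (j div 2))))) else (%_. 0)
 else wick (dd (j div 2)))"

lemma fam_VV: "fam j \<in> VV"
proof -
 have "wick (dd i) \<in> VV" for i
 using wick_inner(2)[OF dd_H[of i] dd_H[of i]] L2_inner_scale_right[of M "wick (dd i)" _ "%_. 1"]
 by (simp add: L2_orth_constants_def wick_L2[OF dd_H])
 then show ?thesis using csub_zero[OF V] xv_VV by (simp add: fam_def)
qed

text \<open>A vector orthogonal to all orbits is orthogonal to the \<open>xv p\<close>, hence to the
  first chaos, and to the \<open>wick\<close> vectors. Together with the constants these make up the
  exponential vectors of a dense subset of \<open>H\<close>, which are total.\<close>

lemma fam_total: "ltotal M VV (orb (range fam))"
 unfolding ltotal_def
proof (intro conjI ballI impI)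
 show "orb (range fam) \<subseteq> VV" by (rule orb_sub) (use fam_VV in auto)
 fix f assume f: "f \<in> VV" and 0: "\<forall>a\<in>orb (range fam). L2_inner M f a = 0"
 note fL = VL[OF f]
 have 0: "L2_inner M f (P n (fam j)) = 0" for n j using 0 unfolding orb_def by blast
 have x0: "L2_inner M f (xv p) = 0" for p
 proof -
 define r where "r = nat (time p mod int N)"
 have r: "r < N" "int r + (time p div int N) * int N = time p" by (simp_all add: r_def nat_less_iff mod_div_mult_eq)
 have "fam (2 * prod_encode (comp p, r)) = xv (idx (comp p) (int r))" using r by (simp add: fam_def)
 moreover have "shift ((time p div int N) * int N) (idx (comp p) (int r)) = p"
  by (rule idx_eqI) (use r(2) in simp_all)
 ultimately have e: "AE x in M. P (time p div int N) (fam (2 * prod_encode (comp p, r))) x = xv p x"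
  using P_xv[of "time p div int N" "idx (comp p) (int r)"] by simp
 show ?thesis
  using L2_inner_cong_AE[OF fL fL VL[OF P_in[OF fam_VV]] xv_L2 _ e] 0 by simp
 qed
 have H0: "L2_inner M f F = 0" if "F \<in> HCH" for F
 proof -
 have "L2_inner M (xv p) f = 0" for p using x0[of p] L2_inner_commute[of M "xv p" f] by simp
 then have "L2_inner M F f = 0" using cspan_orth[of "range xv" M f F] xv_L2 fL that unfolding HCH_span by auto
 then show ?thesis using L2_inner_commute[of M f F] by simp
 qed
 have w0: "L2_inner M f (wick (dd j)) = 0" for j
 proof -
 have "fam (Suc (2 * j)) = wick (dd j)" by (simp add: fam_def)
 then show ?thesis
  using L2_inner_cong_AE[OF fL fL VL[OF P_in[OF fam_VV]] VL[OF fam_VV] _ P_zero[OF fam_VV, of "Suc (2 * j)"]]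
  0[of 0 "Suc (2 * j)"] by simp
 qed
 have 10: "L2_inner M f (%_. 1) = 0" using f by (simp add: L2_orth_constants_def)
 show "AE x in M. f x = 0"
 proof (rule gexp_total_dense[OF gen fL])
 show "range dd \<subseteq> H" using dd_H by auto
 fix h assume "h \<in> range dd"
 then obtain j where h: "h = dd j" by blast
 have "gexp h = (%x. wick h x + (1 + \<i> * cx h x))" by (simp add: wick_def)
 then show "L2_inner M f (gexp h) = 0"
  using w0[of j] 10 H0[OF cx_HCH[OF dd_H[of j]]]
  by (simp add: h L2_inner_add_right fL wick_L2 dd_H L2_add one_L2 L2_scale cx_L2 L2_inner_scale_right)
 qed (rule dd_dense)
qed

text \<open>Under \<open>T\<close> the vector keeps the spectral measure it has under
  \<open>U\<close>, because \<open>rho (comp p)\<close> is invariant under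
  \<open>z ^ 3 ^ k\<close>.\<close>

lemma xv_density: "spectral_density \<theta> (xv p) (dn (comp p))"
proof -
 have "L2_inner M (P n (xv p)) (xv p) = (\<integral>z. z powi n * of_real (dn (comp p) z) \<partial>\<theta>)" for n
 proof -
 have "L2_inner M (P n (xv p)) (xv p) = (\<integral>z. z powi (n * int N) \<partial>rho (comp p))"
  unfolding P_xv_inner of_real_kern by simp
 also have "\<dots> = (\<integral>z. z powi n \<partial>rho (comp p))" using rho_Fourier_power[where k = k and n = n and i = "comp p"] by (simp add: mult.commute)
 also have "\<dots> = (\<integral>z. z powi n * of_real (dn (comp p) z) \<partial>\<theta>)"
  by (subst rho_integral) (measurable, simp add: mult.commute)
 finally show ?thesis .
 qed
 then show ?thesis unfolding spectral_density_def using dn_integrable dn_nonneg by simp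
qed

text \<open>A spectral representation of the Koopman operator with its intertwiner named. The
  condition \<open>1 \<le> m\<close> is kept apart, because for the reference representation it is
  known only after the lower bounds.\<close>

definition rep :: "complex measure => (complex => enat) => (('a => complex) => complex \<times> nat => complex) => bool" where
 "rep \<rho> m X \<longleftrightarrow> circle_measure \<rho> & m \<in> \<rho> \<rightarrow>\<^sub>M count_space UNIV &
  unitary_map M VV (fibre_measure \<rho> m) (L2 (fibre_measure \<rho> m)) X &
  (\<forall>f\<in>VV. AE y in fibre_measure \<rho> m. X (P 1 f) y = fst y * X f y)"

text \<open>On \<open>S\<close> only the \<open>3 ^ k\<close> vectors of the family in the first component have nonzero density.\<close>

lemma reference_rep:
 obtains m X where "rep \<theta> m X" "AE z in \<theta>. z \<in> S --> m z \<le> enat N"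
proof -
 have ex: "\<exists>f. spectral_density \<theta> (fam j) f & (\<forall>z\<in>S. f z ~= 0 --> j \<in> (%r. 2 * prod_encode (0, r)) ` {..<N})" for j
 proof (cases "even j")
 case False
 obtain f where f: "spectral_density \<theta> (wick (dd (j div 2))) f" "!!z. z \<in> S ==> f z = 0"
  by (rule wick_density[OF dd_H[of "j div 2"]]) (rule that)
 have "fam j = wick (dd (j div 2))" using False by (simp add: fam_def)
 with f show ?thesis by (intro exI[of _ f]) simp
 next
 case True
 define i r where "i = fst (prod_decode (j div 2))" and "r = snd (prod_decode (j div 2))"
 have j: "j = 2 * prod_encode (i, r)" using True by (simp add: i_def r_def)
 show ?thesis
 proof (cases "r < N")
  case True
  have "fam j = xv (idx i (int r))" using True by (simp add: fam_def j)
  then have "spectral_density \<theta> (fam j) (dn i)" using xv_density[of "idx i (int r)"] by simp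
  moreover have "\<forall>z\<in>S. dn i z ~= 0 --> j \<in> (%r. 2 * prod_encode (0, r)) ` {..<N}"
  using True by (auto simp: dn_def j)
  ultimately show ?thesis by blast
 next
  case False
  then have "fam j = (%_. 0)" by (simp add: fam_def j)
  then have "spectral_density \<theta> (fam j) (%_. 0)" by (simp add: spectral_density_def)
  then show ?thesis by (intro exI[of _ "%_. 0"]) simp
 qed
 qed
 from choice[OF allI[OF ex]] obtain f0 where f0: "\<forall>j. spectral_density \<theta> (fam j) (f0 j) &
  (\<forall>z\<in>S. f0 j z ~= 0 --> j \<in> (%r. 2 * prod_encode (0, r)) ` {..<N})" ..
 obtain f where f: "!!j. spectral_density \<theta> (fam j) (f j)"
 "!!j z. z \<in> S ==> f j z ~= 0 ==> j \<in> (%r. 2 * prod_encode (0, r)) ` {..<N}" using f0 by blast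
 obtain v' f' where v: "!!i. v' i \<in> VV" "!!i. spectral_density \<theta> (v' i) (f' i)"
 "!!i. AE z in \<theta>. f i z = 0 --> f' i z = 0" "!!i j n. i ~= j ==> L2_inner M (P n (v' i)) (v' j) = 0"
 "ltotal M VV (orb (range v'))"
 by (rule cyclic_decomposition[OF \<theta>_circle fam_VV f(1) fam_total]) (rule that)
 obtain X where X: "unitary_map M VV (fibre_measure \<theta> (mult_count f')) (L2 (fibre_measure \<theta> (mult_count f'))) X"
 "!!n u. u \<in> VV ==> AE x in fibre_measure \<theta> (mult_count f'). X (P n u) x = fst x powi n * X u x"
 by (rule fibre_representation[OF \<theta>_circle v(1,2) _ v(5)]) (rule v(4), assumption, rule that)
 have "mult_count f' \<in> borel \<rightarrow>\<^sub>M count_space UNIV"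
 by (rule mult_count_measurable) (use v(2) in \<open>simp add: spectral_density_def\<close>)
 then have "mult_count f' \<in> \<theta> \<rightarrow>\<^sub>M count_space UNIV" by (simp only: measurable_cong_sets[OF sets_\<theta> refl])
 moreover have "AE y in fibre_measure \<theta> (mult_count f'). X (P 1 u) y = fst y * X u y" if "u \<in> VV" for u
 using X(2)[OF that, of 1] by simp
 ultimately have "rep \<theta> (mult_count f') X" unfolding rep_def using \<theta>_circle X(1) by blast
 moreover have "AE z in \<theta>. \<forall>i. f i z = 0 --> f' i z = 0" unfolding AE_all_countable using v(3) by (intro allI)
 then have "AE z in \<theta>. z \<in> S --> mult_count f' z \<le> enat N"
 proof eventually_elim
 case (elim z)
 show ?case
 proof
  assume z: "z \<in> S"
  show "mult_count f' z \<le> enat N" unfolding mult_count_def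
  proof (rule SUP_least)
  fix i
  have "{j. j < i & 0 < f' j z} \<subseteq> (%r. 2 * prod_encode (0, r)) ` {..<N}"
  proof
   fix j assume "j \<in> {j. j < i & 0 < f' j z}"
   then have "f j z ~= 0" using elim by force
   then show "j \<in> (%r. 2 * prod_encode (0, r)) ` {..<N}" by (rule f(2)[OF z])
  qed
  then have "occ_rank f' i z \<le> card ((%r. 2 * prod_encode (0, r)) ` {..<N})"
   unfolding occ_rank_def by (intro card_mono) auto
  also have "\<dots> \<le> N" using card_image_le[of "{..<N}" "%r. 2 * prod_encode (0, r)"] by simp
  finally show "enat (occ_rank f' i z) \<le> enat N" by simp
  qed
 qed
 qed
 ultimately show thesis by (rule that)
qed

lemma rep_imap: "rep \<rho> m X ==> isometric_map M VV (fibre_measure \<rho> m) (L2 (fibre_measure \<rho> m)) X"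
 by (simp add: rep_def unitary_map_iff)

lemma rep_power:
 assumes r: "rep \<rho> m X" and f: "f \<in> VV"
 shows "AE y in fibre_measure \<rho> m. X (P (int n) f) y = fst y ^ n * X f y"
proof (induct n)
 case 0
 show ?case using imap_cong[OF rep_imap[OF r] V csub_UNIV P_in[OF f] f P_zero[OF f]] by simp
next
 case (Suc n)
 have "AE x in M. P (int (Suc n)) f x = P 1 (P (int n) f) x"
 using P_comp[OF f, of 1 "int n"] by (simp add: eq_commute)
 from imap_cong[OF rep_imap[OF r] V csub_UNIV P_in[OF f] P_in[OF P_in[OF f]] this]
 have "AE y in fibre_measure \<rho> m. X (P (int (Suc n)) f) y = X (P 1 (P (int n) f)) y" .
 moreover have "AE y in fibre_measure \<rho> m. X (P 1 (P (int n) f)) y = fst y * X (P (int n) f) y"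
 using r P_in[OF f] unfolding rep_def by blast
 ultimately show ?case using Suc by eventually_elim (simp add: mult.assoc)
qed

lemma rep_inner:
 assumes r: "rep \<rho> m X" and fg: "f \<in> VV" "g \<in> VV"
 shows "L2_inner (fibre_measure \<rho> m) (%y. fst y ^ n * X f y) (X g) = L2_inner M (P (int n) f) g"
proof -
 interpret fibre \<rho> m using r by unfold_locales (simp_all add: rep_def)
 note X = rep_imap[OF r]
 have L: "(%y. fst y powi (int n) * X f y) \<in> L2 (fibre_measure \<rho> m)"
 by (rule imap_in[OF mult_imap[OF FM_fst FM_AE_circle] imap_in[OF X fg(1)]])
 have "L2_inner (fibre_measure \<rho> m) (%y. fst y ^ n * X f y) (X g) = L2_inner (fibre_measure \<rho> m) (X (P (int n) f)) (X g)"
 by (rule L2_inner_cong_AE[OF _ imap_in[OF X P_in[OF fg(1)]] imap_in[OF X fg(2)] imap_in[OF X fg(2)]])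
  (use L rep_power[OF r fg(1), of n] in \<open>auto simp: eq_commute\<close>)
 also have "\<dots> = L2_inner M (P (int n) f) g" by (rule imap_inner[OF X P_in[OF fg(1)] fg(2)])
 finally show ?thesis .
qed

lemma rep_lower:
 assumes r: "rep \<rho> m X" and \<kappa>: "circle_measure \<kappa>" and n: "0 < n"
 and g: "!!l. l < n ==> g l \<in> VV"
 and eq: "!!(j::nat) l l'. l < n ==> l' < n ==> L2_inner M (P (int j) (g l)) (g l') = (if l = l' then \<integral>z. z ^ j \<partial>\<kappa> else 0)"
 shows "absolutely_continuous \<rho> \<kappa>" "AE z in \<kappa>. enat n \<le> m z"
proof -
 interpret fibre \<rho> m using r by unfold_locales (simp_all add: rep_def)
 have "!!l. l < n ==> X (g l) \<in> L2 FM" using imap_in[OF rep_imap[OF r]] g by blast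
 moreover have "L2_inner FM (%y. fst y ^ j * X (g l) y) (X (g l')) = (if l = l' then \<integral>z. z ^ j \<partial>\<kappa> else 0)"
 if "l < n" "l' < n" for j l l'
 unfolding rep_inner[OF r g[OF that(1)] g[OF that(2)]] by (rule eq[OF that])
 ultimately show "absolutely_continuous \<rho> \<kappa>" "AE z in \<kappa>. enat n \<le> m z"
 using multiplicity_lower[OF \<kappa> n, of "%l. X (g l)"] by blast+
qed

text \<open>The time 0 vectors of the components \<open>Suc l\<close> have mutually orthogonal
  orbits and common spectral measure \<open>rho 1\<close>. Taking any number of them shows that
  \<open>m\<close> exceeds every finite bound.\<close>

lemma rep_tau:
 assumes r: "rep \<rho> m X"
 shows "absolutely_continuous \<rho> (rho 1)" "AE z in rho 1. m z = \<infinity>"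
proof -
 have e: "L2_inner M (P (int j) (xv (idx (Suc l) 0))) (xv (idx (Suc l') 0)) = (if l = l' then \<integral>z. z ^ j \<partial>rho 1 else 0)" for j l l'
 unfolding P_xv_inner of_real_kern using rho_Fourier_power[where k = k and n = "int j" and i = "Suc l"] rho_Suc[of l] rho_Suc[of l']
 by (simp add: mult.commute del: One_nat_def)
 have *: "absolutely_continuous \<rho> (rho 1)" "AE z in rho 1. enat (Suc n) \<le> m z" for n
 using rep_lower[OF r rho_circle, of "Suc n" "%l. xv (idx (Suc l) 0)" 1] e xv_VV by blast+
 show "absolutely_continuous \<rho> (rho 1)" by (rule *(1))
 have "AE z in rho 1. \<forall>n. enat (Suc n) \<le> m z" unfolding AE_all_countable using *(2) by (intro allI)
 then show "AE z in rho 1. m z = \<infinity>"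
 proof eventually_elim
 case (elim z)
 show ?case
 proof (cases "m z")
  case (enat n) with elim[rule_format, of n] show ?thesis by simp
 qed
 qed
qed

text \<open>The digit functions \<open>wk k l\<close> split the simple spectrum of type \<open>\<sigma>\<close> of \<open>U\<close> into \<open>3 ^ k\<close> cyclic
 subspaces of \<open>U ^^ 3 ^ k\<close>, each of which is again of type \<open>\<sigma>\<close>.\<close>

lemma rep_sigma:
 assumes r: "rep \<rho> m X"
 shows "absolutely_continuous \<rho> \<sigma>" "AE z in \<sigma>. enat N \<le> m z"
proof -
 note sc = circle_measureD(3)[OF \<sigma>_circle] and sm = circle_measurable[OF \<sigma>_circle]
 and pL = circle_power_L2[OF \<sigma>_circle] and tot = circle_power_total[OF \<sigma>_circle]
 have pin: "L2_inner \<sigma> (%z. z powi n) (%z. z powi l) = of_real (kern (idx 0 n) (idx 0 l))" for n l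
 by (simp add: of_real_kern rho_0 circle_power_inner[OF \<sigma>_circle])
 note Ls = csub_UNIV[of \<sigma>]
 have gram: "L2_inner \<sigma> (%z. z powi n) (%z. z powi l) = L2_inner M (xv (idx 0 n)) (xv (idx 0 l))" for n l
 by (simp only: pin xv_inner)
 \<comment> \<open>\<open>Q\<close> places \<open>L2 \<sigma>\<close> as component 0 of the first
   chaos; multiplication by \<open>z powi (n * N)\<close> becomes \<open>P n\<close>.\<close>
 obtain Q where Q: "isometric_map \<sigma> (L2 \<sigma>) M VV Q" "!!n. AE x in M. Q (%z. z powi n) x = xv (idx 0 n) x"
 by (rule imap_extension[OF Ls V, of UNIV "%n z. z powi n" "%n. xv (idx 0 n)", OF pL xv_VV gram tot])
  (rule that, assumption, simp)
 have id: "(%z. z) \<in> borel_measurable \<sigma>" by (rule sm) simp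
 have QP: "AE x in M. Q (%z. z powi (n * int N) * f z) x = P n (Q f) x" if f: "f \<in> L2 \<sigma>" for f n
 proof (rule imap_agree[OF imap_comp[OF mult_imap[OF id sc] Q(1) Ls Ls V] imap_comp[OF Q(1) P_imap Ls V V] Ls V tot _ f])
 fix a :: "complex => complex" assume "a \<in> range (%n z. z powi n)"
 then obtain l where a: "a = (%z. z powi l)" by blast
 have "AE x in M. Q (%z. z powi (n * int N) * a z) x = Q (%z. z powi (l + n * int N)) x"
 proof (rule imap_cong[OF Q(1) Ls V])
  show "(%z. z powi (n * int N) * a z) \<in> L2 \<sigma>" unfolding a by (rule imap_in[OF mult_imap[OF id sc] pL])
  show "AE z in \<sigma>. z powi (n * int N) * a z = z powi (l + n * int N)" using sc
  proof eventually_elim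
  case (elim z)
  then have "z ~= 0" by auto
  then show ?case by (simp add: a power_int_add mult.commute)
  qed
 qed (rule pL)
 moreover have "AE x in M. Q (%z. z powi (l + n * int N)) x = xv (idx 0 (l + n * int N)) x" by (rule Q(2))
 moreover have "AE x in M. P n (Q a) x = P n (xv (idx 0 l)) x"
  unfolding a by (rule P_cong[OF imap_in[OF Q(1) pL] xv_VV Q(2)])
 moreover have "AE x in M. P n (xv (idx 0 l)) x = xv (idx 0 (l + n * int N)) x"
  using P_xv[of n "idx 0 l"] by (simp add: shift_def)
 ultimately show "AE x in M. Q (%z. z powi (n * int N) * a z) x = P n (Q a) x" by eventually_elim simp
 qed
 have wL: "wk k l \<in> L2 \<sigma>" for l by (rule circle_bounded_L2[OF \<sigma>_circle wk_measurable, of _ _ "2 ^ k"]) (simp add: wk_bound)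
 have "L2_inner M (P (int j) (Q (wk k l))) (Q (wk k l')) = (if l = l' then \<integral>z. z ^ j \<partial>\<sigma> else 0)"
 if l: "l < N" "l' < N" for j l l'
 proof -
 \<comment> \<open>\<open>wk_orthonormal\<close> asks for a function bounded on the whole plane, so
   the power is cut off outside the circle.\<close>
 define g where "g z = (if cmod z = 1 then z ^ j else 0)" for z :: complex
 have gm [measurable]: "g \<in> borel_measurable borel" unfolding g_def by measurable
 have mL: "(%z. z powi (int j * int N) * wk k l z) \<in> L2 \<sigma>" by (rule imap_in[OF mult_imap[OF id sc] wL])
 have "L2_inner M (P (int j) (Q (wk k l))) (Q (wk k l'))
  = L2_inner M (Q (%z. z powi (int j * int N) * wk k l z)) (Q (wk k l'))"
  by (rule L2_inner_cong_AE[OF VL[OF P_in[OF imap_in[OF Q(1) wL]]] VL[OF imap_in[OF Q(1) mL]]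
   VL[OF imap_in[OF Q(1) wL]] VL[OF imap_in[OF Q(1) wL]]])
  (use QP[OF wL, of "int j" l] in \<open>auto simp: eq_commute\<close>)
 also have "\<dots> = L2_inner \<sigma> (%z. z powi (int j * int N) * wk k l z) (wk k l')" by (rule imap_inner[OF Q(1) mL wL])
 also have "\<dots> = (\<integral>z. wk k l z * cnj (wk k l' z) * g (z ^ (3 ^ k)) \<partial>\<sigma>)" unfolding L2_inner_def
 proof (rule integral_cong_AE)
  have cm: "(%z. cnj (wk k l' z)) \<in> borel_measurable borel" by (rule measurable_compose[OF wk_measurable cnj_borel])
  show "(%z. z powi (int j * int N) * wk k l z * cnj (wk k l' z)) \<in> borel_measurable \<sigma>"
  "(%z. wk k l z * cnj (wk k l' z) * g (z ^ (3 ^ k))) \<in> borel_measurable \<sigma>" by (rule sm, use cm in measurable)+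
  show "AE z in \<sigma>. z powi (int j * int N) * wk k l z * cnj (wk k l' z) = wk k l z * cnj (wk k l' z) * g (z ^ (3 ^ k))"
  using sc
  proof eventually_elim
  case (elim z)
  have "z powi (int j * int N) = (z ^ N) ^ j"
   by (simp only: of_nat_mult[symmetric] power_int_of_nat power_mult[symmetric] mult.commute)
  then show ?case using elim by (simp add: g_def norm_power mult_ac)
  qed
 qed
 also have "\<dots> = (if l = l' then \<integral>z. g z \<partial>\<sigma> else 0)"
  by (rule wk_orthonormal[OF l gm, of 1]) (simp add: g_def norm_power)
 also have "(\<integral>z. g z \<partial>\<sigma>) = (\<integral>z. z ^ j \<partial>\<sigma>)"
 proof (rule integral_cong_AE)
  show "AE z in \<sigma>. g z = z ^ j" using sc by eventually_elim (simp add: g_def)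
 qed (rule sm, measurable)+
 finally show ?thesis .
 qed
 then show "absolutely_continuous \<rho> \<sigma>" "AE z in \<sigma>. enat N \<le> m z"
 using rep_lower[OF r \<sigma>_circle, of N "%l. Q (wk k l)"] imap_in[OF Q(1) wL] by simp_all
qed

end

section \<open>Uniqueness of the multiplicity function, and ergodicity\<close>

lemma rho_AE_iff: "(AE z in rho i. Q z) \<longleftrightarrow> (AE z in \<theta>. z \<in> (if i = 0 then S else - S) --> Q z)"
proof -
 have m: "(%z. ennreal (dn i z)) \<in> borel_measurable \<theta>" by measurable
 have d: "0 < ennreal (dn i z) \<longleftrightarrow> z \<in> (if i = 0 then S else - S)" for z by (simp add: dn_def indicator_def)
 show ?thesis unfolding rho_def AE_density[OF m] d ..
qed

lemma AE_False_null: "(AE x in M. False) ==> emeasure M (space M) = 0"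
 using AE_iff_measurable[of "space M" M "%_. False"] by simp

context gaussian_core
begin

text \<open>One direction of Hahn-Hellinger. Over the set where \<open>m >= n\<close> the indicators
  of the first \<open>n\<close> sheets are vectors with orthogonal orbits and common spectral
  measure, the restriction of \<rho> to that set. Carried back to the Koopman space, they force in
  the other representation both absolute continuity of this restriction to \<open>\<rho>'\<close>
  and \<open>n <= m'\<close>.\<close>

lemma rep_compare:
 assumes r: "rep \<rho> m X" and r': "rep \<rho>' m' X'" and n: "0 < n" and Q: "AE z in \<rho>'. Q z"
 shows "AE z in \<rho>. enat n \<le> m z --> Q z & enat n \<le> m' z"
proof -
 interpret fibre \<rho> m using r by unfold_locales (simp_all add: rep_def)
 note X = rep_imap[OF r]
 define A where "A = {z. enat n \<le> m z}"
 have A [measurable]: "A \<in> sets borel"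
 using measurable_sets[OF m, of "{i. enat n \<le> i}"] by (simp add: A_def vimage_def sets_\<rho>)
 define E where "E l y = (if fst y \<in> A & snd y = l then 1 else 0 :: complex)" for l and y :: "complex \<times> nat"
 have lA: "z \<in> A ==> enat l < m z" if "l < n" for z l
 unfolding A_def using that by (auto intro: less_le_trans[of "enat l" "enat n"])
 have ip: "integrable \<rho> (%z. z ^ j)" for j :: nat
 using power_int_integrable[OF \<rho>, of "%_. 1" "int j"] by simp

 have gi: "integrable FM (%y. fst y ^ j * E l y * cnj (E l y))"
 "(\<integral>y. fst y ^ j * E l y * cnj (E l y) \<partial>FM) = (\<integral>z. (if z \<in> A then z ^ j else 0) \<partial>\<rho>)" if "l < n" for l j
 proof -
 have "(%y. fst y ^ j * E l y * cnj (E l y)) = (%y. if fst y \<in> A & snd y = l then fst y ^ j else 0)"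
  by (auto simp: E_def)
 moreover have "(%_. l) \<in> \<rho> \<rightarrow>\<^sub>M count_space UNIV" by simp
 note graph_integral[where r = "%_. l" and \<phi> = "%z. z ^ j" and A = A, OF ip A this lA[OF that]]
 ultimately
 show "integrable FM (%y. fst y ^ j * E l y * cnj (E l y))"
  "(\<integral>y. fst y ^ j * E l y * cnj (E l y) \<partial>FM) = (\<integral>z. (if z \<in> A then z ^ j else 0) \<partial>\<rho>)" by simp_all
 qed
 have EL: "E l \<in> L2 FM" if "l < n" for l
 proof -
 have "integrable FM (%y. Re (fst y ^ 0 * E l y * cnj (E l y)))" by (intro integrable_Re gi(1) that)
 moreover have "Re (fst y ^ 0 * E l y * cnj (E l y)) = (norm (E l y))\<^sup>2" for y by (simp add: E_def)
 moreover have "E l \<in> borel_measurable FM" by (rule FM_measurable) (unfold E_def, measurable)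
 ultimately show ?thesis by (simp add: L2_def)
 qed
 have "\<exists>g. l < n --> g \<in> VV & (AE y in FM. X g y = E l y)" for l
 using r EL[of l] unfolding rep_def unitary_map_iff by blast
 then obtain g where g: "!!l. l < n ==> g l \<in> VV" "!!l. l < n ==> AE y in FM. X (g l) y = E l y" by metis
 define \<kappa> where "\<kappa> = density \<rho> (%z. ennreal (indicator A z))"
 have Am: "(%z. ennreal (indicator A z)) \<in> borel_measurable \<rho>" by measurable
 have kc: "circle_measure \<kappa>" unfolding circle_measure_def
 proof (intro conjI)
 show "AE z in \<kappa>. cmod z = 1" unfolding \<kappa>_def by (rule AE_densityI[OF Am circle_measureD(3)[OF \<rho>]])
 have "emeasure \<kappa> (space \<kappa>) = emeasure \<rho> A"
  unfolding \<kappa>_def by (subst emeasure_density[OF Am]) (simp_all add: sets_\<rho> ennreal_indicator)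
 then show "finite_measure \<kappa>" by (intro finite_measureI) simp
 qed (simp add: \<kappa>_def sets_\<rho>)
 have ki: "(\<integral>z. z ^ j \<partial>\<kappa>) = (\<integral>z. (if z \<in> A then z ^ j else 0) \<partial>\<rho>)" for j :: nat
 proof -
 have "(\<integral>z. z ^ j \<partial>\<kappa>) = (\<integral>z. indicator A z *\<^sub>R z ^ j \<partial>\<rho>)"
  unfolding \<kappa>_def by (rule integral_density) measurable
 also have "\<dots> = (\<integral>z. (if z \<in> A then z ^ j else 0) \<partial>\<rho>)"
  by (intro Bochner_Integration.integral_cong) auto
 finally show ?thesis .
 qed
 have eq: "L2_inner M (P (int j) (g l)) (g l') = (if l = l' then \<integral>z. z ^ j \<partial>\<kappa> else 0)" if l: "l < n" "l' < n" for j l l'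
 proof -
 have pow: "(%y. fst y ^ j * f y) \<in> L2 FM" if "f \<in> L2 FM" for f
  using imap_in[OF mult_imap[OF FM_fst FM_AE_circle, of "int j"] that] by simp
 have "L2_inner M (P (int j) (g l)) (g l') = L2_inner FM (%y. fst y ^ j * X (g l) y) (X (g l'))"
  by (rule rep_inner[OF r g(1)[OF l(1)] g(1)[OF l(2)], symmetric])
 also have "\<dots> = L2_inner FM (%y. fst y ^ j * E l y) (E l')"
 proof (rule L2_inner_cong_AE[OF pow pow _ _ _ g(2)[OF l(2)]])
  show "AE y in FM. fst y ^ j * X (g l) y = fst y ^ j * E l y" using g(2)[OF l(1)] by eventually_elim simp
 qed (use imap_in[OF X] g(1) EL l in blast)+
 also have "\<dots> = (if l = l' then \<integral>z. z ^ j \<partial>\<kappa> else 0)"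
 proof (cases "l = l'")
  case True then show ?thesis using gi(2)[OF l(1), of j] by (simp add: L2_inner_def ki)
 next
  case False
  then have "(%y. fst y ^ j * E l y * cnj (E l' y)) = (%_. 0)" by (auto simp: E_def)
  with False show ?thesis by (simp add: L2_inner_def)
 qed
 finally show ?thesis .
 qed
 have low: "absolutely_continuous \<rho>' \<kappa>" "AE z in \<kappa>. enat n \<le> m' z"
 using rep_lower[OF r' kc n, of g] g(1) eq by blast+
 have "sets \<kappa> = sets \<rho>'" using r' by (simp add: rep_def circle_measure_def \<kappa>_def sets_\<rho>)
 from absolutely_continuous_AE[OF this low(1) Q] low(2) have "AE z in \<kappa>. Q z & enat n \<le> m' z" by eventually_elim simp
 then show ?thesis unfolding \<kappa>_def AE_density[OF Am] by eventually_elim (auto simp: A_def)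
qed

text \<open>The lower bounds for \<sigma> and \<open>rho 1\<close>, which hold in every
  representation, become statements about \<theta> on \<open>S\<close> and off
  \<open>S\<close>.\<close>

lemma rep_multiplicity_reference:
 assumes r: "rep \<rho> m X"
 shows "AE z in \<theta>. (z \<in> S --> enat N \<le> m z) & (z \<notin> S --> m z = \<infinity>)"
proof -
 have "AE z in rho 0. enat N \<le> m z" using rep_sigma(2)[OF r] by (simp only: rho_0)
 then have "AE z in \<theta>. z \<in> S --> enat N \<le> m z" by (simp add: rho_AE_iff)
 moreover have "AE z in \<theta>. z \<in> - S --> m z = \<infinity>" using rep_tau(2)[OF r] unfolding rho_AE_iff by simp
 ultimately show ?thesis by eventually_elim simp
qed

text \<open>Comparison with the reference representation, used twice. With \<open>n = 1\<close> it
  transports the lower bounds from \<theta> to \<rho>; with \<open>n = N + 1\<close> it shows that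
  \<open>m\<close> cannot exceed \<open>N\<close> on \<open>S\<close>, since the reference
  multiplicity does not.\<close>

lemma rep_multiplicity:
 assumes r: "rep \<rho> m X" and 1: "AE z in \<rho>. 1 \<le> m z"
 shows "AE z in \<rho>. m z = (if z \<in> S then enat N else \<infinity>)"
proof -
 obtain m0 X0 where r0: "rep \<theta> m0 X0" and b: "AE z in \<theta>. z \<in> S --> m0 z \<le> enat N" by (rule reference_rep; blast)
 have "AE z in \<rho>. enat 1 \<le> m z --> ((z \<in> S --> enat N \<le> m z) & (z \<notin> S --> m z = \<infinity>)) & enat 1 \<le> m0 z"
 by (rule rep_compare[OF r r0 _ rep_multiplicity_reference[OF r]]) simp
 moreover have "AE z in \<rho>. enat (Suc N) \<le> m z --> (z \<in> S --> m0 z \<le> enat N) & enat (Suc N) \<le> m0 z"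
 by (rule rep_compare[OF r r0 _ b]) simp
 ultimately show ?thesis using 1
 proof eventually_elim
 case (elim z)
 show ?case
 proof (cases "z \<in> S")
  case True
  have "\<not> enat (Suc N) \<le> m z"
  proof
  assume "enat (Suc N) \<le> m z"
  with elim(2) True have "enat (Suc N) \<le> enat N" by (meson order_trans)
  then show False by simp
  qed
  then have "m z \<le> enat N" by (cases "m z") auto
  with True elim(1,3) show ?thesis by (simp add: one_enat_def)
 next
  case False with elim(1,3) show ?thesis by (simp add: one_enat_def)
 qed
 qed
qed

text \<open>Both values are attained on sets of positive measure because \<sigma>, carried by
  \<open>S\<close>, and \<open>rho 1\<close>, carried by the complement, are nonzero and absolutely
  continuous to \<rho>.\<close>

lemma rep_essential_values:
 assumes r: "rep \<rho> m X" and 1: "AE z in \<rho>. 1 \<le> m z"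
 shows "essential_values \<rho> m = {enat N, \<infinity>}"
proof -
 have mm: "m \<in> \<rho> \<rightarrow>\<^sub>M count_space UNIV" and sr: "sets \<rho> = sets borel" and sp: "space \<rho> = UNIV"
 using r circle_measureD(2,4) by (auto simp: rep_def)
 have ms: "{z \<in> space \<rho>. m z = n} \<in> sets \<rho>" for n
 proof -
 have "{z \<in> space \<rho>. m z = n} = m -` {n} \<inter> space \<rho>" by blast
 then show ?thesis using measurable_sets[OF mm, of "{n}"] by simp
 qed
 have ev: "n \<notin> essential_values \<rho> m \<longleftrightarrow> (AE z in \<rho>. m z ~= n)" for n
 by (subst AE_iff_measurable[OF ms[of n]]) (auto simp: essential_values_def)
 note M = rep_multiplicity[OF r 1]
 have "n \<notin> essential_values \<rho> m" if "n ~= enat N" "n ~= \<infinity>" for n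
 unfolding ev using M by eventually_elim (use that in auto)
 moreover have "enat N \<in> essential_values \<rho> m"
 proof (rule ccontr)
 assume "enat N \<notin> essential_values \<rho> m"
 then have "AE z in \<rho>. m z ~= enat N" by (simp only: ev not_not)
 with M have "AE z in \<rho>. z \<notin> S" by eventually_elim auto
 then have "AE z in \<sigma>. z \<notin> S"
  by (intro absolutely_continuous_AE[OF _ rep_sigma(1)[OF r]]) (simp_all add: sr circle_measureD(2)[OF \<sigma>_circle])
 moreover have "AE z in rho 0. z \<in> S" unfolding rho_AE_iff by simp
 ultimately have "AE z in \<sigma>. False" unfolding rho_0 by eventually_elim simp
 then show False using AE_False_null prob_space.emeasure_space_1[OF \<sigma>_prob] by fastforce
 qed
 moreover have "\<infinity> \<in> essential_values \<rho> m"
 proof (rule ccontr)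
 assume "\<infinity> \<notin> essential_values \<rho> m"
 then have "AE z in \<rho>. m z ~= \<infinity>" by (simp only: ev not_not)
 with M have "AE z in \<rho>. z \<in> S" by eventually_elim (auto split: if_splits)
 then have "AE z in rho 1. z \<in> S"
  by (intro absolutely_continuous_AE[OF _ rep_tau(1)[OF r]]) (simp_all only: sr sets_rho)
 moreover have "AE z in rho 1. z \<notin> S" unfolding rho_AE_iff by simp
 ultimately have "AE z in rho 1. False" by eventually_elim simp
 then have "emeasure (rho 1) UNIV = 0" using AE_False_null[of "rho 1"] circle_measureD(4)[OF rho_circle, of 1] by simp
 then show False using rho_total[of 1] by (simp add: measure_def)
 qed
 ultimately show ?thesis by blast
qed

lemma spectral_representation_iff:
 "spectral_representation M VV (koopman T) \<rho> m \<longleftrightarrow> (\<exists>X. rep \<rho> m X) & (AE z in \<rho>. 1 \<le> m z)"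
 unfolding spectral_representation_def unitarily_equivalent_def rep_def circle_measure_def P_1 case_prod_beta prod.collapse
 by auto

theorem multiplicities_power: "multiplicities M T = {enat N, \<infinity>}"
proof -
 obtain m0 X0 where r0: "rep \<theta> m0 X0" by (rule reference_rep; blast)
 have N1: "1 \<le> enat N" by (simp add: one_enat_def)
 have "AE z in \<theta>. 1 \<le> m0 z" using rep_multiplicity_reference[OF r0]
 proof eventually_elim
 case (elim z)
 then show ?case using N1 by (cases "z \<in> S") (auto intro: order_trans)
 qed
 with r0 have "spectral_representation M VV (koopman T) \<theta> m0" unfolding spectral_representation_iff by blast
 moreover have "essential_values \<rho> m = {enat N, \<infinity>}" if "spectral_representation M VV (koopman T) \<rho> m" for \<rho> m
 using that rep_essential_values unfolding spectral_representation_iff by blast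
 ultimately show ?thesis unfolding multiplicities_def spectral_multiplicities_def by blast
qed

text \<open>The centred indicator of an invariant set is fixed by the Koopman operator. In the
  reference representation this means \<open>z * f = f\<close> for its image, which vanishes since
  \<theta> does not charge the point 1.\<close>

theorem ergodic_T: "ergodic M T"
 unfolding ergodic_def
proof (intro ballI impI)
 fix A assume A [measurable]: "A \<in> sets M" and i: "AE x in M. T x \<in> A \<longleftrightarrow> x \<in> A"
 obtain m0 X0 where r0: "rep \<theta> m0 X0" by (rule reference_rep; blast)
 interpret f0: fibre \<theta> m0 using r0 by unfold_locales (simp_all add: rep_def)
 define f where "f x = complex_of_real (indicator A x - prob A)" for x
 have fm: "f \<in> borel_measurable M" unfolding f_def by measurable
 have fL: "f \<in> L2 M"
 proof (rule L2_bound[OF fm, of "%_. 1"], simp, rule AE_I2)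
 fix x
 have "\<bar>indicator A x - prob A\<bar> \<le> 1" using prob_le_1[of A] measure_nonneg[of M A] by (auto simp: indicator_def)
 then show "(norm (f x))\<^sup>2 \<le> 1" unfolding f_def norm_of_real by (simp add: abs_square_le_1)
 qed
 have ii: "integrable M (%x. indicator A x :: real)" by (rule integrable_real_indicator[OF A]) (simp add: less_top[symmetric])
 have "(\<integral>x. f x \<partial>M) = of_real (\<integral>x. indicator A x - prob A \<partial>M)" unfolding f_def by (rule integral_complex_of_real)
 also have "(\<integral>x. indicator A x - prob A \<partial>M) = 0" using ii by (simp add: prob_space)
 finally have f0: "L2_inner M f (%_. 1) = 0" by (simp add: L2_inner_def)
 have f: "f \<in> VV"
 using f0 L2_inner_scale_right[of M f _ "%_. 1"] by (simp add: L2_orth_constants_def fL)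
 have "AE x in M. P 1 f x = f x"
 unfolding P_1 koopman_def using i by eventually_elim (simp add: f_def indicator_def)
 from imap_cong[OF rep_imap[OF r0] V csub_UNIV P_in[OF f] f this]
 have "AE y in f0.FM. X0 (P 1 f) y = X0 f y" .
 moreover have "AE y in f0.FM. X0 (P 1 f) y = fst y * X0 f y" using r0 f unfolding rep_def by blast
 moreover have "AE y in f0.FM. fst y ~= 1" by (rule f0.FM_AE[OF f0.PM_AE_fst[OF \<theta>_AE_neq]])
 ultimately have "AE y in f0.FM. X0 f y = 0" by eventually_elim auto
 then have "l2sq f0.FM (X0 f) = 0" using l2sq_zero_iff[OF imap_in[OF rep_imap[OF r0] f]] by simp
 then have "l2sq M f = 0" by (simp only: l2sq_inner imap_inner[OF rep_imap[OF r0] f f])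
 then have c: "AE x in M. f x = 0" by (simp only: l2sq_zero_iff[OF fL])
 show "prob A = 0 \<or> prob A = 1"
 proof (rule ccontr)
 assume "\<not> (prob A = 0 \<or> prob A = 1)"
 then have "f x ~= 0" for x unfolding f_def by (auto simp: indicator_def)
 with c have "AE x in M. False" by simp
 then show False using AE_False_null[of M] emeasure_space_1 by simp
 qed
qed

end

section \<open>Assembling the result\<close>

lemma gaussian_coreE:
 assumes a: "automorphism M T" and H: "closed_real_subspace M H" "!!h. h \<in> H ==> koopman T h \<in> H"
 "!!h. h \<in> H ==> centered_gaussian M h" "generates_mod_null M H"
 and e: "unitarily_equivalent M (complexification H) (koopman T) counting ell2 (U ^^ (3 ^ k))"
 obtains R W where "gaussian_core M T R H k W"
proof -
 obtain R where R: "invertible_mpres M T R" by (rule automorphismE[OF a]; blast)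
 obtain W where W: "unitary_map M (complexification H) counting ell2 W"
 "!!f. f \<in> complexification H ==> AE y in counting. W (koopman T f) y = (U ^^ (3 ^ k)) (W f) y"
 using e unfolding unitarily_equivalent_def by blast
 have "gaussian_space M H"
 by (intro gaussian_space.intro gaussian_space_axioms.intro H invertible_mpres.M[OF R])
 then have "gaussian_core M T R H k W"
 by (intro gaussian_core.intro gaussian_core_axioms.intro R H W)
 then show thesis by (rule that)
qed

theorem theorem3:
  shows "\<exists>U. unitary_operator counting ell2 U \<and> continuous_spectrum counting ell2 U \<and>
    (\<forall>k::nat.
      (\<exists>(M :: (nat \<Rightarrow> real) measure) T.
         gaussian_automorphism M T counting ell2 (U ^^ (3 ^ k)) \<and>
         multiplicities M T = {enat (3 ^ k), \<infinity>}) \<and>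
      (\<forall>(M :: 'x measure) T.
         gaussian_automorphism M T counting ell2 (U ^^ (3 ^ k)) \<longrightarrow>
         multiplicities M T = {enat (3 ^ k), \<infinity>}))"
proof (rule exI[of _ U], intro conjI allI impI)
  show "unitary_operator counting ell2 U" unfolding unitary_operator_def by (rule U_unitary)
  show "continuous_spectrum counting ell2 U" by (rule U_continuous)
  fix k
  \<comment> \<open>The process is indexed by the times of \<open>U\<close>, so for every
    \<open>k\<close> its shift by \<open>3 ^ k\<close> steps realises \<open>U ^^ 3 ^ k\<close> on
    the same space \<open>GM\<close>.\<close>
  let ?T = "cshift (int (3 ^ k))"
  have GE: "unitarily_equivalent GM (complexification GH) (koopman ?T) counting ell2 (U ^^ (3 ^ k))"
    by (rule GM_equivalent)
  obtain R W where "gaussian_core GM ?T R GH k W"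
    by (rule gaussian_coreE[OF cshift_automorphism GH_closed GH_koopman GH_gaussian GH_generates GE]; blast)
  then interpret g: gaussian_core GM ?T R GH k W .
  have "gaussian_automorphism GM ?T counting ell2 (U ^^ (3 ^ k))"
    unfolding gaussian_automorphism_def
    using cshift_automorphism g.ergodic_T GH_closed GH_koopman GH_gaussian GH_generates GE by blast
  then show "\<exists>(M :: (nat \<Rightarrow> real) measure) T. gaussian_automorphism M T counting ell2 (U ^^ (3 ^ k)) \<and>
      multiplicities M T = {enat (3 ^ k), \<infinity>}"
    using g.multiplicities_power by blast
  fix M :: "'x measure" and T
  assume "gaussian_automorphism M T counting ell2 (U ^^ (3 ^ k))"
  then obtain H where a: "automorphism M T" and H: "closed_real_subspace M H" "\<And>h. h \<in> H \<Longrightarrow> koopman T h \<in> H"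
    "\<And>h. h \<in> H \<Longrightarrow> centered_gaussian M h" "generates_mod_null M H"
    and e: "unitarily_equivalent M (complexification H) (koopman T) counting ell2 (U ^^ (3 ^ k))"
    unfolding gaussian_automorphism_def by blast
  obtain R W where "gaussian_core M T R H k W" by (rule gaussian_coreE[OF a H e]; blast)
  then interpret h: gaussian_core M T R H k W .
  show "multiplicities M T = {enat (3 ^ k), \<infinity>}" by (rule h.multiplicities_power)
qed


end
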